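(* For every integer $n\geq 2$ and every $A\in\mathcal K(\mathbb C^n)$, $$Q_n(A,B_{2n}[n-1])^2\;\geq\;\Big(\frac{2n-2}{2n-1}\Big)\,Q_n(A[2],B_{2n}[n-2])\,P_n(B_{2n}).$$
   Context: $\mathbb C^n$ carries the Hermitian product $\langle z,w\rangle=\sum_\ell z_\ell\bar w_\ell$. $\mathcal K(\mathbb C^n)$ is the set of convex bodies (non-empty compact convex subsets) of $\mathbb C^n$; the support function of $A$ is $h_A(z)=\max_{v\in A}\operatorname{Re}\langle z,v\rangle$. $B_{2n}$ is the closed unit ball of $\mathbb C^n$ centred at the origin. $\varkappa_m$ is the Lebesgue measure of the unit ball of $\mathbb R^m$. $d^c=i(\bar\partial-\partial)$, so $dd^c=2i\partial\bar\partial$. Wedge products of the currents $dd^c h_A$ are taken in the Bedford–Taylor sense; a product of $n$ of them is a positive measure, and the integral over $B_{2n}$ is the measure of $B_{2n}$. The Kazarnovskiĭ mixed pseudovolume is $$Q_n(A_1,\ldots,A_n)=\frac{1}{n!\,\varkappa_n}\int_{B_{2n}}dd^c h_{A_1}\wedge\cdots\wedge dd^c h_{A_n},$$ and $P_n(A)=Q_n(A,\ldots,A)$. $A[m]$ denotes $A$ repeated $m$ times. *)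

theory Defs
  imports "HOL-Analysis.Analysis"
begin

section \<open>Convex bodies in complex n-space and their support functions\<close>

definition hermitian_product :: "complex^'n \<Rightarrow> complex^'n \<Rightarrow> complex" where
  "hermitian_product z w = (\<Sum>l\<in>UNIV. z $ l * cnj (w $ l))"

definition convex_body :: "(complex^'n) set \<Rightarrow> bool" where
  "convex_body A \<longleftrightarrow> A \<noteq> {} \<and> compact A \<and> convex A"

text \<open>For a convex body the supremum is a maximum, by compactness.\<close>

definition support_function :: "(complex^'n) set \<Rightarrow> complex^'n \<Rightarrow> real" where
  "support_function A z = (SUP v\<in>A. Re (hermitian_product z v))"


section \<open>Test functions and Wirtinger derivatives\<close>

text \<open>Differentiability is real differentiability throughout.\<close>

fun Ck :: "nat \<Rightarrow> (complex^'n \<Rightarrow> complex) \<Rightarrow> bool" where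
  "Ck 0 f \<longleftrightarrow> continuous_on UNIV f"
| "Ck (Suc k) f \<longleftrightarrow> (\<forall>z. f differentiable (at z)) \<and>
     (\<forall>v. Ck k (\<lambda>z. frechet_derivative f (at z) v))"

definition test_function :: "(complex^'n \<Rightarrow> complex) \<Rightarrow> bool" where
  "test_function f \<longleftrightarrow> (\<forall>k. Ck k f) \<and> compact (closure {z. f z \<noteq> 0})"

definition d_dz :: "'n \<Rightarrow> (complex^'n \<Rightarrow> complex) \<Rightarrow> complex^'n \<Rightarrow> complex" where
  "d_dz a f z = (frechet_derivative f (at z) (axis a 1)
                 - \<i> * frechet_derivative f (at z) (axis a \<i>)) / 2"

definition d_dzbar :: "'n \<Rightarrow> (complex^'n \<Rightarrow> complex) \<Rightarrow> complex^'n \<Rightarrow> complex" where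
  "d_dzbar b f z = (frechet_derivative f (at z) (axis b 1)
                    + \<i> * frechet_derivative f (at z) (axis b \<i>)) / 2"


section \<open>Currents\<close>

text \<open>
  A current \<open>T\<close> of bidegree \<open>(k,k)\<close> is recorded through its values on the test forms
  \<open>f dz\<^bsub>a1\<^esub> \<and> d\<zeta>\<^bsub>b1\<^esub> \<and> \<dots> \<and> dz\<^bsub>ap\<^esub> \<and> d\<zeta>\<^bsub>bp\<^esub>\<close> with \<open>p = n - k\<close>, where \<open>\<zeta>\<close> stands for
  the conjugate of \<open>z\<close>; these span all test forms of bidegree \<open>(p,p)\<close>. The value on this form is
  \<open>T [(a1,b1), \<dots>, (ap,bp)] f\<close>. Only lists of length \<open>n - k\<close> carry information.
\<close>

type_synonym 'n current = "('n \<times> 'n) list \<Rightarrow> (complex^'n \<Rightarrow> complex) \<Rightarrow> complex"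

text \<open>
  The current of integration over the whole space (bidegree \<open>(0,0)\<close>). If the first and the second
  components of the list both enumerate the coordinates, the form
  \<open>dz\<^bsub>a1\<^esub> \<and> d\<zeta>\<^bsub>b1\<^esub> \<and> \<dots> \<and> dz\<^bsub>an\<^esub> \<and> d\<zeta>\<^bsub>bn\<^esub>\<close> is the sign of the permutation
  \<open>ai \<mapsto> bi\<close> times the product of the \<open>dz\<^bsub>l\<^esub> \<and> d\<zeta>\<^bsub>l\<^esub>\<close>, each of which is \<open>-2\<i>\<close> times the
  area form; otherwise it has a repeated factor or is not of top degree.
\<close>

definition integration_current :: "'n::finite current" where
  "integration_current L f =
     (if distinct (map fst L) \<and> set (map fst L) = UNIV \<and>
         distinct (map snd L) \<and> set (map snd L) = UNIV
      then of_int (sign (\<lambda>a. the (map_of L a))) * (- 2 * \<i>) ^ CARD('n) * (LINT z|lborel. f z)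
      else 0)"

text \<open>
  The value, on a continuous compactly supported \<open>g\<close>, of the continuous extension of a distribution
  \<open>D\<close> of order zero, i.e. the integral of \<open>g\<close> against the complex Radon measure that \<open>D\<close> is. It is
  used for the coefficients of positive currents, which are distributions of order zero.
\<close>

definition order0_extension ::
    "((complex^'n \<Rightarrow> complex) \<Rightarrow> complex) \<Rightarrow> (complex^'n \<Rightarrow> complex) \<Rightarrow> complex" where
  "order0_extension D g =
     (THE c. \<forall>\<phi> :: nat \<Rightarrow> complex^'n \<Rightarrow> complex.
        (\<forall>m. test_function (\<phi> m)) \<and>
        (\<exists>K. compact K \<and> (\<forall>m. {z. \<phi> m z \<noteq> 0} \<subseteq> K)) \<and>
        uniform_limit UNIV \<phi> g sequentially
        \<longrightarrow> (\<lambda>m. D (\<phi> m)) \<longlonglongrightarrow> c)"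

text \<open>
  The Bedford--Taylor step \<open>dd\<^sup>c u \<and> T := dd\<^sup>c (u T)\<close> for a closed positive current \<open>T\<close> and a
  continuous plurisubharmonic \<open>u\<close>; support functions are convex and finite, so continuity is no
  restriction here. The convention is \<open>d\<^sup>c = \<i> (\<partial>' - \<partial>)\<close>, hence \<open>dd\<^sup>c = 2 \<i> \<partial> \<partial>'\<close>, where
  \<open>\<partial>'\<close> is the conjugate of \<open>\<partial>\<close>. The value on a test form \<open>f \<eta>\<close>, \<open>\<eta>\<close> a product of coordinate
  differentials, is the value of \<open>u T\<close> on \<open>dd\<^sup>c f \<and> \<eta>\<close>, and \<open>dd\<^sup>c f\<close> is the sum over \<open>a, b\<close> of
  \<open>2 \<i> (\<partial>\<^sup>2f / \<partial>z\<^bsub>a\<^esub>\<partial>\<zeta>\<^bsub>b\<^esub>) dz\<^bsub>a\<^esub> \<and> d\<zeta>\<^bsub>b\<^esub>\<close>.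
\<close>

definition ddc_wedge :: "(complex^'n::finite \<Rightarrow> real) \<Rightarrow> 'n current \<Rightarrow> 'n current" where
  "ddc_wedge u T L f =
     (\<Sum>a\<in>UNIV. \<Sum>b\<in>UNIV. 2 * \<i> *
        order0_extension (T ((a, b) # L)) (\<lambda>z. of_real (u z) * d_dz a (d_dzbar b f) z))"

definition bedford_taylor :: "(complex^'n::finite \<Rightarrow> real) list \<Rightarrow> 'n current" where
  "bedford_taylor us = foldr ddc_wedge us integration_current"

text \<open>
  A product of \<open>n\<close> factors has top bidegree, hence acts on functions; it is a positive distribution,
  that is, a unique locally finite Borel measure.
\<close>

definition bedford_taylor_measure ::
    "(complex^'n::finite \<Rightarrow> real) list \<Rightarrow> (complex^'n) measure" where
  "bedford_taylor_measure us =
     (THE \<mu>. sets \<mu> = sets borel \<and> (\<forall>K. compact K \<longrightarrow> emeasure \<mu> K < \<infinity>) \<and>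
             (\<forall>\<phi>. test_function \<phi> \<longrightarrow> (LINT z|\<mu>. \<phi> z) = bedford_taylor us [] \<phi>))"


section \<open>Mixed pseudovolume\<close>

text \<open>Meaningful for lists of exactly \<open>n = CARD('n)\<close> convex bodies.\<close>

definition mixed_pseudovolume :: "(complex^'n::finite) set list \<Rightarrow> real" where
  "mixed_pseudovolume As =
     measure (bedford_taylor_measure (map support_function As)) (cball 0 1)
       / (fact CARD('n) * measure lborel (cball (0 :: real^'n) 1))"

definition pseudovolume :: "(complex^'n::finite) set \<Rightarrow> real" where
  "pseudovolume A = mixed_pseudovolume (replicate CARD('n) A)"

end

theory Submission
  imports Defs "HOL-Combinatorics.Multiset_Permutations"
begin

text \<open>
  The measures are computed along smooth approximations: \<open>h\<^sub>A\<close> is replaced by soft maxima over finite nets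
  of \<open>A\<close>, and \<open>|z|\<close> by \<open>(|z|\<^sup>2 + \<epsilon>)\<^sup>1\<^sup>/\<^sup>2\<close>. Stokes' theorem moves all radial factors into a radial test function;
  what remains of the wedge products are the trace and the second elementary symmetric function of the complex
  Hessian of \<open>h\<^sub>A\<close>. The latter is at most a multiple of the same function of the real Hessian, and
  integration by parts reduces both to first derivatives. With \<open>N = 2n\<close> and \<open>S\<close> the integral over the unit
  sphere, the three measures of the ball become, up to constants, \<open>S(1)\<close>, \<open>S(h)\<close> and at most
  \<open>N S(h\<^sup>2) - S(|\<nabla>h|\<^sup>2)\<close> for \<open>h = h\<^sub>A\<close>. So the claim follows from
  \<open>S(1) (N S(h\<^sup>2) - S(|\<nabla>h|\<^sup>2)) \<le> (N - 1) S(h)\<^sup>2\<close>, which is Poincare's inequality on the sphere, deduced here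
  from the Gaussian one.
\<close>

text \<open>The measures are given by definite descriptions, first for the extension of each
  coefficient to continuous functions, then for the measure itself; both can be computed only after
  uniform mass bounds show that smooth approximation passes through them. Only one-sided estimates
  are available: the measure with two factors h is bounded from above, where passing from the
  complex to the real Hessian loses in the right direction, and the one with a single factor h from
  below. The Gaussian inequality loses nothing on the sphere. For H of degree one with mean zero it
  reads N S(H^2) <= S(|grad H|^2), because the second radial moment of the Gaussian is N times the
  zeroth; since the radial derivative of H is H itself on the sphere, this is the spectral gap N -
  1. Origin of the constant: with V the volume of the unit ball and leaving out powers of 2 that
  balance, the measure of n balls is at most n! V, that with one h at least (n-1)! S(h), that with
  two h at most (n-2)! (N-1) S(h)^2 / (N V), and n (N-1) / ((n-1) N) = (2n-1) / (2n-2).\<close>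

definition dird :: "complex^'n \<Rightarrow> (complex^'n \<Rightarrow> complex) \<Rightarrow> complex^'n \<Rightarrow> complex" where
  "dird v f z = frechet_derivative f (at z) v"

definition smooth :: "(complex^'n \<Rightarrow> complex) \<Rightarrow> bool" where
  "smooth f \<longleftrightarrow> (\<forall>k. Ck k f)"

lemma has_derivative_dird: "f differentiable (at z) \<Longrightarrow> (f has_derivative (\<lambda>v. dird v f z)) (at z)"
  unfolding dird_def by (simp add: frechet_derivative_works eta_contract_eq)

lemma dird_eq: "(f has_derivative f') (at z) \<Longrightarrow> dird v f z = f' v"
  unfolding dird_def using frechet_derivative_at by metis

lemma Ck_Suc_iff: "Ck (Suc k) f \<longleftrightarrow> (\<forall>z. f differentiable (at z)) \<and> (\<forall>v. Ck k (dird v f))"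
  by (simp add: dird_def[abs_def])

declare Ck.simps(2)[simp del]

lemma Ck_SucI:
  assumes "\<And>z. (f has_derivative (\<lambda>v. f' v z)) (at z)" "\<And>v. Ck k (f' v)"
  shows "Ck (Suc k) f"
proof -
  have "dird v f = f' v" for v using dird_eq[OF assms(1)] by auto
  then show ?thesis using assms by (auto simp: Ck_Suc_iff differentiable_def)
qed

lemma Ck_continuous: "Ck k f \<Longrightarrow> continuous_on UNIV f"
  by (cases k) (auto simp: Ck_Suc_iff intro!: differentiable_imp_continuous_on differentiable_at_imp_differentiable_on)

lemma Ck_SucD: "Ck (Suc k) f \<Longrightarrow> Ck k f"
proof (induction k arbitrary: f)
  case 0
  then show ?case using Ck_continuous[of "Suc 0" f] by simp
next
  case (Suc k)
  then show ?case by (auto simp: Ck_Suc_iff[of "Suc k"] Ck_Suc_iff[of k])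
qed

lemma Ck_const: "Ck k (\<lambda>_. c)"
proof (induction k arbitrary: c)
  case (Suc k)
  show ?case by (rule Ck_SucI[where f'="\<lambda>_ _. 0"]) (auto simp: Suc.IH)
qed simp

lemma Ck_add: "Ck k f \<Longrightarrow> Ck k g \<Longrightarrow> Ck k (\<lambda>z. f z + g z)"
proof (induction k arbitrary: f g)
  case 0 then show ?case by (simp add: continuous_on_add)
next
  case (Suc k)
  then have "(f has_derivative (\<lambda>v. dird v f z)) (at z)" "(g has_derivative (\<lambda>v. dird v g z)) (at z)" for z
    by (auto simp: Ck_Suc_iff has_derivative_dird)
  then have "((\<lambda>z. f z + g z) has_derivative (\<lambda>v. dird v f z + dird v g z)) (at z)" for z
    by (auto intro: derivative_eq_intros)
  then show ?case using Suc
    by (intro Ck_SucI[where f'="\<lambda>v z. dird v f z + dird v g z"]) (auto simp: Ck_Suc_iff)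
qed

lemma Ck_mult: "Ck k f \<Longrightarrow> Ck k g \<Longrightarrow> Ck k (\<lambda>z. f z * g z)"
proof (induction k arbitrary: f g)
  case 0 then show ?case by (simp add: continuous_on_mult)
next
  case (Suc k)
  then have "(f has_derivative (\<lambda>v. dird v f z)) (at z)" "(g has_derivative (\<lambda>v. dird v g z)) (at z)" for z
    by (auto simp: Ck_Suc_iff has_derivative_dird)
  then have "((\<lambda>z. f z * g z) has_derivative (\<lambda>v. f z * dird v g z + dird v f z * g z)) (at z)" for z
    by (auto intro: derivative_eq_intros)
  moreover have "Ck k f" "Ck k g" using Suc.prems Ck_SucD by blast+
  ultimately show ?case using Suc
    by (intro Ck_SucI[where f'="\<lambda>v z. f z * dird v g z + dird v f z * g z"])
      (auto simp: Ck_Suc_iff intro!: Ck_add Suc.IH)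
qed

lemma Ck_bounded_linear: "bounded_linear f \<Longrightarrow> Ck k f"
proof (cases k)
  case 0 assume "bounded_linear f" then show ?thesis using 0 by (simp add: linear_continuous_on)
next
  case (Suc m) assume "bounded_linear f" then show ?thesis unfolding Suc
    by (intro Ck_SucI[where f'="\<lambda>v z. f v"]) (auto simp: Ck_const bounded_linear_imp_has_derivative)
qed

named_theorems smooth_intros

lemma smooth_const [smooth_intros, simp]: "smooth (\<lambda>_. c)"
  and smooth_add [smooth_intros]: "smooth f \<Longrightarrow> smooth g \<Longrightarrow> smooth (\<lambda>z. f z + g z)"
  and smooth_mult [smooth_intros]: "smooth f \<Longrightarrow> smooth g \<Longrightarrow> smooth (\<lambda>z. f z * g z)"
  and smooth_bounded_linear: "bounded_linear f \<Longrightarrow> smooth f"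
  by (auto simp: smooth_def Ck_const Ck_add Ck_mult Ck_bounded_linear)

lemma smooth_uminus [smooth_intros]: "smooth f \<Longrightarrow> smooth (\<lambda>z. - f z)"
  using smooth_mult[of "\<lambda>_. -1" f] by simp

lemma smooth_diff [smooth_intros]: "smooth f \<Longrightarrow> smooth g \<Longrightarrow> smooth (\<lambda>z. f z - g z)"
  using smooth_add[of f "\<lambda>z. - g z"] smooth_uminus[of g] by simp

lemma smooth_sum [smooth_intros]: "(\<And>i. i \<in> I \<Longrightarrow> smooth (f i)) \<Longrightarrow> smooth (\<lambda>z. \<Sum>i\<in>I. f i z)"
  by (induction I rule: infinite_finite_induct) (simp_all add: smooth_add)

lemma smooth_power [smooth_intros]: "smooth f \<Longrightarrow> smooth (\<lambda>z. f z ^ m)"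
  by (induction m) (simp_all add: smooth_mult)

lemma smooth_differentiable: "smooth f \<Longrightarrow> f differentiable (at z)"
  unfolding smooth_def using Ck_Suc_iff by blast

lemma smooth_has_derivative: "smooth f \<Longrightarrow> (f has_derivative (\<lambda>v. dird v f z)) (at z)"
  by (simp add: smooth_differentiable has_derivative_dird)

lemma smooth_dird [smooth_intros]: "smooth f \<Longrightarrow> smooth (dird v f)"
  unfolding smooth_def using Ck_Suc_iff by blast

lemma smooth_continuous: "smooth f \<Longrightarrow> continuous_on S f"
  unfolding smooth_def using Ck_continuous continuous_on_subset by blast

lemma dird_add: "smooth f \<Longrightarrow> smooth g \<Longrightarrow> dird v (\<lambda>z. f z + g z) z = dird v f z + dird v g z"
  by (rule dird_eq) (auto intro!: derivative_eq_intros smooth_has_derivative)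

lemma dird_mult: "smooth f \<Longrightarrow> smooth g \<Longrightarrow> dird v (\<lambda>z. f z * g z) z = f z * dird v g z + dird v f z * g z"
  by (rule dird_eq) (auto intro!: derivative_eq_intros smooth_has_derivative)

lemma dird_const [simp]: "dird v (\<lambda>_. c) z = 0"
  by (rule dird_eq[where f'="\<lambda>_. 0"]) auto

lemma dird_cmult: "smooth f \<Longrightarrow> dird v (\<lambda>z. c * f z) z = c * dird v f z"
  by (subst dird_mult) auto

lemma dird_linear: "smooth f \<Longrightarrow> linear (\<lambda>v. dird v f z)"
  using smooth_has_derivative has_derivative_linear by blast

lemma dird_bounded_linear: "bounded_linear f \<Longrightarrow> dird v f z = f v"
  by (rule dird_eq) (rule bounded_linear_imp_has_derivative)

lemma dird_line:
  assumes "smooth f"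
  shows "((\<lambda>t. f (z + t *\<^sub>R v)) has_vector_derivative dird v f (z + t *\<^sub>R v)) (at t within S)"
proof -
  have "((\<lambda>t. f (z + t *\<^sub>R v)) has_derivative (\<lambda>h. dird (h *\<^sub>R v) f (z + t *\<^sub>R v))) (at t within S)"
    by (rule has_derivative_compose[where g = f and f = "\<lambda>t. z + t *\<^sub>R v", OF _ smooth_has_derivative[OF assms]])
      (auto intro!: derivative_eq_intros)
  then show ?thesis
    by (simp add: has_vector_derivative_def linear_scale[OF dird_linear[OF assms]])
qed

text \<open>Differentiating \<open>f (z + t w) - f z = \<integral>\<^sub>0\<^sup>t D\<^sub>w f (z + s w) ds\<close> in direction \<open>v\<close>, then in \<open>t\<close>.\<close>

lemma dird_commute:
  fixes f :: "complex^'n \<Rightarrow> complex"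
  assumes f: "smooth f"
  shows "dird v (dird w f) z = dird w (dird v f) z"
proof -
  define A where "A r s = f (z + r *\<^sub>R v + s *\<^sub>R w)" for r s
  define Aw where "Aw r s = dird w f (z + r *\<^sub>R v + s *\<^sub>R w)" for r s
  define Avw where "Avw r s = dird v (dird w f) (z + r *\<^sub>R v + s *\<^sub>R w)" for r s
  have dAw: "((\<lambda>r. Aw r s) has_vector_derivative Avw r s) (at r within S)" for r s S
    using dird_line[OF smooth_dird[OF f], of w "z + s *\<^sub>R w" v r S]
    unfolding Aw_def Avw_def by (simp add: algebra_simps)
  have cont: "continuous_on X (\<lambda>x. Avw (fst x) (snd x))" for X
    unfolding Avw_def
    by (rule continuous_on_compose2[OF smooth_continuous[of _ UNIV]]) (auto intro!: continuous_intros smooth_intros f)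
  have contw: "continuous_on X (Aw r)" for X r unfolding Aw_def
    by (rule continuous_on_compose2[OF smooth_continuous[of _ UNIV]]) (auto intro!: continuous_intros smooth_intros f)
  have int: "integral {0..t} (Aw r) = A r t - A r 0" if "t \<ge> 0" for r t
  proof (rule integral_unique, rule fundamental_theorem_of_calculus[OF that])
    show "(A r has_vector_derivative Aw r x) (at x within {0..t})" for x
      unfolding A_def Aw_def by (rule dird_line[OF f])
  qed
  have "dird v f (z + t *\<^sub>R w) - dird v f z = integral {0..t} (\<lambda>s. Avw 0 s)" if "t \<ge> 0" for t
  proof -
    have "((\<lambda>r. integral (cbox 0 t) (Aw r)) has_vector_derivative integral (cbox 0 t) (Avw 0)) (at 0 within UNIV)"
      by (rule leibniz_rule_vector_derivative)
       (auto intro: dAw cont contw integrable_continuous_interval simp: case_prod_unfold)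
    moreover have "((\<lambda>r. A r t - A r 0) has_vector_derivative dird v f (z + t *\<^sub>R w) - dird v f z) (at 0 within UNIV)"
      using dird_line[OF f, of "z + t *\<^sub>R w" v 0] dird_line[OF f, of "z" v 0]
      unfolding A_def by (auto intro!: derivative_eq_intros simp: algebra_simps)
    ultimately show ?thesis using int[OF that] by (auto dest: vector_derivative_unique_at)
  qed
  then have eq: "dird v f (z + t *\<^sub>R w) = integral {0..t} (\<lambda>s. Avw 0 s) + dird v f z" if "t \<ge> 0" for t
    using that by (simp add: algebra_simps)
  have "continuous_on {0..1} (Avw 0)" unfolding Avw_def
    by (rule continuous_on_compose2[OF smooth_continuous[of _ UNIV]]) (auto intro!: continuous_intros smooth_intros f)
  from integral_has_vector_derivative[OF this, of 0]
  have "((\<lambda>t. integral {0..t} (Avw 0) + dird v f z) has_vector_derivative Avw 0 0) (at 0 within {0..1})"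
    by (auto intro!: derivative_eq_intros)
  \<comment> \<open>The identity \<open>eq\<close> holds for t >= 0 only, so both derivatives are
    taken within \<open>{0..1}\<close> at its left end, where they are still unique.\<close>
  then have 1: "((\<lambda>t. dird v f (z + t *\<^sub>R w)) has_vector_derivative Avw 0 0) (at 0 within {0..1})"
    by (rule has_vector_derivative_transform[rotated 2]) (auto simp: eq)
  have 2: "((\<lambda>t. dird v f (z + t *\<^sub>R w)) has_vector_derivative dird w (dird v f) z) (at 0 within {0..1})"
    using dird_line[OF smooth_dird[OF f], of v z w 0 "{0..1}"] by simp
  have "Avw 0 0 = dird w (dird v f) z"
    by (rule vector_derivative_unique_within[OF _ 1 2]) (simp add: at_within_Icc_at_right)
  then show ?thesis by (simp add: Avw_def)
qed

section \<open>Smooth functions of one real variable\<close>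

text \<open>Relative to a set because the square root and the logarithm are composed on half-lines
  only. The derivative is two-sided at each point of \<open>S\<close>, so \<open>S\<close> is meant
  to be open; leaving it existential keeps the closure rules free of explicit formulas.\<close>

fun Dk :: "real set \<Rightarrow> nat \<Rightarrow> (real \<Rightarrow> real) \<Rightarrow> bool" where
  "Dk S 0 f \<longleftrightarrow> continuous_on S f"
| "Dk S (Suc k) f \<longleftrightarrow> (\<exists>f'. (\<forall>x\<in>S. (f has_real_derivative f' x) (at x)) \<and> Dk S k f')"

lemma Dk_continuous: "Dk S k f \<Longrightarrow> continuous_on S f"
  by (cases k) (auto intro!: continuous_at_imp_continuous_on dest: DERIV_isCont)

lemma Dk_SucI: "(\<And>x. x \<in> S \<Longrightarrow> (f has_real_derivative f' x) (at x)) \<Longrightarrow> Dk S k f' \<Longrightarrow> Dk S (Suc k) f"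
  by auto

lemma Dk_SucD: "Dk S (Suc k) f \<Longrightarrow> Dk S k f"
proof (induction k arbitrary: f)
  case 0 show ?case using Dk_continuous[OF 0] by (simp only: Dk.simps(1))
next
  case (Suc k)
  from Suc.prems obtain f' where "\<forall>x\<in>S. (f has_real_derivative f' x) (at x)" "Dk S (Suc k) f'"
    unfolding Dk.simps(2)[of S "Suc k"] by blast
  with Suc.IH[of f'] show ?case unfolding Dk.simps(2)[of S k] by blast
qed

lemma Dk_const: "Dk S k (\<lambda>_. c)"
proof (induction k arbitrary: c)
  case (Suc k) then show ?case by (auto intro!: exI[of _ "\<lambda>_. 0"])
qed simp

lemma Dk_ident: "Dk S k (\<lambda>x. x)"
  by (cases k) (auto intro!: exI[of _ "\<lambda>_. 1"] Dk_const)

lemma Dk_add: "Dk S k f \<Longrightarrow> Dk S k g \<Longrightarrow> Dk S k (\<lambda>x. f x + g x)"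
proof (induction k arbitrary: f g)
  case (Suc k)
  then obtain f' g' where "\<forall>x\<in>S. (f has_real_derivative f' x) (at x)" "Dk S k f'"
    "\<forall>x\<in>S. (g has_real_derivative g' x) (at x)" "Dk S k g'" by auto
  then show ?case using Suc.IH
    by (auto intro!: exI[of _ "\<lambda>x. f' x + g' x"] derivative_eq_intros)
qed (auto intro: continuous_intros)

lemma Dk_mult: "Dk S k f \<Longrightarrow> Dk S k g \<Longrightarrow> Dk S k (\<lambda>x. f x * g x)"
proof (induction k arbitrary: f g)
  case (Suc k)
  then obtain f' g' where *: "\<forall>x\<in>S. (f has_real_derivative f' x) (at x)" "Dk S k f'"
    "\<forall>x\<in>S. (g has_real_derivative g' x) (at x)" "Dk S k g'" by auto
  have "Dk S k f" "Dk S k g" using Suc.prems Dk_SucD by blast+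
  with * show ?case using Suc.IH
    by (auto intro!: exI[of _ "\<lambda>x. f' x * g x + f x * g' x"] derivative_eq_intros Dk_add)
qed (auto intro: continuous_intros)

lemma Dk_cong: "open S \<Longrightarrow> Dk S k f \<Longrightarrow> (\<And>x. x \<in> S \<Longrightarrow> f x = g x) \<Longrightarrow> Dk S k g"
proof (cases k)
  case 0 assume "Dk S k f" "(\<And>x. x \<in> S \<Longrightarrow> f x = g x)" then show ?thesis using 0 by (simp cong: continuous_on_cong)
next
  case (Suc m) assume *: "open S" "Dk S k f" "(\<And>x. x \<in> S \<Longrightarrow> f x = g x)"
  then obtain f' where f': "\<forall>x\<in>S. (f has_real_derivative f' x) (at x)" "Dk S m f'" using Suc by auto
  have "(g has_real_derivative f' x) (at x)" if "x \<in> S" for x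
    using has_field_derivative_transform_within_open[OF _ \<open>open S\<close> that] f' * that by blast
  then show ?thesis using f' Suc by auto
qed

lemma Dk_inverse:
  assumes "\<And>x. x \<in> S \<Longrightarrow> f x \<noteq> 0"
  shows "Dk S k f \<Longrightarrow> Dk S k (\<lambda>x. inverse (f x))"
proof (induction k)
  case 0 then show ?case using assms by (auto intro: continuous_intros)
next
  case (Suc k)
  then obtain f' where f': "\<forall>x\<in>S. (f has_real_derivative f' x) (at x)" "Dk S k f'" by auto
  have "Dk S k (\<lambda>x. inverse (f x))" using Suc Dk_SucD by blast
  then have "Dk S k (\<lambda>x. (-1) * f' x * (inverse (f x) * inverse (f x)))"
    using f' by (intro Dk_mult Dk_const) auto
  moreover have "((\<lambda>x. inverse (f x)) has_real_derivative (-1) * f' x * (inverse (f x) * inverse (f x))) (at x)"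
    if "x \<in> S" for x
    using f' assms that by (auto intro!: derivative_eq_intros)
  ultimately show ?case by (rule Dk_SucI[rotated])
qed

lemma Dk_sqrt: "(\<And>x. x \<in> S \<Longrightarrow> f x > 0) \<Longrightarrow> Dk S k f \<Longrightarrow> Dk S k (\<lambda>x. sqrt (f x))"
proof (induction k)
  case 0 then show ?case by (auto intro: continuous_intros)
next
  case (Suc k)
  then obtain f' where f': "\<forall>x\<in>S. (f has_real_derivative f' x) (at x)" "Dk S k f'" by auto
  have sq: "Dk S k (\<lambda>x. sqrt (f x))" using Suc Dk_SucD by blast
  have "Dk S k (\<lambda>x. f' x * (1/2) * inverse (sqrt (f x)))"
    using sq f' Suc.prems(1) by (intro Dk_mult Dk_const Dk_inverse) force+
  moreover have "((\<lambda>x. sqrt (f x)) has_real_derivative f' x * (1/2) * inverse (sqrt (f x))) (at x)"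
    if "x \<in> S" for x
    using f' Suc.prems(1)[OF that] that by (auto intro!: derivative_eq_intros simp: field_simps)
  ultimately show ?case by (rule Dk_SucI[rotated])
qed

lemma Dk_compose: "f ` S \<subseteq> T \<Longrightarrow> Dk T k g \<Longrightarrow> Dk S k f \<Longrightarrow> Dk S k (\<lambda>x. g (f x))"
proof (induction k arbitrary: g)
  case 0 then show ?case by (auto intro: continuous_on_compose2)
next
  case (Suc k)
  then obtain f' g' where *: "\<forall>x\<in>S. (f has_real_derivative f' x) (at x)" "Dk S k f'"
    "\<forall>x\<in>T. (g has_real_derivative g' x) (at x)" "Dk T k g'" by auto
  have "Dk S k f" using Suc.prems(3) Dk_SucD by blast
  then have "Dk S k (\<lambda>x. g' (f x) * f' x)" using Suc.IH[OF Suc.prems(1) *(4)] * by (intro Dk_mult) auto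
  moreover have "((\<lambda>x. g (f x)) has_real_derivative g' (f x) * f' x) (at x)" if "x \<in> S" for x
    by (rule DERIV_chain2) (use * that Suc.prems(1) in auto)
  ultimately show ?case by (rule Dk_SucI[rotated])
qed

lemma dird_of_real:
  assumes "smooth (\<lambda>z. of_real (g z))"
  shows "of_real (Re (dird v (\<lambda>z. of_real (g z)) z)) = dird v (\<lambda>z. of_real (g z)) z"
    "(g has_derivative (\<lambda>v. Re (dird v (\<lambda>z. of_real (g z)) z))) (at z)"
proof -
  have "((\<lambda>z. Re (of_real (g z))) has_derivative (\<lambda>v. Re (dird v (\<lambda>z. of_real (g z)) z))) (at z)"
    by (intro derivative_intros smooth_has_derivative assms)
  then show *: "(g has_derivative (\<lambda>v. Re (dird v (\<lambda>z. of_real (g z)) z))) (at z)" by simp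
  have "((\<lambda>z. complex_of_real (g z)) has_derivative (\<lambda>v. of_real (Re (dird v (\<lambda>z. of_real (g z)) z)))) (at z)"
    by (intro derivative_intros *)
  from dird_eq[OF this] show "of_real (Re (dird v (\<lambda>z. of_real (g z)) z)) = dird v (\<lambda>z. of_real (g z)) z" by simp
qed

lemma Ck_compose_real:
  assumes g: "smooth (\<lambda>z. of_real (g z))" and S: "\<And>z. g z \<in> S"
  shows "Dk S k \<psi> \<Longrightarrow> Ck k (\<lambda>z. of_real (\<psi> (g z)))"
proof (induction k arbitrary: \<psi>)
  case 0
  have "continuous_on UNIV (\<lambda>z. Re (of_real (g z)))"
    by (intro continuous_intros smooth_continuous g)
  then show ?case using 0 S by (auto intro!: continuous_on_of_real intro: continuous_on_compose2)
next
  case (Suc k)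
  then obtain \<psi>' where *: "\<forall>x\<in>S. (\<psi> has_real_derivative \<psi>' x) (at x)" "Dk S k \<psi>'" by auto
  let ?f = "\<lambda>v z. of_real (\<psi>' (g z)) * dird v (\<lambda>z. of_real (g z)) z"
  have "((\<lambda>z. complex_of_real (\<psi> (g z))) has_derivative (\<lambda>v. ?f v z)) (at z)" for z
  proof -
    have "((\<lambda>z. \<psi> (g z)) has_derivative (\<lambda>v. \<psi>' (g z) * Re (dird v (\<lambda>z. of_real (g z)) z))) (at z)"
      using has_derivative_compose[OF dird_of_real(2)[OF g], of \<psi> "(*) (\<psi>' (g z))" z] * S
      by (auto simp: has_field_derivative_def)
    from has_derivative_of_real[OF this, where 'a = complex] show ?thesis by (simp add: dird_of_real(1)[OF g])
  qed
  moreover have "Ck k (dird v (\<lambda>z. of_real (g z)))" for v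
    using smooth_dird[OF g] by (simp add: smooth_def)
  ultimately show ?case using Suc.IH[OF *(2)]
    by (intro Ck_SucI[where f'="?f"]) (auto intro!: Ck_mult)
qed

lemma smooth_compose_real:
  "smooth (\<lambda>z. of_real (g z)) \<Longrightarrow> (\<And>z. g z \<in> S) \<Longrightarrow> (\<And>k. Dk S k \<psi>) \<Longrightarrow> smooth (\<lambda>z. of_real (\<psi> (g z)))"
  unfolding smooth_def[of "\<lambda>z. of_real (\<psi> (g z))"] using Ck_compose_real by blast

lemma dird_compose_real:
  assumes g: "smooth (\<lambda>z. of_real (g z))" and *: "(\<psi> has_real_derivative \<psi>') (at (g z))"
  shows "dird v (\<lambda>z. complex_of_real (\<psi> (g z))) z = of_real \<psi>' * dird v (\<lambda>z. of_real (g z)) z"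
proof -
  have "((\<lambda>z. \<psi> (g z)) has_derivative (\<lambda>v. \<psi>' * Re (dird v (\<lambda>z. of_real (g z)) z))) (at z)"
    using has_derivative_compose[OF dird_of_real(2)[OF g], of \<psi> "(*) \<psi>'" z] *
    by (auto simp: has_field_derivative_def)
  from dird_eq[OF has_derivative_of_real[OF this]] show ?thesis using dird_of_real(1)[OF g] by simp
qed

text \<open>The family \<open>x\<^sup>-\<^sup>j exp (-1/x)\<close> is closed under differentiation up to linear combinations.\<close>

definition flat :: "nat \<Rightarrow> real \<Rightarrow> real" where
  "flat j x = (if x > 0 then inverse x ^ j * exp (- inverse x) else 0)"

lemma flat_tendsto_0: "(flat j \<longlongrightarrow> 0) (at 0)"
proof -
  have "((\<lambda>x::real. inverse x ^ j / exp (inverse x)) \<longlongrightarrow> 0) (at_right 0)"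
    by (rule filterlim_compose[OF tendsto_power_div_exp_0 filterlim_inverse_at_top_right])
  then have R: "(flat j \<longlongrightarrow> 0) (at_right 0)"
    by (rule Lim_transform_eventually)
     (auto simp: flat_def exp_minus field_simps eventually_at_filter)
  have L: "(flat j \<longlongrightarrow> 0) (at_left 0)"
    by (rule Lim_transform_eventually[where f="\<lambda>_. 0"]) (auto simp: flat_def eventually_at_filter)
  show ?thesis using L R filterlim_at_split by blast
qed

lemma flat_deriv: "(flat j has_real_derivative (- real j * flat (Suc j) x + flat (Suc (Suc j)) x)) (at x)"
proof -
  consider "x > 0" | "x < 0" | "x = 0" by linarith
  then show ?thesis
  proof cases
    case 1
    have "((\<lambda>x. inverse x ^ j * exp (- inverse x)) has_real_derivative
        (real j * inverse x ^ (j - 1) * (- (inverse x ^ 2)) * exp (- inverse x)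
          + inverse x ^ j * (exp (- inverse x) * inverse x ^ 2))) (at x)"
      using 1 by (auto intro!: derivative_eq_intros simp: power2_eq_square)
    also have "real j * inverse x ^ (j - 1) * (- (inverse x ^ 2)) * exp (- inverse x)
          + inverse x ^ j * (exp (- inverse x) * inverse x ^ 2) =
        (- real j * flat (Suc j) x + flat (Suc (Suc j)) x)"
      using 1 by (cases j) (simp_all add: flat_def algebra_simps power2_eq_square)
    finally have "((\<lambda>x. inverse x ^ j * exp (- inverse x)) has_real_derivative
        (- real j * flat (Suc j) x + flat (Suc (Suc j)) x)) (at x)" .
    then show ?thesis
      by (rule has_field_derivative_transform_within_open[where S="{0<..}"]) (use 1 in \<open>auto simp: flat_def\<close>)
  next
    case 2
    have "((\<lambda>_. 0) has_real_derivative (- real j * flat (Suc j) x + flat (Suc (Suc j)) x)) (at x)"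
      using 2 by (auto simp: flat_def)
    then show ?thesis
      by (rule has_field_derivative_transform_within_open[where S="{..<0}"]) (use 2 in \<open>auto simp: flat_def\<close>)
  next
    case 3
    \<comment> \<open>At the origin the difference quotient of \<open>flat j\<close> is exactly
      \<open>flat (Suc j)\<close>, which tends to 0.\<close>
    have "((\<lambda>h. (flat j (0 + h) - flat j 0) / h) \<longlongrightarrow> 0) (at 0)"
      by (rule Lim_transform_eventually[OF flat_tendsto_0[of "Suc j"]])
        (auto simp: flat_def eventually_at_filter divide_inverse)
    then show ?thesis using 3 by (simp add: flat_def DERIV_def)
  qed
qed

lemma Dk_flat: "Dk UNIV k (flat j)"
proof (induction k arbitrary: j)
  case 0 show ?case by (auto intro!: continuous_at_imp_continuous_on DERIV_isCont[OF flat_deriv])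
next
  case (Suc k)
  have "Dk UNIV k (\<lambda>x. (- real j) * flat (Suc j) x + flat (Suc (Suc j)) x)"
    by (intro Dk_add Dk_mult Dk_const Suc)
  then show ?case by (rule Dk_SucI[OF flat_deriv])
qed

text \<open>A smooth monotone transition from 0 on x <= 0 to 1 on x >= 1. The denominator is
  positive since x and 1 - x cannot both be nonpositive.\<close>

definition step :: "real \<Rightarrow> real" where
  "step x = flat 0 x * inverse (flat 0 x + flat 0 (1 - x))"

lemma flat_nonneg: "flat j x \<ge> 0" and flat_pos: "x > 0 \<Longrightarrow> flat j x > 0"
  by (auto simp: flat_def)

lemma flat_mono: "x \<le> y \<Longrightarrow> flat 0 x \<le> flat 0 y"
  by (auto simp: flat_def)

lemma step_den: "flat 0 x + flat 0 (1 - x) > 0"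
  using flat_pos[of x 0] flat_pos[of "1 - x" 0] flat_nonneg[of 0 x] flat_nonneg[of 0 "1-x"]
  by (cases "x > 0") auto

lemma Dk_step: "Dk UNIV k step"
proof -
  have "Dk UNIV k (\<lambda>x. 1 + (-1) * x)" by (intro Dk_add Dk_mult Dk_const Dk_ident)
  then have "Dk UNIV k (\<lambda>x. flat 0 (1 + (-1) * x))"
    by (rule Dk_compose[OF _ Dk_flat, rotated]) auto
  then have "Dk UNIV k (\<lambda>x. flat 0 (1 - x))" by simp
  then show ?thesis unfolding step_def[abs_def] using step_den
    by (intro Dk_mult Dk_inverse Dk_add Dk_flat) (auto simp: less_imp_neq[symmetric])
qed

lemma step_0: "x \<le> 0 \<Longrightarrow> step x = 0" and step_1: "x \<ge> 1 \<Longrightarrow> step x = 1"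
  using step_den[of x] by (auto simp: step_def flat_def)

lemma step_range: "0 \<le> step x" "step x \<le> 1"
  using step_den[of x] flat_nonneg[of 0 x] flat_nonneg[of 0 "1-x"]
  by (auto simp: step_def field_simps)

lemma step_mono: "x \<le> y \<Longrightarrow> step x \<le> step y"
proof -
  assume "x \<le> y"
  then have "flat 0 x * flat 0 (1 - y) \<le> flat 0 y * flat 0 (1 - x)"
    by (intro mult_mono flat_mono flat_nonneg) auto
  then show ?thesis using step_den[of x] step_den[of y]
    by (simp add: step_def field_simps)
qed

section \<open>Test functions\<close>

lemma test_function_iff: "test_function f \<longleftrightarrow> smooth f \<and> bounded {z. f z \<noteq> 0}"
  by (simp add: test_function_def smooth_def)

lemma test_functionI: "smooth f \<Longrightarrow> {z. f z \<noteq> 0} \<subseteq> K \<Longrightarrow> compact K \<Longrightarrow> test_function f"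
  using test_function_iff bounded_subset compact_imp_bounded by blast

lemma test_smooth: "test_function f \<Longrightarrow> smooth f"
  by (simp add: test_function_iff)

lemma test_support: "test_function f \<Longrightarrow> compact (closure {z. f z \<noteq> 0})"
  by (simp add: test_function_def)

lemma test_mult_left [intro]: "test_function f \<Longrightarrow> smooth g \<Longrightarrow> test_function (\<lambda>z. f z * g z)"
  by (auto simp: test_function_iff intro!: smooth_mult elim!: bounded_subset)

lemma test_mult_right [intro]: "test_function g \<Longrightarrow> smooth f \<Longrightarrow> test_function (\<lambda>z. f z * g z)"
  by (auto simp: test_function_iff intro!: smooth_mult elim!: bounded_subset)

lemma test_add [intro]: "test_function f \<Longrightarrow> test_function g \<Longrightarrow> test_function (\<lambda>z. f z + g z)"
  by (auto simp: test_function_iff intro!: smooth_add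
      intro: bounded_subset[of "{z. f z \<noteq> 0} \<union> {z. g z \<noteq> 0}"])

lemma support_dird:
  assumes "\<And>z. z \<notin> K \<Longrightarrow> f z = 0" "closed K"
  shows "z \<notin> K \<Longrightarrow> dird v f z = 0"
proof -
  assume z: "z \<notin> K"
  have "(f has_derivative (\<lambda>_. 0)) (at z)"
    by (rule has_derivative_transform_within_open[OF has_derivative_const[of 0], where s = "- K"])
      (use assms z in auto)
  then show ?thesis by (rule dird_eq)
qed

lemma test_dird [intro]: "test_function f \<Longrightarrow> test_function (dird v f)"
proof (rule test_functionI)
  assume f: "test_function f"
  show "smooth (dird v f)" by (rule smooth_dird[OF test_smooth[OF f]])
  show "{z. dird v f z \<noteq> 0} \<subseteq> closure {z. f z \<noteq> 0}"
  proof
    fix z assume z: "z \<in> {z. dird v f z \<noteq> 0}"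
    let ?K = "closure {z. f z \<noteq> 0}"
    have 0: "f y = 0" if "y \<notin> ?K" for y
    proof (rule ccontr)
      assume "f y \<noteq> 0"
      then have "y \<in> ?K" by (intro subsetD[OF closure_subset]) simp
      then show False using that by contradiction
    qed
    show "z \<in> ?K"
    proof (rule ccontr)
      assume "z \<notin> ?K"
      from support_dird[OF 0 closed_closure this, where v = v] z show False by simp
    qed
  qed
qed (rule test_support)

section \<open>Integration by parts for test functions\<close>

lemma integrable_compact_support:
  fixes f :: "'a::euclidean_space \<Rightarrow> 'b::{banach, second_countable_topology}"
  assumes "continuous_on UNIV f" "{z. f z \<noteq> 0} \<subseteq> K" "compact K"
  shows "integrable lborel f"
proof -
  have "(\<lambda>x. indicator K x *\<^sub>R f x) = f" using assms(2) by (auto simp: fun_eq_iff indicator_def)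
  then show ?thesis
    using borel_integrable_compact[OF assms(3) continuous_on_subset[OF assms(1)]] by simp
qed

lemma test_integrable: "test_function f \<Longrightarrow> integrable lborel f"
  using closure_subset[of "{z. f z \<noteq> 0}"]
  by (intro integrable_compact_support[of f, OF _ _ test_support] smooth_continuous test_smooth)

lemma test_mult_integrable:
  assumes "continuous_on UNIV g" "test_function f"
  shows "integrable lborel (\<lambda>z. g z * f z)"
proof (rule integrable_compact_support)
  show "compact (closure {z. f z \<noteq> 0})" by (rule test_support[OF assms(2)])
qed (use assms closure_subset[of "{z. f z \<noteq> 0}"] in
      \<open>auto intro!: continuous_on_mult[OF _ smooth_continuous[OF test_smooth]]\<close>)

lemma lborel_integrable_translate:
  fixes f :: "'a::euclidean_space \<Rightarrow> 'b::{banach, second_countable_topology}"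
  assumes "integrable lborel f"
  shows "integrable lborel (\<lambda>x. f (x + c))"
proof -
  have "integrable (distr lborel borel ((+) c)) f" by (simp add: lborel_distr_plus assms)
  then have "integrable lborel (\<lambda>x. f (c + x))"
    using assms by (subst (asm) integrable_distr_eq) auto
  then show ?thesis by (simp add: add.commute)
qed

lemma lborel_integral_translate:
  fixes f :: "'a::euclidean_space \<Rightarrow> 'b::{banach, second_countable_topology}"
  assumes "f \<in> borel_measurable borel"
  shows "(LINT x|lborel. f (x + c)) = (LINT x|lborel. f x)"
proof -
  have "(LINT x|lborel. f x) = (LINT x|distr lborel borel ((+) c). f x)" by (simp add: lborel_distr_plus)
  also have "\<dots> = (LINT x|lborel. f (c + x))" using assms by (subst integral_distr) auto
  finally show ?thesis by (simp add: add.commute)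
qed

lemma nn_integral_translate:
  fixes f :: "'a::euclidean_space \<Rightarrow> ennreal"
  assumes "f \<in> borel_measurable borel"
  shows "(\<integral>\<^sup>+x. f (x + c) \<partial>lborel) = (\<integral>\<^sup>+x. f x \<partial>lborel)"
proof -
  have "(\<integral>\<^sup>+x. f x \<partial>lborel) = (\<integral>\<^sup>+x. f x \<partial>distr lborel borel ((+) c))" by (simp add: lborel_distr_plus)
  also have "\<dots> = (\<integral>\<^sup>+x. f (c + x) \<partial>lborel)" using assms by (subst nn_integral_distr) auto
  finally show ?thesis by (simp add: add.commute)
qed

text \<open>Integrating the derivative along the segment from x to x + v gives g (x + v) - g x,
  whose integral over x vanishes by translation invariance; exchanging the two integrals, the inner
  one does not depend on the point of the segment. Integrability is assumed in place of compact
  support so that the rule covers Gaussian weights as well as test functions.\<close>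

lemma integral_directional_derivative_eq_0:
  fixes g k :: "'a::euclidean_space \<Rightarrow> 'b::euclidean_space"
  assumes der: "\<And>x. ((\<lambda>t. g (x + t *\<^sub>R v)) has_vector_derivative k x) (at 0)"
    and cont: "continuous_on UNIV k" and g: "integrable lborel g" and k: "integrable lborel k"
  shows "(LINT x|lborel. k x) = 0"
proof -
  have der': "((\<lambda>s. g (x + s *\<^sub>R v)) has_vector_derivative k (x + s *\<^sub>R v)) (at s within S)" for x s S
  proof -
    have "((\<lambda>t. g ((x + s *\<^sub>R v) + t *\<^sub>R v)) \<circ> (\<lambda>r. r - s) has_vector_derivative (1 *\<^sub>R k (x + s *\<^sub>R v))) (at s)"
      by (rule vector_diff_chain_at) (auto intro!: derivative_eq_intros der)
    then show ?thesis by (auto simp: o_def algebra_simps intro: has_vector_derivative_at_within)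
  qed
  have [measurable]: "k \<in> borel_measurable borel" "g \<in> borel_measurable borel"
    using k g by auto
  define F where "F = (\<lambda>(s::real, x). indicator {0..1} s *\<^sub>R k (x + s *\<^sub>R v))"
  have Fm: "F \<in> borel_measurable (lborel \<Otimes>\<^sub>M lborel)" unfolding F_def by measurable
  have "(\<integral>\<^sup>+y. norm (F y) \<partial>(lborel \<Otimes>\<^sub>M lborel)) = (\<integral>\<^sup>+s. \<integral>\<^sup>+x. norm (F (s, x)) \<partial>lborel \<partial>lborel)"
    using Fm by (subst lborel.nn_integral_fst[symmetric]) auto
  also have "\<dots> = (\<integral>\<^sup>+s. indicator {0..1} s * (\<integral>\<^sup>+x. norm (k x) \<partial>lborel) \<partial>(lborel::real measure))"
  proof (rule nn_integral_cong)
    fix s :: real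
    have "(\<integral>\<^sup>+x. norm (F (s, x)) \<partial>lborel) = indicator {0..1} s * (\<integral>\<^sup>+x. norm (k (x + s *\<^sub>R v)) \<partial>lborel)"
      by (subst nn_integral_cmult[symmetric]) (auto simp: F_def indicator_def)
    then show "(\<integral>\<^sup>+x. norm (F (s, x)) \<partial>lborel) = indicator {0..1} s * (\<integral>\<^sup>+x. norm (k x) \<partial>lborel)"
      by (simp add: nn_integral_translate[where f="\<lambda>x. ennreal (norm (k x))"])
  qed
  also have "\<dots> = (\<integral>\<^sup>+x. norm (k x) \<partial>lborel)" by (simp add: nn_integral_multc)
  also have "\<dots> < \<infinity>" using k by (simp add: integrable_iff_bounded)
  finally have Fi: "integrable (lborel \<Otimes>\<^sub>M lborel) F" using Fm by (simp add: integrable_iff_bounded)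
  have "(LINT x|lborel. (LINT s|lborel. F (s, x))) = (LINT x|lborel. g (x + v) - g x)"
  proof (rule Bochner_Integration.integral_cong)
    fix x
    have "(LINT s|lborel. indicator {0..1} s *\<^sub>R k (x + s *\<^sub>R v)) = g (x + 1 *\<^sub>R v) - g (x + 0 *\<^sub>R v)"
      by (rule integral_FTC_Icc) (auto intro!: der' continuous_on_compose2[OF cont] continuous_intros)
    then show "(LINT s|lborel. F (s, x)) = g (x + v) - g x" by (simp add: F_def)
  qed simp
  also have "\<dots> = 0" using g
    by (subst Bochner_Integration.integral_diff) (auto simp: lborel_integrable_translate lborel_integral_translate)
  finally have 0: "(LINT x|lborel. (LINT s|lborel. F (s, x))) = 0" .
  have "(LINT x|lborel. (LINT s|lborel. F (s, x))) = (LINT s|lborel. (LINT x|lborel. F (s, x)))"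
    using Fi by (intro lborel_pair.Fubini_integral) (simp add: case_prod_unfold F_def)
  also have "\<dots> = (LINT s|lborel. indicator {0..1::real} s *\<^sub>R (LINT x|lborel. k x))"
    by (rule Bochner_Integration.integral_cong) (auto simp: F_def lborel_integral_translate)
  also have "\<dots> = (LINT x|lborel. k x)" by simp
  finally show ?thesis using 0 by simp
qed

lemma test_integral_dird:
  assumes "test_function f" shows "(LINT z|lborel. dird v f z) = 0"
proof (rule integral_directional_derivative_eq_0[where g = f and v = v])
  show "((\<lambda>t. f (x + t *\<^sub>R v)) has_vector_derivative dird v f x) (at 0)" for x
    using dird_line[OF test_smooth[OF assms], of x v 0 UNIV] by simp
qed (use assms in \<open>auto intro!: smooth_continuous test_integrable test_smooth\<close>)

lemma test_integral_by_parts: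
  assumes f: "test_function f" and g: "smooth g"
  shows "(LINT z|lborel. g z * dird v f z) = - (LINT z|lborel. dird v g z * f z)"
proof -
  have "0 = (LINT z|lborel. dird v (\<lambda>z. g z * f z) z)"
    using test_integral_dird[OF test_mult_right[OF f g]] by simp
  also have "\<dots> = (LINT z|lborel. g z * dird v f z + dird v g z * f z)"
    using dird_mult[OF g test_smooth[OF f]] by simp
  also have "\<dots> = (LINT z|lborel. g z * dird v f z) + (LINT z|lborel. dird v g z * f z)"
    using f g by (intro Bochner_Integration.integral_add test_mult_integrable)
      (auto intro!: smooth_continuous smooth_dird)
  finally show ?thesis by (simp add: eq_neg_iff_add_eq_0)
qed

section \<open>Polynomials, cutoffs and density of test functions\<close>

lemma smooth_Re_Im:
  assumes "smooth f"
  shows "smooth (\<lambda>z. of_real (Re (f z)))" "smooth (\<lambda>z. of_real (Im (f z)))" "smooth (\<lambda>z. cnj (f z))"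
proof -
  have lin: "Ck k (\<lambda>z. L (f z))" if "bounded_linear L" for L :: "complex \<Rightarrow> complex" and k
    using assms
  proof (induction k arbitrary: f)
    case 0 then show ?case using bounded_linear.continuous_on[OF that] smooth_continuous by auto
  next
    case (Suc k)
    then show ?case
      by (intro Ck_SucI[where f'="\<lambda>v z. L (dird v f z)"])
        (auto intro!: bounded_linear.has_derivative[OF that] smooth_has_derivative Suc.IH smooth_dird)
  qed
  show "smooth (\<lambda>z. of_real (Re (f z)))" "smooth (\<lambda>z. of_real (Im (f z)))" "smooth (\<lambda>z. cnj (f z))"
    unfolding smooth_def
    using lin[OF bounded_linear_compose[OF bounded_linear_of_real bounded_linear_Re]]
      lin[OF bounded_linear_compose[OF bounded_linear_of_real bounded_linear_Im]]
      lin[OF bounded_linear_cnj] by auto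
qed

lemma smooth_real_polynomial: "real_polynomial_function p \<Longrightarrow> smooth (\<lambda>z. of_real (p z))"
proof (induction rule: real_polynomial_function.induct)
  case (linear f)
  then show ?case by (intro smooth_bounded_linear bounded_linear_compose[OF bounded_linear_of_real])
qed (simp_all add: smooth_add smooth_mult)

lemma smooth_polynomial_function:
  assumes "polynomial_function p" shows "smooth p"
proof -
  have "real_polynomial_function (Re \<circ> p)" "real_polynomial_function (Im \<circ> p)"
    using assms bounded_linear_Re bounded_linear_Im unfolding polynomial_function_def by blast+
  from this[THEN smooth_real_polynomial]
  have "smooth (\<lambda>z. of_real (Re (p z)) + \<i> * of_real (Im (p z)))"
    by (intro smooth_intros) (simp_all add: o_def)
  then show ?thesis by (simp add: complex_eq[symmetric])
qed

lemma smooth_coord [smooth_intros, simp]: "smooth (\<lambda>z. z $ a)" "smooth (\<lambda>z. cnj (z $ a))"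
  using smooth_bounded_linear[OF bounded_linear_vec_nth] smooth_Re_Im(3)[OF smooth_bounded_linear[OF bounded_linear_vec_nth]]
  by auto

lemma smooth_inner [smooth_intros, simp]: "smooth (\<lambda>z. of_real (z \<bullet> v))"
  by (intro smooth_bounded_linear bounded_linear_compose[OF bounded_linear_of_real bounded_linear_inner_left])

lemma smooth_norm2 [smooth_intros, simp]: "smooth (\<lambda>z::complex^'n. of_real (z \<bullet> z))"
proof -
  have "smooth (\<lambda>z::complex^'n. \<Sum>a\<in>UNIV. z $ a * cnj (z $ a))" by (intro smooth_intros)
  moreover have "complex_of_real (z \<bullet> z) = (\<Sum>a\<in>UNIV. z $ a * cnj (z $ a))" for z :: "complex^'n"
    unfolding inner_vec_def of_real_sum
    by (intro sum.cong) (auto simp: complex_mult_cnj inner_complex_def power2_eq_square)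
  ultimately show ?thesis by simp
qed

text \<open>Since (R + 1)^2 - R^2 = 2 R + 1, the argument of \<open>step\<close> runs from 1 at norm
  R to 0 at norm R + 1. The squared norm keeps the function smooth at the origin.\<close>

definition cutoff :: "real \<Rightarrow> complex^'n \<Rightarrow> real" where
  "cutoff R z = step (((R + 1)^2 - z \<bullet> z) / (2 * R + 1))"

lemma smooth_cutoff: "smooth (\<lambda>z. of_real (cutoff R z))"
  unfolding cutoff_def
proof (rule smooth_compose_real[OF _ _ Dk_step])
  have "smooth (\<lambda>z. of_real ((R + 1)^2 / (2 * R + 1)) - of_real (1 / (2 * R + 1)) * of_real (z \<bullet> z))"
    by (intro smooth_intros)
  then show "smooth (\<lambda>z. of_real (((R + 1)^2 - z \<bullet> z) / (2 * R + 1)))"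
    by (simp add: diff_divide_distrib)
qed simp

lemma cutoff_1: assumes "R \<ge> 0" "norm z \<le> R" shows "cutoff R z = 1"
proof -
  have "z \<bullet> z \<le> R^2" using assms by (simp add: power2_norm_eq_inner[symmetric] power_mono)
  then show ?thesis unfolding cutoff_def using assms by (intro step_1) (auto simp: field_simps power2_eq_square)
qed

lemma cutoff_0: assumes "R \<ge> 0" "norm z \<ge> R + 1" shows "cutoff R z = 0"
proof -
  have "z \<bullet> z \<ge> (R + 1)^2" using assms by (simp add: power2_norm_eq_inner[symmetric] power_mono)
  then show ?thesis unfolding cutoff_def using assms by (intro step_0) (auto simp: field_simps)
qed

lemma cutoff_range: "0 \<le> cutoff R z" "cutoff R z \<le> 1"
  by (auto simp: cutoff_def step_range)

lemma cutoff_support: "R \<ge> 0 \<Longrightarrow> {z. complex_of_real (cutoff R z) \<noteq> 0} \<subseteq> cball 0 (R + 1)"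
  using cutoff_0[of R] by force

lemma test_cutoff: "R \<ge> 0 \<Longrightarrow> test_function (\<lambda>z. of_real (cutoff R z))"
  by (rule test_functionI[OF smooth_cutoff cutoff_support]) auto

text \<open>A Stone-Weierstrass polynomial close to \<open>g\<close> on the larger ball is
  multiplied by a cutoff. Wherever the cutoff differs from 1 the function \<open>g\<close> is
  already 0, so the multiplication does not enlarge the error.\<close>

lemma test_function_approx:
  fixes g :: "complex^'n \<Rightarrow> complex"
  assumes g: "continuous_on UNIV g" "{z. g z \<noteq> 0} \<subseteq> cball 0 R" and R: "R \<ge> 0" and e: "e > 0"
  obtains \<phi> where "test_function \<phi>" "{z. \<phi> z \<noteq> 0} \<subseteq> cball 0 (R + 1)" "\<And>z. norm (\<phi> z - g z) < e"
proof -
  obtain p where p: "polynomial_function p" "\<forall>z\<in>cball 0 (R + 1). norm (g z - p z) < e"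
    using Stone_Weierstrass_polynomial_function[OF compact_cball continuous_on_subset[OF g(1) subset_UNIV] e] by metis
  define \<phi> where "\<phi> z = of_real (cutoff R z) * p z" for z
  have "norm (\<phi> z - g z) < e" for z
  proof (cases "norm z \<le> R + 1")
    case True
    have "g z = 0" if "norm z > R"
      using g(2) that by (metis (mono_tags, lifting) mem_Collect_eq mem_cball_0 not_le subset_iff)
    then have "cutoff R z = 1 \<or> g z = 0"
      using cutoff_1[OF R, of z] by fastforce
    then have "\<phi> z - g z = of_real (cutoff R z) * (p z - g z)" by (auto simp: \<phi>_def algebra_simps)
    then have "norm (\<phi> z - g z) = cutoff R z * norm (p z - g z)" by (simp add: norm_mult cutoff_range)
    also have "\<dots> \<le> 1 * norm (p z - g z)" by (intro mult_right_mono cutoff_range) auto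
    also have "\<dots> < e" using p(2) True by (simp add: norm_minus_commute)
    finally show ?thesis .
  next
    case False
    then have "g z = 0" using g(2) by (metis (mono_tags, lifting) add_increasing2 mem_Collect_eq mem_cball_0 subset_iff zero_le_one)
    then show ?thesis using False R e cutoff_0[of R z] by (simp add: \<phi>_def)
  qed
  moreover have "test_function \<phi>" unfolding \<phi>_def[abs_def]
    by (rule test_mult_left[OF test_cutoff[OF R] smooth_polynomial_function[OF p(1)]])
  moreover have "{z. \<phi> z \<noteq> 0} \<subseteq> cball 0 (R + 1)"
    using cutoff_support[OF R] by (auto simp: \<phi>_def simp del: mem_cball_0 mem_cball)
  ultimately show ?thesis by (rule that[rotated 2])
qed

text \<open>A continuous Urysohn function is approximated within 1/4 by a test function; x ->
  \<open>step\<close> (2 x - 1/2) then sends all values up to 1/4 to 0 and all values from 3/4 on to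
  1. Shrinking \<open>U\<close> to a bounded \<open>V\<close> first makes the support
  compact.\<close>

lemma smooth_Urysohn:
  fixes K U :: "(complex^'n) set"
  assumes K: "compact K" and U: "open U" "K \<subseteq> U"
  obtains \<eta> :: "complex^'n \<Rightarrow> real" where "test_function (\<lambda>z. of_real (\<eta> z))"
    "\<And>z. 0 \<le> \<eta> z" "\<And>z. \<eta> z \<le> 1" "\<And>z. z \<in> K \<Longrightarrow> \<eta> z = 1" "\<And>z. z \<notin> U \<Longrightarrow> \<eta> z = 0"
proof -
  obtain R where R: "R > 0" "K \<subseteq> ball 0 R"
    using compact_imp_bounded[OF K] bounded_subset_ballD by blast
  define V where "V = U \<inter> ball 0 R"
  have V: "closed (- V)" "K \<inter> - V = {}" using U R by (auto simp: V_def)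
  obtain g :: "complex^'n \<Rightarrow> real" where g: "continuous_on UNIV g" "\<And>z. g z \<in> closed_segment 1 0"
      "\<And>z. z \<in> K \<Longrightarrow> g z = 1" "\<And>z. z \<in> - V \<Longrightarrow> g z = 0"
    using Urysohn[OF compact_imp_closed[OF K] V, of 1 0] by metis
  have "{z. complex_of_real (g z) \<noteq> 0} \<subseteq> cball 0 R" using g(4) by (force simp: V_def)
  then obtain \<phi> :: "complex^'n \<Rightarrow> complex" where \<phi>: "test_function \<phi>" "\<And>z. norm (\<phi> z - of_real (g z)) < 1/4"
    using test_function_approx[of "\<lambda>z. complex_of_real (g z)" R "1/4"] continuous_on_of_real[OF g(1)] R
    by (metis less_eq_real_def zero_less_divide_1_iff zero_less_numeral)
  have close: "\<bar>Re (\<phi> z) - g z\<bar> < 1/4" for z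
    using abs_Re_le_cmod[of "\<phi> z - of_real (g z)"] \<phi>(2)[of z] by simp
  define \<eta> where "\<eta> z = step (2 * Re (\<phi> z) - 1/2)" for z
  have sm: "smooth (\<lambda>z. of_real (\<eta> z))" unfolding \<eta>_def
  proof (rule smooth_compose_real[OF _ _ Dk_step])
    have "smooth (\<lambda>z. 2 * of_real (Re (\<phi> z)) - 1/2)"
      using smooth_Re_Im(1)[OF test_smooth[OF \<phi>(1)]] by (intro smooth_intros)
    then show "smooth (\<lambda>z. of_real (2 * Re (\<phi> z) - 1/2))" by simp
  qed simp
  have 0: "\<eta> z = 0" if "z \<notin> V" for z
    unfolding \<eta>_def using close[of z] g(4)[of z] that by (intro step_0) auto
  show ?thesis
  proof
    show "test_function (\<lambda>z. of_real (\<eta> z))"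
      by (rule test_functionI[OF sm, of "cball 0 R"]) (use 0 in \<open>force simp: V_def\<close>)+
    show "\<eta> z = 1" if "z \<in> K" for z
      unfolding \<eta>_def using close[of z] g(3)[OF that] by (intro step_1) linarith
    show "\<eta> z = 0" if "z \<notin> U" for z using that 0 by (simp add: V_def)
  qed (auto simp: \<eta>_def step_range)
qed

section \<open>Mixed discriminants\<close>

definition icoef :: "('n::finite \<times> 'n) list \<Rightarrow> complex" where
  "icoef L = (if distinct (map fst L) \<and> set (map fst L) = UNIV \<and>
         distinct (map snd L) \<and> set (map snd L) = UNIV
      then of_int (sign (\<lambda>a. the (map_of L a))) * (- 2 * \<i>) ^ CARD('n) else 0)"

lemma integration_current_icoef: "integration_current L f = icoef L * (LINT z|lborel. f z)"
  by (simp add: integration_current_def icoef_def)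

lemma permutation_map_of:
  fixes L :: "('n::finite \<times> 'n) list"
  assumes "distinct (map fst L)" "set (map fst L) = UNIV" "distinct (map snd L)" "set (map snd L) = UNIV"
  shows "permutation (\<lambda>a. the (map_of L a))"
proof -
  have *: "\<exists>b. (a, b) \<in> set L \<and> the (map_of L a) = b" for a
  proof -
    have "a \<in> set (map fst L)" using assms by simp
    then obtain b where "(a, b) \<in> set L" by auto
    then have "map_of L a = Some b" using map_of_eq_Some_iff[OF assms(1)] by blast
    with \<open>(a, b) \<in> set L\<close> show ?thesis by simp
  qed
  have "inj (\<lambda>a. the (map_of L a))"
  proof (rule injI)
    fix a a' assume eq: "the (map_of L a) = the (map_of L a')"
    obtain b b' where b: "(a, b) \<in> set L" "the (map_of L a) = b" "(a', b') \<in> set L" "the (map_of L a') = b'"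
      using * by metis
    then have "(a, b) = (a', b')"
      using assms(3) eq unfolding distinct_map by (intro inj_onD[of snd "set L"]) auto
    then show "a = a'" by simp
  qed
  then have "(\<lambda>a. the (map_of L a)) permutes UNIV"
    by (intro bij_imp_permutes) (auto simp: bij_def finite_UNIV_inj_surj)
  then show ?thesis using permutation_permutes finite_class.finite_UNIV by blast
qed

text \<open>The index type carries no order, so an arbitrary enumeration of the coordinates serves
  as reference, and \<open>levi\<close> is the Levi-Civita symbol relative to it. Another reference
  would change \<open>levi\<close> by a global sign, which cancels in the product of two
  symbols.\<close>

definition enum_perm :: "'n::finite list \<Rightarrow> 'n \<Rightarrow> 'n" where
  "enum_perm A = (\<lambda>a. the (map_of (zip (SOME U. distinct U \<and> set U = UNIV) A) a))"

definition levi :: "'n::finite list \<Rightarrow> int" where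
  "levi A = (if distinct A \<and> set A = UNIV then sign (enum_perm A) else 0)"

text \<open>The permutation that carries \<open>A\<close> to \<open>B\<close>, composed with the one
  from the reference to \<open>A\<close>, is the one from the reference to \<open>B\<close>; hence
  its sign factors. The product form turns the form in \<open>kform_nonneg\<close> into a square in
  top degree.\<close>

lemma icoef_zip:
  fixes A B :: "'n::finite list"
  assumes len: "length A = length B"
  shows "icoef (zip A B) = of_int (levi A) * of_int (levi B) * (- 2 * \<i>) ^ CARD('n)"
proof (cases "distinct A \<and> set A = UNIV \<and> distinct B \<and> set B = UNIV")
  case False
  have *: "map fst (zip A B) = A" "map snd (zip A B) = B" using len by simp_all
  have "icoef (zip A B) = 0" unfolding icoef_def * using False by auto
  moreover have "levi A = 0 \<or> levi B = 0" using False by (auto simp: levi_def)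
  ultimately show ?thesis by auto
next
  case True
  define U :: "'n list" where "U = (SOME U. distinct U \<and> set U = UNIV)"
  have "\<exists>U :: 'n list. distinct U \<and> set U = UNIV"
    using finite_distinct_list[OF finite_class.finite_UNIV[where 'a='n]] by blast
  from someI_ex[OF this] have U: "distinct U" "set U = UNIV" unfolding U_def by auto
  have lenU: "length U = length A" "length U = length B"
    using True U distinct_card by metis+
  let ?s = "\<lambda>a. the (map_of (zip A B) a)"
  have pA: "permutation (enum_perm A)" and pB: "permutation (enum_perm B)"
    unfolding enum_perm_def U_def[symmetric] using True U lenU
    by (auto intro!: permutation_map_of)
  have ps: "permutation ?s" using True len by (auto intro!: permutation_map_of)
  have "?s \<circ> enum_perm A = enum_perm B"
  proof
    fix x
    obtain i where i: "i < length U" "x = U ! i" using U by (metis UNIV_I in_set_conv_nth)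
    have 1: "map_of (zip U A) x = Some (A ! i)" "map_of (zip U B) x = Some (B ! i)"
      using U i lenU by (auto simp: map_of_zip_nth)
    have 2: "map_of (zip A B) (A ! i) = Some (B ! i)"
      using True len i lenU by (auto simp: map_of_zip_nth)
    show "(?s \<circ> enum_perm A) x = enum_perm B x"
      by (simp add: enum_perm_def U_def[symmetric] 1 2)
  qed
  then have "sign ?s * sign (enum_perm A) = sign (enum_perm B)"
    using sign_compose[OF ps pA] by simp
  then have "sign ?s = sign (enum_perm A) * sign (enum_perm B)"
    using sign_idempotent[of "enum_perm A"] by (metis mult.assoc mult.commute mult_1)
  then show ?thesis using True len by (simp add: icoef_def levi_def)
qed

text \<open>Each pair stands for a two-form, and two-forms commute.\<close>

lemma icoef_mset: assumes "mset L = mset L'" shows "icoef L = icoef L'"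
proof -
  have "mset (map fst L) = mset (map fst L')" "mset (map snd L) = mset (map snd L')"
    using assms by (metis mset_map)+
  then have "distinct (map fst L) = distinct (map fst L')" "distinct (map snd L) = distinct (map snd L')"
    "set (map fst L) = set (map fst L')" "set (map snd L) = set (map snd L')"
    using mset_eq_imp_distinct_iff mset_eq_setD by blast+
  moreover have "map_of L = map_of L'" if "distinct (map fst L)"
    using map_of_inject_set[of L L'] that calculation assms mset_eq_setD by blast
  ultimately show ?thesis by (simp add: icoef_def)
qed

text \<open>By \<open>icoef_zip\<close> the product of the two symbols is the sign of a
  transposition, that is, -1; integers of modulus at most 1 with product -1 are opposite.\<close>

lemma levi_swap: "levi (a # a' # A) = - levi (a' # a # A)"
proof (cases "distinct (a # a' # A) \<and> set (a # a' # A) = UNIV")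
  case False then show ?thesis by (auto simp: levi_def)
next
  case True
  have len: "length (a # a' # A) = length (a' # a # A)" by simp
  have aa: "a \<noteq> a'" using True by auto
  have "icoef (zip (a # a' # A) (a' # a # A)) = - ((- 2 * \<i>) ^ CARD('a))"
  proof -
    have "map_of (zip A A) x = (if x \<in> set A then Some x else None)" for x
      by (induction A) auto
    moreover have "x \<in> set A" if "x \<noteq> a" "x \<noteq> a'" for x using True that by auto
    ultimately have "(\<lambda>x. the (map_of (zip (a # a' # A) (a' # a # A)) x)) = Transposition.transpose a a'"
      using aa by (auto simp: fun_eq_iff Transposition.transpose_def)
    then show ?thesis using True aa by (auto simp: icoef_def sign_swap_id insert_commute)
  qed
  then have "complex_of_int (levi (a # a' # A) * levi (a' # a # A)) = -1"
    unfolding icoef_zip[OF len] of_int_mult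
    by (metis (no_types, lifting) divide_minus_left mult.commute mult_minus1 nonzero_mult_div_cancel_left
        power_not_zero complex_i_not_zero mult_eq_0_iff neg_equal_0_iff_equal zero_neq_numeral)
  then have "of_int (levi (a # a' # A) * levi (a' # a # A)) = (of_int (-1) :: complex)" by simp
  then have 1: "levi (a # a' # A) * levi (a' # a # A) = -1" by (simp only: of_int_eq_iff)
  have "\<bar>levi (a # a' # A)\<bar> \<le> 1" "\<bar>levi (a' # a # A)\<bar> \<le> 1" by (auto simp: levi_def sign_def)
  moreover have "x = - y" if "x * y = -1" "\<bar>x\<bar> \<le> 1" "\<bar>y\<bar> \<le> 1" for x y :: int
  proof -
    have "x \<in> {-1, 0, 1}" "y \<in> {-1, 0, 1}" using that by auto
    then show ?thesis using that(1) by auto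
  qed
  ultimately show ?thesis using 1 by blast
qed

lemma icoef_unzip:
  fixes L :: "('n::finite \<times> 'n) list"
  shows "icoef L = of_int (levi (map fst L)) * of_int (levi (map snd L)) * (- 2 * \<i>) ^ CARD('n)"
  using icoef_zip[of "map fst L" "map snd L"] by (simp add: zip_map_fst_snd)

text \<open>The pointwise model of \<open>ddc_wedge\<close>: the wedge product of the forms 2 i H_ab
  dz_a d(conj z_b), evaluated on the remaining form listed in \<open>L\<close>. For as many matrices
  as coordinates and \<open>L\<close> empty it is a multiple of the mixed discriminant.\<close>

fun mdisc :: "('n::finite \<Rightarrow> 'n \<Rightarrow> complex) list \<Rightarrow> ('n \<times> 'n) list \<Rightarrow> complex" where
  "mdisc [] L = icoef L"
| "mdisc (H # Hs) L = (\<Sum>a\<in>UNIV. \<Sum>b\<in>UNIV. 2 * \<i> * H a b * mdisc Hs ((a, b) # L))"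

lemma mdisc_mset: "mset L = mset L' \<Longrightarrow> mdisc Hs L = mdisc Hs L'"
  by (induction Hs arbitrary: L L') (auto intro!: sum.cong icoef_mset arg_cong[where f="(*) _"])

lemma mdisc_swap_fst: "mdisc Hs ((a, b) # (a', b') # L) = - mdisc Hs ((a', b) # (a, b') # L)"
proof (induction Hs arbitrary: L)
  case Nil
  then show ?case using levi_swap[of a a'] by (simp add: icoef_unzip)
next
  case (Cons H Hs)
  have "mdisc Hs ((c, d) # (a, b) # (a', b') # L) = - mdisc Hs ((c, d) # (a', b) # (a, b') # L)" for c d
  proof -
    have "mdisc Hs ((c, d) # (a, b) # (a', b') # L) = mdisc Hs ((a, b) # (a', b') # (c, d) # L)"
      by (rule mdisc_mset) simp
    also have "\<dots> = - mdisc Hs ((a', b) # (a, b') # (c, d) # L)" by (rule Cons.IH)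
    also have "mdisc Hs ((a', b) # (a, b') # (c, d) # L) = mdisc Hs ((c, d) # (a', b) # (a, b') # L)"
      by (rule mdisc_mset) simp
    finally show ?thesis .
  qed
  then show ?case by (simp add: sum_negf)
qed

lemma mdisc_swap_snd: "mdisc Hs ((a, b) # (a', b') # L) = - mdisc Hs ((a, b') # (a', b) # L)"
  using mdisc_swap_fst[of Hs a b a' b' L] mdisc_mset[of "(a', b) # (a, b') # L" "(a, b') # (a', b) # L" Hs]
  by simp

lemma mdisc_commute: "mdisc (H # K # Hs) L = mdisc (K # H # Hs) L"
proof -
  have "mdisc (H # K # Hs) L = (\<Sum>a\<in>UNIV. \<Sum>b\<in>UNIV. \<Sum>c\<in>UNIV. \<Sum>d\<in>UNIV.
      2 * \<i> * H a b * (2 * \<i> * K c d * mdisc Hs ((c, d) # (a, b) # L)))"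
    by (simp add: sum_distrib_left)
  also have "\<dots> = (\<Sum>a\<in>UNIV. \<Sum>c\<in>UNIV. \<Sum>b\<in>UNIV. \<Sum>d\<in>UNIV.
      2 * \<i> * H a b * (2 * \<i> * K c d * mdisc Hs ((c, d) # (a, b) # L)))"
    by (intro sum.cong refl sum.swap)
  also have "\<dots> = (\<Sum>c\<in>UNIV. \<Sum>a\<in>UNIV. \<Sum>d\<in>UNIV. \<Sum>b\<in>UNIV.
      2 * \<i> * H a b * (2 * \<i> * K c d * mdisc Hs ((c, d) # (a, b) # L)))"
    by (subst sum.swap, intro sum.cong refl sum.swap)
  also have "\<dots> = (\<Sum>c\<in>UNIV. \<Sum>d\<in>UNIV. \<Sum>a\<in>UNIV. \<Sum>b\<in>UNIV.
      2 * \<i> * H a b * (2 * \<i> * K c d * mdisc Hs ((c, d) # (a, b) # L)))"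
    by (intro sum.cong refl sum.swap)
  also have "\<dots> = (\<Sum>c\<in>UNIV. \<Sum>d\<in>UNIV. \<Sum>a\<in>UNIV. \<Sum>b\<in>UNIV.
      2 * \<i> * K c d * (2 * \<i> * H a b * mdisc Hs ((a, b) # (c, d) # L)))"
    using mdisc_mset[of "(c, d) # (a, b) # L" "(a, b) # (c, d) # L" Hs for a b c d]
    by (simp add: mult_ac)
  also have "\<dots> = mdisc (K # H # Hs) L" by (simp add: sum_distrib_left)
  finally show ?thesis .
qed

lemma mdisc_move: "mdisc (H # Hs @ Ks) L = mdisc (Hs @ H # Ks) L"
proof (induction Hs arbitrary: L)
  case (Cons K Hs)
  have "mdisc (H # (K # Hs) @ Ks) L = mdisc (K # H # Hs @ Ks) L" using mdisc_commute by simp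
  also have "\<dots> = mdisc ((K # Hs) @ H # Ks) L" using Cons by simp
  finally show ?case .
qed simp

section \<open>Positive matrices and positivity of wedge products\<close>

definition lists_len :: "nat \<Rightarrow> 'n::finite list set" where "lists_len j = {A. length A = j}"

lemma lists_len_0: "lists_len 0 = {[]}"
  and lists_len_Suc: "lists_len (Suc j) = (\<lambda>(a, A). a # A) ` (UNIV \<times> lists_len j)"
  and finite_lists_len [simp]: "finite (lists_len j)"
proof -
  show 1: "lists_len 0 = {[]}" by (auto simp: lists_len_def)
  show 2: "lists_len (Suc j) = (\<lambda>(a, A). a # A) ` (UNIV \<times> lists_len j)" for j
    by (auto simp: lists_len_def length_Suc_conv image_iff)
  show "finite (lists_len j :: 'n::finite list set)"
    by (induction j) (simp_all add: 1 2)
qed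

lemma sum_lists_len_Suc: "sum f (lists_len (Suc j)) = (\<Sum>a\<in>UNIV. \<Sum>A\<in>lists_len j. f (a # A))"
  by (subst lists_len_Suc, subst sum.reindex) (auto simp: inj_on_def sum.cartesian_product case_prod_unfold)

text \<open>Positive semidefiniteness is encoded as being a finite sum of rank-one matrices. All
  Hessians below arise in this shape, and positivity of wedge products is proved by induction over
  the summands.\<close>

inductive psd :: "('n::finite \<Rightarrow> 'n \<Rightarrow> complex) \<Rightarrow> bool" where
  psd_zero: "psd (\<lambda>_ _. 0)"
| psd_add_rank1: "psd H \<Longrightarrow> psd (\<lambda>a b. H a b + w a * cnj (w b))"

lemma psd_add: "psd H \<Longrightarrow> psd K \<Longrightarrow> psd (\<lambda>a b. H a b + K a b)"
proof (induction rule: psd.induct)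
  case (psd_add_rank1 H w)
  then have "psd (\<lambda>a b. (H a b + K a b) + w a * cnj (w b))" by (intro psd.psd_add_rank1)
  then show ?case by (simp add: algebra_simps)
qed simp

lemma psd_rank1: "psd (\<lambda>a b. w a * cnj (w b))"
  using psd_add_rank1[OF psd_zero, of w] by simp

lemma psd_sum: "(\<And>r. r \<in> R \<Longrightarrow> psd (H r)) \<Longrightarrow> psd (\<lambda>a b. \<Sum>r\<in>R. H r a b)"
  by (induction R rule: infinite_finite_induct) (simp_all add: psd_zero psd_add)

lemma psd_scale: "c \<ge> 0 \<Longrightarrow> psd H \<Longrightarrow> psd (\<lambda>a b. of_real c * H a b)"
proof (rotate_tac, induction rule: psd.induct)
  case (psd_add_rank1 H w)
  then have "psd (\<lambda>a b. of_real c * H a b + (of_real (sqrt c) * w a) * cnj (of_real (sqrt c) * w b))"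
    by (intro psd.psd_add_rank1)
  also have "(\<lambda>a b. of_real c * H a b + (of_real (sqrt c) * w a) * cnj (of_real (sqrt c) * w b))
      = (\<lambda>a b. of_real c * (H a b + w a * cnj (w b)))"
  proof -
    have "complex_of_real (sqrt c) * complex_of_real (sqrt c) = of_real c"
      using \<open>c \<ge> 0\<close> by (simp flip: of_real_mult)
    then show ?thesis by (simp add: fun_eq_iff algebra_simps)
  qed
  finally show ?case .
qed (simp add: psd_zero)

definition kform :: "('n::finite \<Rightarrow> 'n \<Rightarrow> complex) list \<Rightarrow> nat \<Rightarrow> ('n list \<Rightarrow> complex) \<Rightarrow> complex" where
  "kform Hs j x = (2 * \<i>) ^ j * (\<Sum>A\<in>lists_len j. \<Sum>B\<in>lists_len j. x A * cnj (x B) * mdisc Hs (zip A B))"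

text \<open>Wedging with the rank-one form of \<open>w\<close> amounts to replacing beta by w wedge
  beta, which raises the degree j by one.\<close>

lemma kform_rank1:
  "(2 * \<i>) ^ j * (\<Sum>A\<in>lists_len j. \<Sum>B\<in>lists_len j. x A * cnj (x B) *
     (\<Sum>a\<in>UNIV. \<Sum>b\<in>UNIV. 2 * \<i> * (w a * cnj (w b)) * mdisc Hs ((a, b) # zip A B)))
   = kform Hs (Suc j) (\<lambda>A. w (hd A) * x (tl A))"
proof -
  have "kform Hs (Suc j) (\<lambda>A. w (hd A) * x (tl A)) = (2 * \<i>) ^ Suc j * (\<Sum>a\<in>UNIV. \<Sum>A\<in>lists_len j. \<Sum>b\<in>UNIV. \<Sum>B\<in>lists_len j.
      (w a * x A) * cnj (w b * x B) * mdisc Hs ((a, b) # zip A B))"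
    by (simp add: kform_def sum_lists_len_Suc)
  also have "\<dots> = (\<Sum>a\<in>UNIV. \<Sum>A\<in>lists_len j. \<Sum>b\<in>UNIV. \<Sum>B\<in>lists_len j.
      (2 * \<i>) ^ j * (x A * cnj (x B) * (2 * \<i> * (w a * cnj (w b)) * mdisc Hs ((a, b) # zip A B))))"
    by (simp add: sum_distrib_left mult_ac)
  also have "\<dots> = (\<Sum>A\<in>lists_len j. \<Sum>a\<in>UNIV. \<Sum>B\<in>lists_len j. \<Sum>b\<in>UNIV.
      (2 * \<i>) ^ j * (x A * cnj (x B) * (2 * \<i> * (w a * cnj (w b)) * mdisc Hs ((a, b) # zip A B))))"
    by (subst sum.swap) (intro sum.cong refl sum.swap)
  also have "\<dots> = (\<Sum>A\<in>lists_len j. \<Sum>B\<in>lists_len j. \<Sum>a\<in>UNIV. \<Sum>b\<in>UNIV.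
      (2 * \<i>) ^ j * (x A * cnj (x B) * (2 * \<i> * (w a * cnj (w b)) * mdisc Hs ((a, b) # zip A B))))"
    by (intro sum.cong refl sum.swap)
  finally show ?thesis by (simp add: sum_distrib_left)
qed

lemma kform_Cons_nonneg:
  assumes H: "psd H" and Hs: "\<And>x. kform Hs (Suc j) x \<in> \<real>\<^sub>\<ge>\<^sub>0"
  shows "kform (H # Hs) j x \<in> \<real>\<^sub>\<ge>\<^sub>0"
  using H
proof (induction rule: psd.induct)
  case psd_zero then show ?case by (simp add: kform_def)
next
  case (psd_add_rank1 H w)
  have "kform ((\<lambda>a b. H a b + w a * cnj (w b)) # Hs) j x =
      kform (H # Hs) j x + kform Hs (Suc j) (\<lambda>A. w (hd A) * x (tl A))"
    unfolding kform_rank1[symmetric] unfolding kform_def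
    by (simp add: algebra_simps sum.distrib)
  then show ?case using psd_add_rank1 Hs by simp
qed

text \<open>By induction, each rank-one summand of the head factor is traded for one more index of
  \<open>x\<close>. When no factor is left, \<open>icoef_zip\<close> separates the two lists and the
  form becomes a power of 4 times the squared modulus of a single sum.\<close>

lemma kform_nonneg:
  fixes Hs :: "('n::finite \<Rightarrow> 'n \<Rightarrow> complex) list"
  assumes "\<And>H. H \<in> set Hs \<Longrightarrow> psd H" "length Hs + j = CARD('n)"
  shows "kform Hs j x \<in> \<real>\<^sub>\<ge>\<^sub>0"
  using assms
proof (induction Hs arbitrary: j x)
  case Nil
  then have j: "j = CARD('n)" by simp
  define S where "S = (\<Sum>A\<in>lists_len j. x A * of_int (levi A))"
  have "(\<Sum>A\<in>lists_len j. \<Sum>B\<in>lists_len j. x A * cnj (x B) * mdisc [] (zip A B)) =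
     (\<Sum>A\<in>lists_len j. \<Sum>B\<in>lists_len j. (x A * of_int (levi A)) * cnj (x B * of_int (levi B)) * (- 2 * \<i>) ^ CARD('n))"
    by (intro sum.cong refl) (simp add: lists_len_def icoef_zip mult_ac)
  also have "\<dots> = S * cnj S * (- 2 * \<i>) ^ CARD('n)"
    unfolding S_def cnj_sum sum_product sum_distrib_right[of _ _ "_ ^ _"] ..
  finally have "kform [] j x = (S * cnj S) * ((2 * \<i>) * (- 2 * \<i>)) ^ j"
    unfolding kform_def j[symmetric] power_mult_distrib by (simp only: mult_ac)
  also have "(2 * \<i>) * (- 2 * \<i>) = 4" by simp
  also have "S * cnj S * 4 ^ j = of_real (4 ^ j * (norm S)^2)"
    unfolding of_real_mult complex_norm_square by simp
  finally have "kform [] j x = of_real (4 ^ j * (norm S)^2)" .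
  then show ?case by (simp only: nonneg_Reals_of_real_iff) simp
next
  case (Cons H Hs)
  show ?case by (rule kform_Cons_nonneg) (use Cons in auto)
qed

text \<open>The values at 1 and at i force q to be the conjugate of p; the value at - p / |p| is
  then S - 2 |p|.\<close>

lemma hermitian_2x2_bound:
  fixes p q :: complex
  assumes "\<And>\<theta>. norm \<theta> = 1 \<Longrightarrow> of_real S + cnj \<theta> * p + \<theta> * q \<in> \<real>\<^sub>\<ge>\<^sub>0"
  shows "2 * norm p \<le> S"
proof -
  have "Im p + Im q = 0" using assms[of 1] by (auto simp: nonneg_Reals_def complex_eq_iff)
  moreover have "Re q - Re p = 0" using assms[of \<i>] by (auto simp: complex_nonneg_Reals_iff)
  ultimately have q: "q = cnj p" by (simp add: complex_eq_iff)
  show ?thesis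
  proof (cases "p = 0")
    case True then show ?thesis using assms[of 1] q by (simp add: complex_nonneg_Reals_iff)
  next
    case False
    let ?t = "- p / of_real (norm p)"
    have "norm ?t = 1" using False by (simp add: norm_divide)
    from assms[OF this] have "0 \<le> Re (of_real S + cnj ?t * p + ?t * q)"
      by (simp add: complex_nonneg_Reals_iff)
    moreover have "cnj ?t * p = - of_real (norm p)" "?t * q = - of_real (norm p)"
      unfolding q using False by (simp_all add: mult.commute[of _ p] complex_norm_square[symmetric] power2_eq_square)
    ultimately have "0 \<le> Re (of_real S + - of_real (norm p) + - of_real (norm p))" by (simp only:)
    then show ?thesis by simp
  qed
qed

definition idm :: "'n \<Rightarrow> 'n \<Rightarrow> complex" where "idm a b = of_bool (a = b)"

lemma mdisc_idm: "mdisc (idm # Hs) L = 2 * \<i> * (\<Sum>a\<in>UNIV. mdisc Hs ((a, a) # L))"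
  by (simp add: idm_def sum_distrib_left of_bool_def if_distrib[of "\<lambda>x. _ * x"] if_distrib[of "\<lambda>x. x * _"] cong: if_cong)

lemma mdisc_replicate_idm:
  "mdisc (replicate j idm @ Hs) L = (2 * \<i>) ^ j * (\<Sum>A\<in>lists_len j. mdisc Hs (zip A A @ L))"
proof (induction j arbitrary: L)
  case 0 then show ?case by (simp add: lists_len_0)
next
  case (Suc j)
  have "mdisc (replicate (Suc j) idm @ Hs) L = 2 * \<i> * (\<Sum>a\<in>UNIV. (2 * \<i>) ^ j * (\<Sum>A\<in>lists_len j. mdisc Hs (zip A A @ (a, a) # L)))"
    unfolding replicate_Suc append_Cons mdisc_idm Suc.IH ..
  also have "\<dots> = (2 * \<i>) ^ Suc j * (\<Sum>a\<in>UNIV. (\<Sum>A\<in>lists_len j. mdisc Hs (zip (a # A) (a # A) @ L)))"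
    using mdisc_mset[of "zip A A @ (a, a) # L" "(a, a) # zip A A @ L" Hs for a A]
    by (simp add: sum_distrib_left mult_ac)
  finally show ?case by (simp add: sum_lists_len_Suc)
qed

lemma mdisc_nonneg:
  fixes Hs :: "('n::finite \<Rightarrow> 'n \<Rightarrow> complex) list"
  assumes "\<And>H. H \<in> set Hs \<Longrightarrow> psd H" "length Hs = CARD('n)"
  shows "mdisc Hs [] \<in> \<real>\<^sub>\<ge>\<^sub>0"
  using kform_nonneg[of Hs 0 "\<lambda>_. 1"] assms by (simp add: kform_def lists_len_0)

text \<open>In a positive Hermitian form every entry is bounded by the trace, and the trace over
  index lists is the wedge product with j Euclidean forms, by \<open>mdisc_replicate_idm\<close>.
  This reduces the control of all coefficients of a positive current to one positive
  density.\<close>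

lemma mdisc_bound:
  fixes Hs :: "('n::finite \<Rightarrow> 'n \<Rightarrow> complex) list"
  assumes psd: "\<And>H. H \<in> set Hs \<Longrightarrow> psd H" and len: "length Hs + length L = CARD('n)"
  shows "norm (mdisc Hs L) \<le> Re (mdisc (replicate (length L) idm @ Hs) [])"
proof -
  define j where "j = length L"
  define A B where "A = map fst L" and "B = map snd L"
  define K where "K A B = (2 * \<i>) ^ j * mdisc Hs (zip A B)" for A B
  have AB: "A \<in> lists_len j" "B \<in> lists_len j" by (auto simp: A_def B_def lists_len_def j_def)
  have L: "L = zip A B" by (simp add: A_def B_def zip_map_fst_snd)
  have kf: "kform Hs j x = (\<Sum>A\<in>lists_len j. \<Sum>B\<in>lists_len j. x A * cnj (x B) * K A B)" for x
    by (simp add: kform_def K_def sum_distrib_left mult_ac)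
  have pos: "(\<Sum>A\<in>lists_len j. \<Sum>B\<in>lists_len j. x A * cnj (x B) * K A B) \<in> \<real>\<^sub>\<ge>\<^sub>0" for x
    using kform_nonneg[where Hs = Hs and j = j and x = x] psd len unfolding kf by (simp add: j_def)
  have two: "(\<Sum>C\<in>lists_len j. \<Sum>D\<in>lists_len j. x C * cnj (x D) * K C D) =
      (\<Sum>C\<in>T. \<Sum>D\<in>T. x C * cnj (x D) * K C D)"
    if "\<And>C. C \<notin> T \<Longrightarrow> x C = 0" "T \<subseteq> lists_len j" for x and T :: "'n list set"
  proof -
    have "(\<Sum>D\<in>lists_len j. x C * cnj (x D) * K C D) = (\<Sum>D\<in>T. x C * cnj (x D) * K C D)" for C
      using that by (intro sum.mono_neutral_right) auto
    then show ?thesis using that by (simp, intro sum.mono_neutral_right) auto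
  qed
  have diag: "K C C \<in> \<real>\<^sub>\<ge>\<^sub>0" if "C \<in> lists_len j" for C
    using pos[of "\<lambda>D. of_bool (D = C)"] two[of "{C}" "\<lambda>D. of_bool (D = C)"] that by simp
  have tr: "mdisc (replicate j idm @ Hs) [] = (\<Sum>C\<in>lists_len j. K C C)"
    unfolding mdisc_replicate_idm K_def sum_distrib_left by simp
  have Re_diag: "Re (K C C) \<ge> 0" "K C C = of_real (Re (K C C))" if "C \<in> lists_len j" for C
    using diag[OF that] by (auto simp: complex_nonneg_Reals_iff complex_eq_iff)
  have "norm (K A B) \<le> Re (mdisc (replicate j idm @ Hs) [])"
  proof (cases "A = B")
    case True
    have "norm (K A A) = Re (K A A)" using Re_diag[OF AB(1)] by (metis abs_of_nonneg norm_of_real)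
    also have "\<dots> \<le> (\<Sum>C\<in>lists_len j. Re (K C C))"
      using AB Re_diag by (intro member_le_sum) auto
    finally show ?thesis using True by (simp add: tr)
  next
    case False
    have "2 * norm (K A B) \<le> Re (K A A) + Re (K B B)"
    proof (rule hermitian_2x2_bound[where q = "K B A"])
      fix \<theta> :: complex assume th: "norm \<theta> = 1"
      have "\<theta> * cnj \<theta> = 1" using th by (simp add: complex_norm_square[symmetric])
      \<comment> \<open>Testing with a vector supported on \<open>A\<close> and \<open>B\<close>
        isolates the 2x2 block of these two indices; the phase of its second entry is free.\<close>
      let ?x = "\<lambda>C. if C = A then 1 else if C = B then \<theta> else 0"
      have "(\<Sum>C\<in>{A,B}. \<Sum>D\<in>{A,B}. ?x C * cnj (?x D) * K C D) \<in> \<real>\<^sub>\<ge>\<^sub>0"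
        using pos[of ?x] two[of "{A,B}" ?x] AB by simp
      moreover have "(\<Sum>C\<in>{A,B}. \<Sum>D\<in>{A,B}. ?x C * cnj (?x D) * K C D) =
          K A A + cnj \<theta> * K A B + \<theta> * K B A + (\<theta> * cnj \<theta>) * K B B"
        using False by (simp add: algebra_simps)
      moreover have "complex_of_real (Re (K A A) + Re (K B B)) = K A A + K B B"
        using Re_diag AB by simp
      ultimately show "of_real (Re (K A A) + Re (K B B)) + cnj \<theta> * K A B + \<theta> * K B A \<in> \<real>\<^sub>\<ge>\<^sub>0"
        using \<open>\<theta> * cnj \<theta> = 1\<close> by (simp add: algebra_simps)
    qed
    also have "Re (K A A) + Re (K B B) = (\<Sum>C\<in>{A,B}. Re (K C C))" using False by simp
    also have "\<dots> \<le> (\<Sum>C\<in>lists_len j. Re (K C C))"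
      using AB Re_diag by (intro sum_mono2) auto
    finally have "2 * norm (K A B) \<le> Re (mdisc (replicate j idm @ Hs) [])" by (simp add: tr)
    then show ?thesis using norm_ge_zero[of "K A B"] by linarith
  qed
  moreover have "norm (mdisc Hs L) \<le> norm (K A B)"
    unfolding K_def L[symmetric] norm_mult norm_power
    using mult_right_mono[of 1 "2 ^ j" "norm (mdisc Hs L)"] by simp
  ultimately show ?thesis by (simp add: j_def)
qed

section \<open>Complex Hessians of smooth functions and wedge products\<close>

text \<open>\<open>c = - \<i>\<close> gives the derivative in the coordinate \<open>a\<close>,
  \<open>c = \<i>\<close> the one in its conjugate, so that the product rule and integration by
  parts are proved once for both.\<close>

definition wirt :: "complex \<Rightarrow> 'n \<Rightarrow> (complex^'n \<Rightarrow> complex) \<Rightarrow> complex^'n \<Rightarrow> complex" where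
  "wirt c a f z = (dird (axis a 1) f z + c * dird (axis a \<i>) f z) / 2"

lemma d_dz_wirt: "d_dz a f = wirt (- \<i>) a f" and d_dzbar_wirt: "d_dzbar a f = wirt \<i> a f"
  by (auto simp: fun_eq_iff d_dz_def d_dzbar_def wirt_def dird_def)

lemma wirt_alt: "wirt c a f = (\<lambda>z. (1/2) * (dird (axis a 1) f z + c * dird (axis a \<i>) f z))"
  by (simp add: fun_eq_iff wirt_def)

lemma smooth_wirt [smooth_intros]: "smooth f \<Longrightarrow> smooth (wirt c a f)"
  unfolding wirt_alt by (intro smooth_intros)

lemma wirt_add: "smooth f \<Longrightarrow> smooth g \<Longrightarrow> wirt c a (\<lambda>z. f z + g z) z = wirt c a f z + wirt c a g z"
  by (simp add: wirt_def dird_add algebra_simps add_divide_distrib)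

lemma wirt_mult: "smooth f \<Longrightarrow> smooth g \<Longrightarrow> wirt c a (\<lambda>z. f z * g z) z = f z * wirt c a g z + wirt c a f z * g z"
  by (simp add: wirt_def dird_mult algebra_simps add_divide_distrib)

lemma wirt_const [simp]: "wirt c a (\<lambda>_. k) z = 0" by (simp add: wirt_def)

lemma wirt_cmult: "smooth f \<Longrightarrow> wirt c a (\<lambda>z. k * f z) z = k * wirt c a f z"
  by (simp add: wirt_mult)

lemma wirt_sum: "(\<And>i. i \<in> I \<Longrightarrow> smooth (f i)) \<Longrightarrow> wirt c a (\<lambda>z. \<Sum>i\<in>I. f i z) z = (\<Sum>i\<in>I. wirt c a (f i) z)"
  by (induction I rule: infinite_finite_induct) (simp_all add: wirt_add smooth_sum)

lemma dird_wirt: "smooth f \<Longrightarrow> dird v (wirt c a f) z = (1/2) * (dird v (dird (axis a 1) f) z + c * dird v (dird (axis a \<i>) f) z)"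
  unfolding wirt_alt
  by (simp add: dird_cmult dird_add smooth_intros del: times_divide_eq_left)

lemma wirt_commute: "smooth f \<Longrightarrow> wirt c a (wirt d b f) z = wirt d b (wirt c a f) z"
  unfolding wirt_def[of c a "wirt d b f"] wirt_def[of d b "wirt c a f"]
  by (simp add: dird_wirt dird_commute[of f "axis b _"] algebra_simps)

lemma wirt_test [intro]: "test_function f \<Longrightarrow> test_function (wirt c a f)"
  unfolding wirt_alt by (intro test_mult_right[OF _ smooth_const] test_add test_dird)

lemma test_ibp_wirt:
  assumes f: "test_function f" and g: "smooth g"
  shows "(LINT z|lborel. g z * wirt c a f z) = - (LINT z|lborel. wirt c a g z * f z)"
proof -
  have i: "integrable lborel (\<lambda>z. g z * dird v f z)" "integrable lborel (\<lambda>z. dird v g z * f z)" for v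
    using f g by (auto intro!: test_mult_integrable smooth_continuous smooth_dird)
  have "(LINT z|lborel. g z * wirt c a f z) =
      (LINT z|lborel. (1/2) * (g z * dird (axis a 1) f z + c * (g z * dird (axis a \<i>) f z)))"
    by (intro Bochner_Integration.integral_cong refl) (simp add: wirt_def field_simps)
  also have "\<dots> = (1/2) * ((LINT z|lborel. g z * dird (axis a 1) f z) + c * (LINT z|lborel. g z * dird (axis a \<i>) f z))"
    using i by simp
  also have "\<dots> = - ((1/2) * ((LINT z|lborel. dird (axis a 1) g z * f z) + c * (LINT z|lborel. dird (axis a \<i>) g z * f z)))"
    by (simp add: test_integral_by_parts[OF f g] algebra_simps)
  also have "\<dots> = - (LINT z|lborel. (1/2) * (dird (axis a 1) g z * f z + c * (dird (axis a \<i>) g z * f z)))"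
    using i by simp
  also have "(LINT z|lborel. (1/2) * (dird (axis a 1) g z * f z + c * (dird (axis a \<i>) g z * f z)))
      = (LINT z|lborel. wirt c a g z * f z)"
    by (intro Bochner_Integration.integral_cong refl) (simp add: wirt_def field_simps)
  finally show ?thesis .
qed

abbreviation cplx :: "(complex^'n \<Rightarrow> real) \<Rightarrow> complex^'n \<Rightarrow> complex" where
  "cplx u \<equiv> \<lambda>z. complex_of_real (u z)"

definition hess :: "(complex^'n \<Rightarrow> real) \<Rightarrow> complex^'n \<Rightarrow> 'n \<Rightarrow> 'n \<Rightarrow> complex" where
  "hess u z a b = wirt (- \<i>) a (wirt \<i> b (cplx u)) z"

text \<open>For smooth functions this is the density of the Bedford-Taylor product:
  \<open>integral_wcoef_Cons\<close> reproduces the recursion of \<open>ddc_wedge\<close>.\<close>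

definition wcoef :: "(complex^'n \<Rightarrow> real) list \<Rightarrow> ('n \<times> 'n) list \<Rightarrow> complex^'n \<Rightarrow> complex" where
  "wcoef us L z = mdisc (map (\<lambda>u. hess u z) us) L"

lemma wcoef_Nil: "wcoef [] L z = icoef L"
  by (simp add: wcoef_def)

lemma wcoef_Cons: "wcoef (u # us) L z = (\<Sum>a\<in>UNIV. \<Sum>b\<in>UNIV. 2 * \<i> * hess u z a b * wcoef us ((a, b) # L) z)"
  by (simp add: wcoef_def)

lemma wcoef_mset: "mset L = mset L' \<Longrightarrow> wcoef us L z = wcoef us L' z"
  unfolding wcoef_def by (rule mdisc_mset)

lemma wcoef_move: "wcoef (u # us @ vs) L z = wcoef (us @ u # vs) L z"
  by (simp add: wcoef_def mdisc_move[simplified])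

lemma smooth_hess [smooth_intros]: "smooth (cplx u) \<Longrightarrow> smooth (\<lambda>z. hess u z a b)"
  unfolding hess_def by (intro smooth_intros)

lemma smooth_wcoef: "(\<And>u. u \<in> set us \<Longrightarrow> smooth (cplx u)) \<Longrightarrow> smooth (wcoef us L)"
proof (induction us arbitrary: L)
  case Nil then show ?case by (simp add: wcoef_Nil[abs_def])
next
  case (Cons u us) then show ?case unfolding wcoef_Cons[abs_def] by (intro smooth_intros) auto
qed

lemma antisym_sum_eq_0:
  fixes T M :: "'n::finite \<Rightarrow> 'n \<Rightarrow> complex"
  assumes "\<And>a c. T a c = T c a" "\<And>a c. M a c = - M c a"
  shows "(\<Sum>a\<in>UNIV. \<Sum>c\<in>UNIV. T a c * M a c) = 0"
proof -
  have "(\<Sum>a\<in>UNIV. \<Sum>c\<in>UNIV. T a c * M a c) = (\<Sum>c\<in>UNIV. \<Sum>a\<in>UNIV. T a c * M a c)" by (rule sum.swap)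
  also have "\<dots> = (\<Sum>c\<in>UNIV. \<Sum>a\<in>UNIV. - (T c a * M c a))"
    using assms by (intro sum.cong refl) (metis mult_minus_right)
  also have "\<dots> = - (\<Sum>a\<in>UNIV. \<Sum>c\<in>UNIV. T a c * M a c)" by (simp add: sum_negf)
  finally show ?thesis by simp
qed

lemma wirt_wcoef_Cons:
  assumes "smooth (cplx u)" "\<And>u. u \<in> set us \<Longrightarrow> smooth (cplx u)"
  shows "wirt s a (wcoef (u # us) L) z = (\<Sum>c\<in>UNIV. \<Sum>d\<in>UNIV.
      2 * \<i> * (hess u z c d * wirt s a (wcoef us ((c, d) # L)) z + wirt s a (\<lambda>z. hess u z c d) z * wcoef us ((c, d) # L) z))"
  unfolding wcoef_Cons[abs_def] mult.assoc
  by (simp add: wirt_sum wirt_cmult wirt_mult smooth_wcoef assms smooth_intros)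

text \<open>Closedness of the wedge product, in both kinds of variables. The derivative falling on the first
  factor drops out, since third derivatives are symmetric and the coefficients alternate.\<close>

lemma wcoef_closed:
  assumes "\<And>u. u \<in> set us \<Longrightarrow> smooth (cplx u)"
  shows "(\<Sum>a\<in>UNIV. wirt (- \<i>) a (wcoef us ((a, e) # L)) z) = 0"
    "(\<Sum>b\<in>UNIV. wirt \<i> b (wcoef us ((e, b) # L)) z) = 0"
  using assms
proof (induction us arbitrary: L e)
  case Nil
  { case 1 show ?case by (simp add: wcoef_Nil[abs_def]) }
  { case 2 show ?case by (simp add: wcoef_Nil[abs_def]) }
next
  case (Cons u us)
  have comm: "wcoef us ((c, d) # (a, b) # L) = wcoef us ((a, b) # (c, d) # L)" for a b c d L
    by (rule ext, rule wcoef_mset) simp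
  { case 1
    have sm: "smooth (cplx u)" and sms: "\<And>u. u \<in> set us \<Longrightarrow> smooth (cplx u)" using 1 by auto
    have exp: "wirt s a (wcoef (u # us) L) z = (\<Sum>c\<in>UNIV. \<Sum>d\<in>UNIV.
        2 * \<i> * (hess u z c d * wirt s a (wcoef us ((c, d) # L)) z + wirt s a (\<lambda>z. hess u z c d) z * wcoef us ((c, d) # L) z))"
      for s a L by (rule wirt_wcoef_Cons) (auto intro: sm sms)
    have 0: "(\<Sum>a\<in>UNIV. wirt (- \<i>) a (wcoef us ((c, d) # (a, e) # L)) z) = 0" for c d
      unfolding comm[of c d] by (rule Cons.IH(1)) (rule sms)
    have A: "(\<Sum>a\<in>UNIV. \<Sum>c\<in>UNIV. wirt (- \<i>) a (\<lambda>z. hess u z c d) z * wcoef us ((c, d) # (a, e) # L) z) = 0" for d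
    proof (rule antisym_sum_eq_0)
      show "wirt (- \<i>) a (\<lambda>z. hess u z c d) z = wirt (- \<i>) c (\<lambda>z. hess u z a d) z" for a c
      proof -
        have f: "wirt (- \<i>) a (wirt (- \<i>) c (wirt \<i> d (cplx u))) z = wirt (- \<i>) c (wirt (- \<i>) a (wirt \<i> d (cplx u))) z"
          by (rule wirt_commute[OF smooth_wirt[OF sm]])
        show ?thesis using f unfolding hess_def[abs_def] by (simp add: eta_contract_eq)
      qed
      show "wcoef us ((c, d) # (a, e) # L) z = - wcoef us ((a, d) # (c, e) # L) z" for a c
        unfolding wcoef_def by (rule mdisc_swap_fst)
    qed
    have "(\<Sum>a\<in>UNIV. wirt (- \<i>) a (wcoef (u # us) ((a, e) # L)) z) =
        (\<Sum>a\<in>UNIV. \<Sum>c\<in>UNIV. \<Sum>d\<in>UNIV. 2 * \<i> * (hess u z c d * wirt (- \<i>) a (wcoef us ((c, d) # (a, e) # L)) z)) +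
        (\<Sum>a\<in>UNIV. \<Sum>c\<in>UNIV. \<Sum>d\<in>UNIV. 2 * \<i> * (wirt (- \<i>) a (\<lambda>z. hess u z c d) z * wcoef us ((c, d) # (a, e) # L) z))"
      unfolding exp by (simp add: sum.distrib distrib_left)
    also have "(\<Sum>a\<in>UNIV. \<Sum>c\<in>UNIV. \<Sum>d\<in>UNIV. 2 * \<i> * (hess u z c d * wirt (- \<i>) a (wcoef us ((c, d) # (a, e) # L)) z)) =
       (\<Sum>c\<in>UNIV. \<Sum>d\<in>UNIV. 2 * \<i> * (hess u z c d * (\<Sum>a\<in>UNIV. wirt (- \<i>) a (wcoef us ((c, d) # (a, e) # L)) z)))"
      unfolding sum_distrib_left by (rule trans[OF sum.swap], rule sum.cong[OF refl], rule sum.swap)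
    also have "(\<Sum>a\<in>UNIV. \<Sum>c\<in>UNIV. \<Sum>d\<in>UNIV. 2 * \<i> * (wirt (- \<i>) a (\<lambda>z. hess u z c d) z * wcoef us ((c, d) # (a, e) # L) z)) =
       2 * \<i> * (\<Sum>d\<in>UNIV. \<Sum>a\<in>UNIV. \<Sum>c\<in>UNIV. wirt (- \<i>) a (\<lambda>z. hess u z c d) z * wcoef us ((c, d) # (a, e) # L) z)"
      unfolding sum_distrib_left by (rule trans[OF _ sum.swap], rule sum.cong[OF refl], rule sum.swap)
    finally show ?case unfolding 0 A by simp }
  { case 2
    have sm: "smooth (cplx u)" and sms: "\<And>u. u \<in> set us \<Longrightarrow> smooth (cplx u)" using 2 by auto
    have exp: "wirt s a (wcoef (u # us) L) z = (\<Sum>c\<in>UNIV. \<Sum>d\<in>UNIV.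
        2 * \<i> * (hess u z c d * wirt s a (wcoef us ((c, d) # L)) z + wirt s a (\<lambda>z. hess u z c d) z * wcoef us ((c, d) # L) z))"
      for s a L by (rule wirt_wcoef_Cons) (auto intro: sm sms)
    have 0: "(\<Sum>b\<in>UNIV. wirt \<i> b (wcoef us ((c, d) # (e, b) # L)) z) = 0" for c d
      unfolding comm[of c d] by (rule Cons.IH(2)) (rule sms)
    have A: "(\<Sum>b\<in>UNIV. \<Sum>d\<in>UNIV. wirt \<i> b (\<lambda>z. hess u z c d) z * wcoef us ((c, d) # (e, b) # L) z) = 0" for c
    proof (rule antisym_sum_eq_0)
      have "(\<lambda>z. hess u z c d) = wirt \<i> d (wirt (- \<i>) c (cplx u))" for d
        by (simp add: fun_eq_iff hess_def wirt_commute sm)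
      then show "wirt \<i> b (\<lambda>z. hess u z c d) z = wirt \<i> d (\<lambda>z. hess u z c b) z" for b d
        by (simp add: wirt_commute smooth_intros sm)
      show "wcoef us ((c, d) # (e, b) # L) z = - wcoef us ((c, b) # (e, d) # L) z" for b d
        unfolding wcoef_def by (rule mdisc_swap_snd)
    qed
    have "(\<Sum>b\<in>UNIV. wirt \<i> b (wcoef (u # us) ((e, b) # L)) z) =
        (\<Sum>b\<in>UNIV. \<Sum>c\<in>UNIV. \<Sum>d\<in>UNIV. 2 * \<i> * (hess u z c d * wirt \<i> b (wcoef us ((c, d) # (e, b) # L)) z)) +
        (\<Sum>b\<in>UNIV. \<Sum>c\<in>UNIV. \<Sum>d\<in>UNIV. 2 * \<i> * (wirt \<i> b (\<lambda>z. hess u z c d) z * wcoef us ((c, d) # (e, b) # L) z))"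
      unfolding exp by (simp add: sum.distrib distrib_left)
    also have "(\<Sum>b\<in>UNIV. \<Sum>c\<in>UNIV. \<Sum>d\<in>UNIV. 2 * \<i> * (hess u z c d * wirt \<i> b (wcoef us ((c, d) # (e, b) # L)) z)) =
       (\<Sum>c\<in>UNIV. \<Sum>d\<in>UNIV. 2 * \<i> * (hess u z c d * (\<Sum>b\<in>UNIV. wirt \<i> b (wcoef us ((c, d) # (e, b) # L)) z)))"
      unfolding sum_distrib_left by (rule trans[OF sum.swap], rule sum.cong[OF refl], rule sum.swap)
    also have "(\<Sum>b\<in>UNIV. \<Sum>c\<in>UNIV. \<Sum>d\<in>UNIV. 2 * \<i> * (wirt \<i> b (\<lambda>z. hess u z c d) z * wcoef us ((c, d) # (e, b) # L) z)) =
       2 * \<i> * (\<Sum>c\<in>UNIV. \<Sum>b\<in>UNIV. \<Sum>d\<in>UNIV. wirt \<i> b (\<lambda>z. hess u z c d) z * wcoef us ((c, d) # (e, b) # L) z)"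
      unfolding sum_distrib_left by (rule sum.swap)
    finally show ?case unfolding 0 A by simp }
qed

section \<open>Stokes' theorem for wedge products\<close>

lemma smooth_mult_test_integrable:
  "smooth g \<Longrightarrow> test_function f \<Longrightarrow> integrable lborel (\<lambda>z. g z * f z)"
  by (rule test_mult_integrable[OF smooth_continuous])

text \<open>In the product rule the derivatives of the coefficients sum to 0 by
  \<open>wcoef_closed\<close>, so the derivative passes from one function to the other as if the
  coefficients were constant.\<close>

lemma wcoef_ibp:
  assumes us: "\<And>u. u \<in> set us \<Longrightarrow> smooth (cplx u)" and f: "test_function f" and g: "smooth g"
  shows "(\<Sum>a\<in>UNIV. LINT z|lborel. wcoef us ((a, b) # L) z * f z * wirt (- \<i>) a g z) =
      - (\<Sum>a\<in>UNIV. LINT z|lborel. wcoef us ((a, b) # L) z * wirt (- \<i>) a f z * g z)" (is ?A)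
    and "(\<Sum>b\<in>UNIV. LINT z|lborel. wcoef us ((a, b) # L) z * f z * wirt \<i> b g z) =
      - (\<Sum>b\<in>UNIV. LINT z|lborel. wcoef us ((a, b) # L) z * wirt \<i> b f z * g z)" (is ?B)
proof -
  have smf: "smooth f" using f by (rule test_smooth)
  have main: "(\<Sum>i\<in>UNIV. LINT z|lborel. C i z * f z * wirt s i g z) = - (\<Sum>i\<in>UNIV. LINT z|lborel. C i z * wirt s i f z * g z)"
    if C: "\<And>i. smooth (C i)" and cl: "\<And>z. (\<Sum>i\<in>UNIV. wirt s i (C i) z) = 0" for C :: "'a \<Rightarrow> _" and s
  proof -
    have t: "test_function (\<lambda>z. C i z * f z)" for i by (rule test_mult_right[OF f C])
    have int1: "integrable lborel (\<lambda>z. g z * (C i z * wirt s i f z))" for i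
      by (intro smooth_mult_test_integrable g test_mult_right wirt_test f C)
    have int2: "integrable lborel (\<lambda>z. g z * (wirt s i (C i) z * f z))" for i
      by (intro smooth_mult_test_integrable g test_mult_right smooth_wirt f C)
    have "(LINT z|lborel. C i z * f z * wirt s i g z) = - (LINT z|lborel. g z * (C i z * wirt s i f z)) - (LINT z|lborel. g z * (wirt s i (C i) z * f z))" for i
    proof -
      have "(LINT z|lborel. C i z * f z * wirt s i g z) = - (LINT z|lborel. g z * wirt s i (\<lambda>z. C i z * f z) z)"
        using test_ibp_wirt[OF t g, of s i i] by (simp add: mult_ac)
      also have "(LINT z|lborel. g z * wirt s i (\<lambda>z. C i z * f z) z) =
          (LINT z|lborel. g z * (C i z * wirt s i f z) + g z * (wirt s i (C i) z * f z))"
        by (simp add: wirt_mult C smf distrib_left)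
      finally show ?thesis using int1[of i] int2[of i] by simp
    qed
    then have "(\<Sum>i\<in>UNIV. LINT z|lborel. C i z * f z * wirt s i g z) =
        - (\<Sum>i\<in>UNIV. LINT z|lborel. g z * (C i z * wirt s i f z)) - (\<Sum>i\<in>UNIV. LINT z|lborel. g z * (wirt s i (C i) z * f z))"
      by (simp add: sum_subtractf sum_negf)
    also have "(\<Sum>i\<in>UNIV. LINT z|lborel. g z * (wirt s i (C i) z * f z)) = (LINT z|lborel. (\<Sum>i\<in>UNIV. g z * (wirt s i (C i) z * f z)))"
      by (rule Bochner_Integration.integral_sum[symmetric]) (rule int2)
    also have "(\<lambda>z. \<Sum>i\<in>UNIV. g z * (wirt s i (C i) z * f z)) = (\<lambda>_. 0)"
      using cl by (simp add: fun_eq_iff sum_distrib_left[symmetric] sum_distrib_right[symmetric])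
    finally show ?thesis by (simp add: mult_ac)
  qed
  show ?A by (rule main[OF smooth_wcoef[OF us] wcoef_closed(1)[OF us]])
  show ?B by (rule main[OF smooth_wcoef[OF us] wcoef_closed(2)[OF us]])
qed

text \<open>One or two integrations by parts take the head factor out of the wedge product. With one
  derivative on each side the formula suits radial functions; with both on \<open>f\<close> it
  contains \<open>u\<close> undifferentiated and therefore survives locally uniform limits.\<close>

lemma integral_wcoef_Cons:
  assumes u: "smooth (cplx u)" and us: "\<And>u. u \<in> set us \<Longrightarrow> smooth (cplx u)" and f: "test_function f"
  shows "(LINT z|lborel. wcoef (u # us) L z * f z) =
    - (\<Sum>a\<in>UNIV. \<Sum>b\<in>UNIV. 2 * \<i> * (LINT z|lborel. wcoef us ((a, b) # L) z * wirt (- \<i>) a f z * wirt \<i> b (cplx u) z))" (is ?A)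
    and "(LINT z|lborel. wcoef (u # us) L z * f z) =
    (\<Sum>a\<in>UNIV. \<Sum>b\<in>UNIV. 2 * \<i> * (LINT z|lborel. wcoef us ((a, b) # L) z * (of_real (u z) * d_dz a (d_dzbar b f) z)))" (is ?B)
proof -
  have "(LINT z|lborel. wcoef (u # us) L z * f z) =
     (LINT z|lborel. (\<Sum>a\<in>UNIV. \<Sum>b\<in>UNIV. 2 * \<i> * (wcoef us ((a, b) # L) z * f z * hess u z a b)))"
    unfolding wcoef_Cons sum_distrib_right by (simp add: mult_ac)
  also have "\<dots> = (\<Sum>a\<in>UNIV. \<Sum>b\<in>UNIV. 2 * \<i> * (LINT z|lborel. wcoef us ((a, b) # L) z * f z * hess u z a b))"
  proof -
    have "integrable lborel (\<lambda>z. 2 * \<i> * (hess u z a b * (wcoef us ((a, b) # L) z * f z)))" for a b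
      by (intro integrable_mult_right smooth_mult_test_integrable smooth_hess u test_mult_right f smooth_wcoef us)
    then have "integrable lborel (\<lambda>z. 2 * \<i> * (wcoef us ((a, b) # L) z * f z * hess u z a b))" for a b
      by (simp only: mult_ac)
    then show ?thesis by (simp add: Bochner_Integration.integral_sum)
  qed
  also have "\<dots> = (\<Sum>b\<in>UNIV. 2 * \<i> * (\<Sum>a\<in>UNIV. LINT z|lborel. wcoef us ((a, b) # L) z * f z * wirt (- \<i>) a (wirt \<i> b (cplx u)) z))"
    unfolding hess_def sum_distrib_left by (rule sum.swap)
  also have "\<dots> = - (\<Sum>b\<in>UNIV. \<Sum>a\<in>UNIV. 2 * \<i> * (LINT z|lborel. wcoef us ((a, b) # L) z * wirt (- \<i>) a f z * wirt \<i> b (cplx u) z))"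
    by (subst wcoef_ibp(1)[OF us f smooth_wirt[OF u]]) (simp_all add: sum_distrib_left sum_negf)
  finally show A: ?A by (subst sum.swap)
  also have "- (\<Sum>a\<in>UNIV. \<Sum>b\<in>UNIV. 2 * \<i> * (LINT z|lborel. wcoef us ((a, b) # L) z * wirt (- \<i>) a f z * wirt \<i> b (cplx u) z))
     = (\<Sum>a\<in>UNIV. - (2 * \<i> * (\<Sum>b\<in>UNIV. (LINT z|lborel. wcoef us ((a, b) # L) z * wirt (- \<i>) a f z * wirt \<i> b (cplx u) z))))"
    by (simp add: sum_negf sum_distrib_left)
  also have "\<dots> = (\<Sum>a\<in>UNIV. \<Sum>b\<in>UNIV. 2 * \<i> * (LINT z|lborel. wcoef us ((a, b) # L) z * wirt \<i> b (wirt (- \<i>) a f) z * of_real (u z)))"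
    by (subst wcoef_ibp(2)[OF us wirt_test[OF f] u]) (simp_all add: sum_distrib_left)
  also have "\<dots> = (\<Sum>a\<in>UNIV. \<Sum>b\<in>UNIV. 2 * \<i> * (LINT z|lborel. wcoef us ((a, b) # L) z * (of_real (u z) * d_dz a (d_dzbar b f) z)))"
    unfolding d_dz_wirt d_dzbar_wirt by (subst wirt_commute[OF test_smooth[OF f]]) (simp add: mult_ac)
  finally show ?B .
qed

text \<open>Since \<open>\<partial>f \<and> \<partial>'\<phi>(s) = f'(s) \<phi>'(s) \<partial>s \<and> \<partial>'s\<close> for radial \<open>f\<close>, the factor \<open>\<phi>'\<close> can be moved into the test function.\<close>

lemma integral_wcoef_radial:
  fixes us :: "(complex^'n \<Rightarrow> real) list" and s :: "complex^'n \<Rightarrow> real"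
  assumes s: "smooth (cplx s)" and \<phi>: "smooth (cplx (\<lambda>z. \<phi> (s z)))" and us: "\<And>u. u \<in> set us \<Longrightarrow> smooth (cplx u)"
    and f: "test_function (cplx (\<lambda>z. f (s z)))" and F: "test_function (cplx (\<lambda>z. F (s z)))"
    and df: "\<And>z. (f has_real_derivative f' (s z)) (at (s z))"
    and dF: "\<And>z. (F has_real_derivative f' (s z) * \<phi>' (s z)) (at (s z))"
    and d\<phi>: "\<And>z. (\<phi> has_real_derivative \<phi>' (s z)) (at (s z))"
  shows "(LINT z|lborel. wcoef ((\<lambda>z. \<phi> (s z)) # us) L z * of_real (f (s z))) =
    (LINT z|lborel. wcoef (s # us) L z * of_real (F (s z)))"
proof -
  have w: "wirt c a (cplx (\<lambda>z. h (s z))) z = of_real h' * wirt c a (cplx s) z"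
    if "(h has_real_derivative h') (at (s z))" for c a h h' z
    by (simp add: wirt_def dird_compose_real[OF s that] algebra_simps)
  have 1: "(LINT z|lborel. wcoef ((\<lambda>z. \<phi> (s z)) # us) L z * of_real (f (s z))) =
    - (\<Sum>a\<in>UNIV. \<Sum>b\<in>UNIV. 2 * \<i> * (LINT z|lborel. wcoef us ((a, b) # L) z *
        wirt (- \<i>) a (cplx (\<lambda>z. f (s z))) z * wirt \<i> b (cplx (\<lambda>z. \<phi> (s z))) z))"
    by (rule integral_wcoef_Cons(1)[OF \<phi> us f])
  have 2: "(LINT z|lborel. wcoef (s # us) L z * of_real (F (s z))) =
    - (\<Sum>a\<in>UNIV. \<Sum>b\<in>UNIV. 2 * \<i> * (LINT z|lborel. wcoef us ((a, b) # L) z *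
        wirt (- \<i>) a (cplx (\<lambda>z. F (s z))) z * wirt \<i> b (cplx s) z))"
    by (rule integral_wcoef_Cons(1)[OF s us F])
  show ?thesis unfolding 1 2 w[OF df] w[OF dF] w[OF d\<phi>] by (simp add: mult_ac)
qed

section \<open>Convergence of wedge products along smooth approximations\<close>

definition sq :: "complex^'n \<Rightarrow> real" where "sq z = z \<bullet> z"

lemma smooth_sq [smooth_intros, simp]: "smooth (cplx sq)" by (simp add: sq_def)

lemma cplx_sq: "complex_of_real (sq z) = (\<Sum>a\<in>UNIV. z $ a * cnj (z $ a))"
  unfolding sq_def inner_vec_def of_real_sum
  by (intro sum.cong) (auto simp: complex_mult_cnj inner_complex_def power2_eq_square)

lemma wirt_coord:
  "wirt (- \<i>) a (\<lambda>z. z $ b) z = of_bool (a = b)" "wirt \<i> a (\<lambda>z. z $ b) z = 0"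
  "wirt (- \<i>) a (\<lambda>z. cnj (z $ b)) z = 0" "wirt \<i> a (\<lambda>z. cnj (z $ b)) z = of_bool (a = b)"
proof -
  have d: "dird v (\<lambda>z. z $ b) z = v $ b" for v
    by (rule dird_bounded_linear) (rule bounded_linear_vec_nth)
  have dc: "dird v (\<lambda>z. cnj (z $ b)) z = cnj (v $ b)" for v
    by (rule dird_bounded_linear) (rule bounded_linear_compose[OF bounded_linear_cnj bounded_linear_vec_nth])
  show "wirt (- \<i>) a (\<lambda>z. z $ b) z = of_bool (a = b)" "wirt \<i> a (\<lambda>z. z $ b) z = 0"
    "wirt (- \<i>) a (\<lambda>z. cnj (z $ b)) z = 0" "wirt \<i> a (\<lambda>z. cnj (z $ b)) z = of_bool (a = b)"
    by (auto simp: wirt_def d dc axis_def)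
qed

lemma wirt_sq: "wirt \<i> b (cplx sq) z = z $ b" "wirt (- \<i>) b (cplx sq) z = cnj (z $ b)"
  unfolding cplx_sq by (simp_all add: wirt_sum wirt_mult smooth_intros wirt_coord of_bool_def
      if_distrib[of "\<lambda>x. _ * x"] if_distrib[of "\<lambda>x. x * _"] cong: if_cong)

lemma hess_sq: "hess sq z = (idm :: 'n::finite \<Rightarrow> 'n \<Rightarrow> complex)"
proof -
  have "wirt \<i> b (cplx sq) = (\<lambda>z. z $ b)" for b :: 'n using wirt_sq by blast
  then show ?thesis unfolding hess_def[abs_def] by (intro ext) (simp only: wirt_coord idm_def)
qed

text \<open>Smooth plurisubharmonic functions, with positivity in the sense of
  \<open>psd\<close>.\<close>

definition spsh :: "(complex^'n \<Rightarrow> real) \<Rightarrow> bool" where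
  "spsh u \<longleftrightarrow> smooth (cplx u) \<and> (\<forall>z. psd (hess u z))"

lemma psd_idm: "psd (idm :: 'n::finite \<Rightarrow> 'n \<Rightarrow> complex)"
proof -
  have "psd (\<lambda>a b. \<Sum>c\<in>UNIV. (of_bool (a = c) :: complex) * cnj (of_bool (b = c)))"
    by (intro psd_sum psd_rank1)
  also have "(\<lambda>a b. \<Sum>c\<in>UNIV. (of_bool (a = c) :: complex) * cnj (of_bool (b = c))) = (idm :: 'n \<Rightarrow> 'n \<Rightarrow> complex)"
    by (simp add: fun_eq_iff idm_def of_bool_def if_distrib[of "\<lambda>x. x * _"] cong: if_cong)
  finally show ?thesis .
qed

lemma spsh_sq: "spsh sq" by (simp add: spsh_def hess_sq psd_idm)

lemma wcoef_replicate_sq: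
  "wcoef (replicate j sq @ us) L z = (2 * \<i>) ^ j * (\<Sum>A\<in>lists_len j. wcoef us (zip A A @ L) z)"
  by (simp add: wcoef_def hess_sq mdisc_replicate_idm)

lemma wcoef_nonneg:
  fixes us :: "(complex^'n \<Rightarrow> real) list"
  assumes "\<And>u. u \<in> set us \<Longrightarrow> spsh u" "length us = CARD('n)"
  shows "wcoef us [] z \<in> \<real>\<^sub>\<ge>\<^sub>0"
  unfolding wcoef_def using assms by (intro mdisc_nonneg) (auto simp: spsh_def)

lemma wcoef_bound:
  fixes us :: "(complex^'n \<Rightarrow> real) list"
  assumes "\<And>u. u \<in> set us \<Longrightarrow> spsh u" "length us + length L = CARD('n)"
  shows "norm (wcoef us L z) \<le> Re (wcoef (replicate (length L) sq @ us) [] z)"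
proof -
  have "map (\<lambda>u. hess u z) (replicate (length L) sq @ us) = replicate (length L) idm @ map (\<lambda>u. hess u z) us"
    by (simp add: hess_sq)
  moreover have "norm (mdisc (map (\<lambda>u. hess u z) us) L) \<le> Re (mdisc (replicate (length L) idm @ map (\<lambda>u. hess u z) us) [])"
    using assms by (intro mdisc_bound) (auto simp: spsh_def)
  ultimately show ?thesis unfolding wcoef_def by (simp only:)
qed

section \<open>Masses and the extension to continuous functions\<close>

definition mass :: "('a::euclidean_space \<Rightarrow> complex) \<Rightarrow> real \<Rightarrow> real" where
  "mass c R = (LINT z|lborel. indicator (cball 0 R) z * norm (c z))"

lemma mass_integrable:
  assumes "continuous_on UNIV c" shows "integrable lborel (\<lambda>z. indicator (cball 0 R) z * norm (c z))"
  using borel_integrable_compact[of "cball 0 R" "\<lambda>z. norm (c z)"] continuous_on_subset[OF assms]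
  by (simp add: continuous_on_norm)

lemma mass_nonneg: "mass c R \<ge> 0"
  unfolding mass_def by (intro Bochner_Integration.integral_nonneg) simp

lemma mass_sum:
  assumes "\<And>i. i \<in> I \<Longrightarrow> continuous_on UNIV (c i)"
  shows "mass (\<lambda>z. \<Sum>i\<in>I. c i z) R \<le> (\<Sum>i\<in>I. mass (c i) R)"
proof -
  have "mass (\<lambda>z. \<Sum>i\<in>I. c i z) R \<le> (LINT z|lborel. (\<Sum>i\<in>I. indicator (cball 0 R) z * norm (c i z)))"
    unfolding mass_def using assms
    by (intro integral_mono mass_integrable Bochner_Integration.integrable_sum continuous_on_sum)
      (auto simp: sum_distrib_left[symmetric] indicator_def intro: norm_sum)
  also have "\<dots> = (\<Sum>i\<in>I. mass (c i) R)"
    unfolding mass_def using assms by (intro Bochner_Integration.integral_sum mass_integrable)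
  finally show ?thesis .
qed

lemma integral_mass_bound:
  fixes c h :: "'a::euclidean_space \<Rightarrow> complex"
  assumes c: "continuous_on UNIV c" and h: "continuous_on UNIV h" "\<And>z. norm (h z) \<le> e" "\<And>z. z \<notin> cball 0 R \<Longrightarrow> h z = 0"
  shows "norm (LINT z|lborel. c z * h z) \<le> e * mass c R"
proof -
  have i: "integrable lborel (\<lambda>z. c z * h z)"
    by (rule integrable_compact_support[of _ "cball 0 R"]) (use c h in \<open>force intro: continuous_intros\<close>)+
  have "norm (LINT z|lborel. c z * h z) \<le> (LINT z|lborel. norm (c z * h z))" by (rule integral_norm_bound)
  also have "\<dots> \<le> (LINT z|lborel. e * (indicator (cball 0 R) z * norm (c z)))"
  proof (intro integral_mono integrable_norm i integrable_mult_right mass_integrable c)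
    fix z show "norm (c z * h z) \<le> e * (indicator (cball 0 R) z * norm (c z))"
    proof (cases "z \<in> cball 0 R")
      case True
      have "norm (c z) * norm (h z) \<le> norm (c z) * e" by (intro mult_left_mono h) simp
      then show ?thesis using True by (simp add: norm_mult mult.commute)
    qed (use h(3) in simp)
  qed
  finally show ?thesis by (simp add: mass_def)
qed

text \<open>Bounded masses make the functionals uniformly continuous for the sup norm on functions
  supported in a fixed ball. Convergence therefore extends from test functions to \<open>g\<close>,
  and the limit is the only value that fits the description of
  \<open>order0_extension\<close>.\<close>

lemma order0_extension_limit:
  fixes c :: "nat \<Rightarrow> complex^'n \<Rightarrow> complex"
  assumes c: "\<And>m. continuous_on UNIV (c m)" and bd: "\<And>R. \<exists>C. \<forall>m. mass (c m) R \<le> C"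
    and D: "\<And>\<phi>. test_function \<phi> \<Longrightarrow> (\<lambda>m. LINT z|lborel. c m z * \<phi> z) \<longlonglongrightarrow> D \<phi>"
    and g: "continuous_on UNIV g" "{z. g z \<noteq> 0} \<subseteq> cball 0 R"
  shows "(\<lambda>m. LINT z|lborel. c m z * g z) \<longlonglongrightarrow> order0_extension D g"
proof -
  define R' where "R' = max R 0"
  have g': "{z. g z \<noteq> 0} \<subseteq> cball 0 R'" "R' \<ge> 0" using g(2) by (auto simp: R'_def)
  have diff: "norm ((LINT z|lborel. c m z * \<phi> z) - (LINT z|lborel. c m z * g z)) \<le> e * mass (c m) S"
    if \<phi>: "continuous_on UNIV \<phi>" "{z. \<phi> z \<noteq> 0} \<subseteq> cball 0 S" "\<And>z. norm (\<phi> z - g z) \<le> e" and S: "R' \<le> S" for \<phi> e S m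
  proof -
    have gS: "{z. g z \<noteq> 0} \<subseteq> cball 0 S" using g' S by auto
    have "integrable lborel (\<lambda>z. c m z * \<phi> z)" "integrable lborel (\<lambda>z. c m z * g z)"
      by (rule integrable_compact_support[of _ "cball 0 S"]; use c \<phi> g gS in \<open>force intro: continuous_intros\<close>)+
    then have "(LINT z|lborel. c m z * \<phi> z) - (LINT z|lborel. c m z * g z) = (LINT z|lborel. c m z * (\<phi> z - g z))"
      by (simp add: right_diff_distrib)
    moreover have "\<phi> z - g z = 0" if "z \<notin> cball 0 S" for z
    proof -
      have "\<phi> z = 0" "g z = 0" using that gS \<phi>(2) by blast+
      then show ?thesis by simp
    qed
    ultimately show ?thesis using integral_mass_bound[OF c, of "\<lambda>z. \<phi> z - g z" e S m] \<phi> g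
      by (auto intro: continuous_intros)
  qed
  have "Cauchy (\<lambda>m. LINT z|lborel. c m z * g z)"
  proof (rule metric_CauchyI)
    fix e :: real assume e: "e > 0"
    obtain C where C: "\<And>m. mass (c m) (R' + 1) \<le> C" using bd by blast
    have C0: "C \<ge> 0" using mass_nonneg C order_trans by blast
    define d where "d = e / (4 * (C + 1))"
    have d: "d > 0" using e C0 by (simp add: d_def)
    obtain \<phi> where \<phi>: "test_function \<phi>" "{z. \<phi> z \<noteq> 0} \<subseteq> cball 0 (R' + 1)" "\<And>z. norm (\<phi> z - g z) < d"
      using test_function_approx[OF g(1) g' d] by blast
    have close: "norm ((LINT z|lborel. c m z * \<phi> z) - (LINT z|lborel. c m z * g z)) < e / 3" for m
    proof -
      have "norm ((LINT z|lborel. c m z * \<phi> z) - (LINT z|lborel. c m z * g z)) \<le> d * mass (c m) (R' + 1)"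
        using \<phi> by (intro diff smooth_continuous test_smooth) (auto intro: less_imp_le)
      also have "\<dots> \<le> d * C" using C d by (intro mult_left_mono) auto
      also have "\<dots> \<le> d * (C + 1)" using d by simp
      also have "\<dots> = e / 4" using C0 by (simp add: d_def field_simps)
      also have "\<dots> < e / 3" using e by simp
      finally show ?thesis .
    qed
    have "Cauchy (\<lambda>m. LINT z|lborel. c m z * \<phi> z)" using D[OF \<phi>(1)] LIMSEQ_imp_Cauchy by blast
    from metric_CauchyD[OF this, of "e / 3"] e obtain M where M: "\<And>m n. m \<ge> M \<Longrightarrow> n \<ge> M \<Longrightarrow>
        dist (LINT z|lborel. c m z * \<phi> z) (LINT z|lborel. c n z * \<phi> z) < e / 3"
      by auto
    show "\<exists>M. \<forall>m\<ge>M. \<forall>n\<ge>M. dist (LINT z|lborel. c m z * g z) (LINT z|lborel. c n z * g z) < e"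
    proof (intro exI allI impI)
      fix m n assume "m \<ge> M" "n \<ge> M"
      then have "dist (LINT z|lborel. c m z * \<phi> z) (LINT z|lborel. c n z * \<phi> z) < e / 3" by (rule M)
      note mid = this
      have "dist (LINT z|lborel. c k z * g z) (LINT z|lborel. c k z * \<phi> z) < e / 3" for k
        using close[of k] by (simp add: dist_norm norm_minus_commute)
      from this[of m] mid this[of n, unfolded dist_commute[of "LINT z|lborel. c n z * g z"]]
      show "dist (LINT z|lborel. c m z * g z) (LINT z|lborel. c n z * g z) < e"
        by (rule dist_triangle_third)
    qed
  qed
  then obtain l where l: "(\<lambda>m. LINT z|lborel. c m z * g z) \<longlonglongrightarrow> l"
    using Cauchy_convergent_iff convergent_def by blast
  have lim: "(\<lambda>j. D (\<phi> j)) \<longlonglongrightarrow> l"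
    if \<phi>: "\<And>j. test_function (\<phi> j)" "compact K" "\<And>j. {z. \<phi> j z \<noteq> 0} \<subseteq> K" "uniform_limit UNIV \<phi> g sequentially" for \<phi> K
  proof -
    obtain S0 where S0: "K \<subseteq> cball 0 S0"
      using compact_imp_bounded[OF \<phi>(2)] bounded_subset_ballD ball_subset_cball by (metis subset_trans)
    define S where "S = max S0 R'"
    have S: "{z. \<phi> j z \<noteq> 0} \<subseteq> cball 0 S" "R' \<le> S" for j using \<phi>(3)[of j] S0 by (auto simp: S_def)
    obtain C where C: "\<And>m. mass (c m) S \<le> C" using bd by blast
    have C0: "C \<ge> 0" using mass_nonneg C order_trans by blast
    have est: "norm (D (\<phi> j) - l) \<le> e * C" if "\<And>z. norm (\<phi> j z - g z) \<le> e" for j e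
    proof (rule tendsto_upperbound[OF tendsto_norm[OF tendsto_diff[OF D[OF \<phi>(1)] l]]])
      have e0: "e \<ge> 0" using that norm_ge_zero order_trans by blast
      have "norm ((LINT z|lborel. c m z * \<phi> j z) - (LINT z|lborel. c m z * g z)) \<le> e * C" for m
        using diff[OF smooth_continuous[OF test_smooth[OF \<phi>(1)]] S(1) that S(2), of m]
          mult_left_mono[OF C[of m] e0] by linarith
      then show "\<forall>\<^sub>F m in sequentially. norm ((LINT z|lborel. c m z * \<phi> j z) - (LINT z|lborel. c m z * g z)) \<le> e * C"
        by simp
    qed simp
    show ?thesis
    proof (rule LIMSEQ_I)
      fix r :: real assume r: "r > 0"
      define e where "e = r / (C + 1) / 2"
      have e: "e > 0" using r C0 by (simp add: e_def)
      have "e * C \<le> e * (C + 1)" using e by simp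
      also have "\<dots> = r / 2" using C0 by (simp add: e_def field_simps)
      finally have eC: "e * C < r" using r by simp
      obtain N where N: "\<And>j z. j \<ge> N \<Longrightarrow> dist (\<phi> j z) (g z) < e"
        using uniform_limitD[OF \<phi>(4) e] by (auto simp: eventually_sequentially)
      show "\<exists>N. \<forall>j\<ge>N. norm (D (\<phi> j) - l) < r"
      proof (intro exI allI impI)
        fix j assume "N \<le> j"
        then have "norm (\<phi> j z - g z) \<le> e" for z using N[of j z] by (simp add: dist_norm)
        then have "norm (D (\<phi> j) - l) \<le> e * C" by (rule est)
        then show "norm (D (\<phi> j) - l) < r" using eC by simp
      qed
    qed
  qed
  have "order0_extension D g = l"
    unfolding order0_extension_def
  proof (rule the_equality)
    fix l' assume l': "\<forall>\<phi>. (\<forall>m. test_function (\<phi> m)) \<and> (\<exists>K. compact K \<and> (\<forall>m. {z. \<phi> m z \<noteq> 0} \<subseteq> K)) \<and>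
        uniform_limit UNIV \<phi> g sequentially \<longrightarrow> (\<lambda>m. D (\<phi> m)) \<longlonglongrightarrow> l'"
    \<comment> \<open>An admissible approximating sequence exists, so the universally quantified
      description is not vacuous and determines its value.\<close>
    have "\<exists>\<phi>. test_function \<phi> \<and> {z. \<phi> z \<noteq> 0} \<subseteq> cball 0 (R' + 1) \<and> (\<forall>z. norm (\<phi> z - g z) < inverse (real (Suc j)))" for j
    proof -
      have "inverse (real (Suc j)) > 0" by simp
      show ?thesis
      proof (rule test_function_approx[OF g(1) g' \<open>inverse (real (Suc j)) > 0\<close>])
        fix \<phi> assume "test_function \<phi>" "{z. \<phi> z \<noteq> 0} \<subseteq> cball 0 (R' + 1)" "\<And>z. norm (\<phi> z - g z) < inverse (real (Suc j))"
        then show ?thesis by (intro exI[of _ \<phi>] conjI allI)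
      qed
    qed
    then obtain \<phi> where \<phi>: "\<And>j. test_function (\<phi> j)" "\<And>j. {z. \<phi> j z \<noteq> 0} \<subseteq> cball 0 (R' + 1)"
        "\<And>j z. norm (\<phi> j z - g z) < inverse (real (Suc j))" by metis
    have ul: "uniform_limit UNIV \<phi> g sequentially"
    proof (rule uniform_limitI)
      fix e :: real assume "e > 0"
      then have "\<forall>\<^sub>F j in sequentially. inverse (real (Suc j)) < e"
        using LIMSEQ_inverse_real_of_nat by (rule order_tendstoD(2)[rotated])
      then show "\<forall>\<^sub>F j in sequentially. \<forall>x\<in>UNIV. dist (\<phi> j x) (g x) < e"
        by eventually_elim (use \<phi>(3) in \<open>force simp: dist_norm intro: less_trans\<close>)
    qed
    have "(\<forall>m. test_function (\<phi> m)) \<and> (\<exists>K. compact K \<and> (\<forall>m. {z. \<phi> m z \<noteq> 0} \<subseteq> K)) \<and> uniform_limit UNIV \<phi> g sequentially"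
      by (intro conjI allI exI[of _ "cball 0 (R' + 1)"] \<phi> ul compact_cball)
    from mp[OF spec[OF l'] this] show "l' = l" using lim[OF \<phi>(1) compact_cball \<phi>(2) ul] by (rule LIMSEQ_unique)
  next
    show "\<forall>\<phi>. (\<forall>m. test_function (\<phi> m)) \<and> (\<exists>K. compact K \<and> (\<forall>m. {z. \<phi> m z \<noteq> 0} \<subseteq> K)) \<and>
        uniform_limit UNIV \<phi> g sequentially \<longrightarrow> (\<lambda>m. D (\<phi> m)) \<longlonglongrightarrow> l"
    proof (intro allI impI, elim conjE exE)
      fix \<phi> K
      assume "\<forall>m. test_function (\<phi> m)" "uniform_limit UNIV \<phi> g sequentially" "compact K" "\<forall>m. {z. \<phi> m z \<noteq> 0} \<subseteq> K"
      then show "(\<lambda>m. D (\<phi> m)) \<longlonglongrightarrow> l" by (intro lim[of \<phi> K]) auto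
    qed
  qed
  then show ?thesis using l by simp
qed

definition approximates :: "(complex^'n \<Rightarrow> real) \<Rightarrow> (nat \<Rightarrow> complex^'n \<Rightarrow> real) \<Rightarrow> bool" where
  "approximates u U \<longleftrightarrow> (\<forall>m. spsh (U m)) \<and> (\<forall>R. uniform_limit (cball 0 R) U u sequentially)"

lemma continuous_cplx: "smooth (cplx u) \<Longrightarrow> continuous_on S u"
  using continuous_on_Re[OF smooth_continuous[of "cplx u" S]] by simp

lemma approximates_continuous:
  assumes "approximates u U" shows "continuous_on UNIV u"
proof -
  have "continuous_on (cball 0 R) u" for R
  proof (rule uniform_limit_theorem[OF _ _ trivial_limit_sequentially])
    show "\<forall>\<^sub>F m in sequentially. continuous_on (cball 0 R) (U m)"
      using assms by (auto simp: approximates_def spsh_def intro!: continuous_cplx always_eventually)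
    show "uniform_limit (cball 0 R) U u sequentially" using assms by (simp add: approximates_def)
  qed
  then have "continuous_on (ball 0 R) u" for R
    using continuous_on_subset[OF _ ball_subset_cball] by blast
  then have "continuous (at x) u" for x
    using continuous_on_eq_continuous_at[OF open_ball, of 0 "norm x + 1" u] by auto
  then show ?thesis by (simp add: continuous_at_imp_continuous_on)
qed

lemma approximates_bounded:
  assumes "approximates u U" shows "\<exists>C\<ge>0. \<forall>m. \<forall>z\<in>cball 0 R. \<bar>U m z\<bar> \<le> C"
proof -
  have "uniform_limit (cball 0 R) U u sequentially" using assms by (simp add: approximates_def)
  from uniform_limitD[OF this, of 1] obtain N where "\<forall>m\<ge>N. \<forall>z\<in>cball 0 R. dist (U m z) (u z) < 1"
    unfolding eventually_sequentially by auto
  then have N: "\<And>m z. m \<ge> N \<Longrightarrow> z \<in> cball 0 R \<Longrightarrow> dist (U m z) (u z) < 1" by blast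
  have bd: "\<exists>C. \<forall>z\<in>cball 0 R. \<bar>v z\<bar> \<le> C" if "continuous_on UNIV v" for v :: "complex^'a \<Rightarrow> real"
    using compact_imp_bounded[OF compact_continuous_image[OF continuous_on_subset[OF that subset_UNIV] compact_cball]]
    unfolding bounded_iff by (metis image_eqI real_norm_def)
  obtain C where C: "\<And>z. z \<in> cball 0 R \<Longrightarrow> \<bar>u z\<bar> \<le> C"
    using bd[OF approximates_continuous[OF assms]] by blast
  have "\<exists>C. \<forall>z\<in>cball 0 R. \<bar>U m z\<bar> \<le> C" for m
    using assms by (intro bd continuous_cplx) (auto simp: approximates_def spsh_def)
  then obtain Cm where Cm: "\<And>m z. z \<in> cball 0 R \<Longrightarrow> \<bar>U m z\<bar> \<le> Cm m" by metis
  define K where "K = \<bar>C\<bar> + 1 + (\<Sum>m<N. \<bar>Cm m\<bar>)"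
  have "\<bar>U m z\<bar> \<le> K" if z: "z \<in> cball 0 R" for m z
  proof (cases "m < N")
    case True
    have "\<bar>Cm m\<bar> \<le> (\<Sum>m<N. \<bar>Cm m\<bar>)" using True by (intro member_le_sum) auto
    then show ?thesis using Cm[OF z, of m] by (simp add: K_def)
  next
    case False
    have "(\<Sum>m<N. \<bar>Cm m\<bar>) \<ge> 0" by (simp add: sum_nonneg)
    moreover have "\<bar>U m z - u z\<bar> < 1" using N[OF _ z, of m] False by (simp add: dist_real_def)
    moreover have "\<bar>u z\<bar> \<le> C" by (rule C[OF z])
    ultimately show ?thesis unfolding K_def by linarith
  qed
  moreover have "K \<ge> 0" by (simp add: K_def sum_nonneg)
  ultimately show ?thesis by blast
qed

lemma test_bounded:
  assumes "test_function f" shows "\<exists>C\<ge>0. \<forall>z. norm (f z) \<le> C"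
proof -
  let ?K = "closure {z. f z \<noteq> 0}"
  have "compact (f ` ?K)"
    by (intro compact_continuous_image smooth_continuous test_smooth test_support assms)
  from compact_imp_bounded[OF this] obtain C where C: "\<And>z. z \<in> ?K \<Longrightarrow> norm (f z) \<le> C"
    by (auto simp: bounded_iff)
  have "norm (f z) \<le> max C 0" for z
  proof (cases "f z = 0")
    case False
    then have "z \<in> ?K" by (intro subsetD[OF closure_subset]) simp
    then show ?thesis using C by (simp add: le_max_iff_disj)
  qed simp
  then show ?thesis by (intro exI[of _ "max C 0"]) simp
qed

text \<open>The Chern--Levine--Nirenberg inequality: positivity bounds all coefficients by the trace, and
  the trace is estimated by moving \<open>dd\<^sup>c\<close> of the first factor to a cutoff function.\<close>

lemma wcoef_mass_bounded:
  fixes Us :: "(nat \<Rightarrow> complex^'n \<Rightarrow> real) list"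
  assumes "\<And>U. U \<in> set Us \<Longrightarrow> \<exists>u. approximates u U" "length Us + length L = CARD('n)"
  shows "\<exists>C. \<forall>m. mass (wcoef (map (\<lambda>U. U m) Us) L) R \<le> C"
  using assms
proof (induction Us arbitrary: L R)
  case Nil then show ?case by (auto simp: wcoef_Nil[abs_def])
next
  case (Cons U Us)
  obtain u where U: "approximates u U" using Cons.prems by auto
  define us where "us m = map (\<lambda>U. U m) Us" for m
  define j where "j = length L"
  \<comment> \<open>Together with \<open>U m\<close> in front this list has as many factors as
    coordinates: it is the trace that dominates all coefficients of the product.\<close>
  define W where "W m = replicate j sq @ us m" for m
  define S where "S = max R 0"
  have S0: "S \<ge> 0" by (simp add: S_def)
  have psh: "spsh v" if "v \<in> set (U m # us m)" for v m
    using that Cons.prems(1) by (auto simp: us_def approximates_def)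
  have pshW: "spsh v" if "v \<in> set (W m)" for v m
    using that psh spsh_sq by (auto simp: W_def)
  have smW: "smooth (cplx v)" if "v \<in> set (W m)" for v m using pshW[OF that] by (simp add: spsh_def)
  have smU: "smooth (cplx (U m))" for m using U by (simp add: approximates_def spsh_def)
  have lenW: "length (U m # W m) = CARD('n)" for m using Cons.prems by (simp add: W_def us_def j_def)
  have W: "wcoef (replicate j sq @ (U m # us m)) [] z = wcoef (U m # W m) [] z" for m z
    by (simp add: W_def wcoef_move)
  define ct where "ct = (cutoff S :: complex^'n \<Rightarrow> real)"
  have ct: "test_function (cplx ct)" unfolding ct_def by (rule test_cutoff[OF S0])
  obtain CU where CU: "CU \<ge> 0" "\<And>m z. z \<in> cball 0 (S + 1) \<Longrightarrow> \<bar>U m z\<bar> \<le> CU"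
    using approximates_bounded[OF U] by blast
  have "\<exists>C\<ge>0. \<forall>z. norm (d_dz a (d_dzbar b (cplx ct)) z) \<le> C" for a b
    unfolding d_dz_wirt d_dzbar_wirt by (intro test_bounded wirt_test ct)
  then obtain D where D: "\<And>a b. D a b \<ge> 0" "\<And>a b z. norm (d_dz a (d_dzbar b (cplx ct)) z) \<le> D a b" by metis
  have supp: "d_dz a (d_dzbar b (cplx ct)) z = 0" if "z \<notin> cball 0 (S + 1)" for a b z
  proof -
    have 0: "cplx ct z = 0" if "z \<notin> cball 0 (S + 1)" for z
      using cutoff_support[OF S0] that unfolding ct_def by blast
    have 1: "wirt c b f z = 0" if "\<And>z. z \<notin> cball 0 (S + 1) \<Longrightarrow> f z = 0" "z \<notin> cball 0 (S + 1)" for c b f z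
      using support_dird[OF that(1) closed_cball that(2)] by (simp add: wirt_def)
    show ?thesis unfolding d_dz_wirt d_dzbar_wirt by (intro 1 that) (rule 0)
  qed
  \<comment> \<open>The j copies of \<open>sq\<close> expand into coefficients of the shorter
    product at lists longer by one pair than \<open>L\<close>, so the induction hypothesis is needed
    for arbitrary lists and on a larger ball.\<close>
  have "\<exists>C. \<forall>m. mass (wcoef (W m) [(a, b)]) (S + 1) \<le> C" for a b
  proof -
    have "\<exists>C. \<forall>m. mass (wcoef (us m) (zip A A @ [(a, b)])) (S + 1) \<le> C" if "A \<in> lists_len j" for A
      unfolding us_def by (rule Cons.IH) (use Cons.prems that in \<open>auto simp: lists_len_def j_def\<close>)
    then obtain C where C: "\<And>A m. A \<in> lists_len j \<Longrightarrow> mass (wcoef (us m) (zip A A @ [(a, b)])) (S + 1) \<le> C A" by metis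
    have cont: "continuous_on UNIV (wcoef (us m) K)" for m K
      by (intro smooth_continuous smooth_wcoef) (use psh in \<open>auto simp: spsh_def\<close>)
    have "mass (wcoef (W m) [(a, b)]) (S + 1) \<le> 2 ^ j * (\<Sum>A\<in>lists_len j. C A)" for m
    proof -
      have "mass (wcoef (W m) [(a, b)]) (S + 1) = 2 ^ j * mass (\<lambda>z. \<Sum>A\<in>lists_len j. wcoef (us m) (zip A A @ [(a, b)]) z) (S + 1)"
        unfolding W_def wcoef_replicate_sq mass_def by (simp add: norm_mult norm_power mult_ac)
      also have "\<dots> \<le> 2 ^ j * (\<Sum>A\<in>lists_len j. mass (wcoef (us m) (zip A A @ [(a, b)])) (S + 1))"
        by (intro mult_left_mono mass_sum cont) auto
      also have "\<dots> \<le> 2 ^ j * (\<Sum>A\<in>lists_len j. C A)"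
        by (intro mult_left_mono sum_mono C) auto
      finally show ?thesis .
    qed
    then show ?thesis by blast
  qed
  then obtain CW where CW: "\<And>a b m. mass (wcoef (W m) [(a, b)]) (S + 1) \<le> CW a b" by metis
  have "mass (wcoef (map (\<lambda>U. U m) (U # Us)) L) R \<le> (\<Sum>a\<in>UNIV. \<Sum>b\<in>UNIV. 2 * (CU * D a b * CW a b))" for m
  proof -
    let ?c = "wcoef (U m # W m) []"
    have sm: "smooth ?c" using smU smW by (intro smooth_wcoef) auto
    have pos: "?c z \<in> \<real>\<^sub>\<ge>\<^sub>0" for z
      using lenW psh pshW by (intro wcoef_nonneg) auto
    have int: "integrable lborel (\<lambda>z. ?c z * cplx ct z)" by (rule smooth_mult_test_integrable[OF sm ct])
    have "mass (wcoef (map (\<lambda>U. U m) (U # Us)) L) R \<le> (LINT z|lborel. Re (?c z * cplx ct z))"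
      unfolding mass_def
    proof (intro integral_mono integrable_Re int mass_integrable)
      show "continuous_on UNIV (wcoef (map (\<lambda>U. U m) (U # Us)) L)"
        using psh by (intro smooth_continuous smooth_wcoef) (auto simp: us_def spsh_def)
      fix z
      have 1: "norm (wcoef (map (\<lambda>U. U m) (U # Us)) L z) \<le> Re (?c z)"
        using wcoef_bound[of "U m # us m" L z] psh Cons.prems(2) W by (simp add: us_def j_def)
      have 2: "indicator (cball 0 R) z \<le> ct z" "0 \<le> ct z"
        using cutoff_1[OF S0, of z] cutoff_range[of S z] by (auto simp: ct_def indicator_def S_def)
      have "indicator (cball 0 R) z * norm (wcoef (map (\<lambda>U. U m) (U # Us)) L z) \<le> ct z * Re (?c z)"
        by (rule mult_mono[OF 2(1) 1 2(2)]) simp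
      then show "indicator (cball 0 R) z * norm (wcoef (map (\<lambda>U. U m) (U # Us)) L z) \<le> Re (?c z * cplx ct z)"
        by (simp add: mult.commute)
    qed
    also have "\<dots> = Re (LINT z|lborel. ?c z * cplx ct z)" by (rule integral_Re[OF int])
    also have "\<dots> \<le> norm (LINT z|lborel. ?c z * cplx ct z)" by (rule complex_Re_le_cmod)
    also have "\<dots> = norm (\<Sum>a\<in>UNIV. \<Sum>b\<in>UNIV. 2 * \<i> * (LINT z|lborel. wcoef (W m) [(a, b)] z * (of_real (U m z) * d_dz a (d_dzbar b (cplx ct)) z)))"
      by (subst integral_wcoef_Cons(2)[OF smU smW ct]) auto
    also have "\<dots> \<le> (\<Sum>a\<in>UNIV. \<Sum>b\<in>UNIV. norm (2 * \<i> * (LINT z|lborel. wcoef (W m) [(a, b)] z * (of_real (U m z) * d_dz a (d_dzbar b (cplx ct)) z))))"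
      by (intro order_trans[OF norm_sum] sum_mono norm_sum)
    also have "\<dots> \<le> (\<Sum>a\<in>UNIV. \<Sum>b\<in>UNIV. 2 * (CU * D a b * CW a b))"
    proof (intro sum_mono)
      fix a b
      have "norm (LINT z|lborel. wcoef (W m) [(a, b)] z * (of_real (U m z) * d_dz a (d_dzbar b (cplx ct)) z)) \<le> (CU * D a b) * mass (wcoef (W m) [(a, b)]) (S + 1)"
      proof (rule integral_mass_bound)
        show "continuous_on UNIV (wcoef (W m) [(a, b)])" by (intro smooth_continuous smooth_wcoef smW)
        show "continuous_on UNIV (\<lambda>z. of_real (U m z) * d_dz a (d_dzbar b (cplx ct)) z)"
          unfolding d_dz_wirt d_dzbar_wirt
          by (intro smooth_continuous smooth_mult smU smooth_wirt test_smooth[OF ct])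
        show "norm (complex_of_real (U m z) * d_dz a (d_dzbar b (cplx ct)) z) \<le> CU * D a b" for z
        proof (cases "z \<in> cball 0 (S + 1)")
          case True
          then show ?thesis using CU(2)[OF True, of m] CU(1) D(2)[of a b z] by (simp add: norm_mult mult_mono)
        next
          case False then show ?thesis using supp[of z a b] CU(1) D(1)[of a b] by simp
        qed
      qed (use supp in simp)
      also have "\<dots> \<le> CU * D a b * CW a b"
        using CU(1) D(1) CW by (intro mult_left_mono) auto
      finally show "norm (2 * \<i> * (LINT z|lborel. wcoef (W m) [(a, b)] z * (of_real (U m z) * d_dz a (d_dzbar b (cplx ct)) z))) \<le> 2 * (CU * D a b * CW a b)"
        by (simp add: norm_mult)
    qed
    finally show ?thesis .
  qed
  then show ?case by blast
qed

text \<open>All approximants run along one index m. Replacing \<open>U m\<close> by its limit in the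
  head factor costs at most the uniform distance times the mass of the remaining product, which is
  bounded; what is left is \<open>order0_extension_limit\<close> applied to the remaining
  factors.\<close>

lemma bedford_taylor_limit:
  fixes us :: "(complex^'n \<Rightarrow> real) list"
  assumes "list_all2 approximates us Us" "length us + length L = CARD('n)" "test_function f"
  shows "(\<lambda>m. LINT z|lborel. wcoef (map (\<lambda>U. U m) Us) L z * f z) \<longlonglongrightarrow> bedford_taylor us L f"
  using assms
proof (induction us Us arbitrary: L f rule: list_all2_induct)
  case Nil
  then show ?case by (simp add: wcoef_Nil bedford_taylor_def integration_current_icoef)
next
  case (Cons u us U Us)
  define c where "c m a b = wcoef (map (\<lambda>U. U m) Us) ((a, b) # L)" for m a b
  define g where "g a b = d_dz a (d_dzbar b f)" for a b
  have g: "test_function (g a b)" for a b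
    unfolding g_def d_dz_wirt d_dzbar_wirt by (intro wirt_test Cons.prems)
  have Us: "\<exists>u. approximates u V" if "V \<in> set Us" for V
    using Cons.hyps(2) that by (metis in_set_conv_nth list_all2_conv_all_nth)
  have sm: "smooth (cplx v)" if "v \<in> set (map (\<lambda>U. U m) Us)" for v m
    using that Us by (auto simp: approximates_def spsh_def)
  have smU: "smooth (cplx (U m))" for m using Cons.hyps(1) by (simp add: approximates_def spsh_def)
  have contc: "continuous_on UNIV (c m a b)" for m a b
    unfolding c_def by (intro smooth_continuous smooth_wcoef sm)
  have contu: "continuous_on UNIV u" by (rule approximates_continuous[OF Cons.hyps(1)])
  have mass: "\<exists>C. \<forall>m. mass (c m a b) R \<le> C" for a b R
    unfolding c_def using Cons.prems Us list_all2_lengthD[OF Cons.hyps(2)] by (intro wcoef_mass_bounded) auto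
  have lim: "(\<lambda>m. LINT z|lborel. c m a b z * (of_real (U m z) * g a b z)) \<longlonglongrightarrow>
      order0_extension (bedford_taylor us ((a, b) # L)) (\<lambda>z. of_real (u z) * g a b z)" for a b
  proof -
    obtain R where R: "{z. g a b z \<noteq> 0} \<subseteq> cball 0 R"
      using g[of a b] unfolding test_function_iff using bounded_subset_ballD ball_subset_cball by (metis subset_trans)
    have R0: "g a b z = 0" if "z \<notin> cball 0 R" for z using R that by blast
    have 1: "(\<lambda>m. LINT z|lborel. c m a b z * (of_real (u z) * g a b z)) \<longlonglongrightarrow>
      order0_extension (bedford_taylor us ((a, b) # L)) (\<lambda>z. of_real (u z) * g a b z)"
    proof (rule order0_extension_limit[OF contc mass])
      show "(\<lambda>m. LINT z|lborel. c m a b z * \<phi> z) \<longlonglongrightarrow> bedford_taylor us ((a, b) # L) \<phi>" if "test_function \<phi>" for \<phi>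
        unfolding c_def using Cons.IH[OF _ that, of "(a, b) # L"] Cons.prems by simp
      show "continuous_on UNIV (\<lambda>z. of_real (u z) * g a b z)"
        by (intro continuous_on_mult continuous_on_of_real contu smooth_continuous test_smooth g)
      show "{z. of_real (u z) * g a b z \<noteq> 0} \<subseteq> cball 0 R" using R by auto
    qed
    obtain C where C: "\<And>m. mass (c m a b) R \<le> C" using mass by blast
    have C0: "C \<ge> 0" using mass_nonneg C order_trans by blast
    obtain G where G: "G \<ge> 0" "\<And>z. norm (g a b z) \<le> G" using test_bounded[OF g] by blast
    have 2: "(\<lambda>m. (LINT z|lborel. c m a b z * (of_real (U m z) * g a b z)) - (LINT z|lborel. c m a b z * (of_real (u z) * g a b z))) \<longlonglongrightarrow> 0"
    proof (rule LIMSEQ_I)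
      fix r :: real assume r: "r > 0"
      define k where "k = G * C + 1"
      define e where "e = r / k / 2"
      have den: "k > 0" "G * C \<le> k" using G C0 by (simp_all add: add_nonneg_pos k_def)
      have e: "e > 0" using r den by (simp add: e_def)
      have "e * (G * C) \<le> e * k" using e den by simp
      also have "\<dots> = r / 2" using den by (simp add: e_def)
      finally have eGC: "e * G * C < r" using r by (simp add: mult.assoc)
      obtain N where N: "\<And>m z. m \<ge> N \<Longrightarrow> z \<in> cball 0 R \<Longrightarrow> dist (U m z) (u z) < e"
      proof -
        have "uniform_limit (cball 0 R) U u sequentially" using Cons.hyps(1) by (simp add: approximates_def)
        from uniform_limitD[OF this e] show ?thesis using that unfolding eventually_sequentially by blast
      qed
      show "\<exists>N. \<forall>m\<ge>N. norm ((LINT z|lborel. c m a b z * (of_real (U m z) * g a b z)) - (LINT z|lborel. c m a b z * (of_real (u z) * g a b z)) - 0) < r"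
      proof (intro exI allI impI)
        fix m assume m: "m \<ge> N"
        have contUg: "continuous_on UNIV (\<lambda>z. of_real (U m z) * g a b z)"
          by (intro continuous_on_mult smooth_continuous[OF smU] smooth_continuous test_smooth g)
        have contug: "continuous_on UNIV (\<lambda>z. of_real (u z) * g a b z)"
          by (intro continuous_on_mult continuous_on_of_real contu smooth_continuous test_smooth g)
        have "integrable lborel (\<lambda>z. c m a b z * (of_real (U m z) * g a b z))" "integrable lborel (\<lambda>z. c m a b z * (of_real (u z) * g a b z))"
          by (rule integrable_compact_support[of _ "cball 0 R"]; use R contUg contug in \<open>auto intro!: continuous_on_mult[OF contc]\<close>)+
        then have "(LINT z|lborel. c m a b z * (of_real (U m z) * g a b z)) - (LINT z|lborel. c m a b z * (of_real (u z) * g a b z)) =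
            (LINT z|lborel. c m a b z * (of_real (U m z) * g a b z - of_real (u z) * g a b z))"
          by (simp add: right_diff_distrib)
        moreover have "norm \<dots> \<le> (e * G) * mass (c m a b) R"
        proof (rule integral_mass_bound[OF contc])
          show "continuous_on UNIV (\<lambda>z. of_real (U m z) * g a b z - of_real (u z) * g a b z)"
            by (intro continuous_on_diff contUg contug)
          show "norm (of_real (U m z) * g a b z - of_real (u z) * g a b z) \<le> e * G" for z
          proof (cases "z \<in> cball 0 R")
            case True
            have "norm (of_real (U m z) * g a b z - of_real (u z) * g a b z) = \<bar>U m z - u z\<bar> * norm (g a b z)"
              unfolding left_diff_distrib[symmetric] norm_mult of_real_diff[symmetric] norm_of_real ..
            also have "\<dots> \<le> e * G" using N[OF m True] e G by (intro mult_mono) (auto simp: dist_real_def)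
            finally show ?thesis .
          next
            case False then show ?thesis using R0 e G by simp
          qed
        qed (use R0 in simp)
        moreover have "(e * G) * mass (c m a b) R \<le> e * G * C" using e G C by (intro mult_left_mono) auto
        ultimately show "norm ((LINT z|lborel. c m a b z * (of_real (U m z) * g a b z)) - (LINT z|lborel. c m a b z * (of_real (u z) * g a b z)) - 0) < r"
          using eGC by simp
      qed
    qed
    show ?thesis using tendsto_add[OF 1 2] by simp
  qed
  have eq: "(LINT z|lborel. wcoef (map (\<lambda>U. U m) (U # Us)) L z * f z) =
      (\<Sum>a\<in>UNIV. \<Sum>b\<in>UNIV. 2 * \<i> * (LINT z|lborel. c m a b z * (of_real (U m z) * g a b z)))" for m
    unfolding c_def g_def list.map by (rule integral_wcoef_Cons(2)[OF smU sm Cons.prems(2)])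
  have "bedford_taylor (u # us) L f =
      (\<Sum>a\<in>UNIV. \<Sum>b\<in>UNIV. 2 * \<i> * order0_extension (bedford_taylor us ((a, b) # L)) (\<lambda>z. of_real (u z) * g a b z))"
    by (simp add: bedford_taylor_def ddc_wedge_def g_def)
  then show ?case unfolding eq by (simp only:) (intro tendsto_intros lim)
qed

section \<open>Representation of positive functionals by measures\<close>

definition Cc :: "('a::euclidean_space \<Rightarrow> real) \<Rightarrow> bool" where
  "Cc f \<longleftrightarrow> continuous_on UNIV f \<and> bounded {x. f x \<noteq> 0}"

lemma Cc_add: "Cc f \<Longrightarrow> Cc g \<Longrightarrow> Cc (\<lambda>x. f x + g x)"
proof -
  assume "Cc f" "Cc g"
  then have "bounded ({x. f x \<noteq> 0} \<union> {x. g x \<noteq> 0})" "continuous_on UNIV (\<lambda>x. f x + g x)"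
    by (auto simp: Cc_def intro: continuous_intros)
  moreover have "{x. f x + g x \<noteq> 0} \<subseteq> {x. f x \<noteq> 0} \<union> {x. g x \<noteq> 0}" by auto
  ultimately show ?thesis unfolding Cc_def using bounded_subset by blast
qed

lemma Cc_cmult: "Cc f \<Longrightarrow> Cc (\<lambda>x. c * f x)"
  unfolding Cc_def by (auto intro!: continuous_intros elim!: bounded_subset)

lemma Cc_mult: "Cc f \<Longrightarrow> continuous_on UNIV g \<Longrightarrow> Cc (\<lambda>x. f x * g x)"
  unfolding Cc_def by (auto intro!: continuous_intros elim!: bounded_subset)

lemma Cc_zero: "Cc (\<lambda>_. 0)" by (simp add: Cc_def)

lemma Cc_sum: "(\<And>i. i \<in> I \<Longrightarrow> Cc (f i)) \<Longrightarrow> Cc (\<lambda>x. \<Sum>i\<in>I. f i x)"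
  by (induction I rule: infinite_finite_induct) (simp_all add: Cc_zero Cc_add)

lemma Cc_measurable: "Cc f \<Longrightarrow> f \<in> borel_measurable borel"
  by (auto simp: Cc_def intro: borel_measurable_continuous_onI)

lemma Cc_bump: assumes "bounded S"
  obtains h where "Cc h" "\<And>x. h x \<ge> 0" "\<And>x. x \<in> S \<Longrightarrow> h x \<ge> 1"
proof -
  obtain R where R: "S \<subseteq> ball 0 R" using bounded_subset_ballD[OF assms] by blast
  show ?thesis
  proof (rule that[of "\<lambda>x. max 0 (R + 1 - norm x)"])
    have "{x::'a. max 0 (R + 1 - norm x) \<noteq> 0} \<subseteq> ball 0 (R + 1)" by auto
    then show "Cc (\<lambda>x::'a. max 0 (R + 1 - norm x))"
      unfolding Cc_def using bounded_subset[OF bounded_ball] by (auto intro!: continuous_intros)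
  qed (use R in auto)
qed

section \<open>The outer measure of a positive functional\<close>

locale positive_functional =
  fixes \<Lambda> :: "('a::euclidean_space \<Rightarrow> real) \<Rightarrow> real"
  assumes add: "Cc f \<Longrightarrow> Cc g \<Longrightarrow> \<Lambda> (\<lambda>x. f x + g x) = \<Lambda> f + \<Lambda> g"
    and cmult: "Cc f \<Longrightarrow> \<Lambda> (\<lambda>x. c * f x) = c * \<Lambda> f"
    and nonneg: "Cc f \<Longrightarrow> (\<And>x. f x \<ge> 0) \<Longrightarrow> \<Lambda> f \<ge> 0"
begin

lemma zero: "\<Lambda> (\<lambda>_. 0) = 0"
  using cmult[OF Cc_zero, of 0] by simp

lemma sum: "(\<And>i. i \<in> I \<Longrightarrow> Cc (f i)) \<Longrightarrow> \<Lambda> (\<lambda>x. \<Sum>i\<in>I. f i x) = (\<Sum>i\<in>I. \<Lambda> (f i))"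
  by (induction I rule: infinite_finite_induct) (simp_all add: zero add Cc_sum)

lemma mono: assumes "Cc f" "Cc g" "\<And>x. f x \<le> g x" shows "\<Lambda> f \<le> \<Lambda> g"
proof -
  have "Cc (\<lambda>x. g x + (-1) * f x)" by (intro Cc_add Cc_cmult assms)
  then have "0 \<le> \<Lambda> (\<lambda>x. g x + (-1) * f x)" by (rule nonneg) (use assms in simp)
  also have "\<dots> = \<Lambda> g - \<Lambda> f" by (subst add) (use assms cmult[of f "-1"] in \<open>auto intro: Cc_cmult[of f "-1", simplified]\<close>)
  finally show ?thesis by simp
qed

text \<open>A Daniell-type outer measure: sets are covered by sequences of functions rather than by
  open sets, so that the functional itself prices a cover and additivity of the functional splits
  it.\<close>

definition covers :: "'a set \<Rightarrow> (nat \<Rightarrow> 'a \<Rightarrow> real) set" where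
  "covers E = {g. (\<forall>i. Cc (g i) \<and> (\<forall>x. g i x \<ge> 0)) \<and> (\<forall>x\<in>E. 1 \<le> (\<Sum>i. ennreal (g i x)))}"

definition outer :: "'a set \<Rightarrow> ennreal" where
  "outer E = (INF g\<in>covers E. \<Sum>i. ennreal (\<Lambda> (g i)))"

lemma outer_le: "g \<in> covers E \<Longrightarrow> outer E \<le> (\<Sum>i. ennreal (\<Lambda> (g i)))"
  unfolding outer_def by (rule INF_lower)

lemma outer_le_pair:
  assumes g: "\<And>i j. Cc (g i j)" "\<And>i j x. g i j x \<ge> 0" and c: "\<And>x. x \<in> E \<Longrightarrow> 1 \<le> (\<Sum>i. \<Sum>j. ennreal (g i j x))"
  shows "outer E \<le> (\<Sum>i. \<Sum>j. ennreal (\<Lambda> (g i j)))"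
proof -
  have "(\<lambda>k. (\<lambda>(i, j). g i j) (prod_decode k)) \<in> covers E"
  proof -
    have "(\<Sum>k. ennreal ((\<lambda>(i, j). g i j) (prod_decode k) x)) = (\<Sum>i. \<Sum>j. ennreal (g i j x))" for x
      using suminf_ennreal_2dimen[of "\<lambda>i. \<Sum>j. ennreal (g i j x)" "\<lambda>(i, j). ennreal (g i j x)"]
      by (simp add: case_prod_unfold)
    then show ?thesis using g c by (auto simp: covers_def case_prod_unfold)
  qed
  from outer_le[OF this] show ?thesis
    using suminf_ennreal_2dimen[of "\<lambda>i. \<Sum>j. ennreal (\<Lambda> (g i j))" "\<lambda>(i, j). ennreal (\<Lambda> (g i j))"]
    by (simp add: case_prod_unfold)
qed

lemma outer_le_single:
  assumes "Cc g" "\<And>x. g x \<ge> 0" "\<And>x. x \<in> E \<Longrightarrow> g x \<ge> 1"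
  shows "outer E \<le> ennreal (\<Lambda> g)"
proof -
  have s: "(\<Sum>i. ennreal ((if i = 0 then g else (\<lambda>_. 0)) x)) = ennreal (g x)" for x
    by (subst suminf_finite[of "{0::nat}"]) auto
  have "(\<lambda>i::nat. if i = 0 then g else (\<lambda>_. 0)) \<in> covers E"
    using assms by (auto simp: covers_def s Cc_zero simp flip: ennreal_1)
  from outer_le[OF this] show ?thesis by (subst (asm) suminf_finite[of "{0::nat}"]) (auto simp: zero)
qed

lemma outer_measure_space: "outer_measure_space UNIV outer"
proof -
  have "outer {} = 0"
    using outer_le_single[OF Cc_zero, of "{}"] by (simp add: zero)
  then have "positive UNIV outer" by (simp add: positive_def)
  moreover have "increasing UNIV outer"
    unfolding increasing_def outer_def by (auto intro!: INF_superset_mono simp: covers_def)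
  moreover have "countably_subadditive UNIV outer"
    unfolding countably_subadditive_def
  proof (intro allI impI)
    fix A :: "nat \<Rightarrow> 'a set"
    show "outer (\<Union>i. A i) \<le> (\<Sum>i. outer (A i))"
    proof (cases "(\<Sum>i. outer (A i)) = \<infinity>")
      case False
      show ?thesis
      proof (rule ennreal_le_epsilon)
        fix e :: real assume e: "e > 0"
        have "\<exists>g\<in>covers (A i). (\<Sum>j. ennreal (\<Lambda> (g j))) \<le> outer (A i) + ennreal (e * (1/2) ^ Suc i)" for i
        proof -
          have "outer (A i) \<noteq> \<infinity>"
            using False by (metis (no_types, lifting) ennreal_suminf_lessD infinity_ennreal_def less_top)
          then have "outer (A i) < outer (A i) + ennreal (e * (1/2) ^ Suc i)"
            using e by (simp add: ennreal_zero_less_divide ennreal_less_zero_iff)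
          then show ?thesis unfolding outer_def INF_less_iff by (auto intro: less_imp_le)
        qed
        then obtain g where g: "\<And>i. g i \<in> covers (A i)"
          "\<And>i. (\<Sum>j. ennreal (\<Lambda> (g i j))) \<le> outer (A i) + ennreal (e * (1/2) ^ Suc i)" by metis
        have "outer (\<Union>i. A i) \<le> (\<Sum>i. \<Sum>j. ennreal (\<Lambda> (g i j)))"
        proof (rule outer_le_pair)
          fix x assume "x \<in> (\<Union>i. A i)"
          then obtain i where "x \<in> A i" by blast
          then have "1 \<le> (\<Sum>j. ennreal (g i j x))" using g(1)[of i] by (auto simp: covers_def)
          also have "\<dots> \<le> (\<Sum>i. \<Sum>j. ennreal (g i j x))"
            using sum_le_suminf[of "\<lambda>i. \<Sum>j. ennreal (g i j x)" "{i}"] by simp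
          finally show "1 \<le> (\<Sum>i. \<Sum>j. ennreal (g i j x))" .
        qed (use g(1) in \<open>auto simp: covers_def\<close>)
        also have "\<dots> \<le> (\<Sum>i. outer (A i) + ennreal (e * (1/2) ^ Suc i))"
          by (intro suminf_le g) auto
        also have "\<dots> = (\<Sum>i. outer (A i)) + (\<Sum>i. ennreal (e * (1/2) ^ Suc i))"
          by (intro suminf_add[symmetric]) auto
        also have "(\<Sum>i. ennreal (e * (1/2) ^ Suc i)) = ennreal e"
        proof -
          have "(\<lambda>i. e * (1/2) ^ Suc i) sums (e * 1)" by (intro sums_mult power_half_series)
          then show ?thesis using e by (intro suminf_ennreal_eq) auto
        qed
        finally show "outer (\<Union>i. A i) \<le> (\<Sum>i. outer (A i)) + ennreal e" .
      qed
    qed simp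
  qed
  ultimately show ?thesis by (simp add: outer_measure_space_def)
qed

text \<open>With \<open>\<psi>\<^sub>k\<close> increasing to the indicator of an open set \<open>U\<close>, a cover \<open>g\<close> splits into the cover
  \<open>g\<^sub>i (\<psi>\<^sub>k\<^sub>+\<^sub>1 - \<psi>\<^sub>k)\<close> of the part inside and the covers \<open>g\<^sub>i (1 - \<psi>\<^sub>k)\<close> of the part outside \<open>U\<close>.\<close>

lemma open_lambda_system:
  assumes U: "open U" shows "U \<in> lambda_system UNIV UNIV outer"
proof -
  have sub: "outer X \<le> outer (U \<inter> X) + outer (X - U)" for X
  proof -
    have "subadditive UNIV outer"
      using outer_measure_space ring_of_sets.countably_subadditive_subadditive[of UNIV UNIV outer]
        sigma_algebra_Pow[of "UNIV :: 'a set"]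
      by (auto simp: outer_measure_space_def sigma_algebra_def algebra_def)
    then have "outer ((U \<inter> X) \<union> (X - U)) \<le> outer (U \<inter> X) + outer (X - U)"
      by (intro subadditiveD) auto
    moreover have "(U \<inter> X) \<union> (X - U) = X" by auto
    ultimately show ?thesis by simp
  qed
  have sup: "outer (U \<inter> X) + outer (X - U) \<le> outer X" for X
  proof (cases "U = UNIV")
    case True
    then show ?thesis using outer_measure_space by (simp add: outer_measure_space_def positive_def)
  next
    case False
    \<comment> \<open>The functions increase to the indicator of \<open>U\<close>. They need a
      nonempty complement, since \<open>infdist\<close> to the empty set is 0, hence the case
      distinction.\<close>
    define \<psi> where "\<psi> k x = min 1 (real k * infdist x (- U))" for k x
    have cont: "continuous_on UNIV (\<psi> k)" for k
      unfolding \<psi>_def[abs_def] by (intro continuous_intros)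
    have \<psi>: "0 \<le> \<psi> k x" "\<psi> k x \<le> 1" "\<psi> k x \<le> \<psi> (Suc k) x" "\<psi> 0 x = 0" for k x
      using infdist_nonneg[of x "- U"] by (auto simp: \<psi>_def min_def mult_right_mono distrib_right) 
    have \<psi>0: "\<psi> k x = 0" if "x \<notin> U" for k x using that by (simp add: \<psi>_def)
    have \<psi>1: "\<exists>k. \<psi> k x = 1" if "x \<in> U" for x
    proof -
      have "infdist x (- U) > 0"
        using U False that in_closed_iff_infdist_zero[of "- U" x] infdist_nonneg[of x "- U"]
        by (auto simp: less_le closed_Compl)
      then obtain k where "1 < real k * infdist x (- U)" using reals_Archimedean3 by blast
      then show ?thesis by (intro exI[of _ k]) (simp add: \<psi>_def)
    qed
    show ?thesis unfolding outer_def[of X]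
    proof (rule INF_greatest)
      fix g assume g: "g \<in> covers X"
      then have gC: "Cc (g i)" "g i x \<ge> 0" for i x by (auto simp: covers_def)
      define h where "h j i x = g i x * (\<psi> (Suc j) x - \<psi> j x)" for j i x
      have hC: "Cc (h j i)" "h j i x \<ge> 0" for i j x
        unfolding h_def[abs_def] using gC \<psi> by (auto intro!: Cc_mult continuous_on_diff cont)
      have hsum: "(\<Sum>j<k. h j i x) = g i x * \<psi> k x" for k i x
        unfolding h_def sum_distrib_left[symmetric] by (simp add: sum_lessThan_telescope[of "\<lambda>j. \<psi> j x"] \<psi>(4))
      have in_le: "outer (U \<inter> X) \<le> (\<Sum>j. \<Sum>i. ennreal (\<Lambda> (h j i)))"
      proof (rule outer_le_pair[OF hC])
        fix x assume x: "x \<in> U \<inter> X"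
        then obtain k where k: "\<psi> k x = 1" using \<psi>1 by blast
        have "1 \<le> (\<Sum>i. ennreal (g i x))" using g x by (auto simp: covers_def)
        also have "\<dots> = (\<Sum>i. \<Sum>j<k. ennreal (h j i x))"
          by (subst sum_ennreal) (auto simp: hC hsum k)
        also have "\<dots> = (\<Sum>j<k. \<Sum>i. ennreal (h j i x))" by (intro suminf_sum) auto
        also have "\<dots> \<le> (\<Sum>j. \<Sum>i. ennreal (h j i x))" by (intro sum_le_suminf) auto
        finally show "1 \<le> (\<Sum>j. \<Sum>i. ennreal (h j i x))" .
      qed
      have "(\<Sum>j. \<Sum>i. ennreal (\<Lambda> (h j i))) + outer (X - U) \<le> (\<Sum>i. ennreal (\<Lambda> (g i)))"
      proof (rule ennreal_suminf_bound_add)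
        fix k
        define r where "r i x = g i x * (1 - \<psi> k x)" for i x
        have r: "Cc (r i)" "r i x \<ge> 0" for i x
          unfolding r_def[abs_def] using gC \<psi> by (auto intro!: Cc_mult continuous_on_diff cont)
        have "r \<in> covers (X - U)" using g r \<psi>0 by (auto simp: covers_def r_def)
        from outer_le[OF this] have out_le: "outer (X - U) \<le> (\<Sum>i. ennreal (\<Lambda> (r i)))" .
        have "(\<Sum>j<k. \<Sum>i. ennreal (\<Lambda> (h j i))) = (\<Sum>i. \<Sum>j<k. ennreal (\<Lambda> (h j i)))"
          by (intro suminf_sum[symmetric]) auto
        also have "\<dots> = (\<Sum>i. ennreal (\<Lambda> (\<lambda>x. g i x * \<psi> k x)))"
          by (subst sum_ennreal) (auto simp: nonneg hC hsum sum[symmetric])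
        finally have "(\<Sum>j<k. \<Sum>i. ennreal (\<Lambda> (h j i))) + outer (X - U) \<le>
            (\<Sum>i. ennreal (\<Lambda> (\<lambda>x. g i x * \<psi> k x))) + (\<Sum>i. ennreal (\<Lambda> (r i)))"
          using out_le by (simp add: add_left_mono)
        also have "\<dots> = (\<Sum>i. ennreal (\<Lambda> (\<lambda>x. g i x * \<psi> k x)) + ennreal (\<Lambda> (r i)))"
          by (intro suminf_add) auto
        also have "\<dots> = (\<Sum>i. ennreal (\<Lambda> (g i)))"
        proof (intro arg_cong[where f=suminf] ext)
          fix i
          have C: "Cc (\<lambda>x. g i x * \<psi> k x)" by (intro Cc_mult gC cont)
          have "\<Lambda> (\<lambda>x. g i x * \<psi> k x) + \<Lambda> (r i) = \<Lambda> (\<lambda>x. g i x * \<psi> k x + r i x)"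
            by (rule add[symmetric, OF C r(1)])
          also have "(\<lambda>x. g i x * \<psi> k x + r i x) = g i" by (simp add: r_def algebra_simps)
          finally show "ennreal (\<Lambda> (\<lambda>x. g i x * \<psi> k x)) + ennreal (\<Lambda> (r i)) = ennreal (\<Lambda> (g i))"
            using nonneg[OF C] nonneg[OF r(1)] gC r \<psi> by (subst ennreal_plus[symmetric]) auto
        qed
        finally show "(\<Sum>j<k. \<Sum>i. ennreal (\<Lambda> (h j i))) + outer (X - U) \<le> (\<Sum>i. ennreal (\<Lambda> (g i)))" .
      qed
      then show "outer (U \<inter> X) + outer (X - U) \<le> (\<Sum>i. ennreal (\<Lambda> (g i)))"
        using in_le by (meson add_right_mono order_trans)
    qed
  qed
  show ?thesis using sub sup by (auto simp: lambda_system_def Diff_eq Int_commute intro!: antisym)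
qed

definition rep :: "'a measure" where "rep = measure_of UNIV (sets borel) outer"

lemma rep: "sets rep = sets borel" "space rep = UNIV" "A \<in> sets borel \<Longrightarrow> emeasure rep A = outer A"
proof -
  have sig: "sigma_algebra (UNIV :: 'a set) UNIV" using sigma_algebra_Pow[of "UNIV :: 'a set"] by simp
  have ms: "measure_space UNIV (lambda_system UNIV UNIV outer) outer"
    by (rule sigma_algebra.caratheodory_lemma[OF sig outer_measure_space])
  then have sl: "sigma_algebra UNIV (lambda_system UNIV UNIV outer)" by (simp add: measure_space_def)
  have "sigma_sets UNIV {S :: 'a set. open S} \<subseteq> lambda_system UNIV UNIV outer"
    by (rule sigma_algebra.sigma_sets_subset[OF sl]) (use open_lambda_system in auto)
  then have sub: "sets borel \<subseteq> lambda_system UNIV UNIV outer" by (simp add: borel_def)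
  have sb: "sigma_algebra (UNIV :: 'a set) (sets borel)" using sets.sigma_algebra_axioms[of borel] by simp
  have mb: "measure_space UNIV (sets borel) outer" by (rule measure_down[OF ms sb sub])
  show "sets rep = sets borel" "space rep = UNIV"
    unfolding rep_def using sigma_algebra.sets_measure_of_eq[OF sb] by (simp_all add: space_measure_of_conv)
  show "emeasure rep A = outer A" if "A \<in> sets borel" for A
    unfolding rep_def using mb that sb
    by (intro emeasure_measure_of_sigma) (auto simp: measure_space_def)
qed

text \<open>On the compact set where g >= e finitely many members of a cover already sum to more
  than 1 - e. Where g < e, the function is at most e times a fixed bump that is at least 1 on the
  support of \<open>g\<close>. Then e tends to 0.\<close>

lemma le_outer:
  assumes g: "Cc g" "\<And>x. 0 \<le> g x" "\<And>x. g x \<le> 1" "\<And>x. x \<notin> E \<Longrightarrow> g x = 0"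
  shows "ennreal (\<Lambda> g) \<le> outer E"
  unfolding outer_def
proof (rule INF_greatest)
  fix f assume f: "f \<in> covers E"
  then have fC: "Cc (f i)" "f i x \<ge> 0" for i x by (auto simp: covers_def)
  obtain h where h: "Cc h" "\<And>x. h x \<ge> 0" "\<And>x. x \<in> {x. g x \<noteq> 0} \<Longrightarrow> h x \<ge> 1"
    using Cc_bump[of "{x. g x \<noteq> 0}"] g(1) by (auto simp: Cc_def)
  show "ennreal (\<Lambda> g) \<le> (\<Sum>i. ennreal (\<Lambda> (f i)))"
  proof (cases "(\<Sum>i. ennreal (\<Lambda> (f i))) = \<infinity>")
    case False
    then obtain t where t: "t \<ge> 0" "(\<Sum>i. ennreal (\<Lambda> (f i))) = ennreal t"
      by (metis ennreal_cases infinity_ennreal_def)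
    have partial: "(\<Sum>i<n. \<Lambda> (f i)) \<le> t" for n
    proof -
      have "ennreal (\<Sum>i<n. \<Lambda> (f i)) = (\<Sum>i<n. ennreal (\<Lambda> (f i)))"
        using nonneg[OF fC(1)] fC(2) by (simp add: sum_ennreal)
      also have "\<dots> \<le> ennreal t" unfolding t(2)[symmetric] by (intro sum_le_suminf) auto
      finally show ?thesis using t(1) by (simp add: ennreal_le_iff)
    qed
    have key: "(1 - e) * \<Lambda> g \<le> t + e * \<Lambda> h" if e: "0 < e" "e < 1" for e
    proof -
      let ?K = "{x. g x \<ge> e}"
      have contg: "continuous_on UNIV g" using g(1) by (simp add: Cc_def)
      have "closed ?K" using contg by (intro closed_Collect_le) auto
      moreover have "bounded ?K" using g(1) e by (auto simp: Cc_def elim!: bounded_subset)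
      ultimately have K: "compact ?K" by (simp add: compact_eq_bounded_closed)
      \<comment> \<open>Nested, because the members of the cover are nonnegative; a finite subcover
        is thus contained in a single one of these sets.\<close>
      define O' where "O' n = {x. 1 - e < (\<Sum>i<n. f i x)}" for n
      have Oopen: "open (O' n)" for n
        unfolding O'_def using fC(1) by (intro open_Collect_less continuous_intros) (auto simp: Cc_def)
      have "?K \<subseteq> (\<Union>n. O' n)"
      proof
        fix x assume x: "x \<in> ?K"
        then have "x \<in> E" using g(4)[of x] e by auto
        then have "1 \<le> (\<Sum>i. ennreal (f i x))" using f by (auto simp: covers_def)
        then have "ennreal (1 - e) < (\<Sum>i. ennreal (f i x))"
          using e by (intro less_le_trans[OF _ \<open>1 \<le> _\<close>]) (auto simp: ennreal_less_one_iff)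
        then obtain n where "ennreal (1 - e) < (\<Sum>i<n. ennreal (f i x))"
          unfolding suminf_eq_SUP less_SUP_iff by blast
        then have "1 - e < (\<Sum>i<n. f i x)" using fC(2) e
          by (simp add: sum_ennreal ennreal_less_iff)
        then show "x \<in> (\<Union>n. O' n)" by (auto simp: O'_def)
      qed
      then obtain N where N: "finite N" "?K \<subseteq> (\<Union>n\<in>N. O' n)"
        using compactE_image[OF K, of UNIV O'] Oopen by metis
      define n where "n = Max (insert 0 N)"
      have On: "O' m \<subseteq> O' n" if "m \<in> N" for m
      proof -
        have "m \<le> n" using N that by (simp add: n_def)
        then have "(\<Sum>i<m. f i x) \<le> (\<Sum>i<n. f i x)" for x using fC(2) by (intro sum_mono2) auto
        then show ?thesis by (auto simp: O'_def intro: less_le_trans)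
      qed
      have "(1 - e) * g x \<le> (\<Sum>i<n. f i x) + e * h x" for x
      proof (cases "x \<in> ?K")
        case True
        then have "1 - e < (\<Sum>i<n. f i x)" using N On by (auto simp: O'_def)
        have "(1 - e) * g x \<le> (1 - e) * 1" using e g(3) by (intro mult_left_mono) auto
        also have "\<dots> \<le> (\<Sum>i<n. f i x)" using \<open>1 - e < _\<close> by simp
        finally have "(1 - e) * g x \<le> (\<Sum>i<n. f i x)" .
        moreover have "e * h x \<ge> 0" using e h(2) by simp
        ultimately show ?thesis by (rule add_increasing2[rotated])
      next
        case False
        have s: "(\<Sum>i<n. f i x) \<ge> 0" using fC(2) by (simp add: sum_nonneg)
        show ?thesis
        proof (cases "g x = 0")
          case True then show ?thesis using s e h(2)[of x] by simp
        next
          case nz: False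
          have "(1 - e) * g x \<le> 1 * g x" using e g(2) by (intro mult_right_mono) auto
          also have "\<dots> \<le> e * 1" using False by simp
          also have "\<dots> \<le> e * h x" using e h(3)[of x] nz by (intro mult_left_mono) auto
          finally show ?thesis using s by linarith
        qed
      qed
      then have "\<Lambda> (\<lambda>x. (1 - e) * g x) \<le> \<Lambda> (\<lambda>x. (\<Sum>i<n. f i x) + e * h x)"
        by (intro mono Cc_cmult Cc_add Cc_sum g fC h)
      also have "\<dots> = (\<Sum>i<n. \<Lambda> (f i)) + e * \<Lambda> h"
        by (simp add: add cmult sum Cc_cmult Cc_sum fC h)
      finally show ?thesis using partial[of n] by (simp add: cmult g)
    qed
    have lim: "((\<lambda>e. (1 - e) * \<Lambda> g) \<longlongrightarrow> (1 - 0) * \<Lambda> g) (at_right 0)" "((\<lambda>e. t + e * \<Lambda> h) \<longlongrightarrow> t + 0 * \<Lambda> h) (at_right 0)"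
      by (intro tendsto_intros)+
    have "(1 - 0) * \<Lambda> g \<le> t + 0 * \<Lambda> h"
      by (rule tendsto_le[OF trivial_limit_at_right_real lim(2,1)])
        (use key in \<open>auto simp: eventually_at_right_field intro!: exI[of _ 1]\<close>)
    then show ?thesis using t by (simp add: ennreal_leI)
  qed simp
qed

lemma outer_finite: "bounded E \<Longrightarrow> outer E < \<infinity>"
proof -
  assume "bounded E"
  then obtain h where "Cc h" "\<And>x. h x \<ge> 0" "\<And>x. x \<in> E \<Longrightarrow> h x \<ge> 1" using Cc_bump by blast
  then have "outer E \<le> ennreal (\<Lambda> h)" by (intro outer_le_single) auto
  then show ?thesis using ennreal_less_top le_less_trans unfolding infinity_ennreal_def by blast
qed

lemma rep_integrable: assumes "Cc f" shows "integrable rep f"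
proof -
  let ?E = "{x. f x \<noteq> 0}"
  have "compact (f ` closure ?E)"
    using assms by (intro compact_continuous_image) (auto simp: Cc_def intro: continuous_on_subset)
  from compact_imp_bounded[OF this] obtain C where C: "\<And>x. x \<in> closure ?E \<Longrightarrow> \<bar>f x\<bar> \<le> C" by (auto simp: bounded_iff)
  have E: "?E \<in> sets borel" using Cc_measurable[OF assms] by measurable
  have "emeasure rep ?E < \<infinity>" using assms outer_finite[of ?E] rep(3)[OF E] by (simp add: Cc_def)
  then have "integrable rep (\<lambda>x. indicator ?E x * C)" using E by (intro integrable_mult_left) (simp add: rep)
  then show ?thesis
  proof (rule Bochner_Integration.integrable_bound)
    show "f \<in> borel_measurable rep" using Cc_measurable[OF assms] by (simp add: measurable_cong_sets[OF rep(1) refl])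
    show "AE x in rep. norm (f x) \<le> norm (indicator ?E x * C)"
      using C subsetD[OF closure_subset, of _ ?E] by (auto simp: indicator_def intro!: AE_I2 order_trans[OF _ abs_ge_self])
  qed
qed

text \<open>The function k f is cut into slices of height one. The functional and the integral of
  the i-th slice both lie between the measures of {f > (i+1)/k} and {f > i/k}; telescoping bounds k
  times their difference on \<open>f\<close> by the measure of {f > 0}, which does not depend on
  k.\<close>

theorem rep_integral_nonneg:
  assumes f: "Cc f" "\<And>x. f x \<ge> 0"
  shows "(LINT x|rep. f x) = \<Lambda> f"
proof -
  have contf: "continuous_on UNIV f" using f(1) by (simp add: Cc_def)
  obtain M where M: "\<And>x. f x \<le> real M"
  proof -
    have "compact (f ` closure {x. f x \<noteq> 0})"
      using f(1) by (intro compact_continuous_image) (auto simp: Cc_def intro: continuous_on_subset)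
    from compact_imp_bounded[OF this] obtain C where C: "\<And>x. x \<in> closure {x. f x \<noteq> 0} \<Longrightarrow> \<bar>f x\<bar> \<le> C" by (auto simp: bounded_iff)
    obtain M where "max C 0 \<le> real M" using real_arch_simple by blast
    moreover have "f x \<le> max C 0" for x
      using C[of x] subsetD[OF closure_subset, of x "{x. f x \<noteq> 0}"] by (cases "f x = 0") auto
    ultimately show ?thesis using that order_trans by blast
  qed
  define a where "a k i = measure rep {x. f x > real i / real k}" for k i :: nat
  have est: "real k * \<bar>\<Lambda> f - (LINT x|rep. f x)\<bar> \<le> a k 0" if k: "k > 0" for k
  proof -
    define \<phi> where "\<phi> i x = min 1 (max 0 (real k * f x - real i))" for i x
    have bE: "bounded {x. f x > real i / real k}" for i
    proof (rule bounded_subset)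
      show "bounded {x. f x \<noteq> 0}" using f(1) by (simp add: Cc_def)
      have "0 < f x" if "real i / real k < f x" for x
        by (rule le_less_trans[OF _ that]) simp
      then have "f x \<noteq> 0" if "real i / real k < f x" for x using that by (metis less_irrefl)
      then show "{x. f x > real i / real k} \<subseteq> {x. f x \<noteq> 0}" by (intro Collect_mono) blast
    qed
    have mE: "{x. f x > real i / real k} \<in> sets borel" for i using Cc_measurable[OF f(1)] by measurable
    have fin: "emeasure rep {x. f x > real i / real k} = ennreal (a k i)" for i
      unfolding a_def using outer_finite[OF bE] rep(3)[OF mE] by (intro emeasure_eq_ennreal_measure) (simp add: less_top)
    have zero_off: "\<phi> i x = 0" if "\<not> f x > real i / real k" for i x
      using that k by (auto simp: \<phi>_def field_simps)
    have one_on: "\<phi> i x = 1" if "f x > real (Suc i) / real k" for i x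
      using that k by (auto simp: \<phi>_def field_simps)
    have \<phi>C: "Cc (\<phi> i)" for i
      unfolding Cc_def
    proof
      show "continuous_on UNIV (\<phi> i)" unfolding \<phi>_def[abs_def] by (intro continuous_intros contf)
      show "bounded {x. \<phi> i x \<noteq> 0}" by (rule bounded_subset[OF bE[of i]]) (use zero_off in auto)
    qed
    have \<phi>r: "0 \<le> \<phi> i x" "\<phi> i x \<le> 1" for i x by (auto simp: \<phi>_def)
    have L: "a k (Suc i) \<le> \<Lambda> (\<phi> i)" "\<Lambda> (\<phi> i) \<le> a k i" for i
    proof -
      have "ennreal (a k (Suc i)) \<le> ennreal (\<Lambda> (\<phi> i))"
        unfolding fin[symmetric] rep(3)[OF mE] by (intro outer_le_single \<phi>C \<phi>r) (use one_on in auto)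
      then show "a k (Suc i) \<le> \<Lambda> (\<phi> i)" using nonneg[OF \<phi>C \<phi>r(1)] by (simp add: ennreal_le_iff)
      have "ennreal (\<Lambda> (\<phi> i)) \<le> ennreal (a k i)"
        unfolding fin[symmetric] rep(3)[OF mE] by (intro le_outer \<phi>C \<phi>r) (use zero_off in auto)
      then show "\<Lambda> (\<phi> i) \<le> a k i" by (simp add: ennreal_le_iff a_def)
    qed
    have ii: "integrable rep (\<lambda>x. indicator {x. f x > real i / real k} x :: real)" for i
      using fin[of i] mE[of i] by (simp add: rep)
    have I: "a k (Suc i) \<le> (LINT x|rep. \<phi> i x)" "(LINT x|rep. \<phi> i x) \<le> a k i" for i
    proof -
      have "(LINT x|rep. indicator {x. f x > real (Suc i) / real k} x) \<le> (LINT x|rep. \<phi> i x)"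
        by (intro integral_mono ii rep_integrable \<phi>C) (use one_on \<phi>r in \<open>auto simp: indicator_def\<close>)
      then show "a k (Suc i) \<le> (LINT x|rep. \<phi> i x)" by (simp add: a_def rep)
      have "(LINT x|rep. \<phi> i x) \<le> (LINT x|rep. indicator {x. f x > real i / real k} x)"
        by (intro integral_mono ii rep_integrable \<phi>C) (use zero_off \<phi>r in \<open>auto simp: indicator_def\<close>)
      then show "(LINT x|rep. \<phi> i x) \<le> a k i" by (simp add: a_def rep)
    qed
    have min_tel: "(\<Sum>i<m. min 1 (max 0 (y - real i))) = min (real m) y" if "y \<ge> 0" for m y
      using that by (induction m) (auto simp: min_def max_def)
    have fs: "(\<Sum>i<k * M. \<phi> i x) = real k * f x" for x
      unfolding \<phi>_def using f(2)[of x] M[of x] by (subst min_tel) (simp_all add: min_absorb2 mult_left_mono)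
    have "real k * \<Lambda> f = \<Lambda> (\<lambda>x. \<Sum>i<k * M. \<phi> i x)" unfolding fs by (simp add: cmult f)
    then have 1: "real k * \<Lambda> f = (\<Sum>i<k * M. \<Lambda> (\<phi> i))" by (simp add: sum \<phi>C)
    have "real k * (LINT x|rep. f x) = (LINT x|rep. (\<Sum>i<k * M. \<phi> i x))" unfolding fs by simp
    then have 2: "real k * (LINT x|rep. f x) = (\<Sum>i<k * M. (LINT x|rep. \<phi> i x))"
      by (simp add: Bochner_Integration.integral_sum rep_integrable \<phi>C)
    have "real k * \<bar>\<Lambda> f - (LINT x|rep. f x)\<bar> = \<bar>real k * \<Lambda> f - real k * (LINT x|rep. f x)\<bar>"
      by (simp add: right_diff_distrib[symmetric] abs_mult)
    also have "\<dots> = \<bar>\<Sum>i<k * M. \<Lambda> (\<phi> i) - (LINT x|rep. \<phi> i x)\<bar>" unfolding 1 2 by (simp add: sum_subtractf)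
    also have "\<dots> \<le> (\<Sum>i<k * M. \<bar>\<Lambda> (\<phi> i) - (LINT x|rep. \<phi> i x)\<bar>)" by (rule sum_abs)
    also have "\<dots> \<le> (\<Sum>i<k * M. a k i - a k (Suc i))"
    proof (rule sum_mono)
      fix i show "\<bar>\<Lambda> (\<phi> i) - (LINT x|rep. \<phi> i x)\<bar> \<le> a k i - a k (Suc i)" using L[of i] I[of i] by linarith
    qed
    also have "\<dots> = a k 0 - a k (k * M)" by (rule sum_lessThan_telescope')
    also have "\<dots> \<le> a k 0" by (simp add: a_def)
    finally show ?thesis .
  qed
  have "\<bar>\<Lambda> f - (LINT x|rep. f x)\<bar> \<le> 0"
  proof (rule ccontr)
    assume "\<not> ?thesis"
    then obtain k where k: "a 1 0 < real k * \<bar>\<Lambda> f - (LINT x|rep. f x)\<bar>" using reals_Archimedean3[of "\<bar>\<Lambda> f - (LINT x|rep. f x)\<bar>"] by auto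
    moreover have "a 1 0 \<ge> 0" by (simp add: a_def)
    ultimately have "k > 0" by (cases k) auto
    from est[OF this] k show False by (simp add: a_def)
  qed
  then show ?thesis by simp
qed

theorem rep_integral: assumes f: "Cc f" shows "(LINT x|rep. f x) = \<Lambda> f"
proof -
  have C: "Cc (\<lambda>x. max 0 (f x))" "Cc (\<lambda>x. max 0 (- f x))"
    using f by (auto simp: Cc_def intro!: continuous_intros elim!: bounded_subset)
  have eq: "f = (\<lambda>x. max 0 (f x) + (-1) * max 0 (- f x))" by (auto simp: fun_eq_iff max_def)
  have "\<Lambda> f = \<Lambda> (\<lambda>x. max 0 (f x)) + (-1) * \<Lambda> (\<lambda>x. max 0 (- f x))"
    by (subst eq) (simp only: add cmult C Cc_cmult)
  also have "\<dots> = (LINT x|rep. max 0 (f x)) + (-1) * (LINT x|rep. max 0 (- f x))"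
    by (simp only: rep_integral_nonneg C max.cobounded1)
  also have "\<dots> = (LINT x|rep. max 0 (f x) + (-1) * max 0 (- f x))"
    using rep_integrable[OF C(1)] rep_integrable[OF C(2)] by simp
  finally show ?thesis by (subst eq) simp
qed

end

text \<open>Open boxes generate the Borel sets and are stable under intersection; the indicator of a
  box is the dominated limit of test functions equal to 1 on compact sets that exhaust it.\<close>

lemma radon_measure_unique:
  fixes \<mu> \<nu> :: "(complex^'n) measure"
  assumes s: "sets \<mu> = sets borel" "sets \<nu> = sets borel"
    and fin: "\<And>K. compact K \<Longrightarrow> emeasure \<mu> K < \<infinity>" "\<And>K. compact K \<Longrightarrow> emeasure \<nu> K < \<infinity>"
    and eq: "\<And>\<phi>. test_function \<phi> \<Longrightarrow> (LINT z|\<mu>. \<phi> z) = (LINT z|\<nu>. \<phi> z)"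
  shows "\<mu> = \<nu>"
proof (rule measure_eqI_generator_eq)
  let ?E = "range (\<lambda>(a, b). box a b :: (complex^'n) set)"
  show "Int_stable ?E" by (auto simp: Int_stable_def box_Int_box)
  show "?E \<subseteq> Pow UNIV" by simp
  show "sets \<mu> = sigma_sets UNIV ?E" "sets \<nu> = sigma_sets UNIV ?E"
    using s by (simp_all add: borel_eq_box)
  show "range (\<lambda>n. box (- (real n *\<^sub>R One)) (real n *\<^sub>R One)) \<subseteq> ?E" by auto
  show "(\<Union>n. box (- (real n *\<^sub>R One)) (real n *\<^sub>R One) :: (complex^'n) set) = UNIV" by (rule UN_box_eq_UNIV)
  have finb: "emeasure \<mu> (box a b) < \<infinity>" "emeasure \<nu> (box a b) < \<infinity>" for a b
    using fin[OF compact_cbox[of a b]] emeasure_mono[OF box_subset_cbox[of a b], where M = \<mu>] emeasure_mono[OF box_subset_cbox[of a b], where M = \<nu>] s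
    by (auto intro: le_less_trans)
  then show "emeasure \<mu> (box (- (real n *\<^sub>R One)) (real n *\<^sub>R One)) \<noteq> \<infinity>" for n by (simp add: less_top[symmetric])
  fix X assume "X \<in> ?E"
  then obtain a b where X: "X = box a b" by auto
  define K where "K k = {x \<in> cbox a b. infdist x (- X) \<ge> inverse (real (Suc k))}" for k
  have Xne: "- X \<noteq> {}" unfolding X using bounded_box[of a b] by (metis Compl_empty_eq boolean_algebra.de_Morgan_conj compl_bot_eq double_compl not_bounded_UNIV)
  have Kc: "compact (K k)" for k
  proof -
    have "K k = cbox a b \<inter> {x. infdist x (- X) \<ge> inverse (real (Suc k))}" by (auto simp: K_def)
    moreover have "closed {x. infdist x (- X) \<ge> inverse (real (Suc k))}"
      by (intro closed_Collect_le continuous_intros)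
    ultimately show ?thesis by (simp add: compact_Int_closed)
  qed
  have KX: "K k \<subseteq> X" for k
  proof
    fix x assume x: "x \<in> K k"
    show "x \<in> X"
    proof (rule ccontr)
      assume "x \<notin> X"
      then have "infdist x (- X) = 0" by simp
      then show False using x by (simp add: K_def)
    qed
  qed
  have "\<exists>\<eta> :: complex^'n \<Rightarrow> real. test_function (\<lambda>z. of_real (\<eta> z)) \<and> (\<forall>z. 0 \<le> \<eta> z \<and> \<eta> z \<le> 1) \<and> (\<forall>z\<in>K k. \<eta> z = 1) \<and> (\<forall>z. z \<notin> X \<longrightarrow> \<eta> z = 0)" for k
    using smooth_Urysohn[OF Kc _ KX, of k] open_box[of a b] unfolding X by metis
  then obtain \<eta> :: "nat \<Rightarrow> complex^'n \<Rightarrow> real" where \<eta>: "\<And>k. test_function (\<lambda>z. of_real (\<eta> k z))"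
    "\<And>k z. 0 \<le> \<eta> k z" "\<And>k z. \<eta> k z \<le> 1" "\<And>k z. z \<in> K k \<Longrightarrow> \<eta> k z = 1" "\<And>k z. z \<notin> X \<Longrightarrow> \<eta> k z = 0" by metis
  have pt: "(\<lambda>k. \<eta> k z) \<longlonglongrightarrow> indicator X z" for z
  proof (cases "z \<in> X")
    case True
    have "infdist z (- X) > 0"
      using True Xne in_closed_iff_infdist_zero[of "- X" z] infdist_nonneg[of z "- X"] open_box[of a b]
      unfolding X by (auto simp: less_le closed_Compl)
    then have "\<forall>\<^sub>F k in sequentially. inverse (real (Suc k)) < infdist z (- X)"
      using LIMSEQ_inverse_real_of_nat by (rule order_tendstoD(2)[rotated])
    then have "\<forall>\<^sub>F k in sequentially. \<eta> k z = indicator X z"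
    proof eventually_elim
      case (elim k)
      then have "z \<in> K k" using True box_subset_cbox[of a b] by (auto simp: K_def X)
      then show ?case using \<eta>(4) True by simp
    qed
    then show ?thesis by (rule tendsto_eventually)
  qed (simp add: \<eta>(5))
  have lim: "(\<lambda>k. LINT z|M. \<eta> k z) \<longlonglongrightarrow> measure M X"
    if M: "sets M = sets borel" "emeasure M (box a b) < \<infinity>" for M
  proof -
    have "(\<lambda>k. LINT z|M. \<eta> k z) \<longlonglongrightarrow> (LINT z|M. indicator X z)"
    proof (rule integral_dominated_convergence[where w="indicator X"])
      have "continuous_on UNIV (\<eta> k)" for k using continuous_on_Re[OF smooth_continuous[OF test_smooth[OF \<eta>(1)]]] by simp
      from borel_measurable_continuous_onI[OF this] show "\<eta> k \<in> borel_measurable M" for k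
        by (simp add: measurable_cong_sets[OF M(1) refl])
      show "integrable M (indicator X :: _ \<Rightarrow> real)" using M X by simp
      show "indicator X \<in> borel_measurable M" using M X by simp
      show "AE z in M. norm (\<eta> k z) \<le> indicator X z" for k
        using \<eta>(2,3,5) by (auto simp: indicator_def)
    qed (use pt in auto)
    moreover have "X \<inter> space M = X" using sets_eq_imp_space_eq[OF M(1)] by simp
    ultimately show ?thesis by simp
  qed
  have "(LINT z|\<mu>. \<eta> k z) = (LINT z|\<nu>. \<eta> k z)" for k
    using eq[OF \<eta>(1)[of k]] by simp
  then have "measure \<mu> X = measure \<nu> X"
    using lim[OF s(1) finb(1)] lim[OF s(2) finb(2)] LIMSEQ_unique by simp
  then show "emeasure \<mu> X = emeasure \<nu> X"
    using finb[of a b] unfolding X by (simp add: emeasure_eq_ennreal_measure less_top)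
qed

section \<open>The Bedford--Taylor measure\<close>

lemma Cc_test: "test_function \<phi> \<Longrightarrow> Cc (\<lambda>z. Re (\<phi> z))" "test_function \<phi> \<Longrightarrow> Cc (\<lambda>z. Im (\<phi> z))"
  unfolding Cc_def test_function_iff
  by (auto intro!: continuous_on_Re continuous_on_Im smooth_continuous elim!: bounded_subset)

text \<open>The densities of the approximants are nonnegative, so their limit is a positive
  functional. Its representing measure satisfies the description of
  \<open>bedford_taylor_measure\<close> and is the only one that does, which gives the definite
  description a value.\<close>

lemma bedford_taylor_measure:
  fixes us :: "(complex^'n \<Rightarrow> real) list"
  assumes us: "list_all2 approximates us Us" and len: "length us = CARD('n)"
  shows "sets (bedford_taylor_measure us) = sets borel"
    "compact K \<Longrightarrow> emeasure (bedford_taylor_measure us) K < \<infinity>"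
    "test_function \<phi> \<Longrightarrow> (LINT z|bedford_taylor_measure us. \<phi> z) = bedford_taylor us [] \<phi>"
proof -
  define c where "c m = wcoef (map (\<lambda>U. U m) Us) []" for m
  define \<Lambda> where "\<Lambda> g = Re (order0_extension (bedford_taylor us []) (cplx g))" for g
  have Us: "\<exists>u. approximates u V" if "V \<in> set Us" for V
    using us that by (metis in_set_conv_nth list_all2_conv_all_nth)
  have lenU: "length Us = CARD('n)" using us len list_all2_lengthD by metis
  have sp: "spsh v" if "v \<in> set (map (\<lambda>U. U m) Us)" for v m
    using that Us by (auto simp: approximates_def)
  have contc: "continuous_on UNIV (c m)" for m
    unfolding c_def by (intro smooth_continuous smooth_wcoef) (use sp in \<open>simp add: spsh_def\<close>)
  have pos: "c m z \<in> \<real>\<^sub>\<ge>\<^sub>0" for m z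
    unfolding c_def by (intro wcoef_nonneg sp) (simp_all add: lenU)
  have mass: "\<exists>C. \<forall>m. mass (c m) R \<le> C" for R
    unfolding c_def by (intro wcoef_mass_bounded Us) (simp_all add: lenU)
  have lim: "(\<lambda>m. LINT z|lborel. c m z * cplx g z) \<longlonglongrightarrow> order0_extension (bedford_taylor us []) (cplx g)" if g: "Cc g" for g
  proof -
    obtain R where "{z. g z \<noteq> 0} \<subseteq> ball 0 R" using g bounded_subset_ballD unfolding Cc_def by metis
    then have "{z. cplx g z \<noteq> 0} \<subseteq> cball 0 R" using ball_subset_cball by auto
    then show ?thesis
      using g by (intro order0_extension_limit[OF contc mass])
        (auto simp: c_def Cc_def intro!: bedford_taylor_limit us len continuous_on_of_real)
  qed
  have int: "integrable lborel (\<lambda>z. c m z * cplx g z)" if "Cc g" for g m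
  proof (rule integrable_compact_support)
    show "compact (closure {z. g z \<noteq> 0})" using that by (simp add: Cc_def)
    show "continuous_on UNIV (\<lambda>z. c m z * cplx g z)"
      using that by (intro continuous_on_mult contc continuous_on_of_real) (simp add: Cc_def)
    show "{z. c m z * cplx g z \<noteq> 0} \<subseteq> closure {z. g z \<noteq> 0}"
      using subsetD[OF closure_subset, of _ "{z. g z \<noteq> 0}"] by auto
  qed
  have Re_int: "(LINT z|lborel. c m z * cplx g z) = of_real (LINT z|lborel. Re (c m z) * g z)" if "Cc g" for m g
  proof -
    have "c m z * cplx g z = of_real (Re (c m z) * g z)" for z
      using pos[of m z] by (simp add: complex_nonneg_Reals_iff complex_eq_iff)
    then show ?thesis by (simp only: integral_complex_of_real)
  qed
  have limR: "(\<lambda>m. LINT z|lborel. Re (c m z) * g z) \<longlonglongrightarrow> \<Lambda> g" if g: "Cc g" for g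
    using tendsto_Re[OF lim[OF g]] unfolding Re_int[OF g] by (simp add: \<Lambda>_def)
  have intR: "integrable lborel (\<lambda>z. Re (c m z) * g z)" if "Cc g" for g m
    using integrable_Re[OF int[OF that, of m]] by simp
  interpret positive_functional \<Lambda>
  proof
    fix f g :: "complex^'n \<Rightarrow> real" and k :: real assume f: "Cc f"
    { assume g: "Cc g"
      have "(\<lambda>m. LINT z|lborel. Re (c m z) * (f z + g z)) \<longlonglongrightarrow> \<Lambda> f + \<Lambda> g"
        using tendsto_add[OF limR[OF f] limR[OF g]] intR[OF f] intR[OF g] by (simp add: distrib_left)
      with limR[OF Cc_add[OF f g]] show "\<Lambda> (\<lambda>x. f x + g x) = \<Lambda> f + \<Lambda> g" by (rule LIMSEQ_unique) }
    have "(\<lambda>m. LINT z|lborel. Re (c m z) * (k * f z)) \<longlonglongrightarrow> k * \<Lambda> f"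
      using tendsto_mult_left[OF limR[OF f], of k] by (simp add: mult.left_commute)
    with limR[OF Cc_cmult[OF f, of k]] show "\<Lambda> (\<lambda>x. k * f x) = k * \<Lambda> f" by (rule LIMSEQ_unique)
    assume "\<And>x. 0 \<le> f x"
    then have "(LINT z|lborel. Re (c m z) * f z) \<ge> 0" for m
      using pos[of m] by (intro Bochner_Integration.integral_nonneg) (simp add: complex_nonneg_Reals_iff)
    then show "\<Lambda> f \<ge> 0" using limR[OF f] by (intro LIMSEQ_le_const) auto
  qed
  have rep_test: "(LINT z|rep. \<phi> z) = bedford_taylor us [] \<phi>" if \<phi>: "test_function \<phi>" for \<phi>
  proof -
    note R = Cc_test(1)[OF \<phi>] and I = Cc_test(2)[OF \<phi>]
    have "(\<lambda>m. of_real (LINT z|lborel. Re (c m z) * Re (\<phi> z)) + \<i> * of_real (LINT z|lborel. Re (c m z) * Im (\<phi> z)))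
        \<longlonglongrightarrow> of_real (\<Lambda> (\<lambda>z. Re (\<phi> z))) + \<i> * of_real (\<Lambda> (\<lambda>z. Im (\<phi> z)))"
      by (intro tendsto_intros limR R I)
    moreover have "of_real (LINT z|lborel. Re (c m z) * Re (\<phi> z)) + \<i> * of_real (LINT z|lborel. Re (c m z) * Im (\<phi> z))
        = (LINT z|lborel. c m z * \<phi> z)" for m
    proof -
      have "(LINT z|lborel. c m z * \<phi> z) = (LINT z|lborel. c m z * cplx (\<lambda>z. Re (\<phi> z)) z + \<i> * (c m z * cplx (\<lambda>z. Im (\<phi> z)) z))"
        by (intro Bochner_Integration.integral_cong refl) (simp add: complex_eq_iff algebra_simps)
      then show ?thesis unfolding Re_int[OF R, symmetric] Re_int[OF I, symmetric]
        using int[OF R] int[OF I] by simp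
    qed
    moreover have "(\<lambda>m. LINT z|lborel. c m z * \<phi> z) \<longlonglongrightarrow> bedford_taylor us [] \<phi>"
      unfolding c_def by (rule bedford_taylor_limit[OF us _ \<phi>]) (simp add: len)
    ultimately have "bedford_taylor us [] \<phi> = of_real (\<Lambda> (\<lambda>z. Re (\<phi> z))) + \<i> * of_real (\<Lambda> (\<lambda>z. Im (\<phi> z)))"
      using LIMSEQ_unique by simp
    also have "\<dots> = of_real (LINT z|rep. Re (\<phi> z)) + \<i> * of_real (LINT z|rep. Im (\<phi> z))"
      by (simp only: rep_integral R I)
    also have "\<dots> = (LINT z|rep. of_real (Re (\<phi> z)) + \<i> * of_real (Im (\<phi> z)))"
      using rep_integrable[OF R] rep_integrable[OF I] by simp
    also have "(\<lambda>z. of_real (Re (\<phi> z)) + \<i> * of_real (Im (\<phi> z))) = \<phi>" by (simp add: complex_eq[symmetric])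
    finally show ?thesis by simp
  qed
  have fin: "emeasure rep K < \<infinity>" if "compact K" for K
    using outer_finite[OF compact_imp_bounded[OF that]] that by (simp add: rep borel_compact)
  have "bedford_taylor_measure us = rep"
    unfolding bedford_taylor_measure_def
  proof (rule the_equality)
    show "sets rep = sets borel \<and> (\<forall>K. compact K \<longrightarrow> emeasure rep K < \<infinity>) \<and>
        (\<forall>\<phi>. test_function \<phi> \<longrightarrow> (LINT z|rep. \<phi> z) = bedford_taylor us [] \<phi>)"
      using rep(1) fin rep_test by blast
    fix \<mu> assume \<mu>: "sets \<mu> = sets borel \<and> (\<forall>K. compact K \<longrightarrow> emeasure \<mu> K < \<infinity>) \<and>
        (\<forall>\<phi>. test_function \<phi> \<longrightarrow> (LINT z|\<mu>. \<phi> z) = bedford_taylor us [] \<phi>)"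
    show "\<mu> = rep"
      by (rule radon_measure_unique) (use \<mu> rep(1) fin rep_test in auto)
  qed
  then show "sets (bedford_taylor_measure us) = sets borel"
    "compact K \<Longrightarrow> emeasure (bedford_taylor_measure us) K < \<infinity>"
    "test_function \<phi> \<Longrightarrow> (LINT z|bedford_taylor_measure us. \<phi> z) = bedford_taylor us [] \<phi>"
    using rep(1) fin rep_test by auto
qed

text \<open>The mass of the ball becomes accessible through test functions above and below its
  indicator, and for these the current is known as a limit of integrals.\<close>

lemma bedford_taylor_measure_bounds:
  fixes us :: "(complex^'n \<Rightarrow> real) list"
  assumes us: "list_all2 approximates us Us" and len: "length us = CARD('n)" and f: "test_function (cplx f)"
  shows "(\<And>z. f z \<ge> 0) \<Longrightarrow> (\<And>z. z \<in> cball 0 1 \<Longrightarrow> f z \<ge> 1) \<Longrightarrow>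
      measure (bedford_taylor_measure us) (cball 0 1) \<le> Re (bedford_taylor us [] (cplx f))"
    and "(\<And>z. f z \<le> 1) \<Longrightarrow> (\<And>z. z \<notin> cball 0 1 \<Longrightarrow> f z \<le> 0) \<Longrightarrow>
      Re (bedford_taylor us [] (cplx f)) \<le> measure (bedford_taylor_measure us) (cball 0 1)"
proof -
  let ?\<mu> = "bedford_taylor_measure us"
  note \<mu> = bedford_taylor_measure[OF us len]
  have sp: "space ?\<mu> = UNIV" using sets_eq_imp_space_eq[OF \<mu>(1)] by simp
  have fin: "emeasure ?\<mu> (cball 0 1) < \<infinity>" by (rule \<mu>(2)) simp
  have i1: "integrable ?\<mu> (indicator (cball 0 1) :: _ \<Rightarrow> real)" using fin \<mu>(1) by simp
  have meas: "(LINT z|?\<mu>. indicator (cball 0 1) z) = measure ?\<mu> (cball 0 1)" by (simp add: sp)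
  have Re_eq: "Re (bedford_taylor us [] (cplx f)) = (LINT z|?\<mu>. f z)"
    unfolding \<mu>(3)[OF f, symmetric] by simp
  have i2: "integrable ?\<mu> f"
  proof -
    let ?E = "closure {z. cplx f z \<noteq> 0}"
    obtain C where C: "\<And>z. norm (cplx f z) \<le> C" using test_bounded[OF f] by blast
    have E: "compact ?E" by (rule test_support[OF f])
    have "integrable ?\<mu> (\<lambda>z. indicator ?E z * C)"
      using \<mu>(2)[OF E] borel_compact[OF E] \<mu>(1) by (intro integrable_mult_left) simp
    then show ?thesis
    proof (rule Bochner_Integration.integrable_bound)
      have "continuous_on UNIV f" using continuous_on_Re[OF smooth_continuous[OF test_smooth[OF f]]] by simp
      from borel_measurable_continuous_onI[OF this] show "f \<in> borel_measurable ?\<mu>"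
        by (simp add: measurable_cong_sets[OF \<mu>(1) refl])
      have "norm (f z) \<le> norm (indicator ?E z * C)" for z
        using C[of z] subsetD[OF closure_subset, of z "{z. cplx f z \<noteq> 0}"] by (cases "f z = 0") auto
      then show "AE z in ?\<mu>. norm (f z) \<le> norm (indicator ?E z * C)" by simp
    qed
  qed
  show "measure ?\<mu> (cball 0 1) \<le> Re (bedford_taylor us [] (cplx f))"
    if "\<And>z. f z \<ge> 0" "\<And>z. z \<in> cball 0 1 \<Longrightarrow> f z \<ge> 1"
    unfolding Re_eq meas[symmetric] by (intro integral_mono i1 i2) (use that in \<open>auto simp: indicator_def\<close>)
  show "Re (bedford_taylor us [] (cplx f)) \<le> measure ?\<mu> (cball 0 1)"
    if "\<And>z. f z \<le> 1" "\<And>z. z \<notin> cball 0 1 \<Longrightarrow> f z \<le> 0"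
    unfolding Re_eq meas[symmetric] by (intro integral_mono i1 i2) (use that in \<open>auto simp: indicator_def\<close>)
qed

section \<open>Contractions with the Euclidean form\<close>

lemma card_completions:
  fixes P :: "'n::finite list"
  assumes "distinct P" "length P + j = CARD('n)"
  shows "card {A \<in> lists_len j. distinct (P @ A) \<and> set (P @ A) = UNIV} = fact j"
proof -
  have c: "card (- set P) = j"
    using assms by (simp add: Compl_eq_Diff_UNIV card_Diff_subset distinct_card)
  have "{A \<in> lists_len j. distinct (P @ A) \<and> set (P @ A) = UNIV} = permutations_of_set (- set P)"
  proof (intro equalityI subsetI)
    fix A assume "A \<in> {A \<in> lists_len j. distinct (P @ A) \<and> set (P @ A) = UNIV}"
    then show "A \<in> permutations_of_set (- set P)" by (auto simp: permutations_of_set_def)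
  next
    fix A assume "A \<in> permutations_of_set (- set P)"
    then have A: "set A = - set P" "distinct A" by (auto simp: permutations_of_set_def)
    then have "length A = j" using c distinct_card by metis
    then show "A \<in> {A \<in> lists_len j. distinct (P @ A) \<and> set (P @ A) = UNIV}"
      using A assms by (auto simp: lists_len_def)
  qed
  then show ?thesis using c by (simp add: card_permutations_of_set)
qed

lemma levi_square: "levi A * levi A = of_bool (distinct A \<and> set A = UNIV)"
  by (simp add: levi_def)

lemma sum_levi_square:
  fixes P :: "'n::finite list"
  assumes "length P + j = CARD('n)"
  shows "(\<Sum>A\<in>lists_len j. levi (P @ A) * levi (P @ A)) = of_bool (distinct P) * fact j"
proof (cases "distinct P")
  case True
  have "(\<Sum>A\<in>lists_len j. levi (P @ A) * levi (P @ A)) = int (card {A \<in> lists_len j. distinct (P @ A) \<and> set (P @ A) = UNIV})"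
    unfolding levi_square by (simp add: of_bool_def sum.If_cases Int_def)
  then show ?thesis using card_completions[OF True assms] True by simp
next
  case False then show ?thesis by (simp add: levi_square)
qed

lemma sum_icoef_0:
  "(\<Sum>A :: 'n::finite list\<in>lists_len CARD('n). icoef (zip A A)) = fact CARD('n) * (- 2 * \<i>) ^ CARD('n)"
proof -
  have "(\<Sum>A :: 'n list\<in>lists_len CARD('n). icoef (zip A A)) = of_int (\<Sum>A\<in>lists_len CARD('n). levi ([] @ (A :: 'n list)) * levi ([] @ A)) * (- 2 * \<i>) ^ CARD('n)"
    by (simp add: icoef_zip sum_distrib_right)
  also have "(\<Sum>A\<in>lists_len CARD('n). levi ([] @ (A :: 'n list)) * levi ([] @ A)) = fact CARD('n)"
    by (subst sum_levi_square) simp_all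
  finally show ?thesis by simp
qed

lemma sum_icoef_1:
  fixes a b :: "'n::finite"
  assumes "j + 1 = CARD('n)"
  shows "(\<Sum>A\<in>lists_len j. icoef ((a, b) # zip A A)) = of_bool (a = b) * fact j * (- 2 * \<i>) ^ CARD('n)"
proof -
  have eq: "icoef ((a, b) # zip A A) = of_int (levi ([a] @ A) * levi ([b] @ A)) * (- 2 * \<i>) ^ CARD('n)" for A
    using icoef_zip[of "a # A" "b # A"] by simp
  have "(\<Sum>A\<in>lists_len j. levi ([a] @ A) * levi ([b] @ A)) = of_bool (a = b) * fact j"
  proof (cases "a = b")
    case True
    then show ?thesis using sum_levi_square[of "[a]" j] assms by simp
  next
    case False
    have "levi ([a] @ A) * levi ([b] @ A) = 0" for A
    proof (rule ccontr)
      assume "levi ([a] @ A) * levi ([b] @ A) \<noteq> 0"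
      then have "a \<notin> set A" "b \<notin> set A" "insert a (set A) = UNIV"
        by (auto simp: levi_def split: if_splits)
      then show False using False by auto
    qed
    then show ?thesis using False by (simp only: sum.neutral_const of_bool_eq mult_zero_left simp_thms)
  qed
  then show ?thesis unfolding eq sum_distrib_right[symmetric] of_int_sum[symmetric] by simp
qed

text \<open>A contracted product of Levi-Civita symbols is the generalized Kronecker delta: once
  \<open>A\<close> is removed, both lists use the same two coordinates, either in the same order or
  in the opposite one.\<close>

lemma sum_icoef_2:
  fixes a b c d :: "'n::finite"
  assumes "j + 2 = CARD('n)"
  shows "(\<Sum>A\<in>lists_len j. icoef ((a, b) # (c, d) # zip A A)) =
    (of_bool (a = b \<and> c = d) - of_bool (a = d \<and> c = b)) * fact j * (- 2 * \<i>) ^ CARD('n)"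
proof -
  have eq: "icoef ((a, b) # (c, d) # zip A A) = of_int (levi ([a, c] @ A) * levi ([b, d] @ A)) * (- 2 * \<i>) ^ CARD('n)" for A
    using icoef_zip[of "a # c # A" "b # d # A"] by simp
  have "(\<Sum>A\<in>lists_len j. levi ([a, c] @ A) * levi ([b, d] @ A)) = (of_bool (a = b \<and> c = d) - of_bool (a = d \<and> c = b)) * fact j"
  proof (cases "a = c \<or> b = d")
    case True
    then have "levi ([a, c] @ A) * levi ([b, d] @ A) = 0" for A by (auto simp: levi_def)
    moreover have "(of_bool (a = b \<and> c = d) - of_bool (a = d \<and> c = b) :: int) = 0" using True by auto
    ultimately show ?thesis by (simp only: sum.neutral_const mult_zero_left)
  next
    case ne: False
    have s: "(\<Sum>A\<in>lists_len j. levi ([a, c] @ A) * levi ([a, c] @ A)) = fact j"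
      using sum_levi_square[of "[a, c]" j] assms ne by simp
    consider "b = a \<and> d = c" | "b = c \<and> d = a" | "\<not> (b = a \<and> d = c)" "\<not> (b = c \<and> d = a)" by blast
    then show ?thesis
    proof cases
      case 1 then show ?thesis using s ne by simp
    next
      case 2
      have "levi ([a, c] @ A) * levi ([b, d] @ A) = - (levi ([a, c] @ A) * levi ([a, c] @ A))" for A
        using levi_swap[of c a A] 2 by simp
      then show ?thesis using s ne 2 by (simp add: sum_negf)
    next
      case 3
      have "levi ([a, c] @ A) * levi ([b, d] @ A) = 0" for A
      proof (rule ccontr)
        assume "levi ([a, c] @ A) * levi ([b, d] @ A) \<noteq> 0"
        then have "a \<notin> set A" "c \<notin> set A" "b \<notin> set A" "d \<notin> set A" "b \<in> insert a (insert c (set A))" "d \<in> insert a (insert c (set A))"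
          by (auto simp: levi_def split: if_splits)
        then show False using 3 ne by auto
      qed
      moreover have "(of_bool (a = b \<and> c = d) - of_bool (a = d \<and> c = b) :: int) = 0" using 3 by auto
      ultimately show ?thesis by (simp only: sum.neutral_const mult_zero_left)
    qed
  qed
  then show ?thesis unfolding eq sum_distrib_right[symmetric] of_int_sum[symmetric] by simp
qed

lemma i_powers: "(2 * \<i>) ^ k * (- 2 * \<i>) ^ k = 4 ^ k"
  unfolding power_mult_distrib[symmetric] by simp

lemma kronecker_sum:
  fixes g :: "'n::finite \<Rightarrow> complex"
  shows "(\<Sum>b\<in>UNIV. of_bool (a = b) * g b) = g a" "(\<Sum>b\<in>UNIV. of_bool (b = a) * g b) = g a"
  by (simp_all add: of_bool_def if_distrib[of "\<lambda>x. x * _"] cong: if_cong)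

lemma wcoef_sq_0: "wcoef (replicate CARD('n) (sq :: complex^'n \<Rightarrow> real)) [] z = 4 ^ CARD('n) * fact CARD('n)"
proof -
  have "wcoef (replicate CARD('n) (sq :: complex^'n \<Rightarrow> real)) [] z = (2 * \<i>) ^ CARD('n) * (fact CARD('n) * (- 2 * \<i>) ^ CARD('n))"
    using wcoef_replicate_sq[of "CARD('n)" "[]" "[]" z] unfolding wcoef_Nil append_Nil2 sum_icoef_0 .
  also have "\<dots> = ((2 * \<i>) ^ CARD('n) * (- 2 * \<i>) ^ CARD('n)) * fact CARD('n)" by (simp only: mult_ac)
  finally show ?thesis unfolding i_powers .
qed

lemma wcoef_sq_1:
  fixes u :: "complex^'n \<Rightarrow> real"
  assumes j: "j + 1 = CARD('n)"
  shows "wcoef (replicate j sq @ [u]) [] z = 4 ^ CARD('n) * fact j * (\<Sum>a\<in>UNIV. hess u z a a)"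
proof -
  have "wcoef (replicate j sq @ [u]) [] z = (2 * \<i>) ^ j * (\<Sum>A\<in>lists_len j. \<Sum>a\<in>UNIV. \<Sum>b\<in>UNIV. 2 * \<i> * hess u z a b * icoef ((a, b) # zip A A))"
    unfolding wcoef_replicate_sq wcoef_Cons wcoef_Nil by simp
  also have "(\<Sum>A\<in>lists_len j. \<Sum>a\<in>UNIV. \<Sum>b\<in>UNIV. 2 * \<i> * hess u z a b * icoef ((a, b) # zip A A))
     = (\<Sum>a\<in>UNIV. \<Sum>b\<in>UNIV. 2 * \<i> * hess u z a b * (\<Sum>A\<in>lists_len j. icoef ((a, b) # zip A A)))"
    unfolding sum_distrib_left by (rule trans[OF sum.swap], rule sum.cong[OF refl], rule sum.swap)
  also have "\<dots> = (\<Sum>a\<in>UNIV. 2 * \<i> * hess u z a a * (fact j * (- 2 * \<i>) ^ CARD('n)))"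
    unfolding sum_icoef_1[OF j] of_bool_def
    by (simp add: if_distrib[of "\<lambda>x. _ * x"] if_distrib[of "\<lambda>x. x * _"] cong: if_cong)
  also have "\<dots> = 2 * \<i> * (fact j * (- 2 * \<i>) ^ CARD('n)) * (\<Sum>a\<in>UNIV. hess u z a a)"
    unfolding sum_distrib_left by (intro sum.cong refl) (simp only: mult_ac)
  also have "(2 * \<i>) ^ j * \<dots> = ((2 * \<i>) ^ CARD('n) * (- 2 * \<i>) ^ CARD('n)) * fact j * (\<Sum>a\<in>UNIV. hess u z a a)"
    unfolding j[symmetric] by (simp add: mult_ac)
  finally show ?thesis unfolding i_powers .
qed

text \<open>The last factor, the squared trace minus the trace of the square, is twice the second
  elementary symmetric function of the complex Hessian.\<close>

lemma wcoef_sq_2: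
  fixes u :: "complex^'n \<Rightarrow> real"
  assumes j: "j + 2 = CARD('n)"
  shows "wcoef (replicate j sq @ [u, u]) [] z =
    4 ^ CARD('n) * fact j * ((\<Sum>a\<in>UNIV. hess u z a a)^2 - (\<Sum>a\<in>UNIV. \<Sum>b\<in>UNIV. hess u z a b * hess u z b a))"
proof -
  have "wcoef (replicate j sq @ [u, u]) [] z = (2 * \<i>) ^ j * (\<Sum>A\<in>lists_len j. \<Sum>c\<in>UNIV. \<Sum>d\<in>UNIV. \<Sum>a\<in>UNIV. \<Sum>b\<in>UNIV.
      (2 * \<i>)^2 * (hess u z c d * hess u z a b) * icoef ((a, b) # (c, d) # zip A A))"
    unfolding wcoef_replicate_sq wcoef_Cons wcoef_Nil by (simp add: sum_distrib_left power2_eq_square mult_ac)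
  also have "(\<Sum>A\<in>lists_len j. \<Sum>c\<in>UNIV. \<Sum>d\<in>UNIV. \<Sum>a\<in>UNIV. \<Sum>b\<in>UNIV.
      (2 * \<i>)^2 * (hess u z c d * hess u z a b) * icoef ((a, b) # (c, d) # zip A A))
     = (\<Sum>c\<in>UNIV. \<Sum>d\<in>UNIV. \<Sum>a\<in>UNIV. \<Sum>b\<in>UNIV. (2 * \<i>)^2 * (hess u z c d * hess u z a b) * (\<Sum>A\<in>lists_len j. icoef ((a, b) # (c, d) # zip A A)))"
    unfolding sum_distrib_left
    by (rule trans[OF sum.swap], rule sum.cong[OF refl], rule trans[OF sum.swap], rule sum.cong[OF refl],
        rule trans[OF sum.swap], rule sum.cong[OF refl], rule sum.swap)
  also have "\<dots> = (\<Sum>c\<in>UNIV. \<Sum>d\<in>UNIV. \<Sum>a\<in>UNIV. \<Sum>b\<in>UNIV. (2 * \<i>)^2 * fact j * (- 2 * \<i>) ^ CARD('n) *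
      ((of_bool (a = b) * (of_bool (c = d) * (hess u z c d * hess u z a b))) - (of_bool (b = c) * (of_bool (a = d) * (hess u z c d * hess u z a b)))))"
    unfolding sum_icoef_2[OF j] by (intro sum.cong refl) (auto simp: of_bool_def)
  also have "\<dots> = (2 * \<i>)^2 * fact j * (- 2 * \<i>) ^ CARD('n) *
      ((\<Sum>c\<in>UNIV. \<Sum>d\<in>UNIV. \<Sum>a\<in>UNIV. \<Sum>b\<in>UNIV. of_bool (a = b) * (of_bool (c = d) * (hess u z c d * hess u z a b)))
      - (\<Sum>c\<in>UNIV. \<Sum>d\<in>UNIV. \<Sum>a\<in>UNIV. \<Sum>b\<in>UNIV. of_bool (b = c) * (of_bool (a = d) * (hess u z c d * hess u z a b))))"
    by (simp only: sum_distrib_left[symmetric] sum_subtractf)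
  also have "(\<Sum>c\<in>UNIV. \<Sum>d\<in>UNIV. \<Sum>a\<in>UNIV. \<Sum>b\<in>UNIV. of_bool (a = b) * (of_bool (c = d) * (hess u z c d * hess u z a b)))
     = (\<Sum>a\<in>UNIV. hess u z a a)^2"
    unfolding kronecker_sum sum_distrib_left[symmetric] by (simp add: sum_distrib_right power2_eq_square)
  also have "(\<Sum>c\<in>UNIV. \<Sum>d\<in>UNIV. \<Sum>a\<in>UNIV. \<Sum>b\<in>UNIV. of_bool (b = c) * (of_bool (a = d) * (hess u z c d * hess u z a b)))
     = (\<Sum>c\<in>UNIV. \<Sum>d\<in>UNIV. hess u z c d * hess u z d c)"
    unfolding kronecker_sum ..
  also have "(2 * \<i>) ^ j * ((2 * \<i>)^2 * fact j * (- 2 * \<i>) ^ CARD('n) *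
      ((\<Sum>a\<in>UNIV. hess u z a a)^2 - (\<Sum>a\<in>UNIV. \<Sum>b\<in>UNIV. hess u z a b * hess u z b a))) =
     ((2 * \<i>) ^ CARD('n) * (- 2 * \<i>) ^ CARD('n)) * fact j *
      ((\<Sum>a\<in>UNIV. hess u z a a)^2 - (\<Sum>a\<in>UNIV. \<Sum>b\<in>UNIV. hess u z a b * hess u z b a))"
    unfolding j[symmetric] power_add by (simp only: mult_ac)
  finally show ?thesis unfolding i_powers .
qed

section \<open>The Gaussian Poincare inequality\<close>

text \<open>Left unnormalised: the inequalities below carry its total mass as a factor.\<close>

definition gauss :: "'a::euclidean_space \<Rightarrow> real" where "gauss x = exp (- (x \<bullet> x) / 2)"

lemma gauss_nonneg: "gauss x \<ge> 0" by (simp add: gauss_def)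

lemma continuous_gauss: "continuous_on S gauss"
  unfolding gauss_def[abs_def] by (intro continuous_intros) auto

lemma gauss_measurable [measurable]: "gauss \<in> borel_measurable borel"
  by (rule borel_measurable_continuous_onI[OF continuous_gauss])

lemma nn_integral_exp_quarter_square: "(\<integral>\<^sup>+(x::real). ennreal (exp (- x\<^sup>2 / 4)) \<partial>lborel) < \<infinity>"
proof -
  have half: "(\<integral>\<^sup>+(x::real). ennreal (exp (- x)) * indicator {0..} x \<partial>lborel) = ennreal 1"
  proof -
    have "((\<lambda>x::real. - exp (- x)) \<longlongrightarrow> - 0) at_top"
      by (intro tendsto_minus filterlim_compose[OF exp_at_bot] filterlim_uminus_at_bot_at_top)
    then have "(\<integral>\<^sup>+(x::real). ennreal (exp (- x)) * indicator {0..} x \<partial>lborel) = ennreal (0 - (- exp (- 0)))"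
      by (intro nn_integral_FTC_atLeast) (auto intro!: derivative_eq_intros)
    then show ?thesis by simp
  qed
  have refl: "(\<integral>\<^sup>+(x::real). ennreal (exp x) * indicator {..0} x \<partial>lborel) = (\<integral>\<^sup>+(x::real). ennreal (exp (- x)) * indicator {0..} x \<partial>lborel)"
    by (subst nn_integral_real_affine[of _ "-1" 0]) (auto simp: indicator_def intro!: nn_integral_cong)
  have "(\<integral>\<^sup>+(x::real). ennreal (exp (- x\<^sup>2 / 4)) \<partial>lborel) \<le>
      (\<integral>\<^sup>+(x::real). ennreal (exp 1) * (ennreal (exp (- x)) * indicator {0..} x + ennreal (exp x) * indicator {..0} x) \<partial>lborel)"
  proof (rule nn_integral_mono)
    fix x :: real
    have "- x\<^sup>2 / 4 \<le> 1 - \<bar>x\<bar>"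
      using zero_le_power2[of "\<bar>x\<bar> / 2 - 1"] by (simp add: power2_diff power_divide algebra_simps)
    then have "exp (- x\<^sup>2 / 4) \<le> exp 1 * exp (- \<bar>x\<bar>)" by (simp add: exp_add[symmetric])
    then have "ennreal (exp (- x\<^sup>2 / 4)) \<le> ennreal (exp 1) * ennreal (exp (- \<bar>x\<bar>))" by (simp add: ennreal_mult'[symmetric])
    also have "ennreal (exp (- \<bar>x\<bar>)) \<le> ennreal (exp (- x)) * indicator {0..} x + ennreal (exp x) * indicator {..0} x"
      by (cases "x \<ge> 0") (auto simp: indicator_def)
    finally show "ennreal (exp (- x\<^sup>2 / 4)) \<le> ennreal (exp 1) * (ennreal (exp (- x)) * indicator {0..} x + ennreal (exp x) * indicator {..0} x)"
      by (simp add: mult_left_mono)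
  qed
  also have "\<dots> = ennreal (exp 1) * (1 + 1)"
    by (simp add: nn_integral_cmult nn_integral_add half refl)
  also have "\<dots> < \<infinity>" by (simp add: ennreal_mult_less_top)
  finally show ?thesis .
qed

text \<open>Half of the exponent absorbs the quadratic growth, since 1 + |x|^2 <= 4 exp (|x|^2 / 4);
  the other half is a product of integrable functions of one variable.\<close>

lemma gauss_integrable_bound:
  fixes f :: "'a::euclidean_space \<Rightarrow> real"
  assumes [measurable]: "f \<in> borel_measurable borel" and bd: "\<And>x. \<bar>f x\<bar> \<le> C * (1 + x \<bullet> x)"
  shows "integrable lborel (\<lambda>x. gauss x * f x)"
proof -
  have C: "C \<ge> 0" using bd[of 0] by (simp add: order_trans[OF abs_ge_zero])
  have "(\<integral>\<^sup>+(x::'a). ennreal (exp (- (x \<bullet> x) / 4)) \<partial>lborel) = (\<integral>\<^sup>+(x::'a). (\<Prod>b\<in>Basis. ennreal (exp (- (x \<bullet> b)\<^sup>2 / 4))) \<partial>lborel)"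
  proof (rule nn_integral_cong)
    fix x :: 'a
    have "exp (- (x \<bullet> x) / 4) = (\<Prod>b\<in>Basis. exp (- (x \<bullet> b)\<^sup>2 / 4))"
      unfolding exp_sum[OF finite_Basis, symmetric] sum_divide_distrib[symmetric] sum_negf euclidean_inner[of x x] power2_eq_square ..
    then show "ennreal (exp (- (x \<bullet> x) / 4)) = (\<Prod>b\<in>Basis. ennreal (exp (- (x \<bullet> b)\<^sup>2 / 4)))"
      by (simp add: prod_ennreal)
  qed
  also have "\<dots> = (\<Prod>b\<in>(Basis :: 'a set). \<integral>\<^sup>+(x::real). ennreal (exp (- x\<^sup>2 / 4)) \<partial>lborel)"
    by (rule nn_integral_lborel_prod) auto
  also have "\<dots> < \<infinity>" using nn_integral_exp_quarter_square by (simp add: power_less_top_ennreal)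
  finally have "integrable lborel (\<lambda>x::'a. exp (- (x \<bullet> x) / 4))" by (simp add: integrable_iff_bounded)
  then have "integrable lborel (\<lambda>x::'a. 4 * C * exp (- (x \<bullet> x) / 4))" by simp
  then show ?thesis
  proof (rule Bochner_Integration.integrable_bound)
    show "AE x in lborel. norm (gauss x * f x) \<le> norm (4 * C * exp (- (x \<bullet> x) / 4))"
    proof (rule AE_I2)
      fix x :: 'a
      have "1 + x \<bullet> x / 4 \<le> exp (x \<bullet> x / 4)" by (rule exp_ge_add_one_self)
      then have e: "1 + x \<bullet> x \<le> 4 * exp (x \<bullet> x / 4)" by linarith
      have "norm (gauss x * f x) \<le> gauss x * (C * (1 + x \<bullet> x))"
        using bd[of x] gauss_nonneg[of x] by (simp add: abs_mult mult_left_mono)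
      also have "\<dots> \<le> gauss x * (C * (4 * exp (x \<bullet> x / 4)))"
        by (intro mult_left_mono e C gauss_nonneg)
      also have "\<dots> = 4 * C * exp (- (x \<bullet> x) / 4)"
        unfolding gauss_def by (simp add: exp_add[symmetric] mult_ac)
      finally show "norm (gauss x * f x) \<le> norm (4 * C * exp (- (x \<bullet> x) / 4))" by simp
    qed
  qed simp
qed

lemma gauss_integrable: "integrable lborel (gauss :: 'a::euclidean_space \<Rightarrow> real)"
  using gauss_integrable_bound[of "\<lambda>_::'a. 1" 1] by simp

lemma gauss_pair: "gauss (x, y) = gauss x * gauss y"
  by (simp add: gauss_def exp_add[symmetric] add_divide_distrib)

lemma nn_integral_shear:
  fixes f :: "'a::euclidean_space \<times> 'a \<Rightarrow> ennreal"
  assumes [measurable]: "f \<in> borel_measurable borel"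
  shows "(\<integral>\<^sup>+p. f (fst p + t *\<^sub>R snd p, snd p) \<partial>lborel) = (\<integral>\<^sup>+p. f p \<partial>lborel)"
    "(\<integral>\<^sup>+p. f (fst p, snd p + t *\<^sub>R fst p) \<partial>lborel) = (\<integral>\<^sup>+p. f p \<partial>lborel)"
proof -
  have m: "f \<in> borel_measurable (lborel \<Otimes>\<^sub>M lborel)" by (simp add: lborel_prod)
  have [measurable]: "(\<lambda>p::'a \<times> 'a. f (fst p + t *\<^sub>R snd p, snd p)) \<in> borel_measurable (lborel \<Otimes>\<^sub>M lborel)"
    "(\<lambda>p::'a \<times> 'a. f (fst p, snd p + t *\<^sub>R fst p)) \<in> borel_measurable (lborel \<Otimes>\<^sub>M lborel)"
    using m by measurable
  have "(\<integral>\<^sup>+p. f (fst p + t *\<^sub>R snd p, snd p) \<partial>lborel) = (\<integral>\<^sup>+y. \<integral>\<^sup>+x. f (x + t *\<^sub>R y, y) \<partial>lborel \<partial>lborel)"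
    unfolding lborel_prod[symmetric] by (subst lborel_pair.nn_integral_snd[symmetric]) auto
  also have "\<dots> = (\<integral>\<^sup>+y. \<integral>\<^sup>+x. f (x, y) \<partial>lborel \<partial>lborel)"
    by (intro nn_integral_cong nn_integral_translate) measurable
  also have "\<dots> = (\<integral>\<^sup>+p. f p \<partial>lborel)"
    unfolding lborel_prod[symmetric] using m by (subst lborel_pair.nn_integral_snd) (auto simp: lborel_prod)
  finally show "(\<integral>\<^sup>+p. f (fst p + t *\<^sub>R snd p, snd p) \<partial>lborel) = (\<integral>\<^sup>+p. f p \<partial>lborel)" .
  have "(\<integral>\<^sup>+p. f (fst p, snd p + t *\<^sub>R fst p) \<partial>lborel) = (\<integral>\<^sup>+x. \<integral>\<^sup>+y. f (x, y + t *\<^sub>R x) \<partial>lborel \<partial>lborel)"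
    unfolding lborel_prod[symmetric] by (subst lborel.nn_integral_fst[symmetric]) auto
  also have "\<dots> = (\<integral>\<^sup>+x. \<integral>\<^sup>+y. f (x, y) \<partial>lborel \<partial>lborel)"
    by (intro nn_integral_cong nn_integral_translate) measurable
  also have "\<dots> = (\<integral>\<^sup>+p. f p \<partial>lborel)"
    unfolding lborel_prod[symmetric] using m by (subst lborel.nn_integral_fst) (auto simp: lborel_prod)
  finally show "(\<integral>\<^sup>+p. f (fst p, snd p + t *\<^sub>R fst p) \<partial>lborel) = (\<integral>\<^sup>+p. f p \<partial>lborel)" .
qed

text \<open>A rotation by an angle \<open>r\<close> in \<open>[0, \<pi>/2]\<close> is a product of three shears, with parameters
  \<open>tan (r/2)\<close>, \<open>- sin r\<close>, \<open>tan (r/2)\<close>.\<close>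

lemma nn_integral_rotation:
  fixes f :: "'a::euclidean_space \<times> 'a \<Rightarrow> ennreal"
  assumes [measurable]: "f \<in> borel_measurable borel" and r: "0 \<le> r" "r \<le> pi / 2"
  shows "(\<integral>\<^sup>+p. f (cos r *\<^sub>R fst p + sin r *\<^sub>R snd p, cos r *\<^sub>R snd p - sin r *\<^sub>R fst p) \<partial>lborel) = (\<integral>\<^sup>+p. f p \<partial>lborel)"
proof -
  define t where "t = tan (r / 2)"
  have c0: "cos (r / 2) > 0" using r pi_gt_zero by (intro cos_gt_zero_pi; linarith)
  have s2: "sin r = 2 * sin (r / 2) * cos (r / 2)" using sin_double[of "r / 2"] by simp
  have c2: "cos r = 1 - 2 * (sin (r / 2))^2" using cos_double_sin[of "r / 2"] by simp
  have tc: "t * cos (r / 2) = sin (r / 2)" using c0 by (simp add: t_def tan_def)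
  have e1: "1 - t * sin r = cos r"
  proof -
    have "t * sin r = 2 * sin (r / 2) * (t * cos (r / 2))" by (simp add: s2)
    then show ?thesis unfolding tc c2 by (simp add: power2_eq_square)
  qed
  have e2: "t + t * cos r = sin r"
  proof -
    have "cos r = 2 * (cos (r / 2))^2 - 1" using cos_double_cos[of "r / 2"] by simp
    then have "t * (1 + cos r) = t * (2 * (cos (r / 2))^2)" by simp
    then have "t + t * cos r = 2 * cos (r / 2) * (t * cos (r / 2))" by (simp add: distrib_left power2_eq_square)
    then show ?thesis unfolding tc s2 by simp
  qed
  define f1 where "f1 p = f (fst p + t *\<^sub>R snd p, snd p)" for p
  define f2 where "f2 p = f1 (fst p, snd p + (- sin r) *\<^sub>R fst p)" for p
  have [measurable]: "f1 \<in> borel_measurable borel"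
  proof -
    have "f1 \<in> borel_measurable (borel \<Otimes>\<^sub>M borel)" unfolding f1_def by (measurable; simp add: borel_prod)
    then show ?thesis by (simp add: borel_prod)
  qed
  have [measurable]: "f2 \<in> borel_measurable borel"
  proof -
    have "f2 \<in> borel_measurable (borel \<Otimes>\<^sub>M borel)" unfolding f2_def by (measurable; simp add: borel_prod)
    then show ?thesis by (simp add: borel_prod)
  qed
  have "(\<integral>\<^sup>+p. f p \<partial>lborel) = (\<integral>\<^sup>+p. f1 p \<partial>lborel)" unfolding f1_def by (rule nn_integral_shear(1)[symmetric]) simp
  also have "\<dots> = (\<integral>\<^sup>+p. f2 p \<partial>lborel)" unfolding f2_def by (rule nn_integral_shear(2)[symmetric]) simp
  also have "\<dots> = (\<integral>\<^sup>+p. f2 (fst p + t *\<^sub>R snd p, snd p) \<partial>lborel)" by (rule nn_integral_shear(1)[symmetric]) simp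
  also have "\<dots> = (\<integral>\<^sup>+p. f (cos r *\<^sub>R fst p + sin r *\<^sub>R snd p, cos r *\<^sub>R snd p - sin r *\<^sub>R fst p) \<partial>lborel)"
  proof (intro nn_integral_cong arg_cong[where f=f])
    fix p :: "'a \<times> 'a"
    obtain x y where p: "p = (x, y)" by force
    have y: "y + (- sin r) *\<^sub>R (x + t *\<^sub>R y) = cos r *\<^sub>R y - sin r *\<^sub>R x"
    proof -
      have "y + (- sin r) *\<^sub>R (x + t *\<^sub>R y) = (1 - t * sin r) *\<^sub>R y - sin r *\<^sub>R x" by (simp add: algebra_simps)
      then show ?thesis by (simp only: e1)
    qed
    have x: "(x + t *\<^sub>R y) + t *\<^sub>R (cos r *\<^sub>R y - sin r *\<^sub>R x) = cos r *\<^sub>R x + sin r *\<^sub>R y"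
    proof -
      have "(x + t *\<^sub>R y) + t *\<^sub>R (cos r *\<^sub>R y - sin r *\<^sub>R x) = (1 - t * sin r) *\<^sub>R x + (t + t * cos r) *\<^sub>R y" by (simp add: algebra_simps)
      then show ?thesis by (simp only: e1 e2)
    qed
    have "f2 (fst p + t *\<^sub>R snd p, snd p) = f ((x + t *\<^sub>R y) + t *\<^sub>R (y + (- sin r) *\<^sub>R (x + t *\<^sub>R y)), y + (- sin r) *\<^sub>R (x + t *\<^sub>R y))"
      by (simp add: f2_def f1_def p)
    then show "f2 (fst p + t *\<^sub>R snd p, snd p) = f (cos r *\<^sub>R fst p + sin r *\<^sub>R snd p, cos r *\<^sub>R snd p - sin r *\<^sub>R fst p)"
      unfolding y x by (simp add: p)
  qed
  finally show ?thesis by simp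
qed

lemma integral_gauss_product:
  fixes f g :: "'a::euclidean_space \<Rightarrow> real"
  assumes f: "integrable lborel (\<lambda>x. gauss x * f x)" and g: "integrable lborel (\<lambda>x. gauss x * g x)"
  shows "integrable lborel (\<lambda>p. gauss p * (f (fst p) * g (snd p)))"
    "(LINT p|lborel. gauss p * (f (fst p) * g (snd p))) = (LINT x|lborel. gauss x * f x) * (LINT x|lborel. gauss x * g x)"
proof -
  let ?h = "\<lambda>p. (gauss (fst p) * f (fst p)) * (gauss (snd p) * g (snd p))"
  have eq: "?h = (\<lambda>p. gauss p * (f (fst p) * g (snd p)))"
    by (auto simp: fun_eq_iff gauss_pair)
  have [measurable]: "(\<lambda>x. gauss x * f x) \<in> borel_measurable borel" "(\<lambda>x. gauss x * g x) \<in> borel_measurable borel"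
    using f g by auto
  have int: "integrable (lborel \<Otimes>\<^sub>M lborel) ?h"
  proof (rule lborel_pair.Fubini_integrable)
    show "?h \<in> borel_measurable (lborel \<Otimes>\<^sub>M lborel)" by measurable
    show "integrable lborel (\<lambda>x. LINT y|lborel. norm (?h (x, y)))"
    proof -
      have "(LINT y|lborel. norm (?h (x, y))) = \<bar>gauss x * f x\<bar> * (LINT y|lborel. \<bar>gauss y * g y\<bar>)" for x
        by (simp only: fst_conv snd_conv real_norm_def abs_mult[of "gauss x * f x"] integral_mult_right_zero)
      then show ?thesis using integrable_mult_left[OF integrable_abs[OF f]] by simp
    qed
    show "AE x in lborel. integrable lborel (\<lambda>y. ?h (x, y))" using g by simp
  qed
  show "integrable lborel (\<lambda>p. gauss p * (f (fst p) * g (snd p)))"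
    using int unfolding eq by (simp add: lborel_prod)
  have "(LINT p|lborel. gauss p * (f (fst p) * g (snd p))) = (LINT p|(lborel \<Otimes>\<^sub>M lborel). ?h p)"
    unfolding eq by (simp add: lborel_prod)
  also have "\<dots> = (LINT x|lborel. LINT y|lborel. ?h (x, y))" by (rule lborel_pair.integral_fst'[OF int, symmetric])
  also have "\<dots> = (LINT x|lborel. gauss x * f x) * (LINT x|lborel. gauss x * g x)" by simp
  finally show "(LINT p|lborel. gauss p * (f (fst p) * g (snd p))) = (LINT x|lborel. gauss x * f x) * (LINT x|lborel. gauss x * g x)" .
qed

lemma norm_le_one_plus_square:
  fixes x :: "'a::euclidean_space"
  shows "norm x \<le> 1 + x \<bullet> x" "(1 + norm x)^2 \<le> 4 * (1 + x \<bullet> x)"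
proof -
  have *: "2 * norm x \<le> 1 + (norm x)^2" using zero_le_power2[of "norm x - 1"] by (simp add: power2_diff)
  show "norm x \<le> 1 + x \<bullet> x"
    using * norm_ge_zero[of x] zero_le_power2[of "norm x"] unfolding power2_norm_eq_inner[symmetric] by linarith
  have "(1 + norm x)^2 = 1 + (norm x)^2 + 2 * norm x" by (simp add: power2_sum)
  also have "\<dots> \<le> 1 + (norm x)^2 + (1 + (norm x)^2)" using * by (rule add_left_mono)
  also have "\<dots> \<le> 4 * (1 + (norm x)^2)" by simp
  finally show "(1 + norm x)^2 \<le> 4 * (1 + x \<bullet> x)" by (simp add: power2_norm_eq_inner)
qed

lemma inner_rotation:
  "(c *\<^sub>R x + s *\<^sub>R y) \<bullet> (c *\<^sub>R x + s *\<^sub>R y) + (c *\<^sub>R y - s *\<^sub>R x) \<bullet> (c *\<^sub>R y - s *\<^sub>R x) = (s^2 + c^2) * (x \<bullet> x + y \<bullet> y)"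
  by (simp add: inner_add_left inner_add_right inner_diff_left inner_diff_right inner_commute power2_eq_square algebra_simps)

lemma gauss_line_derivative: "((\<lambda>t. gauss (p + t *\<^sub>R v)) has_real_derivative - (p \<bullet> v) * gauss p) (at 0)"
proof -
  have "gauss (p + t *\<^sub>R v) = exp (- (p \<bullet> p + 2 * t * (p \<bullet> v) + t * t * (v \<bullet> v)) / 2)" for t
    by (simp add: gauss_def inner_add_left inner_add_right inner_commute algebra_simps)
  moreover have "((\<lambda>t. exp (- (p \<bullet> p + 2 * t * (p \<bullet> v) + t * t * (v \<bullet> v)) / 2)) has_real_derivative - (p \<bullet> v) * gauss p) (at 0)"
    by (auto intro!: derivative_eq_intros simp: gauss_def)
  ultimately show ?thesis by simp
qed

lemma le_mult_one_plus_square: "0 \<le> c \<Longrightarrow> c \<le> c * (1 + x \<bullet> (x::'a::euclidean_space))" for c :: real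
  by (simp add: algebra_simps)

text \<open>Interpolation along \<open>w = cos r x + sin r y\<close> for independent Gaussian \<open>x\<close>, \<open>y\<close>. In the integration by
  parts the direction \<open>(sin r b, - cos r b)\<close> leaves \<open>w\<close> fixed, so that only first derivatives of \<open>F\<close> occur.\<close>

theorem gauss_poincare:
  fixes F :: "'a::euclidean_space \<Rightarrow> real" and G :: "'a \<Rightarrow> 'a"
  assumes der: "\<And>x. (F has_derivative (\<lambda>v. G x \<bullet> v)) (at x)"
    and contG: "continuous_on UNIV G" and bdG: "\<And>x. norm (G x) \<le> M"
  shows "(LINT x|lborel. gauss (x::'a)) * (LINT x|lborel. gauss x * (F x)^2) - (LINT x|lborel. gauss x * F x)\<^sup>2
    \<le> (LINT x|lborel. gauss (x::'a)) * (LINT x|lborel. gauss x * (norm (G x))^2)"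
proof -
  have M0: "M \<ge> 0" using bdG[of 0] norm_ge_zero order_trans by blast
  have contF: "continuous_on UNIV F"
    by (intro continuous_at_imp_continuous_on ballI has_derivative_continuous[OF der])
  have [measurable]: "F \<in> borel_measurable borel" "G \<in> borel_measurable borel"
    using contF contG by (auto intro: borel_measurable_continuous_onI)
  define A where "A = \<bar>F 0\<bar> + M"
  have A0: "A \<ge> 0" using M0 by (simp add: A_def)
  have lin: "\<bar>F x\<bar> \<le> A * (1 + norm x)" for x
  proof -
    have "norm (F x - F 0) \<le> M * norm (x - 0)"
    proof (rule differentiable_bound[where S=UNIV and f'="\<lambda>x v. G x \<bullet> v"])
      show "onorm (\<lambda>v. G x \<bullet> v) \<le> M" for x
      proof (rule onorm_le)
        fix v
        have "norm (G x \<bullet> v) \<le> norm (G x) * norm v" using Cauchy_Schwarz_ineq2[of "G x" v] by simp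
        also have "\<dots> \<le> M * norm v" by (intro mult_right_mono bdG) simp
        finally show "norm (G x \<bullet> v) \<le> M * norm v" .
      qed
    qed (use der in auto)
    then show ?thesis using M0 by (simp add: A_def algebra_simps) (smt (verit) mult_nonneg_nonneg norm_ge_zero)
  qed
  define \<Gamma> where "\<Gamma> = (gauss :: 'a \<times> 'a \<Rightarrow> real)"
  define w where "w r p = cos r *\<^sub>R fst p + sin r *\<^sub>R snd p" for r and p :: "'a \<times> 'a"
  define w' where "w' r p = cos r *\<^sub>R snd p - sin r *\<^sub>R fst p" for r and p :: "'a \<times> 'a"
  define K where "K r p = \<Gamma> p * (F (fst p) * (G (w r p) \<bullet> w' r p))" for r p
  have nfst: "norm (fst p) \<le> norm p" and nsnd: "norm (snd p) \<le> norm p" for p :: "'a \<times> 'a"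
    using norm_fst_le[of "fst p" "snd p"] norm_snd_le[of "snd p" "fst p"] by simp_all
  have nw': "norm (w' r p) \<le> 2 * norm p" for r p
  proof -
    have "norm (w' r p) \<le> \<bar>cos r\<bar> * norm (snd p) + \<bar>sin r\<bar> * norm (fst p)"
      unfolding w'_def by (rule order_trans[OF norm_triangle_ineq4]) simp
    also have "\<dots> \<le> 1 * norm p + 1 * norm p"
      by (intro add_mono mult_mono nfst nsnd abs_cos_le_one abs_sin_le_one) auto
    finally show ?thesis by simp
  qed
  have ww: "continuous_on S (\<lambda>p. w r p)" "continuous_on S (\<lambda>p. w' r p)" for S r
    unfolding w_def w'_def by (intro continuous_intros)+
  \<comment> \<open>Stated for a general vector, since it is applied to \<open>w' r p\<close>, to
    its components along a basis vector, and to the basis vectors themselves.\<close>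
  have bdK: "\<bar>F (fst p) * (G (w r p) \<bullet> v)\<bar> \<le> (A * M * 8) * (1 + p \<bullet> p)" if v: "norm v \<le> 2 * (1 + norm p)" for r p v
  proof -
    have "\<bar>F (fst p) * (G (w r p) \<bullet> v)\<bar> \<le> (A * (1 + norm p)) * (M * (2 * (1 + norm p)))"
      unfolding abs_mult
    proof (intro mult_mono)
      show "\<bar>F (fst p)\<bar> \<le> A * (1 + norm p)"
        using lin[of "fst p"] nfst[of p] A0 by (meson add_left_mono mult_left_mono order_trans)
      show "\<bar>G (w r p) \<bullet> v\<bar> \<le> M * (2 * (1 + norm p))"
        using Cauchy_Schwarz_ineq2[of "G (w r p)" v] mult_mono[OF bdG[of "w r p"] v M0 norm_ge_zero] by linarith
    qed (use A0 in auto)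
    also have "\<dots> = A * M * 2 * (1 + norm p)^2" by (simp add: power2_eq_square algebra_simps)
    also have "\<dots> \<le> A * M * 2 * (4 * (1 + p \<bullet> p))" using norm_le_one_plus_square(2)[of p] A0 M0 by (intro mult_left_mono) auto
    finally show ?thesis by (simp add: algebra_simps)
  qed
  have mK: "(\<lambda>p. F (fst p) * (G (w r p) \<bullet> v p)) \<in> borel_measurable borel" if "continuous_on UNIV v" for r v
    by (intro borel_measurable_continuous_onI continuous_on_mult continuous_on_inner that
        continuous_on_compose2[OF contG] continuous_on_compose2[OF contF] ww) (auto intro!: continuous_intros)
  have intK: "integrable lborel (K r)" for r
    unfolding K_def \<Gamma>_def
    by (rule gauss_integrable_bound[OF mK[OF ww(2)] bdK]) (rule order_trans[OF nw'], simp)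
  have bdGG: "\<bar>G (fst p) \<bullet> G (w r p)\<bar> \<le> M^2 * (1 + p \<bullet> p)" for r p
  proof -
    have "\<bar>G (fst p) \<bullet> G (w r p)\<bar> \<le> M * M"
      using Cauchy_Schwarz_ineq2[of "G (fst p)" "G (w r p)"] mult_mono[OF bdG bdG M0 norm_ge_zero, of "fst p" "w r p"] by linarith
    also have "\<dots> \<le> M^2 * (1 + p \<bullet> p)" unfolding power2_eq_square by (rule le_mult_one_plus_square) (simp add: M0)
    finally show ?thesis .
  qed
  have by_parts: "(LINT p|lborel. K r p) = - sin r * (LINT p|lborel. \<Gamma> p * (G (fst p) \<bullet> G (w r p)))" for r
  proof -
    define g where "g b p = \<Gamma> p * (F (fst p) * (G (w r p) \<bullet> b))" for b p
    define k1 where "k1 b p = \<Gamma> p * (F (fst p) * (G (w r p) \<bullet> ((w' r p \<bullet> b) *\<^sub>R b)))" for b p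
    define k2 where "k2 b p = \<Gamma> p * ((G (fst p) \<bullet> b) * (G (w r p) \<bullet> b))" for b p
    have int1: "integrable lborel (k1 b)" if b: "b \<in> Basis" for b
      unfolding k1_def \<Gamma>_def
    proof (rule gauss_integrable_bound[OF mK bdK])
      show "norm ((w' r p \<bullet> b) *\<^sub>R b) \<le> 2 * (1 + norm p)" for p
        using Basis_le_norm[OF b, of "w' r p"] nw'[of r p] b by simp
    qed (intro continuous_intros ww)
    have int2: "integrable lborel (k2 b)" if b: "b \<in> Basis" for b
      unfolding k2_def \<Gamma>_def
    proof (rule gauss_integrable_bound)
      show "(\<lambda>p. (G (fst p) \<bullet> b) * (G (w r p) \<bullet> b)) \<in> borel_measurable borel"
        by (intro borel_measurable_continuous_onI continuous_intros continuous_on_compose2[OF contG] ww) auto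
      have le: "\<bar>(G (fst p) \<bullet> b) * (G (w r p) \<bullet> b)\<bar> \<le> M * M" for p
        unfolding abs_mult using Basis_le_norm[OF b] bdG M0 by (intro mult_mono) (auto intro: order_trans)
      show "\<bar>(G (fst p) \<bullet> b) * (G (w r p) \<bullet> b)\<bar> \<le> (M * M) * (1 + p \<bullet> p)" for p
        using order_trans[OF le[of p] le_mult_one_plus_square[of "M * M" p]] M0 by simp
    qed
    have zero: "(LINT p|lborel. k1 b p + sin r * k2 b p) = 0" if b: "b \<in> Basis" for b
    proof (rule integral_directional_derivative_eq_0[where g="g b" and v="(sin r *\<^sub>R b, - cos r *\<^sub>R b)"])
      let ?v = "(sin r *\<^sub>R b, - cos r *\<^sub>R b)"
      have wv: "w r (p + t *\<^sub>R ?v) = w r p" for p t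
        by (simp add: w_def algebra_simps)
      show "((\<lambda>t. g b (p + t *\<^sub>R ?v)) has_vector_derivative k1 b p + sin r * k2 b p) (at 0)" for p
      proof -
        have 1: "((\<lambda>t. \<Gamma> (p + t *\<^sub>R ?v)) has_real_derivative - (p \<bullet> ?v) * \<Gamma> p) (at 0)"
          unfolding \<Gamma>_def by (rule gauss_line_derivative)
        have 2: "((\<lambda>t. F (fst p + t *\<^sub>R (sin r *\<^sub>R b))) has_real_derivative sin r * (G (fst p) \<bullet> b)) (at 0)"
        proof -
          have "((\<lambda>t. F (fst p + t *\<^sub>R (sin r *\<^sub>R b))) has_derivative (\<lambda>h. G (fst p + 0 *\<^sub>R (sin r *\<^sub>R b)) \<bullet> (h *\<^sub>R (sin r *\<^sub>R b)))) (at 0)"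
            by (rule has_derivative_compose[OF _ der]) (auto intro!: derivative_eq_intros)
          then show ?thesis unfolding has_field_derivative_def by (rule has_derivative_eq_rhs) (auto simp: fun_eq_iff)
        qed
        have "((\<lambda>t. \<Gamma> (p + t *\<^sub>R ?v) * (F (fst p + t *\<^sub>R (sin r *\<^sub>R b)) * (G (w r p) \<bullet> b))) has_real_derivative
           (- (p \<bullet> ?v) * \<Gamma> p) * (F (fst p) * (G (w r p) \<bullet> b)) + (sin r * (G (fst p) \<bullet> b)) * (G (w r p) \<bullet> b) * \<Gamma> p) (at 0)"
          by (rule derivative_eq_intros 1 2 refl | simp add: zero_prod_def[symmetric])+
        moreover have "p \<bullet> ?v = - (w' r p \<bullet> b)" by (cases p) (simp add: w'_def inner_diff_left)
        ultimately show ?thesis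
          unfolding g_def wv has_real_derivative_iff_has_vector_derivative[symmetric] k1_def k2_def
          by (simp add: mult_ac add.commute)
      qed
      have "continuous_on UNIV \<Gamma>" unfolding \<Gamma>_def by (rule continuous_gauss)
      then show "continuous_on UNIV (\<lambda>p. k1 b p + sin r * k2 b p)"
        unfolding k1_def k2_def
        by (intro continuous_intros ww continuous_on_compose2[OF contG] continuous_on_compose2[OF contF]) auto
      show "integrable lborel (g b)"
        unfolding g_def \<Gamma>_def by (rule gauss_integrable_bound[OF mK bdK]) (use b in \<open>auto simp: algebra_simps\<close>)
      show "integrable lborel (\<lambda>p. k1 b p + sin r * k2 b p)" using int1[OF b] int2[OF b] by simp
    qed
    have "K r p = (\<Sum>b\<in>Basis. k1 b p)" for p
    proof -
      have "G (w r p) \<bullet> w' r p = (\<Sum>b\<in>Basis. G (w r p) \<bullet> ((w' r p \<bullet> b) *\<^sub>R b))"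
        unfolding inner_sum_right[symmetric] euclidean_representation ..
      then show ?thesis unfolding K_def k1_def by (simp only: sum_distrib_left)
    qed
    then have "(LINT p|lborel. K r p) = (\<Sum>b\<in>Basis. LINT p|lborel. k1 b p)"
      using int1 by (simp add: Bochner_Integration.integral_sum)
    also have "\<dots> = (\<Sum>b\<in>Basis. - sin r * (LINT p|lborel. k2 b p))"
    proof (rule sum.cong[OF refl])
      fix b :: 'a assume b: "b \<in> Basis"
      have "(LINT p|lborel. k1 b p) + sin r * (LINT p|lborel. k2 b p) = 0"
        using zero[OF b] int1[OF b] int2[OF b] by simp
      then show "(LINT p|lborel. k1 b p) = - sin r * (LINT p|lborel. k2 b p)" by simp
    qed
    also have "\<dots> = - sin r * (LINT p|lborel. (\<Sum>b\<in>Basis. k2 b p))"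
      using int2 by (simp add: Bochner_Integration.integral_sum sum_distrib_left)
    also have "(\<lambda>p. \<Sum>b\<in>Basis. k2 b p) = (\<lambda>p. \<Gamma> p * (G (fst p) \<bullet> G (w r p)))"
      unfolding k2_def sum_distrib_left[symmetric] euclidean_inner[symmetric] ..
    finally show ?thesis .
  qed
  define Z where "Z = (LINT x|lborel. gauss (x::'a))"
  define D where "D = Z * (LINT x|lborel. gauss x * (norm (G x))^2)"
  have Gsq: "integrable lborel (\<lambda>x. gauss x * (norm (G x))^2)"
  proof (rule gauss_integrable_bound)
    show "\<bar>(norm (G x))^2\<bar> \<le> M^2 * (1 + x \<bullet> x)" for x
    proof -
      have "(norm (G x))^2 \<le> M^2" by (intro power_mono bdG) simp
      then show ?thesis using le_mult_one_plus_square[of "M^2" x] by simp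
    qed
  qed simp
  have one: "integrable lborel (\<lambda>x::'a. gauss x * 1)" using gauss_integrable by simp
  have D1: "(LINT p|lborel. \<Gamma> p * (norm (G (fst p)))^2) = D" "integrable lborel (\<lambda>p. \<Gamma> p * (norm (G (fst p)))^2)"
    using integral_gauss_product[OF Gsq one] by (simp_all add: \<Gamma>_def D_def Z_def)
  \<comment> \<open>The rotation preserves the Gaussian measure of the product space, so
    \<open>G\<close> has the same second moment at \<open>w r p\<close> as at \<open>fst p\<close>;
    the correlation is bounded by the mean of the two.\<close>
  have corr: "\<bar>LINT p|lborel. \<Gamma> p * (G (fst p) \<bullet> G (w r p))\<bar> \<le> D" if r: "0 \<le> r" "r \<le> pi / 2" for r
  proof -
    have rot: "\<Gamma> (w r p, w' r p) = \<Gamma> p" for p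
    proof -
      have "w r p \<bullet> w r p + w' r p \<bullet> w' r p = fst p \<bullet> fst p + snd p \<bullet> snd p"
        unfolding w_def w'_def inner_rotation by simp
      then show ?thesis by (simp add: \<Gamma>_def gauss_def inner_prod_def)
    qed
    have cont2: "continuous_on UNIV (\<lambda>p. \<Gamma> p * (norm (G (w r p)))^2)" "continuous_on UNIV (\<lambda>p. \<Gamma> p * (norm (G (fst p)))^2)"
      unfolding \<Gamma>_def by (intro continuous_intros continuous_gauss ww continuous_on_compose2[OF contG]; auto)+
    have nn: "(\<integral>\<^sup>+p. ennreal (\<Gamma> p * (norm (G (w r p)))^2) \<partial>lborel) = (\<integral>\<^sup>+p. ennreal (\<Gamma> p * (norm (G (fst p)))^2) \<partial>lborel)"
    proof -
      have "(\<lambda>p. ennreal (\<Gamma> p * (norm (G (fst p)))^2)) \<in> borel_measurable borel"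
        using borel_measurable_continuous_onI[OF cont2(2)] by measurable
      from nn_integral_rotation[OF this r] show ?thesis
        unfolding w_def[symmetric] w'_def[symmetric] by (simp add: rot)
    qed
    have i2: "integrable lborel (\<lambda>p. \<Gamma> p * (norm (G (w r p)))^2)"
      unfolding \<Gamma>_def
    proof (rule gauss_integrable_bound)
      show "(\<lambda>p. (norm (G (w r p)))^2) \<in> borel_measurable borel"
        by (intro borel_measurable_continuous_onI continuous_intros ww continuous_on_compose2[OF contG]) auto
      show "\<bar>(norm (G (w r p)))^2\<bar> \<le> M^2 * (1 + p \<bullet> p)" for p
      proof -
        have "(norm (G (w r p)))^2 \<le> M^2" by (intro power_mono bdG) simp
        then show ?thesis using le_mult_one_plus_square[of "M^2" p] by simp
      qed
    qed
    have D2: "(LINT p|lborel. \<Gamma> p * (norm (G (w r p)))^2) = D"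
      unfolding D1(1)[symmetric] using nn i2 D1(2)
      by (subst (1 2) integral_eq_nn_integral) (auto simp: \<Gamma>_def gauss_nonneg)
    have i3: "integrable lborel (\<lambda>p. \<Gamma> p * (G (fst p) \<bullet> G (w r p)))"
      unfolding \<Gamma>_def by (rule gauss_integrable_bound[OF _ bdGG])
        (intro borel_measurable_continuous_onI continuous_intros ww continuous_on_compose2[OF contG]; auto)
    have "\<bar>LINT p|lborel. \<Gamma> p * (G (fst p) \<bullet> G (w r p))\<bar> \<le> (LINT p|lborel. \<bar>\<Gamma> p * (G (fst p) \<bullet> G (w r p))\<bar>)"
      by (rule integral_abs_bound)
    also have "\<dots> \<le> (LINT p|lborel. (\<Gamma> p * (norm (G (fst p)))^2 + \<Gamma> p * (norm (G (w r p)))^2) / 2)"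
    proof (intro integral_mono integrable_abs i3 integrable_divide Bochner_Integration.integrable_add D1(2) i2)
      fix p
      have "\<bar>G (fst p) \<bullet> G (w r p)\<bar> \<le> ((norm (G (fst p)))^2 + (norm (G (w r p)))^2) / 2"
        using Cauchy_Schwarz_ineq2[of "G (fst p)" "G (w r p)"] sum_squares_bound[of "norm (G (fst p))" "norm (G (w r p))"] by simp
      from mult_left_mono[OF this gauss_nonneg[of p]]
      show "\<bar>\<Gamma> p * (G (fst p) \<bullet> G (w r p))\<bar> \<le> (\<Gamma> p * (norm (G (fst p)))^2 + \<Gamma> p * (norm (G (w r p)))^2) / 2"
        by (simp add: \<Gamma>_def abs_mult gauss_nonneg distrib_left)
    qed
    also have "\<dots> = D" using D1 D2 i2 by simp
    finally show ?thesis .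
  qed
  let ?I = "\<lambda>r::real. indicator {0..pi/2} r :: real"
  have Fi: "integrable (lborel \<Otimes>\<^sub>M lborel) (\<lambda>(r, p). ?I r * K r p)"
  proof -
    define gg where "gg p = gauss p * ((A * M * 8) * (1 + p \<bullet> p))" for p :: "'a \<times> 'a"
    let ?dom = "\<lambda>(r, p). ?I r * gg p"
    have [measurable]: "gg \<in> borel_measurable borel" unfolding gg_def by measurable
    then have [measurable]: "gg \<in> borel_measurable (borel \<Otimes>\<^sub>M borel)" by (simp add: borel_prod)
    have gi: "integrable lborel gg"
      unfolding gg_def by (rule gauss_integrable_bound[where C="A * M * 8"]) (use A0 M0 in \<open>auto simp: abs_mult abs_of_nonneg\<close>)
    have "integrable (lborel \<Otimes>\<^sub>M lborel) ?dom"
    proof (rule lborel_pair.Fubini_integrable)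
      show "?dom \<in> borel_measurable (lborel \<Otimes>\<^sub>M lborel)" by measurable
      have "(LINT p|lborel. norm (?dom (r, p))) = ?I r * (LINT p|lborel. norm (gg p))" for r
        by (simp add: abs_mult)
      then show "integrable lborel (\<lambda>r. LINT p|lborel. norm (?dom (r, p)))"
        by (simp del: case_prod_conv)
      show "AE r in lborel. integrable lborel (\<lambda>p. ?dom (r, p))"
        unfolding case_prod_conv by (intro AE_I2 integrable_mult_right gi)
    qed
    then show ?thesis
    proof (rule Bochner_Integration.integrable_bound)
      have "(\<lambda>q. K (fst q) (snd q)) \<in> borel_measurable borel"
        unfolding K_def w_def w'_def \<Gamma>_def gauss_def
        by (intro borel_measurable_continuous_onI continuous_intros continuous_on_compose2[OF contG] continuous_on_compose2[OF contF]) auto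
      then have [measurable]: "(\<lambda>q. K (fst q) (snd q)) \<in> borel_measurable (lborel \<Otimes>\<^sub>M lborel)" by (simp add: lborel_prod)
      have "(\<lambda>q. ?I (fst q) * K (fst q) (snd q)) \<in> borel_measurable (lborel \<Otimes>\<^sub>M lborel)" by measurable
      then show "(\<lambda>(r, p). ?I r * K r p) \<in> borel_measurable (lborel \<Otimes>\<^sub>M lborel)" by (simp add: case_prod_unfold)
      have "norm (?I r * K r p) \<le> ?I r * gg p" for r p
      proof -
        have "norm (w' r p) \<le> 2 * (1 + norm p)" using nw'[of r p] by simp
        from mult_left_mono[OF bdK[OF this] gauss_nonneg[of p]]
        have "\<bar>K r p\<bar> \<le> gg p"
          unfolding K_def gg_def \<Gamma>_def by (simp add: abs_mult gauss_nonneg)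
        then show ?thesis by (simp add: abs_mult indicator_def)
      qed
      then show "AE q in lborel \<Otimes>\<^sub>M lborel. norm (case q of (r, p) \<Rightarrow> ?I r * K r p) \<le> norm (?dom q)"
        by (intro AE_I2) (auto intro: order_trans[OF _ abs_ge_self])
    qed
  qed
  have Fub: "(LINT p|lborel. LINT r|lborel. ?I r * K r p) = (LINT r|lborel. LINT p|lborel. ?I r * K r p)"
    by (rule lborel_pair.Fubini_integral[OF Fi])
  \<comment> \<open>The path \<open>w r p\<close> leads from \<open>fst p\<close> to
    \<open>snd p\<close>. Integrated over p, the difference of its end values is the squared mean
    minus the second moment, that is, the negative variance in unnormalised form.\<close>
  have inner: "(LINT r|lborel. ?I r * K r p) = \<Gamma> p * (F (fst p) * F (snd p)) - \<Gamma> p * ((F (fst p))^2 * 1)" for p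
  proof -
    have "(LINT r|lborel. indicator {0..pi/2} r *\<^sub>R K r p) = \<Gamma> p * (F (fst p) * F (w (pi/2) p)) - \<Gamma> p * (F (fst p) * F (w 0 p))"
    proof (rule integral_FTC_Icc)
      fix r :: real
      have "((\<lambda>r. w r p) has_derivative (\<lambda>h. h *\<^sub>R w' r p)) (at r)"
        unfolding w_def w'_def by (auto intro!: derivative_eq_intros simp: algebra_simps)
      from has_derivative_compose[OF this der]
      have "((\<lambda>r. F (w r p)) has_real_derivative G (w r p) \<bullet> w' r p) (at r)"
        unfolding has_field_derivative_def by (rule has_derivative_eq_rhs) (auto simp: fun_eq_iff)
      then have "((\<lambda>r. \<Gamma> p * (F (fst p) * F (w r p))) has_real_derivative K r p) (at r)"
        unfolding K_def by (intro DERIV_cmult)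
      then show "((\<lambda>r. \<Gamma> p * (F (fst p) * F (w r p))) has_vector_derivative K r p) (at r within {0..pi/2})"
        by (simp add: has_real_derivative_iff_has_vector_derivative has_vector_derivative_at_within)
    next
      show "continuous_on {0..pi/2} (\<lambda>r. K r p)"
        unfolding K_def w_def w'_def by (intro continuous_intros continuous_on_compose2[OF contG]) auto
    qed simp
    then show ?thesis by (simp add: w_def power2_eq_square)
  qed
  have iF: "integrable lborel (\<lambda>x. gauss x * F x)" "integrable lborel (\<lambda>x. gauss x * (F x)^2)"
  proof -
    show "integrable lborel (\<lambda>x. gauss x * F x)"
    proof (rule gauss_integrable_bound)
      show "\<bar>F x\<bar> \<le> (2 * A) * (1 + x \<bullet> x)" for x
      proof -
        have "1 + norm x \<le> 1 + (1 + x \<bullet> x)" using norm_le_one_plus_square(1) by (rule add_left_mono)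
        also have "\<dots> \<le> 2 * (1 + x \<bullet> x)" by simp
        finally have "A * (1 + norm x) \<le> A * (2 * (1 + x \<bullet> x))" using A0 by (rule mult_left_mono)
        then show ?thesis using lin[of x] by (simp add: algebra_simps)
      qed
    qed simp
    show "integrable lborel (\<lambda>x. gauss x * (F x)^2)"
    proof (rule gauss_integrable_bound)
      show "\<bar>(F x)^2\<bar> \<le> (4 * A^2) * (1 + x \<bullet> x)" for x
      proof -
        have "(F x)^2 \<le> (A * (1 + norm x))^2" using lin[of x] by (metis abs_ge_zero power2_abs power_mono)
        also have "\<dots> = A^2 * (1 + norm x)^2" by (simp add: power_mult_distrib)
        also have "\<dots> \<le> A^2 * (4 * (1 + x \<bullet> x))" by (intro mult_left_mono norm_le_one_plus_square(2)) auto
        finally show ?thesis by (simp add: algebra_simps)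
      qed
    qed simp
  qed
  have "(LINT x|lborel. gauss x * F x)^2 - Z * (LINT x|lborel. gauss x * (F x)^2) = (LINT p|lborel. LINT r|lborel. ?I r * K r p)"
    unfolding inner using integral_gauss_product[OF iF(1) iF(1)] integral_gauss_product[OF iF(2) one]
    by (simp add: \<Gamma>_def power2_eq_square[of "integral\<^sup>L _ _"] Z_def mult.commute)
  also have "\<dots> = (LINT r|lborel. ?I r * (- sin r * (LINT p|lborel. \<Gamma> p * (G (fst p) \<bullet> G (w r p)))))"
    unfolding Fub by (simp add: by_parts)
  finally have eq: "(LINT x|lborel. gauss x * F x)^2 - Z * (LINT x|lborel. gauss x * (F x)^2) =
      (LINT r|lborel. ?I r * (- sin r * (LINT p|lborel. \<Gamma> p * (G (fst p) \<bullet> G (w r p)))))" .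
  \<comment> \<open>The integral of sin over [0, pi/2] is 1, which yields the sharp Gaussian
    constant.\<close>
  have e1: "(LINT r|lborel. ?I r *\<^sub>R (- sin r * D)) = cos (pi/2) * D - cos 0 * D"
    by (rule integral_FTC_Icc) (auto intro!: derivative_eq_intros continuous_intros simp: has_real_derivative_iff_has_vector_derivative[symmetric])
  have e2: "(LINT r|lborel. ?I r *\<^sub>R (- sin r * D)) \<le> (LINT r|lborel. ?I r * (- sin r * (LINT p|lborel. \<Gamma> p * (G (fst p) \<bullet> G (w r p)))))"
  proof -
    have i1: "integrable lborel (\<lambda>r. ?I r *\<^sub>R (- sin r * D))"
      by (intro borel_integrable_compact continuous_intros) simp
    have le: "?I r *\<^sub>R (- sin r * D) \<le> ?I r * (- sin r * (LINT p|lborel. \<Gamma> p * (G (fst p) \<bullet> G (w r p))))" for r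
    proof (cases "r \<in> {0..pi/2}")
      case True
      then have s: "sin r \<ge> 0" by (intro sin_ge_zero) (auto intro: order_trans)
      have "(LINT p|lborel. \<Gamma> p * (G (fst p) \<bullet> G (w r p))) \<le> D" using corr[of r] True by auto
      from mult_left_mono[OF this s] True show ?thesis by simp
    qed simp
    show ?thesis
    proof (rule integral_mono[OF i1 _ le])
      have "integrable lborel (\<lambda>r. LINT p|lborel. ?I r * K r p)"
        using lborel_pair.integrable_fst'[OF Fi] by simp
      then show "integrable lborel (\<lambda>r. ?I r * (- sin r * (LINT p|lborel. \<Gamma> p * (G (fst p) \<bullet> G (w r p)))))"
        by (simp add: by_parts)
    qed
  qed
  have "cos (pi/2) * D - cos 0 * D = - D" by simp
  then have "Z * (LINT x|lborel. gauss x * (F x)^2) - (LINT x|lborel. gauss x * F x)\<^sup>2 \<le> D"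
    using eq e1 e2 by linarith
  then show ?thesis by (simp add: D_def Z_def)
qed

section \<open>Integrals of homogeneous functions\<close>

text \<open>Positive homogeneity, so that the value at the origin stays free in degree 0. The growth
  bound gives integrability on balls and against Gaussian weights.\<close>

definition homog :: "nat \<Rightarrow> ('a::euclidean_space \<Rightarrow> real) \<Rightarrow> bool" where
  "homog k \<psi> \<longleftrightarrow> \<psi> \<in> borel_measurable borel \<and> (\<exists>C. \<forall>x. \<bar>\<psi> x\<bar> \<le> C * norm x ^ k) \<and>
     (\<forall>c>0. \<forall>x. \<psi> (c *\<^sub>R x) = c ^ k * \<psi> x)"

text \<open>The integral over the unit sphere, written as a multiple of the integral over the unit ball.\<close>

definition sphere_int :: "nat \<Rightarrow> ('a::euclidean_space \<Rightarrow> real) \<Rightarrow> real" where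
  "sphere_int k \<psi> = (real DIM('a) + real k) * (LINT x|lborel. indicator (cball 0 1) x * \<psi> x)"

definition radial_int :: "nat \<Rightarrow> (real \<Rightarrow> real) \<Rightarrow> real" where
  "radial_int m w = (LINT r|lborel. (indicator {0<..} r * r ^ m) * w r)"

lemma homog_measurable: "homog k \<psi> \<Longrightarrow> \<psi> \<in> borel_measurable borel"
  by (simp add: homog_def)

lemma homog_ball_integrable:
  fixes \<psi> :: "'a::euclidean_space \<Rightarrow> real"
  assumes "homog k \<psi>" shows "integrable lborel (\<lambda>x. indicator (cball 0 1) x * \<psi> x)"
proof -
  obtain C where C: "\<And>x. \<bar>\<psi> x\<bar> \<le> C * norm x ^ k" using assms by (auto simp: homog_def)
  have [measurable]: "\<psi> \<in> borel_measurable borel" using assms by (simp add: homog_def)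
  have "integrable lborel (\<lambda>x::'a. indicator (cball 0 1) x *\<^sub>R (C * norm x ^ k))"
    by (intro borel_integrable_compact continuous_intros) simp
  then show ?thesis
    by (rule Bochner_Integration.integrable_bound)
      (auto simp: indicator_def intro!: AE_I2 order_trans[OF C])
qed

lemma nn_integral_scale:
  fixes f :: "'a::euclidean_space \<Rightarrow> ennreal"
  assumes [measurable]: "f \<in> borel_measurable borel" and a: "a > 0"
  shows "(\<integral>\<^sup>+x. f x \<partial>lborel) = ennreal (a ^ DIM('a)) * (\<integral>\<^sup>+x. f (a *\<^sub>R x) \<partial>lborel)"
proof -
  have "(\<integral>\<^sup>+x. f x \<partial>lborel) = (\<integral>\<^sup>+x. f x \<partial>density (distr lborel borel (\<lambda>x. 0 + a *\<^sub>R x)) (\<lambda>_. ennreal (\<bar>a\<bar> ^ DIM('a))))"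
    using lborel_affine[of a "0::'a"] a by simp
  also have "\<dots> = ennreal (a ^ DIM('a)) * (\<integral>\<^sup>+x. f (a *\<^sub>R x) \<partial>lborel)"
    using a by (simp add: nn_integral_density nn_integral_distr nn_integral_cmult)
  finally show ?thesis .
qed

text \<open>Polar coordinates by comparison of measures: the image under the norm of the measure
  with density \<open>\<psi>\<close> and the measure with density a multiple of r^(N-1), N being the
  dimension plus k, give the same mass to every half-line, by scaling. The factor N hidden in
  \<open>sphere_int\<close> is the derivative of a^N at a = 1.\<close>

lemma radial_integral_nonneg:
  fixes \<psi> :: "'a::euclidean_space \<Rightarrow> real"
  assumes h: "homog k \<psi>" and nn: "\<And>x. \<psi> x \<ge> 0" and [measurable]: "w \<in> borel_measurable borel"
  shows "(LINT x|lborel. \<psi> x * w (norm x)) = sphere_int k \<psi> * radial_int (DIM('a) + k - 1) w"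
proof -
  define N where "N = DIM('a) + k"
  have N: "N > 0" by (simp add: N_def)
  define T where "T = (LINT x|lborel. indicator (cball 0 1) x * \<psi> x)"
  have T0: "T \<ge> 0" unfolding T_def using nn by (intro Bochner_Integration.integral_nonneg) simp
  define S where "S = real N * T"
  have S: "sphere_int k \<psi> = S" by (simp add: sphere_int_def S_def N_def T_def)
  have S0: "S \<ge> 0" using T0 by (simp add: S_def)
  have [measurable]: "\<psi> \<in> borel_measurable borel" by (rule homog_measurable[OF h])
  define \<nu> where "\<nu> = distr (density lborel (\<lambda>x. ennreal (\<psi> x))) borel norm"
  define \<rho> where "\<rho> = density lborel (\<lambda>r. ennreal (S * (indicator {0<..} r * r ^ (N - 1))))"
  have Tnn: "(\<integral>\<^sup>+x. ennreal (indicator (cball 0 1) x * \<psi> x) \<partial>lborel) = ennreal T"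
    unfolding T_def using nn by (intro nn_integral_eq_integral homog_ball_integrable[OF h]) simp
  have nu: "emeasure \<nu> {..a} = (if a > 0 then ennreal (a ^ N * T) else 0)" for a
  proof -
    have e: "emeasure \<nu> {..a} = (\<integral>\<^sup>+x. ennreal (\<psi> x) * indicator {x. norm x \<le> a} x \<partial>lborel)"
      unfolding \<nu>_def by (subst emeasure_distr) (auto simp: emeasure_density vimage_def)
    show ?thesis
    proof (cases "a > 0")
      case True
      have "(\<integral>\<^sup>+x. ennreal (\<psi> x) * indicator {x. norm x \<le> a} x \<partial>lborel) =
          ennreal (a ^ DIM('a)) * (\<integral>\<^sup>+x. ennreal (\<psi> (a *\<^sub>R x)) * indicator {x. norm x \<le> a} (a *\<^sub>R x) \<partial>lborel)"
        by (rule nn_integral_scale[OF _ True]) measurable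
      also have "(\<integral>\<^sup>+x. ennreal (\<psi> (a *\<^sub>R x)) * indicator {x. norm x \<le> a} (a *\<^sub>R x) \<partial>lborel) =
          (\<integral>\<^sup>+x. ennreal (a ^ k) * ennreal (indicator (cball 0 1) x * \<psi> x) \<partial>lborel)"
      proof (rule nn_integral_cong)
        fix x :: 'a
        have "\<psi> (a *\<^sub>R x) = a ^ k * \<psi> x" using h True by (simp add: homog_def)
        moreover have "norm (a *\<^sub>R x) \<le> a \<longleftrightarrow> norm x \<le> 1" using True by simp
        ultimately show "ennreal (\<psi> (a *\<^sub>R x)) * indicator {x. norm x \<le> a} (a *\<^sub>R x) = ennreal (a ^ k) * ennreal (indicator (cball 0 1) x * \<psi> x)"
          using True nn[of x] by (simp add: indicator_def ennreal_mult)
      qed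
      also have "\<dots> = ennreal (a ^ k) * ennreal T" by (simp only: Tnn nn_integral_cmult[OF measurable_compose[OF borel_measurable_integrable[OF homog_ball_integrable[OF h]] measurable_ennreal]])
      finally show ?thesis using True T0 unfolding e by (simp add: N_def power_add ennreal_mult mult_ac)
    next
      case False
      have "(\<integral>\<^sup>+x. ennreal (\<psi> x) * indicator {x. norm x \<le> a} x \<partial>lborel) = (\<integral>\<^sup>+(x::'a). 0 \<partial>lborel)"
      proof (rule nn_integral_cong_AE)
        show "AE x in lborel. ennreal (\<psi> x) * indicator {x. norm x \<le> a} x = 0"
          using AE_lborel_singleton[of "0::'a"]
        proof eventually_elim
          case (elim x)
          then have "norm x > 0" by simp
          then have "\<not> norm x \<le> a" using False by linarith
          then show ?case by simp
        qed
      qed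
      then show ?thesis using False e by simp
    qed
  qed
  have rh: "emeasure \<rho> {..a} = (if a > 0 then ennreal (a ^ N * T) else 0)" for a
  proof -
    have e: "emeasure \<rho> {..a} = (\<integral>\<^sup>+r. ennreal (S * (indicator {0<..} r * r ^ (N - 1))) * indicator {..a} r \<partial>lborel)"
      unfolding \<rho>_def by (simp add: emeasure_density)
    show ?thesis
    proof (cases "a > 0")
      case True
      have "(\<integral>\<^sup>+r. ennreal (S * (indicator {0<..} r * r ^ (N - 1))) * indicator {..a} r \<partial>lborel)
          = (\<integral>\<^sup>+r. ennreal (S * r ^ (N - 1)) * indicator {0..a} r \<partial>lborel)"
      proof (rule nn_integral_cong_AE)
        show "AE r in lborel. ennreal (S * (indicator {0<..} r * r ^ (N - 1))) * indicator {..a} r = ennreal (S * r ^ (N - 1)) * indicator {0..a} r"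
          using AE_lborel_singleton[of "0::real"] by eventually_elim (auto simp: indicator_def)
      qed
      also have "\<dots> = ennreal (T * a ^ N - T * 0 ^ N)"
        using True S0 N by (intro nn_integral_FTC_Icc) (auto intro!: derivative_eq_intros simp: S_def)
      finally show ?thesis unfolding e zero_power[OF N] using True by (simp add: mult.commute)
    next
      case False
      have "(\<integral>\<^sup>+r. ennreal (S * (indicator {0<..} r * r ^ (N - 1))) * indicator {..a} r \<partial>lborel) = (\<integral>\<^sup>+(r::real). 0 \<partial>lborel)"
        using False by (intro nn_integral_cong) (auto simp: indicator_def)
      then show ?thesis using False e by simp
    qed
  qed
  have "\<nu> = \<rho>"
  proof (rule measure_eqI_generator_eq[where E="range atMost" and \<Omega>=UNIV and A="\<lambda>n. {..real n}"])
    show "Int_stable (range atMost :: real set set)" by (auto simp: Int_stable_def)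
    show "emeasure \<nu> X = emeasure \<rho> X" if "X \<in> range atMost" for X using that nu rh by auto
    show "sets \<nu> = sigma_sets UNIV (range atMost)" "sets \<rho> = sigma_sets UNIV (range atMost)"
      by (simp_all add: \<nu>_def \<rho>_def borel_eq_atMost)
    show "(\<Union>n. {..real n}) = UNIV" using real_arch_simple by auto
    show "emeasure \<nu> {..real n} \<noteq> \<infinity>" for n by (simp add: nu)
  qed auto
  have "(LINT x|lborel. \<psi> x * w (norm x)) = (LINT r|\<nu>. w r)"
    unfolding \<nu>_def using nn by (simp add: integral_distr integral_density)
  also have "\<dots> = (LINT r|lborel. (S * (indicator {0<..} r * r ^ (N - 1))) * w r)"
    unfolding \<open>\<nu> = \<rho>\<close> \<rho>_def using S0
    by (subst integral_density) (auto simp: indicator_def intro!: AE_I2)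
  also have "\<dots> = S * radial_int (N - 1) w" by (simp add: radial_int_def mult.assoc)
  finally show ?thesis by (simp add: S N_def)
qed

lemma homog_norm_power: "homog k (\<lambda>x. norm x ^ k)"
  by (auto simp: homog_def power_mult_distrib intro!: exI[of _ 1])

lemma homog_add: "homog k \<psi> \<Longrightarrow> homog k \<phi> \<Longrightarrow> homog k (\<lambda>x. \<psi> x + \<phi> x)"
proof -
  assume h: "homog k \<psi>" "homog k \<phi>"
  then obtain C D where "\<And>x. \<bar>\<psi> x\<bar> \<le> C * norm x ^ k" "\<And>x. \<bar>\<phi> x\<bar> \<le> D * norm x ^ k" by (auto simp: homog_def)
  then have "\<bar>\<psi> x + \<phi> x\<bar> \<le> (C + D) * norm x ^ k" for x
    using abs_triangle_ineq[of "\<psi> x" "\<phi> x"] by (simp add: distrib_right) (meson add_mono order_trans)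
  then show ?thesis using h by (auto simp: homog_def distrib_left)
qed

lemma homog_mult: "homog k \<psi> \<Longrightarrow> homog l \<phi> \<Longrightarrow> homog (k + l) (\<lambda>x. \<psi> x * \<phi> x)"
proof -
  assume h: "homog k \<psi>" "homog l \<phi>"
  then obtain C D where CD: "\<And>x. \<bar>\<psi> x\<bar> \<le> C * norm x ^ k" "\<And>x. \<bar>\<phi> x\<bar> \<le> D * norm x ^ l" by (auto simp: homog_def)
  have "\<bar>\<psi> x * \<phi> x\<bar> \<le> (C * D) * norm x ^ (k + l)" for x
  proof -
    have "\<bar>\<psi> x\<bar> * \<bar>\<phi> x\<bar> \<le> (C * norm x ^ k) * (D * norm x ^ l)"
      by (intro mult_mono CD) (auto intro: order_trans[OF abs_ge_zero CD(1)])
    then show ?thesis by (simp add: abs_mult power_add mult_ac)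
  qed
  then have "\<exists>C. \<forall>x. \<bar>\<psi> x * \<phi> x\<bar> \<le> C * norm x ^ (k + l)" by blast
  moreover have "(\<lambda>x. \<psi> x * \<phi> x) \<in> borel_measurable borel"
    using h unfolding homog_def by (intro borel_measurable_times) auto
  moreover have "\<forall>c>0. \<forall>x. \<psi> (c *\<^sub>R x) * \<phi> (c *\<^sub>R x) = c ^ (k + l) * (\<psi> x * \<phi> x)"
    using h unfolding homog_def by (simp add: power_add)
  ultimately show ?thesis unfolding homog_def by blast
qed

lemma homog_const: "homog 0 (\<lambda>_. c)" by (auto simp: homog_def)

lemma homog_cmult: "homog k \<psi> \<Longrightarrow> homog k (\<lambda>x. c * \<psi> x)"
  using homog_mult[OF homog_const[of c], of k \<psi>] by simp

lemma sphere_int_add: "homog k \<psi> \<Longrightarrow> homog k \<phi> \<Longrightarrow> sphere_int k (\<lambda>x. \<psi> x + \<phi> x) = sphere_int k \<psi> + sphere_int k \<phi>"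
  unfolding sphere_int_def distrib_left
  by (subst Bochner_Integration.integral_add) (auto intro: homog_ball_integrable simp: distrib_left)

lemma sphere_int_cmult: "sphere_int k (\<lambda>x. c * \<psi> x) = c * sphere_int k \<psi>"
  by (simp add: sphere_int_def mult.left_commute[of _ c])

text \<open>A sufficiently large multiple of the k-th power of the norm is added to make the
  function nonnegative, and subtracted again by linearity.\<close>

lemma radial_integral:
  fixes \<psi> :: "'a::euclidean_space \<Rightarrow> real"
  assumes h: "homog k \<psi>" and w: "w \<in> borel_measurable borel"
    and int: "integrable lborel (\<lambda>x::'a. norm x ^ k * w (norm x))"
  shows "integrable lborel (\<lambda>x. \<psi> x * w (norm x))"
    "(LINT x|lborel. \<psi> x * w (norm x)) = sphere_int k \<psi> * radial_int (DIM('a) + k - 1) w"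
proof -
  note w[measurable]
  have [measurable]: "\<psi> \<in> borel_measurable borel" by (rule homog_measurable[OF h])
  obtain C0 where C0: "\<And>x. \<bar>\<psi> x\<bar> \<le> C0 * norm x ^ k" using h by (auto simp: homog_def)
  define C where "C = \<bar>C0\<bar>"
  have C: "\<bar>\<psi> x\<bar> \<le> C * norm x ^ k" for x
    using order_trans[OF C0 mult_right_mono[OF abs_ge_self]] by (simp add: C_def)
  have "integrable lborel (\<lambda>x::'a. C * (norm x ^ k * w (norm x)))" using int by simp
  then show int1: "integrable lborel (\<lambda>x. \<psi> x * w (norm x))"
  proof (rule Bochner_Integration.integrable_bound)
    have "\<bar>\<psi> x\<bar> * \<bar>w (norm x)\<bar> \<le> (C * norm x ^ k) * \<bar>w (norm x)\<bar>" for x :: 'a by (intro mult_right_mono C) simp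
    then show "AE x in lborel. norm (\<psi> x * w (norm x)) \<le> norm (C * (norm x ^ k * w (norm x)))"
      by (simp add: abs_mult C_def mult.assoc)
  qed measurable
  have h2: "homog k (\<lambda>x::'a. C * norm x ^ k)" by (intro homog_cmult homog_norm_power)
  have h1: "homog k (\<lambda>x. \<psi> x + C * norm x ^ k)" by (intro homog_add h h2)
  have "(LINT x|lborel. (\<psi> x + C * norm x ^ k) * w (norm x)) = sphere_int k (\<lambda>x. \<psi> x + C * norm x ^ k) * radial_int (DIM('a) + k - 1) w"
  proof (rule radial_integral_nonneg[OF h1 _ w])
    show "0 \<le> \<psi> x + C * norm x ^ k" for x using C[of x] by linarith
  qed
  moreover have "(LINT x|lborel. (C * norm (x::'a) ^ k) * w (norm x)) = sphere_int k (\<lambda>x::'a. C * norm x ^ k) * radial_int (DIM('a) + k - 1) w"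
    by (rule radial_integral_nonneg[OF h2 _ w]) (simp add: C_def)
  moreover have "(LINT x|lborel. (\<psi> x + C * norm x ^ k) * w (norm x)) = (LINT x|lborel. \<psi> x * w (norm x)) + (LINT x|lborel. (C * norm (x::'a) ^ k) * w (norm x))"
    using int1 int by (simp add: distrib_right mult.assoc)
  ultimately show "(LINT x|lborel. \<psi> x * w (norm x)) = sphere_int k \<psi> * radial_int (DIM('a) + k - 1) w"
    unfolding sphere_int_add[OF h h2] by (simp add: distrib_right)
qed

lemma gauss_norm: "gauss x = exp (- (norm x)\<^sup>2 / 2)"
  by (simp add: gauss_def power2_norm_eq_inner)

lemma gauss_radial_integral:
  fixes \<psi> :: "'a::euclidean_space \<Rightarrow> real"
  assumes h: "homog k \<psi>" and k: "k \<le> 2"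
  shows "integrable lborel (\<lambda>x. gauss x * \<psi> x)"
    "(LINT x|lborel. gauss x * \<psi> x) = sphere_int k \<psi> * radial_int (DIM('a) + k - 1) (\<lambda>r. exp (- r\<^sup>2 / 2))"
proof -
  have "norm x ^ k \<le> 1 + x \<bullet> x" for x :: 'a
  proof -
    consider "k = 0" | "k = 1" | "k = 2" using k by linarith
    then show ?thesis by cases (simp_all add: norm_le_one_plus_square power2_norm_eq_inner)
  qed
  then have "integrable lborel (\<lambda>x::'a. gauss x * norm x ^ k)"
    by (intro gauss_integrable_bound[where C=1]) auto
  then have int: "integrable lborel (\<lambda>x::'a. norm x ^ k * exp (- (norm x)\<^sup>2 / 2))" by (simp add: gauss_norm mult.commute)
  from radial_integral[OF h _ int]
  show "integrable lborel (\<lambda>x. gauss x * \<psi> x)"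
    "(LINT x|lborel. gauss x * \<psi> x) = sphere_int k \<psi> * radial_int (DIM('a) + k - 1) (\<lambda>r. exp (- r\<^sup>2 / 2))"
    by (simp_all add: gauss_norm mult.commute)
qed

lemma gauss_integral_pos: "(LINT x|lborel. gauss (x::'a::euclidean_space)) > 0"
proof -
  have "(LINT x|lborel. gauss (x::'a)) \<ge> 0" by (intro Bochner_Integration.integral_nonneg) (simp add: gauss_nonneg)
  moreover have "(LINT x|lborel. gauss (x::'a)) \<noteq> 0"
  proof
    assume "(LINT x|lborel. gauss (x::'a)) = 0"
    then have "AE x in lborel. gauss (x::'a) = 0"
      using integral_nonneg_eq_0_iff_AE[OF gauss_integrable[where 'a='a]] by (simp add: gauss_nonneg)
    then have "AE (x::'a) in lborel. False" by (simp add: gauss_def)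
    then show False by (simp add: AE_iff_null emeasure_lborel_UNIV null_sets_def)
  qed
  ultimately show ?thesis by simp
qed

lemma gauss_second_moment: "(LINT x|lborel. gauss (x::'a) * (norm x)^2) = real DIM('a) * (LINT x|lborel. gauss (x::'a::euclidean_space))"
proof -
  have ib: "integrable lborel (\<lambda>x::'a. gauss x * (x \<bullet> b)^2)" "integrable lborel (\<lambda>x::'a. gauss x * (x \<bullet> b))" if "b \<in> Basis" for b
  proof -
    have *: "\<bar>x \<bullet> b\<bar> \<le> norm x" for x :: 'a using Basis_le_norm[OF that, of x] .
    show "integrable lborel (\<lambda>x::'a. gauss x * (x \<bullet> b)^2)"
    proof (rule gauss_integrable_bound[where C=1])
      have "(x \<bullet> b)^2 \<le> (norm x)^2" for x :: 'a using *[of x] by (simp add: abs_le_square_iff[symmetric])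
      then show "\<bar>(x \<bullet> b)^2\<bar> \<le> 1 * (1 + x \<bullet> x)" for x :: 'a by (simp add: power2_norm_eq_inner add_increasing)
    qed simp
    show "integrable lborel (\<lambda>x::'a. gauss x * (x \<bullet> b))"
      by (rule gauss_integrable_bound[where C=1]) (use * norm_le_one_plus_square(1) in \<open>auto intro: order_trans\<close>)
  qed
  have b: "(LINT x|lborel. gauss (x::'a) * (x \<bullet> b)^2) = (LINT x|lborel. gauss (x::'a))" if b: "b \<in> Basis" for b
  proof -
    have "(LINT x|lborel. gauss x - gauss x * (x \<bullet> b)^2) = 0"
    proof (rule integral_directional_derivative_eq_0[where g="\<lambda>x. gauss x * (x \<bullet> b)" and v=b])
      fix x :: 'a
      have bb: "b \<bullet> b = 1" using b by simp
      have "((\<lambda>t. gauss (x + t *\<^sub>R b) * ((x + t *\<^sub>R b) \<bullet> b)) has_real_derivative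
          (- (x \<bullet> b) * gauss x) * ((x + 0 *\<^sub>R b) \<bullet> b) + (b \<bullet> b) * gauss (x + 0 *\<^sub>R b)) (at 0)"
        by (rule DERIV_mult[OF gauss_line_derivative]) (auto intro!: derivative_eq_intros simp: inner_add_left)
      then show "((\<lambda>t. gauss (x + t *\<^sub>R b) * ((x + t *\<^sub>R b) \<bullet> b)) has_vector_derivative gauss x - gauss x * (x \<bullet> b)^2) (at 0)"
        by (simp add: has_real_derivative_iff_has_vector_derivative[symmetric] bb power2_eq_square algebra_simps)
    qed (use ib[OF b] gauss_integrable in \<open>auto intro!: continuous_intros continuous_gauss\<close>)
    then show ?thesis
      unfolding Bochner_Integration.integral_diff[OF gauss_integrable ib(1)[OF b]] by simp
  qed
  have "(LINT x|lborel. gauss (x::'a) * (norm x)^2) = (LINT x|lborel. (\<Sum>b\<in>Basis. gauss x * (x \<bullet> (b::'a))^2))"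
    by (simp only: power2_norm_eq_inner euclidean_inner[of x x for x] sum_distrib_left[symmetric] power2_eq_square[symmetric])
  also have "\<dots> = (\<Sum>b\<in>(Basis :: 'a set). LINT x|lborel. gauss x * (x \<bullet> b)^2)"
    using ib by (intro Bochner_Integration.integral_sum) auto
  also have "\<dots> = real DIM('a) * (LINT x|lborel. gauss (x::'a))" using b by simp
  finally show ?thesis .
qed

text \<open>On the sphere the norm is 1; as \<open>sphere_int\<close> is an integral over the ball,
  this is obtained by splitting one Gaussian integral in two ways, the power of the norm counted
  once with the angular and once with the radial part. The bound on the degrees is the range in
  which Gaussian integrability is at hand.\<close>

lemma sphere_int_norm_power:
  fixes \<psi> :: "'a::euclidean_space \<Rightarrow> real"
  assumes h: "homog j \<psi>" and k: "j + k \<le> 2"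
  shows "sphere_int (k + j) (\<lambda>x. norm x ^ k * \<psi> x) = sphere_int j \<psi>"
proof -
  let ?w = "\<lambda>r::real. exp (- r\<^sup>2 / 2)"
  have hk: "homog (k + j) (\<lambda>x. norm x ^ k * \<psi> x)" by (rule homog_mult[OF homog_norm_power h])
  have pos: "radial_int (DIM('a) + (k + j) - 1) ?w \<noteq> 0"
  proof
    assume 0: "radial_int (DIM('a) + (k + j) - 1) ?w = 0"
    have "(LINT x|lborel. gauss (x::'a) * norm x ^ (k + j)) = 0"
      using gauss_radial_integral(2)[OF homog_norm_power[of "k + j"], where 'a = 'a] k 0 by simp
    then have "AE x in lborel. gauss (x::'a) * norm x ^ (k + j) = 0"
      using integral_nonneg_eq_0_iff_AE[OF gauss_radial_integral(1)[OF homog_norm_power[of "k + j"], where 'a = 'a]] k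
      by (simp add: gauss_nonneg)
    then have "AE (x::'a) in lborel. False"
      using AE_lborel_singleton[of "0::'a"] by eventually_elim (simp add: gauss_def)
    then show False by (simp add: AE_iff_null emeasure_lborel_UNIV null_sets_def)
  qed
  have [measurable]: "\<psi> \<in> borel_measurable borel" by (rule homog_measurable[OF h])
  have "norm x ^ (k + j) \<le> 1 + x \<bullet> x" for x :: 'a
  proof -
    consider "k + j = 0" | "k + j = 1" | "k + j = 2" using k by linarith
    then show ?thesis by cases (simp_all add: norm_le_one_plus_square power2_norm_eq_inner)
  qed
  then have "integrable lborel (\<lambda>x::'a. gauss x * norm x ^ (k + j))"
    by (intro gauss_integrable_bound[where C=1]) auto
  then have int: "integrable lborel (\<lambda>x::'a. norm x ^ j * (norm x ^ k * ?w (norm x)))" by (simp add: gauss_norm power_add mult_ac)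
  have "sphere_int (k + j) (\<lambda>x. norm x ^ k * \<psi> x) * radial_int (DIM('a) + (k + j) - 1) ?w = (LINT x|lborel. gauss x * (norm x ^ k * \<psi> x))"
    using gauss_radial_integral(2)[OF hk] k by simp
  also have "\<dots> = (LINT x|lborel. \<psi> x * (norm x ^ k * ?w (norm x)))" by (simp add: gauss_norm mult_ac)
  also have "\<dots> = sphere_int j \<psi> * radial_int (DIM('a) + j - 1) (\<lambda>r. r ^ k * ?w r)"
    by (rule radial_integral(2)[OF h _ int]) measurable
  also have "radial_int (DIM('a) + j - 1) (\<lambda>r. r ^ k * ?w r) = radial_int (DIM('a) + (k + j) - 1) ?w"
  proof -
    have "DIM('a) + (k + j) - 1 = (DIM('a) + j - 1) + k" using DIM_positive[where 'a='a] by linarith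
    then show ?thesis unfolding radial_int_def by (simp add: power_add mult_ac)
  qed
  finally show ?thesis using pos by simp
qed

text \<open>The quadratic Minkowski inequality for a body and the ball, as Poincare's inequality on the sphere:
  the Gaussian Poincare inequality is applied to \<open>h - c |x|\<close> with mean zero.\<close>

theorem sphere_poincare:
  fixes h :: "'a::euclidean_space \<Rightarrow> real" and G :: "'a \<Rightarrow> 'a"
  assumes u: "\<And>j x. (u j has_derivative (\<lambda>v. g j x \<bullet> v)) (at x)"
    and g: "\<And>j. continuous_on UNIV (g j)" "\<And>j x. norm (g j x) \<le> M"
    and lim: "\<And>x. (\<lambda>j. u j x) \<longlonglongrightarrow> h x" "\<And>x. (\<lambda>j. g j x) \<longlonglongrightarrow> G x"
    and bd: "\<And>j x. \<bar>u j x\<bar> \<le> M * (1 + norm x)"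
    and h: "homog 1 h" and G: "homog 0 (\<lambda>x. (norm (G x))^2)" and euler: "\<And>x. G x \<bullet> x = h x"
  shows "real DIM('a) * sphere_int 2 (\<lambda>x. (h x)^2) - sphere_int 0 (\<lambda>x. (norm (G x))^2)
    \<le> (real DIM('a) - 1) * (sphere_int 1 h)^2 / sphere_int 0 (\<lambda>_::'a. 1)"
proof -
  define \<omega> where "\<omega> = sphere_int 0 (\<lambda>_::'a. 1)"
  define \<sigma> where "\<sigma> = sphere_int 1 h"
  define c where "c = \<sigma> / \<omega>"
  define Z where "Z = (LINT x|lborel. gauss (x::'a))"
  define m where "m k = radial_int (DIM('a) + k - 1) (\<lambda>r. exp (- r\<^sup>2 / 2))" for k
  have Z: "Z = \<omega> * m 0" "Z > 0"
    using gauss_radial_integral(2)[OF homog_const[of 1], where 'a = 'a] gauss_integral_pos[where 'a = 'a]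
    by (simp_all add: Z_def \<omega>_def m_def)
  have \<omega>: "\<omega> \<ge> 0" unfolding \<omega>_def sphere_int_def by (intro mult_nonneg_nonneg Bochner_Integration.integral_nonneg) auto
  have \<omega>0: "\<omega> > 0" "m 0 > 0"
  proof -
    have "\<omega> * m 0 > 0" using Z by simp
    then show "\<omega> > 0" "m 0 > 0" using \<omega> zero_less_mult_iff[of \<omega> "m 0"] by linarith+
  qed
  have M0: "M \<ge> 0" using g(2)[of 0 0] norm_ge_zero order_trans by blast
  \<comment> \<open>This ratio of radial moments is what turns the Gaussian constant 1 into the
    factor \<open>DIM('a)\<close> of the conclusion.\<close>
  have m2: "m 2 = real DIM('a) * m 0"
  proof -
    have "sphere_int 2 (\<lambda>x::'a. norm x ^ 2) * m 2 = real DIM('a) * (\<omega> * m 0)"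
      using gauss_radial_integral(2)[OF homog_norm_power[of 2], where 'a = 'a] gauss_second_moment[where 'a = 'a] Z(1)
      by (simp add: m_def Z_def)
    moreover have "sphere_int 2 (\<lambda>x::'a. norm x ^ 2) = \<omega>"
      using sphere_int_norm_power[OF homog_const[of 1], of 2, where 'a = 'a] by (simp add: \<omega>_def)
    ultimately show ?thesis using \<omega>0 by simp
  qed
  \<comment> \<open>The norm is smoothed too, since the Gaussian inequality asks for a
    differentiable function at the origin.\<close>
  define \<phi> where "\<phi> j x = sqrt (x \<bullet> x + (inverse (real (Suc j)))^2)" for j and x :: 'a
  have ppos: "x \<bullet> x + (inverse (real (Suc j)))^2 > 0" for j and x :: 'a by (intro add_nonneg_pos) auto
  have \<phi>pos: "\<phi> j x > 0" for j x using ppos by (simp add: \<phi>_def)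
  define F where "F j x = u j x - c * \<phi> j x" for j x
  define DF where "DF j x = g j x - (c / \<phi> j x) *\<^sub>R x" for j x
  define H where "H x = h x - c * norm x" for x
  define DH where "DH x = G x - (c / norm x) *\<^sub>R x" for x
  have \<phi>le: "\<phi> j x \<le> 1 + norm x" "norm x \<le> \<phi> j x" for j x
  proof -
    have "(inverse (real (Suc j)))^2 \<le> 1" by (simp add: power_le_one inverse_le_1_iff)
    then have "x \<bullet> x + (inverse (real (Suc j)))^2 \<le> (1 + norm x)^2"
      using norm_ge_zero[of x] unfolding power2_sum power2_norm_eq_inner one_power2 mult_1_right by linarith
    then show "\<phi> j x \<le> 1 + norm x" unfolding \<phi>_def by (intro real_le_lsqrt) auto
    show "norm x \<le> \<phi> j x" unfolding \<phi>_def norm_eq_sqrt_inner by simp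
  qed
  have dF: "(F j has_derivative (\<lambda>v. DF j x \<bullet> v)) (at x)" for j x
  proof -
    have "((\<lambda>x. x \<bullet> x + (inverse (real (Suc j)))^2) has_derivative (\<lambda>v. 2 * (x \<bullet> v))) (at x)"
      by (auto intro!: derivative_eq_intros simp: inner_commute)
    from has_derivative_compose[OF this DERIV_real_sqrt[OF ppos, unfolded has_field_derivative_def]]
    have "(\<phi> j has_derivative (\<lambda>v. inverse (\<phi> j x) / 2 * (2 * (x \<bullet> v)))) (at x)" unfolding \<phi>_def .
    then have "(F j has_derivative (\<lambda>v. g j x \<bullet> v - c * (inverse (\<phi> j x) / 2 * (2 * (x \<bullet> v))))) (at x)"
      unfolding F_def[abs_def] by (intro derivative_intros u)
    moreover have "(\<lambda>v. g j x \<bullet> v - c * (inverse (\<phi> j x) / 2 * (2 * (x \<bullet> v)))) = (\<lambda>v. DF j x \<bullet> v)"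
      unfolding DF_def inner_diff_left inner_scaleR_left divide_inverse by (simp add: mult.assoc)
    ultimately show ?thesis by simp
  qed
  have \<phi>cont: "continuous_on UNIV (\<phi> j)" for j unfolding \<phi>_def[abs_def] by (intro continuous_intros)
  have contDF: "continuous_on UNIV (DF j)" for j
    unfolding DF_def[abs_def] using \<phi>pos by (intro continuous_intros g \<phi>cont) (simp add: less_imp_neq[symmetric])
  have bdDF: "norm (DF j x) \<le> M + \<bar>c\<bar>" for j x
  proof -
    have "norm ((c / \<phi> j x) *\<^sub>R x) \<le> \<bar>c\<bar>"
      using \<phi>pos[of j x] \<phi>le(2)[of x j] mult_left_mono[OF \<phi>le(2)[of x j], of "\<bar>c\<bar>"] by (simp add: abs_mult divide_le_eq)
    then show ?thesis unfolding DF_def using norm_triangle_ineq4[of "g j x" "(c / \<phi> j x) *\<^sub>R x"] g(2)[of j x] by linarith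
  qed
  have ineq: "Z * (LINT x|lborel. gauss x * (F j x)^2) - (LINT x|lborel. gauss x * F j x)\<^sup>2
      \<le> Z * (LINT x|lborel. gauss x * (norm (DF j x))^2)" for j
    unfolding Z_def by (rule gauss_poincare[OF dF contDF bdDF])
  have Fm: "F j \<in> borel_measurable borel" for j
    using has_derivative_continuous[OF dF] by (intro borel_measurable_continuous_onI continuous_at_imp_continuous_on) auto
  have DFm: "DF j \<in> borel_measurable borel" for j by (rule borel_measurable_continuous_onI[OF contDF])
  define B where "B = M + \<bar>c\<bar>"
  have B0: "B \<ge> 0" using M0 by (simp add: B_def)
  have bdF: "\<bar>F j x\<bar> \<le> B * (1 + norm x)" for j x
  proof -
    have "\<bar>c * \<phi> j x\<bar> \<le> \<bar>c\<bar> * (1 + norm x)" using \<phi>le(1)[of j x] \<phi>pos[of j x] by (simp add: abs_mult mult_left_mono)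
    then show ?thesis unfolding F_def B_def using bd[of j x] abs_triangle_ineq4[of "u j x" "c * \<phi> j x"] by (simp add: distrib_right)
  qed
  have limphi: "(\<lambda>j. \<phi> j x) \<longlonglongrightarrow> norm x" for x
  proof -
    have "(\<lambda>j. sqrt (x \<bullet> x + (inverse (real (Suc j)))^2)) \<longlonglongrightarrow> sqrt (x \<bullet> x + 0^2)"
      by (intro tendsto_intros LIMSEQ_inverse_real_of_nat)
    then show ?thesis by (simp add: \<phi>_def norm_eq_sqrt_inner)
  qed
  have limF: "(\<lambda>j. F j x) \<longlonglongrightarrow> H x" for x
    unfolding F_def H_def by (intro tendsto_intros lim limphi)
  have limDF: "(\<lambda>j. DF j x) \<longlonglongrightarrow> DH x" for x
  proof (cases "x = 0")
    case True then show ?thesis using lim(2)[of 0] by (simp add: DF_def DH_def)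
  next
    case False then show ?thesis unfolding DF_def DH_def by (intro tendsto_intros lim limphi) auto
  qed
  have Hm: "H \<in> borel_measurable borel" by (rule borel_measurable_LIMSEQ_metric[OF Fm limF])
  have DHm: "DH \<in> borel_measurable borel" by (rule borel_measurable_LIMSEQ_metric[OF DFm limDF])
  have dom: "(\<lambda>j. LINT x|lborel. gauss x * f j x) \<longlonglongrightarrow> (LINT x|lborel. gauss x * k x)"
    if f: "\<And>j. f j \<in> borel_measurable borel" "k \<in> borel_measurable borel" "\<And>x. (\<lambda>j. f j x) \<longlonglongrightarrow> k x" "\<And>j x. \<bar>f j x\<bar> \<le> C * (1 + x \<bullet> x)"
    for f :: "nat \<Rightarrow> 'a \<Rightarrow> real" and k C
  proof (rule integral_dominated_convergence[where w="\<lambda>x. gauss x * (C * (1 + x \<bullet> x))"])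
    have "C \<ge> 0" using f(4)[of 0 0] by (simp add: order_trans[OF abs_ge_zero])
    then show "integrable lborel (\<lambda>x::'a. gauss x * (C * (1 + x \<bullet> x)))"
      by (intro gauss_integrable_bound[where C=C]) (auto simp: abs_mult)
    show "AE x in lborel. norm (gauss x * f j x) \<le> gauss x * (C * (1 + x \<bullet> x))" for j
      using f(4)[of j] by (simp add: abs_mult gauss_nonneg mult_left_mono)
  qed (use f in \<open>auto intro!: tendsto_intros AE_I2\<close>)
  have L1: "(\<lambda>j. LINT x|lborel. gauss x * (F j x)^2) \<longlonglongrightarrow> (LINT x|lborel. gauss x * (H x)^2)"
  proof (rule dom[where C="4 * B^2"])
    show "\<bar>(F j x)^2\<bar> \<le> 4 * B^2 * (1 + x \<bullet> x)" for j x
    proof -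
      have "(F j x)^2 \<le> (B * (1 + norm x))^2" using bdF[of j x] by (metis abs_ge_zero power2_abs power_mono)
      also have "\<dots> = B^2 * (1 + norm x)^2" by (simp add: power_mult_distrib)
      also have "\<dots> \<le> B^2 * (4 * (1 + x \<bullet> x))" by (intro mult_left_mono norm_le_one_plus_square(2)) auto
      finally show ?thesis by (simp add: algebra_simps)
    qed
  qed (use Fm Hm in \<open>auto intro!: tendsto_intros limF\<close>)
  have L2: "(\<lambda>j. LINT x|lborel. gauss x * F j x) \<longlonglongrightarrow> (LINT x|lborel. gauss x * H x)"
  proof (rule dom[where C="2 * B"])
    show "\<bar>F j x\<bar> \<le> 2 * B * (1 + x \<bullet> x)" for j x
    proof -
      have "1 + norm x \<le> 1 + (1 + x \<bullet> x)" using norm_le_one_plus_square(1) by (rule add_left_mono)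
      also have "\<dots> \<le> 2 * (1 + x \<bullet> x)" by simp
      finally have "B * (1 + norm x) \<le> B * (2 * (1 + x \<bullet> x))" using B0 by (rule mult_left_mono)
      then show ?thesis using bdF[of j x] by (simp add: algebra_simps)
    qed
  qed (use Fm Hm in \<open>auto intro!: limF\<close>)
  have L3: "(\<lambda>j. LINT x|lborel. gauss x * (norm (DF j x))^2) \<longlonglongrightarrow> (LINT x|lborel. gauss x * (norm (DH x))^2)"
  proof (rule dom[where C="B^2"])
    show "\<bar>(norm (DF j x))^2\<bar> \<le> B^2 * (1 + x \<bullet> x)" for j x
    proof -
      have "(norm (DF j x))^2 \<le> B^2" using bdDF[of j x] by (intro power_mono) (auto simp: B_def)
      then show ?thesis using le_mult_one_plus_square[of "B^2" x] by simp
    qed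
  qed (use DFm DHm in \<open>auto intro!: tendsto_intros limDF\<close>)
  have final: "Z * (LINT x|lborel. gauss x * (H x)^2) - (LINT x|lborel. gauss x * H x)\<^sup>2 \<le> Z * (LINT x|lborel. gauss x * (norm (DH x))^2)"
    by (rule LIMSEQ_le[OF tendsto_diff[OF tendsto_mult_left[OF L1] tendsto_power[OF L2]] tendsto_mult_left[OF L3]]) (use ineq in blast)
  have hn: "homog 1 (\<lambda>x::'a. norm x)" using homog_norm_power[of 1, where 'a = 'a] by simp
  have hH: "homog 1 H" unfolding H_def[abs_def] using homog_add[OF h homog_cmult[OF hn, of "- c"]] by simp
  have s1: "sphere_int 1 (\<lambda>x::'a. norm x) = \<omega>"
    using sphere_int_norm_power[OF homog_const[of 1], of 1, where 'a = 'a] by (simp add: \<omega>_def)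
  have "sphere_int 1 H = \<sigma> - c * \<omega>"
    using sphere_int_add[OF h homog_cmult[OF hn, of "- c"]] sphere_int_cmult[of 1 "- c" "\<lambda>x::'a. norm x"] s1
    by (simp add: H_def[abs_def] \<sigma>_def)
  then have "sphere_int 1 H = 0" using \<omega>0 by (simp add: c_def)
  then have E1: "(LINT x|lborel. gauss x * H x) = 0" using gauss_radial_integral(2)[OF hH] by simp
  have h2: "homog 2 (\<lambda>x. (h x)^2)" using homog_mult[OF h h] by (simp add: power2_eq_square numeral_2_eq_2)
  have hnh: "homog 2 (\<lambda>x. norm x * h x)" using homog_mult[OF hn h] by (simp add: numeral_2_eq_2)
  have n2: "homog 2 (\<lambda>x::'a. (norm x)^2)" by (rule homog_norm_power)
  have H2: "(H x)^2 = (h x)^2 + ((- 2 * c) * (norm x * h x) + c^2 * (norm x)^2)" for x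
    by (simp add: H_def power2_eq_square algebra_simps)
  have S2: "sphere_int 2 (\<lambda>x. (H x)^2) = sphere_int 2 (\<lambda>x. (h x)^2) - 2 * c * \<sigma> + c^2 * \<omega>"
  proof -
    have a: "sphere_int 2 (\<lambda>x. norm x * h x) = \<sigma>"
      using sphere_int_norm_power[OF h, of 1] by (simp add: \<sigma>_def numeral_2_eq_2)
    have b: "sphere_int 2 (\<lambda>x::'a. (norm x)^2) = \<omega>"
      using sphere_int_norm_power[OF homog_const[of 1], of 2, where 'a = 'a] by (simp add: \<omega>_def)
    show ?thesis unfolding H2
      unfolding sphere_int_add[OF h2 homog_add[OF homog_cmult[OF hnh] homog_cmult[OF n2]]]
        sphere_int_add[OF homog_cmult[OF hnh] homog_cmult[OF n2]] sphere_int_cmult a b by simp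
  qed
  have hH2: "homog 2 (\<lambda>x. (H x)^2)" unfolding H2 by (intro homog_add homog_cmult h2 hnh n2)
  \<comment> \<open>By Euler's relation this is the radial component of \<open>G\<close>. It appears
    in the cross term of |\<open>DH\<close>|^2 and has the same sphere integral as h.\<close>
  define q where "q x = h x / norm x" for x
  have hq: "homog 0 q"
  proof -
    obtain C where C: "\<And>x. \<bar>h x\<bar> \<le> C * norm x ^ 1" using h by (auto simp: homog_def)
    have [measurable]: "h \<in> borel_measurable borel" by (rule homog_measurable[OF h])
    have "\<bar>q x\<bar> \<le> \<bar>C\<bar>" for x
    proof (cases "x = 0")
      case False
      have "\<bar>h x\<bar> \<le> \<bar>C\<bar> * norm x" using order_trans[OF C[of x] mult_right_mono[OF abs_ge_self[of C]]] by simp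
      then show ?thesis using False by (simp add: q_def divide_le_eq)
    qed (simp add: q_def)
    moreover have "q (a *\<^sub>R x) = q x" if "a > 0" for a x
    proof -
      have "h (a *\<^sub>R x) = a * h x" using h that by (simp add: homog_def)
      then show ?thesis using that by (simp add: q_def)
    qed
    moreover have "q \<in> borel_measurable borel" unfolding q_def[abs_def] by measurable
    ultimately show ?thesis unfolding homog_def by auto
  qed
  have h0: "h 0 = 0" using euler[of 0] by simp
  have sq: "sphere_int 0 q = \<sigma>"
  proof -
    have "(\<lambda>x. norm x ^ 1 * q x) = h" using h0 by (auto simp: fun_eq_iff q_def)
    then show ?thesis using sphere_int_norm_power[OF hq, of 1] by (simp add: \<sigma>_def)
  qed
  have DH2: "AE x in lborel. gauss x * (norm (DH x))^2 = gauss x * ((norm (G x))^2 + ((- 2 * c) * q x + c^2))"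
    using AE_lborel_singleton[of "0::'a"]
  proof eventually_elim
    case (elim x)
    have "(norm (DH x))^2 = (norm (G x))^2 - 2 * (c / norm x) * (G x \<bullet> x) + (c / norm x)^2 * (norm x)^2"
      unfolding DH_def power2_norm_eq_inner
      by (simp add: inner_diff_left inner_diff_right inner_commute power2_eq_square algebra_simps)
    also have "(c / norm x)^2 * (norm x)^2 = c^2" using elim by (simp add: power_divide)
    finally show ?case by (simp add: euler q_def)
  qed
  have hDH: "homog 0 (\<lambda>x. (norm (G x))^2 + ((- 2 * c) * q x + c^2))"
    by (intro homog_add homog_cmult hq G homog_const)
  have "(LINT x|lborel. gauss x * (norm (DH x))^2) = (LINT x|lborel. gauss x * ((norm (G x))^2 + ((- 2 * c) * q x + c^2)))"
  proof (rule integral_cong_AE)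
    show "(\<lambda>x. gauss x * (norm (DH x))^2) \<in> borel_measurable lborel" using DHm by measurable
    show "(\<lambda>x. gauss x * ((norm (G x))^2 + ((- 2 * c) * q x + c^2))) \<in> borel_measurable lborel"
      using homog_measurable[OF hDH] by measurable
  qed (rule DH2)
  also have "\<dots> = sphere_int 0 (\<lambda>x. (norm (G x))^2 + ((- 2 * c) * q x + c^2)) * m 0"
    using gauss_radial_integral(2)[OF hDH] by (simp add: m_def)
  also have "sphere_int 0 (\<lambda>x. (norm (G x))^2 + ((- 2 * c) * q x + c^2)) = sphere_int 0 (\<lambda>x. (norm (G x))^2) - 2 * c * \<sigma> + c^2 * \<omega>"
  proof -
    have "sphere_int 0 (\<lambda>_::'a. c^2) = c^2 * \<omega>" using sphere_int_cmult[of 0 "c^2" "\<lambda>_::'a. 1"] by (simp add: \<omega>_def)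
    then show ?thesis
      unfolding sphere_int_add[OF G homog_add[OF homog_cmult[OF hq] homog_const]]
        sphere_int_add[OF homog_cmult[OF hq] homog_const] sphere_int_cmult sq by simp
  qed
  finally have E3: "(LINT x|lborel. gauss x * (norm (DH x))^2) = (sphere_int 0 (\<lambda>x. (norm (G x))^2) - 2 * c * \<sigma> + c^2 * \<omega>) * m 0" .
  have E2: "(LINT x|lborel. gauss x * (H x)^2) = (sphere_int 2 (\<lambda>x. (h x)^2) - 2 * c * \<sigma> + c^2 * \<omega>) * (real DIM('a) * m 0)"
    using gauss_radial_integral(2)[OF hH2] m2 S2 by (simp add: m_def)
  have "Z * m 0 * ((sphere_int 2 (\<lambda>x. (h x)^2) - 2 * c * \<sigma> + c^2 * \<omega>) * real DIM('a)) \<le> Z * m 0 * (sphere_int 0 (\<lambda>x. (norm (G x))^2) - 2 * c * \<sigma> + c^2 * \<omega>)"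
    using final unfolding E1 E2 E3 by (simp add: mult_ac)
  then have "(sphere_int 2 (\<lambda>x. (h x)^2) - 2 * c * \<sigma> + c^2 * \<omega>) * real DIM('a) \<le> sphere_int 0 (\<lambda>x. (norm (G x))^2) - 2 * c * \<sigma> + c^2 * \<omega>"
    by (rule mult_left_le_imp_le) (use Z(2) \<omega>0 in simp)
  moreover have "c * \<sigma> = \<sigma>^2 / \<omega>" "c^2 * \<omega> = \<sigma>^2 / \<omega>" using \<omega>0 by (simp_all add: c_def power2_eq_square)
  moreover define S2 S0 where "S2 = sphere_int 2 (\<lambda>x. (h x)^2)" and "S0 = sphere_int 0 (\<lambda>x. (norm (G x))^2)"
  ultimately have "(S2 - \<sigma>\<^sup>2 / \<omega>) * real DIM('a) \<le> S0 - \<sigma>\<^sup>2 / \<omega>" by (simp add: mult.assoc)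
  then have "real DIM('a) * S2 - S0 \<le> (real DIM('a) - 1) * (\<sigma>^2 / \<omega>)"
    unfolding left_diff_distrib mult_1 by (simp only: mult.commute[of S2] mult.commute[of _ "real DIM('a)"])
  then show ?thesis unfolding \<omega>_def[symmetric] \<sigma>_def[symmetric] S2_def[symmetric] S0_def[symmetric] by simp
qed

section \<open>Hessians of convex functions\<close>

lemma dird_cplx:
  assumes "(u has_derivative u') (at z)" shows "dird v (cplx u) z = of_real (u' v)"
  by (rule dird_eq) (rule has_derivative_of_real[OF assms])

lemma inner_axis_complex: "x \<bullet> axis a 1 = Re (x $ a)" "x \<bullet> axis a \<i> = Im (x $ a)" for x :: "complex^'n"
  by (simp_all add: inner_axis inner_complex_def)

text \<open>A real Hessian that is a sum of squares of linear forms yields a complex Hessian that is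
  a sum of rank-one matrices with the same weights divided by 4, the two Wirtinger derivatives
  contributing 1/2 each.\<close>

lemma hess_rank_sum:
  fixes u :: "complex^'n \<Rightarrow> real" and x :: "'i \<Rightarrow> complex^'n"
  assumes u: "smooth (cplx u)"
    and d2: "\<And>w w'. dird w' (dird w (cplx u)) z = of_real (\<Sum>i\<in>I. c i * ((x i \<bullet> w') * (x i \<bullet> w)))"
  shows "hess u z a b = (\<Sum>i\<in>I. of_real (c i / 4) * (cnj (x i $ a) * x i $ b))"
proof -
  have s: "smooth (wirt \<i> b (cplx u))" by (rule smooth_wirt[OF u])
  have "hess u z a b = (\<Sum>i\<in>I. of_real (c i / 4) * ((of_real (Re (x i $ a)) - \<i> * of_real (Im (x i $ a))) * (of_real (Re (x i $ b)) + \<i> * of_real (Im (x i $ b)))))"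
    unfolding hess_def wirt_def[of "- \<i>"] dird_wirt[OF u] d2 inner_axis_complex of_real_sum of_real_mult
      sum_distrib_left sum_divide_distrib sum.distrib[symmetric]
    by (rule sum.cong) (simp_all add: field_simps)
  also have "(\<lambda>i. of_real (Re (x i $ a)) - \<i> * of_real (Im (x i $ a))) = (\<lambda>i. cnj (x i $ a))"
    by (auto simp: complex_eq_iff)
  also have "(\<lambda>i. of_real (Re (x i $ b)) + \<i> * of_real (Im (x i $ b))) = (\<lambda>i. x i $ b)"
    by (auto simp: complex_eq_iff)
  finally show ?thesis .
qed

lemma psd_hess_rank_sum:
  fixes u :: "complex^'n \<Rightarrow> real" and x :: "'i \<Rightarrow> complex^'n"
  assumes "smooth (cplx u)" "\<And>i. i \<in> I \<Longrightarrow> c i \<ge> 0"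
    and "\<And>w w'. dird w' (dird w (cplx u)) z = of_real (\<Sum>i\<in>I. c i * ((x i \<bullet> w') * (x i \<bullet> w)))"
  shows "psd (hess u z)"
proof -
  have "psd (\<lambda>a b. \<Sum>i\<in>I. of_real (c i / 4) * (cnj (x i $ a) * cnj (cnj (x i $ b))))"
    using assms(2) by (intro psd_sum psd_scale psd_rank1) auto
  also have "(\<lambda>a b. \<Sum>i\<in>I. of_real (c i / 4) * (cnj (x i $ a) * cnj (cnj (x i $ b)))) = hess u z"
    by (intro ext) (simp only: complex_cnj_cnj hess_rank_sum[OF assms(1,3)])
  finally show ?thesis .
qed

lemma hess_trace_rank_sum:
  fixes u :: "complex^'n \<Rightarrow> real" and x :: "'i \<Rightarrow> complex^'n"
  assumes u: "smooth (cplx u)"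
    and d2: "\<And>w w'. dird w' (dird w (cplx u)) z = of_real (\<Sum>i\<in>I. c i * ((x i \<bullet> w') * (x i \<bullet> w)))"
  shows "(\<Sum>a\<in>UNIV. hess u z a a) = (1 / 4) * (\<Sum>b\<in>Basis. dird b (dird b (cplx u)) z)"
proof -
  have n: "(\<Sum>a\<in>UNIV. cnj (y $ a) * y $ a) = of_real (y \<bullet> y)" for y :: "complex^'n"
    using cplx_sq[of y] by (simp add: sq_def mult.commute)
  have "(\<Sum>a\<in>UNIV. hess u z a a) = (\<Sum>i\<in>I. of_real (c i / 4) * (\<Sum>a\<in>UNIV. cnj (x i $ a) * x i $ a))"
    unfolding hess_rank_sum[OF u d2] sum_distrib_left by (rule sum.swap)
  also have "\<dots> = (1 / 4) * of_real (\<Sum>i\<in>I. c i * (\<Sum>b\<in>Basis. (x i \<bullet> b) * (x i \<bullet> b)))"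
    unfolding n euclidean_inner[of "x i" "x i" for i] by (simp add: sum_distrib_left)
  also have "(\<Sum>i\<in>I. c i * (\<Sum>b\<in>Basis. (x i \<bullet> b) * (x i \<bullet> b))) = (\<Sum>b\<in>Basis. \<Sum>i\<in>I. c i * ((x i \<bullet> b) * (x i \<bullet> b)))"
    unfolding sum_distrib_left by (rule sum.swap)
  finally show ?thesis unfolding d2 by simp
qed

lemma norm_complex_product_ge_inner: "(x \<bullet> y)^2 \<le> (norm (\<Sum>a\<in>UNIV. cnj (x $ a) * y $ a))^2" for x y :: "complex^'n"
proof -
  have "x \<bullet> y = Re (\<Sum>a\<in>UNIV. cnj (x $ a) * y $ a)" by (simp add: inner_vec_def inner_complex_def)
  then show ?thesis using abs_Re_le_cmod by (metis abs_le_square_iff abs_norm_cancel)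
qed

text \<open>Both sides expand into sums over pairs \<open>i, j\<close>; the real inner product of \<open>x\<^sub>i\<close> and \<open>x\<^sub>j\<close> is the real part
  of the Hermitian one, hence not larger in modulus.\<close>

lemma hess_e2_rank_sum:
  fixes u :: "complex^'n \<Rightarrow> real" and x :: "'i \<Rightarrow> complex^'n"
  assumes u: "smooth (cplx u)" and c: "\<And>i. i \<in> I \<Longrightarrow> c i \<ge> 0"
    and d2: "\<And>w w'. dird w' (dird w (cplx u)) z = of_real (\<Sum>i\<in>I. c i * ((x i \<bullet> w') * (x i \<bullet> w)))"
  shows "Re ((\<Sum>a\<in>UNIV. hess u z a a)^2 - (\<Sum>a\<in>UNIV. \<Sum>b\<in>UNIV. hess u z a b * hess u z b a))
    \<le> (1 / 16) * Re ((\<Sum>b\<in>Basis. dird b (dird b (cplx u)) z)^2 - (\<Sum>b\<in>Basis. \<Sum>b'\<in>Basis. (dird b' (dird b (cplx u)) z)^2))"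
proof -
  define p where "p i j = (\<Sum>a\<in>UNIV. cnj (x i $ a) * x j $ a)" for i j
  have pc: "p i j * p j i = p i j * cnj (p i j)" for i j by (simp add: p_def mult.commute)
  have H: "(\<Sum>a\<in>UNIV. \<Sum>b\<in>UNIV. hess u z a b * hess u z b a) = (\<Sum>i\<in>I. \<Sum>j\<in>I. of_real (c i * c j / 16) * of_real ((norm (p i j))^2))"
  proof -
    have "(\<Sum>a\<in>UNIV. \<Sum>b\<in>UNIV. hess u z a b * hess u z b a)
        = (\<Sum>a\<in>UNIV. \<Sum>b\<in>UNIV. \<Sum>i\<in>I. \<Sum>j\<in>I. of_real (c i * c j / 16) * ((cnj (x i $ a) * x j $ a) * (cnj (x j $ b) * x i $ b)))"
      unfolding hess_rank_sum[OF u d2] sum_product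
      by (intro sum.cong refl) (simp add: mult_ac)
    also have "\<dots> = (\<Sum>i\<in>I. \<Sum>j\<in>I. \<Sum>a\<in>UNIV. \<Sum>b\<in>UNIV. of_real (c i * c j / 16) * ((cnj (x i $ a) * x j $ a) * (cnj (x j $ b) * x i $ b)))"
      by (simp only: sum.swap[of _ UNIV I])
    also have "\<dots> = (\<Sum>i\<in>I. \<Sum>j\<in>I. of_real (c i * c j / 16) * (p i j * p j i))"
      unfolding p_def sum_product by (simp only: sum_distrib_left)
    also have "\<dots> = (\<Sum>i\<in>I. \<Sum>j\<in>I. of_real (c i * c j / 16) * of_real ((norm (p i j))^2))"
      by (intro sum.cong refl arg_cong2[where f="(*)"]) (subst pc, rule complex_norm_square[symmetric])
    finally show ?thesis .
  qed
  have D: "(\<Sum>b\<in>Basis. \<Sum>b'\<in>Basis. (dird b' (dird b (cplx u)) z)^2) = of_real (\<Sum>i\<in>I. \<Sum>j\<in>I. c i * c j * (x i \<bullet> x j)^2)"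
  proof -
    have "(\<Sum>b\<in>Basis. \<Sum>b'\<in>Basis. (\<Sum>i\<in>I. c i * ((x i \<bullet> b') * (x i \<bullet> b)))^2)
        = (\<Sum>b\<in>Basis. \<Sum>b'\<in>Basis. \<Sum>i\<in>I. \<Sum>j\<in>I. c i * c j * (((x i \<bullet> b) * (x j \<bullet> b)) * ((x i \<bullet> b') * (x j \<bullet> b'))))"
      unfolding power2_eq_square sum_product by (intro sum.cong refl) (simp add: mult_ac)
    also have "\<dots> = (\<Sum>i\<in>I. \<Sum>j\<in>I. \<Sum>b\<in>Basis. \<Sum>b'\<in>Basis. c i * c j * (((x i \<bullet> b) * (x j \<bullet> b)) * ((x i \<bullet> b') * (x j \<bullet> b'))))"
      by (simp only: sum.swap[of _ Basis I])
    also have "\<dots> = (\<Sum>i\<in>I. \<Sum>j\<in>I. c i * c j * (x i \<bullet> x j)^2)"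
      unfolding euclidean_inner[of "x i" "x j" for i j] power2_eq_square sum_product by (simp only: sum_distrib_left)
    finally show ?thesis unfolding d2 by (simp flip: of_real_power of_real_sum)
  qed
  have T: "(\<Sum>a\<in>UNIV. hess u z a a)^2 = (1 / 16) * (\<Sum>b\<in>Basis. dird b (dird b (cplx u)) z)^2"
    unfolding hess_trace_rank_sum[OF u d2] by (simp add: power_mult_distrib power_divide)
  define Q R where "Q = (\<Sum>i\<in>I. \<Sum>j\<in>I. c i * c j * (norm (p i j))^2)" and "R = (\<Sum>i\<in>I. \<Sum>j\<in>I. c i * c j * (x i \<bullet> x j)^2)"
  have "R \<le> Q"
    unfolding p_def Q_def R_def by (intro sum_mono mult_left_mono norm_complex_product_ge_inner mult_nonneg_nonneg c)
  moreover have Q: "(\<Sum>i\<in>I. \<Sum>j\<in>I. of_real (c i * c j / 16) * of_real ((norm (p i j))^2)) = complex_of_real (Q / 16)"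
    unfolding Q_def by (simp add: sum_divide_distrib)
  moreover have "Re ((1 / 16) * W - of_real (Q / 16)) = (1 / 16) * Re (W - of_real Q)" for W by simp
  ultimately show ?thesis unfolding H D T Q R_def[symmetric] by simp
qed

section \<open>Soft maxima of linear functions\<close>

lemma Dk_exp: "Dk S k exp"
  by (induction k) (auto intro!: continuous_intros Dk_SucI DERIV_exp simp del: Dk.simps(2))

lemma Dk_ln: "Dk {0<..} k ln"
proof (cases k)
  case 0 then show ?thesis by (auto intro!: continuous_intros)
next
  case (Suc j)
  have "Dk {0<..} (Suc j) ln"
    by (rule Dk_SucI[where f'=inverse]) (auto intro!: DERIV_ln Dk_inverse Dk_ident)
  then show ?thesis by (simp only: Suc)
qed

definition lse_sum :: "'a::euclidean_space set \<Rightarrow> real \<Rightarrow> 'a \<Rightarrow> real" where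
  "lse_sum P t z = (\<Sum>v\<in>P. exp (t * (z \<bullet> v)))"

definition lse :: "'a::euclidean_space set \<Rightarrow> real \<Rightarrow> 'a \<Rightarrow> real" where
  "lse P t z = ln (lse_sum P t z) / t"

definition softmax :: "'a::euclidean_space set \<Rightarrow> real \<Rightarrow> 'a \<Rightarrow> 'a \<Rightarrow> real" where
  "softmax P t v z = exp (t * (z \<bullet> v)) / lse_sum P t z"

definition lse_grad :: "'a::euclidean_space set \<Rightarrow> real \<Rightarrow> 'a \<Rightarrow> 'a" where
  "lse_grad P t z = (\<Sum>v\<in>P. softmax P t v z *\<^sub>R v)"

context
  fixes P :: "'a::euclidean_space set" and t :: real
  assumes P: "finite P" "P \<noteq> {}" and t: "t > 0"
begin

lemma lse_sum_pos: "lse_sum P t z > 0"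
  unfolding lse_sum_def using P by (intro sum_pos) auto

lemma softmax_nonneg: "softmax P t v z \<ge> 0"
  using lse_sum_pos[of z] by (simp add: softmax_def)

lemma sum_softmax: "(\<Sum>v\<in>P. softmax P t v z) = 1"
  using lse_sum_pos[of z] unfolding softmax_def sum_divide_distrib[symmetric] by (simp add: lse_sum_def)

lemma lse_sum_derivative: "(lse_sum P t has_derivative (\<lambda>w. t * lse_sum P t z * (lse_grad P t z \<bullet> w))) (at z)"
proof -
  have "(lse_sum P t has_derivative (\<lambda>w. \<Sum>v\<in>P. exp (t * (z \<bullet> v)) * (t * (w \<bullet> v)))) (at z)"
    unfolding lse_sum_def[abs_def] by (auto intro!: derivative_eq_intros has_derivative_sum)
  moreover have "(\<Sum>v\<in>P. exp (t * (z \<bullet> v)) * (t * (w \<bullet> v))) = t * lse_sum P t z * (lse_grad P t z \<bullet> w)" for w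
  proof -
    have "lse_sum P t z * (lse_grad P t z \<bullet> w) = (\<Sum>v\<in>P. exp (t * (z \<bullet> v)) * (w \<bullet> v))"
      unfolding lse_grad_def inner_sum_left sum_distrib_left softmax_def
      using lse_sum_pos[of z] by (intro sum.cong refl) (simp add: inner_commute)
    then show ?thesis unfolding mult.assoc by (simp add: sum_distrib_left mult_ac)
  qed
  ultimately show ?thesis by simp
qed

lemma lse_derivative: "(lse P t has_derivative (\<lambda>w. lse_grad P t z \<bullet> w)) (at z)"
  unfolding lse_def[abs_def] using t lse_sum_pos[of z]
  by (auto intro!: derivative_eq_intros lse_sum_derivative simp: fun_eq_iff)

lemma softmax_derivative: "(softmax P t v has_derivative (\<lambda>w. t * softmax P t v z * ((v - lse_grad P t z) \<bullet> w))) (at z)"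
  unfolding softmax_def[abs_def]
proof (rule has_derivative_eq_rhs)
  show "((\<lambda>z. exp (t * (z \<bullet> v)) / lse_sum P t z) has_derivative (\<lambda>w. - exp (t * (z \<bullet> v)) * (inverse (lse_sum P t z) * (t * lse_sum P t z * (lse_grad P t z \<bullet> w)) * inverse (lse_sum P t z)) + (exp (t * (z \<bullet> v)) * (t * (w \<bullet> v))) / lse_sum P t z)) (at z)"
    using lse_sum_pos[of z] by (intro has_derivative_divide lse_sum_derivative) (auto intro!: derivative_eq_intros)
  show "(\<lambda>w. - exp (t * (z \<bullet> v)) * (inverse (lse_sum P t z) * (t * lse_sum P t z * (lse_grad P t z \<bullet> w)) * inverse (lse_sum P t z)) + (exp (t * (z \<bullet> v)) * (t * (w \<bullet> v))) / lse_sum P t z)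
      = (\<lambda>w. t * (exp (t * (z \<bullet> v)) / lse_sum P t z) * ((v - lse_grad P t z) \<bullet> w))"
    using lse_sum_pos[of z] by (auto simp: fun_eq_iff field_simps inner_diff_left inner_diff_right inner_commute)
qed

lemma norm_lse_grad_le: "(\<And>v. v \<in> P \<Longrightarrow> norm v \<le> M) \<Longrightarrow> norm (lse_grad P t z) \<le> M"
proof -
  assume M: "\<And>v. v \<in> P \<Longrightarrow> norm v \<le> M"
  have "norm (lse_grad P t z) \<le> (\<Sum>v\<in>P. softmax P t v z * M)"
    unfolding lse_grad_def by (rule sum_norm_le) (simp add: softmax_nonneg mult_left_mono M)
  also have "\<dots> = M" by (simp add: sum_distrib_right[symmetric] sum_softmax)
  finally show ?thesis .
qed

lemma continuous_lse_grad: "continuous_on UNIV (lse_grad P t)"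
proof -
  have "continuous_on UNIV (softmax P t v)" for v
    using has_derivative_continuous[OF softmax_derivative] by (simp add: continuous_at_imp_continuous_on)
  then show ?thesis unfolding lse_grad_def[abs_def] by (auto intro!: continuous_intros)
qed

end

section \<open>Soft maxima as smooth plurisubharmonic functions\<close>

context
  fixes P :: "(complex^'n::finite) set" and t :: real
  assumes P: "finite P" "P \<noteq> {}" and t: "t > 0"
begin

lemma smooth_exp_inner: "smooth (cplx (\<lambda>z. exp (t * (z \<bullet> v))))"
proof (rule smooth_compose_real[where S=UNIV and \<psi>=exp])
  have "smooth (\<lambda>z. complex_of_real t * of_real (z \<bullet> v))" by (intro smooth_intros)
  then show "smooth (\<lambda>z. complex_of_real (t * (z \<bullet> v)))" by simp
qed (auto intro: Dk_exp)

lemma smooth_lse_sum: "smooth (cplx (lse_sum P t))"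
proof -
  have "smooth (\<lambda>z. \<Sum>v\<in>P. complex_of_real (exp (t * (z \<bullet> v))))" by (intro smooth_sum smooth_exp_inner)
  then show ?thesis by (simp add: lse_sum_def)
qed

lemma smooth_lse: "smooth (cplx (lse P t))"
proof -
  have "smooth (cplx (\<lambda>z. ln (lse_sum P t z)))"
    by (rule smooth_compose_real[OF smooth_lse_sum, where S="{0<..}"]) (simp_all add: Dk_ln lse_sum_pos[OF P t])
  then have "smooth (\<lambda>z. of_real (1 / t) * complex_of_real (ln (lse_sum P t z)))" by (intro smooth_intros)
  then show ?thesis by (simp add: lse_def[abs_def])
qed

lemma dird_lse: "dird w (cplx (lse P t)) = cplx (\<lambda>z. lse_grad P t z \<bullet> w)"
  by (rule ext) (rule dird_cplx[OF lse_derivative[OF P t]])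

text \<open>The Hessian of log-sum-exp is t times the covariance of the points under the softmax
  weights. Differentiation centres only one of the two factors; the other may be centred as well
  because the deviations have mean zero. This provides the sum of squares with nonnegative
  weights.\<close>

lemma dird2_lse:
  "dird w' (dird w (cplx (lse P t))) z = of_real (\<Sum>v\<in>P. t * softmax P t v z * (((v - lse_grad P t z) \<bullet> w') * ((v - lse_grad P t z) \<bullet> w)))"
proof -
  have eq: "lse_grad P t z \<bullet> w = (\<Sum>v\<in>P. softmax P t v z * (v \<bullet> w))" for z
    by (simp add: lse_grad_def inner_sum_left)
  have "((\<lambda>z. lse_grad P t z \<bullet> w) has_derivative (\<lambda>w'. \<Sum>v\<in>P. t * softmax P t v z * ((v - lse_grad P t z) \<bullet> w') * (v \<bullet> w))) (at z)"
    unfolding eq by (intro has_derivative_sum has_derivative_mult_left softmax_derivative P t)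
  then have "dird w' (dird w (cplx (lse P t))) z = of_real (\<Sum>v\<in>P. t * softmax P t v z * ((v - lse_grad P t z) \<bullet> w') * (v \<bullet> w))"
    unfolding dird_lse by (rule dird_cplx)
  moreover have "(\<Sum>v\<in>P. t * softmax P t v z * ((v - lse_grad P t z) \<bullet> w') * (lse_grad P t z \<bullet> w)) = 0"
  proof -
    have "(\<Sum>v\<in>P. softmax P t v z * ((v - lse_grad P t z) \<bullet> w')) = 0"
    proof -
      have "(\<Sum>v\<in>P. softmax P t v z * ((v - lse_grad P t z) \<bullet> w')) = (\<Sum>v\<in>P. softmax P t v z * (v \<bullet> w')) - (\<Sum>v\<in>P. softmax P t v z) * (lse_grad P t z \<bullet> w')"
        by (simp add: inner_diff_left right_diff_distrib sum_subtractf sum_distrib_right)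
      then show ?thesis by (simp add: sum_softmax[OF P t] lse_grad_def inner_sum_left)
    qed
    moreover have "(\<Sum>v\<in>P. t * softmax P t v z * ((v - lse_grad P t z) \<bullet> w') * (lse_grad P t z \<bullet> w)) = t * (\<Sum>v\<in>P. softmax P t v z * ((v - lse_grad P t z) \<bullet> w')) * (lse_grad P t z \<bullet> w)"
      by (simp add: sum_distrib_left sum_distrib_right mult.assoc)
    ultimately show ?thesis by simp
  qed
  ultimately show ?thesis
    by (simp add: inner_diff_left[of _ _ w] right_diff_distrib sum_subtractf mult.assoc del: of_real_sum)
qed

lemma spsh_lse: "spsh (lse P t)"
  unfolding spsh_def
proof (intro conjI allI)
  show "psd (hess (lse P t) z)" for z
    by (rule psd_hess_rank_sum[OF smooth_lse _ dird2_lse]) (simp add: softmax_nonneg[OF P t] less_imp_le[OF t])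
qed (rule smooth_lse)

lemmas hess_trace_lse = hess_trace_rank_sum[OF smooth_lse dird2_lse]

lemma hess_e2_lse:
  "Re ((\<Sum>a\<in>UNIV. hess (lse P t) z a a)^2 - (\<Sum>a\<in>UNIV. \<Sum>b\<in>UNIV. hess (lse P t) z a b * hess (lse P t) z b a))
    \<le> (1 / 16) * Re ((\<Sum>b\<in>Basis. dird b (dird b (cplx (lse P t))) z)^2 - (\<Sum>b\<in>Basis. \<Sum>b'\<in>Basis. (dird b' (dird b (cplx (lse P t))) z)^2))"
  by (rule hess_e2_rank_sum[OF smooth_lse _ dird2_lse]) (simp add: softmax_nonneg[OF P t] less_imp_le[OF t])

end


section \<open>Support functions of finite sets\<close>

definition fin_support :: "'a::euclidean_space set \<Rightarrow> 'a \<Rightarrow> real" where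
  "fin_support P z = Max ((\<lambda>v. z \<bullet> v) ` P)"

definition face :: "'a::euclidean_space set \<Rightarrow> 'a \<Rightarrow> 'a set" where
  "face P z = {v \<in> P. z \<bullet> v = fin_support P z}"

text \<open>The pointwise limit of the gradients of the soft maxima; a measurable selection of subgradients.\<close>

definition face_mean :: "'a::euclidean_space set \<Rightarrow> 'a \<Rightarrow> 'a" where
  "face_mean P z = (\<Sum>v\<in>P. (of_bool (v \<in> face P z) / real (card (face P z))) *\<^sub>R v)"

context
  fixes P :: "'a::euclidean_space set"
  assumes P: "finite P" "P \<noteq> {}"
begin

lemma fin_support_ge: "v \<in> P \<Longrightarrow> z \<bullet> v \<le> fin_support P z"
  unfolding fin_support_def using P by (intro Max_ge) auto

lemma fin_support_attained: obtains v where "v \<in> P" "z \<bullet> v = fin_support P z"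
proof -
  have "fin_support P z \<in> (\<lambda>v. z \<bullet> v) ` P" unfolding fin_support_def using P by (intro Max_in) auto
  then show ?thesis using that by force
qed

lemma card_face_pos: "card (face P z) > 0"
proof -
  obtain v where "v \<in> P" "z \<bullet> v = fin_support P z" using fin_support_attained[where z=z] by blast
  then have "v \<in> face P z" by (simp add: face_def)
  then show ?thesis using P by (auto simp: card_gt_0_iff face_def)
qed

lemma sum_of_bool_face: "(\<Sum>v\<in>P. of_bool (v \<in> face P z)) = real (card (face P z))"
proof -
  have "(\<Sum>v\<in>P. of_bool (v \<in> face P z)) = (\<Sum>v\<in>face P z. 1 :: real)"
    by (rule sum.mono_neutral_cong_right) (use P in \<open>auto simp: face_def\<close>)
  then show ?thesis by simp
qed

lemma sum_face: "(\<Sum>v\<in>P. of_bool (v \<in> face P z) / real (card (face P z))) = 1"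
proof -
  show ?thesis using card_face_pos[of z] by (simp add: sum_divide_distrib[symmetric] sum_of_bool_face del: sum_of_bool_eq)
qed

lemma face_mean_inner: "face_mean P z \<bullet> z = fin_support P z"
proof -
  have "face_mean P z \<bullet> z = (\<Sum>v\<in>P. of_bool (v \<in> face P z) / real (card (face P z)) * fin_support P z)"
    unfolding face_mean_def inner_sum_left inner_scaleR_left
    by (intro sum.cong refl) (auto simp: face_def inner_commute)
  also have "\<dots> = fin_support P z" by (simp only: sum_distrib_right[symmetric] sum_face mult_1)
  finally show ?thesis .
qed

lemma fin_support_scale:
  assumes c: "c > 0" shows "fin_support P (c *\<^sub>R z) = c * fin_support P z"
proof -
  have "(\<lambda>v. (c *\<^sub>R z) \<bullet> v) ` P = (\<lambda>x. c * x) ` ((\<lambda>v. z \<bullet> v) ` P)" by (simp add: image_image)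
  then show ?thesis unfolding fin_support_def
    using mono_Max_commute[of "\<lambda>x. c * x" "(\<lambda>v. z \<bullet> v) ` P"] P c by (simp add: mono_def)
qed

lemma face_scale: "c > 0 \<Longrightarrow> face P (c *\<^sub>R z) = face P z"
  unfolding face_def by (simp add: fin_support_scale)

lemma face_mean_scale: "c > 0 \<Longrightarrow> face_mean P (c *\<^sub>R z) = face_mean P z"
  by (simp add: face_mean_def face_scale)

lemma lse_sum_shift: "lse_sum P t z = exp (t * fin_support P z) * (\<Sum>v\<in>P. exp (t * (z \<bullet> v - fin_support P z)))"
  unfolding lse_sum_def sum_distrib_left by (intro sum.cong refl) (simp add: exp_add[symmetric] algebra_simps)

lemma lse_bounds:
  assumes t: "t > 0"
  shows "fin_support P z \<le> lse P t z" "lse P t z \<le> fin_support P z + ln (real (card P)) / t"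
proof -
  let ?S = "\<Sum>v\<in>P. exp (t * (z \<bullet> v - fin_support P z))"
  have c: "real (card P) > 0" using P by (simp add: card_gt_0_iff)
  have up: "?S \<le> (\<Sum>v\<in>P. 1)"
    by (rule sum_mono) (simp add: mult_le_0_iff t less_imp_le fin_support_ge)
  obtain v where v: "v \<in> P" "z \<bullet> v = fin_support P z" using fin_support_attained[where z=z] by blast
  have lo: "1 \<le> ?S"
    using member_le_sum[of v P "\<lambda>v. exp (t * (z \<bullet> v - fin_support P z))"] v P by simp
  have e: "lse P t z = fin_support P z + ln ?S / t"
    unfolding lse_def lse_sum_shift using lo t by (simp add: ln_mult add_divide_distrib)
  show "fin_support P z \<le> lse P t z" using lo t by (simp add: e)
  show "lse P t z \<le> fin_support P z + ln (real (card P)) / t"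
    unfolding e using lo up t c by (simp add: divide_right_mono)
qed

lemma softmax_limit:
  assumes v: "v \<in> P"
  shows "(\<lambda>i. softmax P (real (Suc i)) v z) \<longlonglongrightarrow> of_bool (v \<in> face P z) / real (card (face P z))"
proof -
  have lim: "(\<lambda>i. exp (real (Suc i) * (z \<bullet> v - fin_support P z))) \<longlonglongrightarrow> of_bool (v \<in> face P z)" if v: "v \<in> P" for v
  proof (cases "v \<in> face P z")
    case True then show ?thesis by (simp add: face_def)
  next
    case False
    define d where "d = z \<bullet> v - fin_support P z"
    have "d < 0" using False v fin_support_ge[OF v, of z] by (simp add: face_def d_def)
    then have "(\<lambda>i. exp d ^ Suc i) \<longlonglongrightarrow> 0" by (intro LIMSEQ_Suc LIMSEQ_power_zero) simp
    then show ?thesis using False by (simp add: exp_of_nat_mult[symmetric] d_def[symmetric] del: of_nat_Suc power_Suc)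
  qed
  have e: "softmax P t v z = exp (t * (z \<bullet> v - fin_support P z)) / (\<Sum>w\<in>P. exp (t * (z \<bullet> w - fin_support P z)))" for t
    unfolding softmax_def lse_sum_shift by (simp add: exp_diff right_diff_distrib)
  show ?thesis unfolding e sum_of_bool_face[of z, symmetric]
    by (rule tendsto_divide[OF lim[OF v] tendsto_sum[OF lim]]) (use card_face_pos[of z] sum_of_bool_face[of z] in linarith)+
qed

lemma lse_grad_limit: "(\<lambda>i. lse_grad P (real (Suc i)) z) \<longlonglongrightarrow> face_mean P z"
  unfolding lse_grad_def face_mean_def by (intro tendsto_sum tendsto_scaleR softmax_limit tendsto_const)

lemma lse_limit: "(\<lambda>i. lse P (real (Suc i)) z) \<longlonglongrightarrow> fin_support P z"
proof (rule tendsto_sandwich[where f="\<lambda>_. fin_support P z"])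
  show "(\<lambda>i. fin_support P z + ln (real (card P)) / real (Suc i)) \<longlonglongrightarrow> fin_support P z"
    using tendsto_add[OF tendsto_const tendsto_mult_right_zero[OF LIMSEQ_inverse_real_of_nat], of "fin_support P z" "ln (real (card P))"]
    by (simp add: divide_inverse)
  show "\<forall>\<^sub>F i in sequentially. fin_support P z \<le> lse P (real (Suc i)) z"
    "\<forall>\<^sub>F i in sequentially. lse P (real (Suc i)) z \<le> fin_support P z + ln (real (card P)) / real (Suc i)"
    by (intro always_eventually allI lse_bounds; simp)+
qed (rule tendsto_const)

lemma lse_continuous: "t > 0 \<Longrightarrow> continuous_on UNIV (lse P t)"
  using has_derivative_continuous[OF lse_derivative[OF P]] by (simp add: continuous_at_imp_continuous_on)

lemma face_mean_measurable: "face_mean P \<in> borel_measurable borel"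
  by (rule borel_measurable_LIMSEQ_metric[OF borel_measurable_continuous_onI[OF continuous_lse_grad[OF P]] lse_grad_limit]) simp

lemma fin_support_measurable: "fin_support P \<in> borel_measurable borel"
  by (rule borel_measurable_LIMSEQ_metric[OF borel_measurable_continuous_onI[OF lse_continuous] lse_limit]) simp

lemma norm_face_mean_le: "(\<And>v. v \<in> P \<Longrightarrow> norm v \<le> M) \<Longrightarrow> norm (face_mean P z) \<le> M"
  by (rule LIMSEQ_le_const2[OF tendsto_norm[OF lse_grad_limit]]) (auto intro!: norm_lse_grad_le P)

lemma abs_fin_support_le: "(\<And>v. v \<in> P \<Longrightarrow> norm v \<le> M) \<Longrightarrow> \<bar>fin_support P z\<bar> \<le> M * norm z"
  unfolding face_mean_inner[symmetric]
  by (rule order_trans[OF Cauchy_Schwarz_ineq2]) (intro mult_right_mono norm_face_mean_le; simp)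

lemma norm_bound: obtains M where "\<And>v. v \<in> P \<Longrightarrow> norm v \<le> M" "M \<ge> 0"
  using that[of "\<Sum>v\<in>P. norm v"] P member_le_sum[of _ P norm] by (simp add: sum_nonneg)

lemma homog_fin_support: "homog 1 (fin_support P)"
proof -
  obtain M where "\<And>v. v \<in> P \<Longrightarrow> norm v \<le> M" by (rule norm_bound) auto
  then show ?thesis unfolding homog_def
    using abs_fin_support_le[of M] fin_support_measurable fin_support_scale by auto
qed

lemma homog_face_mean: "homog 0 (\<lambda>z. (norm (face_mean P z))^2)"
proof -
  obtain M where M: "\<And>v. v \<in> P \<Longrightarrow> norm v \<le> M" by (rule norm_bound) auto
  have "\<bar>(norm (face_mean P z))^2\<bar> \<le> M^2 * norm z ^ 0" for z
    using norm_face_mean_le[OF M, of z] by (simp add: power_mono)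
  moreover have "(\<lambda>z. (norm (face_mean P z))^2) \<in> borel_measurable borel" using face_mean_measurable by measurable
  ultimately show ?thesis unfolding homog_def by (auto simp: face_mean_scale)
qed

lemma fin_support_poincare:
  "real DIM('a) * sphere_int 2 (\<lambda>x. (fin_support P x)^2) - sphere_int 0 (\<lambda>x. (norm (face_mean P x))^2)
    \<le> (real DIM('a) - 1) * (sphere_int 1 (fin_support P))^2 / sphere_int 0 (\<lambda>_::'a. 1)"
proof -
  obtain M0 where M0: "\<And>v. v \<in> P \<Longrightarrow> norm v \<le> M0" "M0 \<ge> 0" by (rule norm_bound) auto
  define L where "L = ln (real (card P))"
  have L: "L \<ge> 0" using P by (simp add: L_def card_gt_0_iff Suc_le_eq)
  have bd: "\<bar>lse P (real (Suc j)) x\<bar> \<le> (M0 + L) * (1 + norm x)" for j x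
  proof -
    have "L / real (Suc j) \<le> L" using L by (simp add: divide_le_eq mult_left_mono del: of_nat_Suc) (simp add: mult_le_cancel_left1 algebra_simps)
    then have "\<bar>lse P (real (Suc j)) x\<bar> \<le> M0 * norm x + L"
      using lse_bounds[of "real (Suc j)" x] abs_fin_support_le[OF M0(1), of x] L unfolding L_def[symmetric] by linarith
    also have "\<dots> \<le> (M0 + L) * (1 + norm x)" using M0(2) L by (simp add: algebra_simps)
    finally show ?thesis .
  qed
  show ?thesis
  proof (rule sphere_poincare[where u="\<lambda>j. lse P (real (Suc j))" and g="\<lambda>j. lse_grad P (real (Suc j))" and M="M0 + L"])
    show "norm (lse_grad P (real (Suc j)) x) \<le> M0 + L" for j x
      using norm_lse_grad_le[OF P _ M0(1), of "real (Suc j)" x] L by simp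
    show "\<bar>lse P (real (Suc j)) x\<bar> \<le> (M0 + L) * (1 + norm x)" for j x by (rule bd)
    show "(lse P (real (Suc j)) has_derivative (\<lambda>v. lse_grad P (real (Suc j)) x \<bullet> v)) (at x)" for j x
      by (rule lse_derivative[OF P]) simp
    show "continuous_on UNIV (lse_grad P (real (Suc j)))" for j by (rule continuous_lse_grad[OF P]) simp
  qed (rule homog_fin_support homog_face_mean face_mean_inner lse_limit lse_grad_limit)+
qed

end

section \<open>Integration by parts for the second elementary symmetric function\<close>

lemma dird_commute2:
  assumes "smooth U"
  shows "dird c (dird b (dird b U)) z = dird b (dird b (dird c U)) z"
proof -
  have "dird c (dird b U) = dird b (dird c U)" by (rule ext) (rule dird_commute[OF assms])
  then show ?thesis using dird_commute[OF smooth_dird[OF assms], of c b b z] by simp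
qed

text \<open>A 2x2 minor of a Hessian is a second-order divergence of products of first derivatives.
  The estimate thereby becomes stable under pointwise convergence of gradients, although the second
  derivatives of the soft maxima blow up.\<close>

lemma e2_pair_by_parts:
  fixes U :: "complex^'n::finite \<Rightarrow> complex"
  assumes U: "smooth U" and f: "test_function f"
  shows "(LINT z|lborel. f z * (dird b (dird b U) z * dird c (dird c U) z - (dird c (dird b U) z)\<^sup>2)) =
    (LINT z|lborel. (dird b U z * dird c U z) * dird b (dird c f) z)
    - (LINT z|lborel. (dird b U z)^2 * dird c (dird c f) z) / 2
    - (LINT z|lborel. (dird c U z)^2 * dird b (dird b f) z) / 2"
proof -
  define B C where "B = dird b U" and "C = dird c U"
  have s: "smooth B" "smooth C" "smooth (dird b B)" "smooth (dird b C)" "smooth (dird c C)" "smooth (dird c (dird b B))"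
    by (simp_all add: B_def C_def smooth_dird U)
  have fs: "smooth f" "smooth (dird c f)" "smooth (dird b f)" using test_smooth[OF f] by (simp_all add: smooth_dird)
  have ft: "test_function (dird c f)" "test_function (dird b f)" "test_function (dird b (dird c f))"
    "test_function (dird c (dird c f))" "test_function (dird b (dird b f))" by (intro test_dird f)+
  have BC: "dird c B z = dird b C z" for z unfolding B_def C_def by (rule dird_commute[OF U])
  have D3: "dird b (dird b C) z = dird c (dird b B) z" for z unfolding B_def C_def by (rule dird_commute2[OF U, symmetric])
  \<comment> \<open>This integral contains the only third derivative. It enters \<open>?E1\<close>
    and \<open>?E2\<close> in the same way and cancels in their difference.\<close>
  let ?T = "LINT z|lborel. (dird c (dird b B) z * C z) * f z"
  let ?P1 = "LINT z|lborel. (dird b B z * C z) * dird c f z"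
  let ?P2 = "LINT z|lborel. (dird b C z * C z) * dird b f z"
  let ?P3 = "LINT z|lborel. (dird b C z * B z) * dird c f z"
  let ?Q = "LINT z|lborel. (B z * C z) * dird b (dird c f) z"
  let ?E1 = "LINT z|lborel. (dird b B z * dird c C z) * f z"
  let ?E2 = "LINT z|lborel. (dird b C z * dird b C z) * f z"
  note int = smooth_mult_test_integrable[OF smooth_mult]
  have 1: "?T + ?P1 = - ?E1"
  proof -
    have "?T + ?P1 = (LINT z|lborel. C z * dird c (\<lambda>z. f z * dird b B z) z)"
      unfolding Bochner_Integration.integral_add[OF int[OF s(6) s(2) f] int[OF s(3) s(2) ft(1)], symmetric]
      by (rule Bochner_Integration.integral_cong) (simp_all add: dird_mult[OF fs(1) s(3)] algebra_simps)
    also have "\<dots> = - (LINT z|lborel. dird c C z * (f z * dird b B z))"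
      by (rule test_integral_by_parts[OF test_mult_left[OF f s(3)] s(2)])
    finally show ?thesis by (simp add: mult_ac)
  qed
  have 2: "?T + ?P2 = - ?E2"
  proof -
    have "?T + ?P2 = (LINT z|lborel. C z * dird b (\<lambda>z. f z * dird b C z) z)"
      unfolding Bochner_Integration.integral_add[OF int[OF s(6) s(2) f] int[OF s(4) s(2) ft(2)], symmetric]
      by (rule Bochner_Integration.integral_cong) (simp_all add: dird_mult[OF fs(1) s(4)] D3 algebra_simps)
    also have "\<dots> = - (LINT z|lborel. dird b C z * (f z * dird b C z))"
      by (rule test_integral_by_parts[OF test_mult_left[OF f s(4)] s(2)])
    finally show ?thesis by (simp add: mult_ac)
  qed
  have 3: "?P3 + ?Q = - ?P1"
  proof -
    have "?P3 + ?Q = (LINT z|lborel. B z * dird b (\<lambda>z. dird c f z * C z) z)"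
      unfolding Bochner_Integration.integral_add[OF int[OF s(4) s(1) ft(1)] int[OF s(1) s(2) ft(3)], symmetric]
      by (rule Bochner_Integration.integral_cong) (rule refl, simp only: dird_mult[OF fs(2) s(2)], simp add: algebra_simps)
    also have "\<dots> = - (LINT z|lborel. dird b B z * (dird c f z * C z))"
      by (rule test_integral_by_parts[OF test_mult_left[OF ft(1) s(2)] s(1)])
    finally show ?thesis by (simp add: mult_ac)
  qed
  have sq: "(LINT z|lborel. (W z)^2 * dird v (dird v f) z) = - 2 * (LINT z|lborel. (dird v W z * W z) * dird v f z)"
    if W: "smooth W" for W and v
  proof -
    have "(LINT z|lborel. (W z * W z) * dird v (dird v f) z) = - (LINT z|lborel. dird v (\<lambda>z. W z * W z) z * dird v f z)"
      by (rule test_integral_by_parts[OF test_dird[OF f] smooth_mult[OF W W]])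
    also have "(LINT z|lborel. dird v (\<lambda>z. W z * W z) z * dird v f z) = (LINT z|lborel. 2 * ((dird v W z * W z) * dird v f z))"
      by (rule Bochner_Integration.integral_cong) (simp_all add: dird_mult[OF W W] algebra_simps)
    finally show ?thesis by (simp add: power2_eq_square)
  qed
  have "(LINT z|lborel. f z * (dird b B z * dird c C z - (dird c B z)\<^sup>2)) = ?E1 - ?E2"
    unfolding Bochner_Integration.integral_diff[OF int[OF s(3) s(5) f] int[OF s(4) s(4) f], symmetric]
    by (rule Bochner_Integration.integral_cong) (simp_all add: BC power2_eq_square algebra_simps)
  moreover have "(LINT z|lborel. (B z)^2 * dird c (dird c f) z) = - 2 * ?P3" using sq[OF s(1), of c] by (simp add: BC)
  moreover have "(LINT z|lborel. (C z)^2 * dird b (dird b f) z) = - 2 * ?P2" by (rule sq[OF s(2)])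
  moreover have "?E1 - ?E2 = ?Q + ?P3 + ?P2"
  proof -
    have "?E1 = - (?T + ?P1)" "?E2 = - (?T + ?P2)" "?P1 = - (?P3 + ?Q)" using 1 2 3 by simp_all
    then show ?thesis by simp
  qed
  ultimately show ?thesis unfolding B_def[symmetric] C_def[symmetric] by simp
qed

lemma e2_by_parts:
  fixes U :: "complex^'n::finite \<Rightarrow> complex"
  assumes U: "smooth U" and f: "test_function f"
  shows "(LINT z|lborel. f z * ((\<Sum>b\<in>Basis. dird b (dird b U) z)^2 - (\<Sum>b\<in>Basis. \<Sum>c\<in>Basis. (dird c (dird b U) z)^2))) =
    (LINT z|lborel. (\<Sum>b\<in>Basis. \<Sum>c\<in>Basis. (dird b U z * dird c U z) * dird b (dird c f) z - (dird b U z)\<^sup>2 * dird c (dird c f) z))"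
proof -
  have s: "smooth (dird b U)" "smooth (dird c (dird b U))" for b c by (simp_all add: smooth_dird U)
  have t: "test_function (dird b (dird c f))" for b c by (intro test_dird f)
  have i0: "integrable lborel (\<lambda>z. f z * (dird b (dird b U) z * dird c (dird c U) z - (dird c (dird b U) z)\<^sup>2))" for b c
    using smooth_mult_test_integrable[OF smooth_diff[OF smooth_mult[OF s(2) s(2)] smooth_power[OF s(2)]] f] by (simp add: mult.commute)
  have i1: "integrable lborel (\<lambda>z. (dird b U z * dird c U z) * dird b (dird c f) z)"
    and i2: "integrable lborel (\<lambda>z. (dird b U z)^2 * dird c (dird c f) z)" for b c
    by (intro smooth_mult_test_integrable smooth_mult smooth_power s t)+
  let ?Q = "\<lambda>b c. LINT z|lborel. (dird b U z * dird c U z) * dird b (dird c f) z"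
  let ?R = "\<lambda>b c. LINT z|lborel. (dird b U z)^2 * dird c (dird c f) z"
  have "(LINT z|lborel. f z * ((\<Sum>b\<in>Basis. dird b (dird b U) z)^2 - (\<Sum>b\<in>Basis. \<Sum>c\<in>Basis. (dird c (dird b U) z)^2)))
      = (LINT z|lborel. (\<Sum>b\<in>Basis. \<Sum>c\<in>Basis. f z * (dird b (dird b U) z * dird c (dird c U) z - (dird c (dird b U) z)\<^sup>2)))"
    by (simp only: sum_distrib_left[symmetric] sum_subtractf power2_eq_square[of "sum _ _"] sum_product)
  also have "\<dots> = (\<Sum>b\<in>Basis. \<Sum>c\<in>Basis. LINT z|lborel. f z * (dird b (dird b U) z * dird c (dird c U) z - (dird c (dird b U) z)\<^sup>2))"
    by (subst Bochner_Integration.integral_sum; (intro Bochner_Integration.integrable_sum i0 sum.cong refl Bochner_Integration.integral_sum)?)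
  also have "\<dots> = (\<Sum>b\<in>Basis. \<Sum>c\<in>Basis. ?Q b c - ?R b c / 2 - ?R c b / 2)"
    by (intro sum.cong refl e2_pair_by_parts U f)
  also have "\<dots> = (\<Sum>b\<in>Basis. \<Sum>c\<in>Basis. ?Q b c) - (\<Sum>b\<in>Basis. \<Sum>c\<in>Basis. ?R b c / 2) - (\<Sum>b\<in>Basis. \<Sum>c\<in>Basis. ?R c b / 2)"
    by (simp only: sum_subtractf)
  also have "(\<Sum>b\<in>Basis. \<Sum>c\<in>Basis. ?R c b / 2) = (\<Sum>b\<in>Basis. \<Sum>c\<in>Basis. ?R b c / 2)" by (rule sum.swap)
  also have "(\<Sum>b\<in>Basis. \<Sum>c\<in>Basis. ?Q b c) - (\<Sum>b\<in>Basis. \<Sum>c\<in>Basis. ?R b c / 2) - (\<Sum>b\<in>Basis. \<Sum>c\<in>Basis. ?R b c / 2)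
      = (\<Sum>b\<in>Basis. \<Sum>c\<in>Basis. ?Q b c - ?R b c)"
    by (simp only: sum_subtractf sum_divide_distrib[symmetric]) simp
  also have "\<dots> = (\<Sum>b\<in>Basis. \<Sum>c\<in>Basis. LINT z|lborel. (dird b U z * dird c U z) * dird b (dird c f) z - (dird b U z)\<^sup>2 * dird c (dird c f) z)"
    by (intro sum.cong refl Bochner_Integration.integral_diff[symmetric] i1 i2)
  also have "\<dots> = (LINT z|lborel. (\<Sum>b\<in>Basis. \<Sum>c\<in>Basis. (dird b U z * dird c U z) * dird b (dird c f) z - (dird b U z)\<^sup>2 * dird c (dird c f) z))"
    by (subst Bochner_Integration.integral_sum; (intro Bochner_Integration.integrable_sum Bochner_Integration.integrable_diff i1 i2 sum.cong refl Bochner_Integration.integral_sum[symmetric])?)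
  finally show ?thesis .
qed

section \<open>Radial test functions\<close>

lemma sq_derivative: "(sq has_derivative (\<lambda>v. 2 * (z \<bullet> v))) (at z)"
  unfolding sq_def[abs_def] by (auto intro!: derivative_eq_intros simp: inner_commute)

lemma sq_nonneg: "sq z \<ge> 0" by (simp add: sq_def)

lemma sq_norm: "sq z = (norm z)^2" by (simp add: sq_def power2_norm_eq_inner)

text \<open>Functions of the squared norm, hence derivatives at s >= 0 only. The parameter
  \<open>dummy\<close> carries the index type, which is not visible in the types of the other
  parameters.\<close>

locale radial =
  fixes F F' F'' :: "real \<Rightarrow> real" and R :: real and dummy :: "'n::finite itself"
  assumes test: "test_function (cplx (\<lambda>z::complex^'n. F (sq z)))"
    and dF: "\<And>s. s \<ge> 0 \<Longrightarrow> (F has_real_derivative F' s) (at s)"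
    and dF': "\<And>s. s \<ge> 0 \<Longrightarrow> (F' has_real_derivative F'' s) (at s)"
    and cF'': "continuous_on {0..} F''"
    and zero: "\<And>s. s \<ge> R^2 \<Longrightarrow> F' s = 0" "\<And>s. s \<ge> R^2 \<Longrightarrow> F'' s = 0"
    and R: "R \<ge> 0"
begin

lemma dird_radial: "dird b (cplx (\<lambda>z::complex^'n. F (sq z))) = cplx (\<lambda>z. 2 * F' (sq z) * (z \<bullet> b))"
proof
  fix z :: "complex^'n"
  have "((\<lambda>z. F (sq z)) has_derivative (\<lambda>v. F' (sq z) * (2 * (z \<bullet> v)))) (at z)"
    by (rule has_derivative_compose[OF sq_derivative dF[OF sq_nonneg, unfolded has_field_derivative_def]])
  from dird_cplx[OF this, of b] show "dird b (cplx (\<lambda>z. F (sq z))) z = cplx (\<lambda>z. 2 * F' (sq z) * (z \<bullet> b)) z"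
    by (simp add: mult_ac)
qed

lemma dird2_radial:
  "dird c (dird b (cplx (\<lambda>z::complex^'n. F (sq z)))) z = of_real (4 * F'' (sq z) * ((z \<bullet> b) * (z \<bullet> c)) + 2 * F' (sq z) * (b \<bullet> c))"
proof -
  have "((\<lambda>z. F' (sq z)) has_derivative (\<lambda>v. F'' (sq z) * (2 * (z \<bullet> v)))) (at z)"
    by (rule has_derivative_compose[OF sq_derivative dF'[OF sq_nonneg, unfolded has_field_derivative_def]])
  then have "((\<lambda>z. 2 * F' (sq z) * (z \<bullet> b)) has_derivative (\<lambda>v. 2 * F' (sq z) * (v \<bullet> b) + 2 * (F'' (sq z) * (2 * (z \<bullet> v))) * (z \<bullet> b))) (at z)"
    by (intro has_derivative_mult has_derivative_mult_right has_derivative_inner_left has_derivative_ident)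
  from dird_cplx[OF this, of c] show ?thesis
    unfolding dird_radial by (simp add: algebra_simps inner_commute)
qed

lemma cont: "continuous_on UNIV (\<lambda>z::'a::euclidean_space. F' ((norm z)^2))" "continuous_on UNIV (\<lambda>z::'a::euclidean_space. F'' ((norm z)^2))"
proof -
  have "continuous_on {0..} F'" using dF' by (intro DERIV_continuous_on[where D=F'']) (auto intro: has_field_derivative_at_within)
  then show "continuous_on UNIV (\<lambda>z::'a. F' ((norm z)^2))"
    by (rule continuous_on_compose2) (auto intro!: continuous_intros)
  show "continuous_on UNIV (\<lambda>z::'a. F'' ((norm z)^2))"
    by (rule continuous_on_compose2[OF cF'']) (auto intro!: continuous_intros)
qed

lemma outside:
  assumes "norm z \<ge> R" shows "F' ((norm z)^2) = 0" "F'' ((norm z)^2) = 0"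
  using zero power_mono[OF assms R] by auto

lemma integrable_radial:
  fixes g :: "'a::euclidean_space \<Rightarrow> real"
  assumes "continuous_on UNIV g"
  shows "integrable lborel (\<lambda>z. g z * F' ((norm z)^2))" "integrable lborel (\<lambda>z. g z * F'' ((norm z)^2))"
proof -
  have s: "{z. g z * F' ((norm z)^2) \<noteq> 0} \<subseteq> cball 0 R" "{z. g z * F'' ((norm z)^2) \<noteq> 0} \<subseteq> cball 0 R"
    using outside linear[of "norm _" R] by fastforce+
  show "integrable lborel (\<lambda>z. g z * F' ((norm z)^2))" "integrable lborel (\<lambda>z. g z * F'' ((norm z)^2))"
    by (rule integrable_compact_support[OF _ s(1)]; intro continuous_on_mult assms cont compact_cball)
       (rule integrable_compact_support[OF _ s(2)]; intro continuous_on_mult assms cont compact_cball)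
qed

lemma measurable_radial: "(\<lambda>r::real. F' (r^2)) \<in> borel_measurable borel" "(\<lambda>r::real. F'' (r^2)) \<in> borel_measurable borel"
  using cont[where 'a=real] by (auto intro: borel_measurable_continuous_onI)

definition J :: "nat \<Rightarrow> real" where "J k = radial_int k (\<lambda>r. F' (r^2))"

lemma integral_F':
  fixes \<psi> :: "complex^'n \<Rightarrow> real"
  assumes "homog k \<psi>"
  shows "integrable lborel (\<lambda>z. \<psi> z * F' (sq z))" "(LINT z|lborel. \<psi> z * F' (sq z)) = sphere_int k \<psi> * J (DIM(complex^'n) + k - 1)"
  unfolding J_def sq_norm
  by (rule radial_integral[OF assms measurable_radial(1)]; intro integrable_radial continuous_intros)+

text \<open>The Laplacian of F (|z|^2) is 4 |z|^2 F'' + 2 N F', with N the real dimension, and has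
  integral 0. This expresses the radial integral of F'' through that of F', and the radial integral
  is the same for every homogeneous function of degree 2.\<close>

lemma radial_int_F'':
  fixes \<psi> :: "complex^'n \<Rightarrow> real"
  assumes h: "homog 2 \<psi>"
  shows "integrable lborel (\<lambda>z. \<psi> z * F'' (sq z))"
    "(LINT z|lborel. \<psi> z * F'' (sq z)) = - (real DIM(complex^'n) / 2) * (sphere_int 2 \<psi> * J (DIM(complex^'n) - 1))"
proof -
  let ?N = "DIM(complex^'n)"
  define K where "K = radial_int (?N + 2 - 1) (\<lambda>r. F'' (r^2))"
  have *: "integrable lborel (\<lambda>z. \<psi> z * F'' (sq z))" "(LINT z|lborel. \<psi> z * F'' (sq z)) = sphere_int 2 \<psi> * K"
    if "homog 2 \<psi>" for \<psi> :: "complex^'n \<Rightarrow> real"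
    unfolding K_def sq_norm
    by (rule radial_integral[OF that measurable_radial(2)]; intro integrable_radial continuous_intros)+
  show "integrable lborel (\<lambda>z. \<psi> z * F'' (sq z))" by (rule *[OF h])
  have sqh: "homog 2 (sq :: complex^'n \<Rightarrow> real)" using homog_norm_power[of 2, where 'a="complex^'n"] by (simp add: sq_norm[abs_def])
  have h1: "homog 0 (\<lambda>_::complex^'n. 1)" by (rule homog_const)
  have s2: "sphere_int 2 (sq :: complex^'n \<Rightarrow> real) = sphere_int 0 (\<lambda>_::complex^'n. 1)"
    using sphere_int_norm_power[OF h1, of 2] by (simp add: sq_norm[abs_def])
  have pos: "sphere_int 0 (\<lambda>_::complex^'n. 1) \<noteq> 0"
    using gauss_radial_integral(2)[OF homog_const[of 1], where 'a = "complex^'n"] gauss_integral_pos[where 'a = "complex^'n"] by auto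
  have "(LINT z|lborel. (4 * (sq (z::complex^'n) * F'' (sq z)) + 2 * real ?N * (1 * F' (sq z)))) = 0"
  proof -
    have i: "integrable lborel (dird b (dird b (cplx (\<lambda>z::complex^'n. F (sq z)))))" for b
      by (intro test_integrable test_dird test)
    have "(LINT z|lborel. (\<Sum>b\<in>Basis. dird b (dird b (cplx (\<lambda>z::complex^'n. F (sq z)))) z)) = 0"
      using i by (simp add: Bochner_Integration.integral_sum test_integral_dird test_dird test)
    moreover have "(\<Sum>b\<in>Basis. dird b (dird b (cplx (\<lambda>z::complex^'n. F (sq z)))) z) = of_real (4 * (sq z * F'' (sq z)) + 2 * real ?N * (1 * F' (sq z)))" for z
    proof -
      have "(\<Sum>b\<in>Basis. (z \<bullet> b) * (z \<bullet> b)) = sq z" by (simp only: sq_def euclidean_inner[of z z])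
      then have "(\<Sum>b\<in>Basis. 4 * F'' (sq z) * ((z \<bullet> b) * (z \<bullet> b)) + 2 * F' (sq z) * (b \<bullet> b)) = 4 * (sq z * F'' (sq z)) + 2 * real ?N * (1 * F' (sq z))"
        by (simp add: sum.distrib sum_distrib_left[symmetric])
      then show ?thesis unfolding dird2_radial of_real_sum[symmetric] by (rule arg_cong)
    qed
    ultimately show ?thesis by (simp only: integral_complex_of_real of_real_eq_0_iff)
  qed
  then have "4 * (sphere_int 0 (\<lambda>_::complex^'n. 1) * K) + 2 * real ?N * (sphere_int 0 (\<lambda>_::complex^'n. 1) * J (?N - 1)) = 0"
    unfolding Bochner_Integration.integral_add[OF integrable_mult_right[OF *(1)[OF sqh]] integrable_mult_right[OF integral_F'(1)[OF h1]]]
      integral_mult_right_zero *(2)[OF sqh] s2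
    using integral_F'(2)[OF h1] by simp
  then have "sphere_int 0 (\<lambda>_::complex^'n. 1) * (4 * K + 2 * real ?N * J (?N - 1)) = 0" by (simp add: algebra_simps)
  then have "K = - (real ?N / 2) * J (?N - 1)" using pos by simp
  then show "(LINT z|lborel. \<psi> z * F'' (sq z)) = - (real DIM(complex^'n) / 2) * (sphere_int 2 \<psi> * J (DIM(complex^'n) - 1))"
    using *(2)[OF h] by simp
qed

text \<open>The Hessian of the test function is 4 F'' z z^T + 2 F' I; by \<open>e2_by_parts\<close>
  it is contracted with m m^T - |m|^2 I.\<close>

lemma e2_radial:
  fixes u :: "complex^'n \<Rightarrow> real" and m :: "complex^'n \<Rightarrow> complex^'n"
  assumes u: "smooth (cplx u)" and m: "\<And>w. dird w (cplx u) = cplx (\<lambda>z. m z \<bullet> w)"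
  shows "(LINT z|lborel. cplx (\<lambda>z. F (sq z)) z * ((\<Sum>b\<in>Basis. dird b (dird b (cplx u)) z)^2 - (\<Sum>b\<in>Basis. \<Sum>c\<in>Basis. (dird c (dird b (cplx u)) z)^2))) =
    of_real (LINT z|lborel. 4 * (((z \<bullet> m z)^2 - sq z * (norm (m z))^2) * F'' (sq z)) - 2 * (real DIM(complex^'n) - 1) * ((norm (m z))^2 * F' (sq z)))"
proof -
  have *: "(\<Sum>b\<in>Basis. \<Sum>c\<in>Basis. (m z \<bullet> b * (m z \<bullet> c)) * (4 * F'' (sq z) * ((z \<bullet> c) * (z \<bullet> b)) + 2 * F' (sq z) * (c \<bullet> b)) - (m z \<bullet> b)\<^sup>2 * (4 * F'' (sq z) * ((z \<bullet> c) * (z \<bullet> c)) + 2 * F' (sq z) * (c \<bullet> c)))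
     = 4 * (((z \<bullet> m z)^2 - sq z * (norm (m z))^2) * F'' (sq z)) - 2 * (real DIM(complex^'n) - 1) * ((norm (m z))^2 * F' (sq z))" (is "?L = _") for z :: "complex^'n"
  proof -
    let ?y = "m z"
    have n: "(norm x)^2 = (\<Sum>b\<in>Basis. (x \<bullet> b)^2)" for x :: "complex^'n"
      unfolding power2_norm_eq_inner unfolding euclidean_inner[of x x] power2_eq_square ..
    have a: "(\<Sum>b\<in>Basis. \<Sum>c\<in>Basis. (?y \<bullet> b * (?y \<bullet> c)) * ((z \<bullet> c) * (z \<bullet> b))) = (z \<bullet> ?y)^2"
      unfolding power2_eq_square euclidean_inner[of z ?y] sum_product by (intro sum.cong refl) (simp add: mult_ac)
    have b: "(\<Sum>b\<in>Basis. \<Sum>c\<in>Basis. (?y \<bullet> b * (?y \<bullet> c)) * (c \<bullet> b)) = (norm ?y)^2"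
    proof -
      have "(\<Sum>c\<in>Basis. (?y \<bullet> b * (?y \<bullet> c)) * (c \<bullet> b)) = (?y \<bullet> b) * (?y \<bullet> b)" if "b \<in> Basis" for b
        using that by (simp add: inner_Basis if_distrib[of "\<lambda>x. _ * x"] sum.delta cong: if_cong)
      then show ?thesis unfolding power2_norm_eq_inner euclidean_inner[of ?y ?y] by simp
    qed
    have c: "(\<Sum>b\<in>Basis. \<Sum>c\<in>Basis. (?y \<bullet> b)^2 * ((z \<bullet> c) * (z \<bullet> c))) = sq z * (norm ?y)^2"
      unfolding n sq_def euclidean_inner[of z z] sum_product
      by (subst sum.swap) (intro sum.cong refl mult.commute)
    have d: "(\<Sum>b\<in>Basis. \<Sum>c\<in>(Basis::(complex^'n) set). (?y \<bullet> b)^2 * (c \<bullet> c)) = real DIM(complex^'n) * (norm ?y)^2"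
      unfolding n by (simp add: sum_distrib_left mult.commute)
    have "?L = (\<Sum>b\<in>Basis. \<Sum>c\<in>Basis. (4 * F'' (sq z)) * ((?y \<bullet> b * (?y \<bullet> c)) * ((z \<bullet> c) * (z \<bullet> b))) + (2 * F' (sq z)) * ((?y \<bullet> b * (?y \<bullet> c)) * (c \<bullet> b))
        - ((4 * F'' (sq z)) * ((?y \<bullet> b)^2 * ((z \<bullet> c) * (z \<bullet> c))) + (2 * F' (sq z)) * ((?y \<bullet> b)^2 * (c \<bullet> c))))"
      by (intro sum.cong refl) (simp add: algebra_simps)
    also have "\<dots> = (4 * F'' (sq z)) * (z \<bullet> ?y)^2 + (2 * F' (sq z)) * (norm ?y)^2 - ((4 * F'' (sq z)) * (sq z * (norm ?y)^2) + (2 * F' (sq z)) * (real DIM(complex^'n) * (norm ?y)^2))"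
      unfolding sum_subtractf sum.distrib sum_distrib_left[where r="4 * F'' (sq z)", symmetric] sum_distrib_left[where r="2 * F' (sq z)", symmetric] a b c d ..
    finally show ?thesis by (simp add: algebra_simps)
  qed
  have "(\<Sum>b\<in>Basis. \<Sum>c\<in>Basis. (dird b (cplx u) z * dird c (cplx u) z) * dird b (dird c (cplx (\<lambda>z. F (sq z)))) z - (dird b (cplx u) z)\<^sup>2 * dird c (dird c (cplx (\<lambda>z. F (sq z)))) z)
     = of_real (\<Sum>b\<in>Basis. \<Sum>c\<in>Basis. (m z \<bullet> b * (m z \<bullet> c)) * (4 * F'' (sq z) * ((z \<bullet> c) * (z \<bullet> b)) + 2 * F' (sq z) * (c \<bullet> b)) - (m z \<bullet> b)\<^sup>2 * (4 * F'' (sq z) * ((z \<bullet> c) * (z \<bullet> c)) + 2 * F' (sq z) * (c \<bullet> c)))" for z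
    unfolding m dird2_radial by (simp only: of_real_sum of_real_diff of_real_mult of_real_power)
  then show ?thesis unfolding e2_by_parts[OF u test] * by (simp only: integral_complex_of_real)
qed

lemma laplacian_radial:
  fixes u :: "complex^'n \<Rightarrow> real" and m :: "complex^'n \<Rightarrow> complex^'n"
  assumes u: "smooth (cplx u)" and m: "\<And>w. dird w (cplx u) = cplx (\<lambda>z. m z \<bullet> w)"
  shows "(LINT z|lborel. cplx (\<lambda>z. F (sq z)) z * (\<Sum>b\<in>Basis. dird b (dird b (cplx u)) z)) = of_real (- 2 * (LINT z|lborel. (z \<bullet> m z) * F' (sq z)))"
proof -
  let ?f = "cplx (\<lambda>z::complex^'n. F (sq z))"
  have s: "smooth (dird b (cplx u))" for b by (rule smooth_dird[OF u])
  have i: "integrable lborel (\<lambda>z. dird b (dird b (cplx u)) z * ?f z)" "integrable lborel (\<lambda>z. dird b (cplx u) z * dird b ?f z)" for b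
    by (intro smooth_mult_test_integrable s smooth_dird test_dird test)+
  have "(LINT z|lborel. ?f z * (\<Sum>b\<in>Basis. dird b (dird b (cplx u)) z)) = (LINT z|lborel. (\<Sum>b\<in>Basis. dird b (dird b (cplx u)) z * ?f z))"
    by (rule Bochner_Integration.integral_cong) (simp, subst mult.commute, rule sum_distrib_right)
  also have "\<dots> = (\<Sum>b\<in>Basis. LINT z|lborel. dird b (dird b (cplx u)) z * ?f z)" by (intro Bochner_Integration.integral_sum i)
  also have "\<dots> = (\<Sum>b\<in>Basis. - (LINT z|lborel. dird b (cplx u) z * dird b ?f z))"
    using test_integral_by_parts[OF test s] by simp
  also have "\<dots> = - (LINT z|lborel. (\<Sum>b\<in>Basis. dird b (cplx u) z * dird b ?f z))"
    by (subst Bochner_Integration.integral_sum) (auto intro: i simp: sum_negf)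
  also have "(\<lambda>z. \<Sum>b\<in>Basis. dird b (cplx u) z * dird b ?f z) = (\<lambda>z. of_real (2 * ((z \<bullet> m z) * F' (sq z))))"
  proof
    fix z :: "complex^'n"
    have "(\<Sum>b\<in>Basis. (m z \<bullet> b) * (2 * F' (sq z) * (z \<bullet> b))) = 2 * ((z \<bullet> m z) * F' (sq z))"
      unfolding euclidean_inner[of z "m z"] sum_distrib_left sum_distrib_right by (intro sum.cong refl) (simp add: mult_ac)
    then show "(\<Sum>b\<in>Basis. dird b (cplx u) z * dird b ?f z) = of_real (2 * ((z \<bullet> m z) * F' (sq z)))"
      unfolding m dird_radial by (simp flip: of_real_mult of_real_sum)
  qed
  finally show ?thesis by (simp only: integral_complex_of_real integral_mult_right_zero mult_minus_left of_real_minus)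
qed

end

section \<open>Smooth approximations of the norm\<close>

definition soft_norm :: "real \<Rightarrow> complex^'n \<Rightarrow> real" where
  "soft_norm e z = sqrt (sq z + e)"

lemma soft_norm_pos: "e > 0 \<Longrightarrow> soft_norm e z > 0"
  using sq_nonneg[of z] by (simp add: soft_norm_def)

lemma soft_norm_square: "e > 0 \<Longrightarrow> soft_norm e z * soft_norm e z = sq z + e"
  using sq_nonneg[of z] by (simp add: soft_norm_def)

lemma smooth_soft_norm:
  assumes "e > 0" shows "smooth (cplx (soft_norm e :: complex^'n::finite \<Rightarrow> real))"
proof -
  have "smooth (\<lambda>z::complex^'n. of_real (sqrt (sq z + e)))"
  proof (rule smooth_compose_real[OF smooth_sq, where S="{- e<..}" and \<psi>="\<lambda>s. sqrt (s + e)"])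
    show "sq z \<in> {- e<..}" for z :: "complex^'n" using sq_nonneg[of z] assms by simp
    show "Dk {- e<..} k (\<lambda>s. sqrt (s + e))" for k by (rule Dk_sqrt) (auto intro: Dk_add Dk_ident Dk_const)
  qed
  then show ?thesis by (simp add: soft_norm_def[abs_def])
qed

lemma soft_norm_derivative: "e > 0 \<Longrightarrow> (soft_norm e has_derivative (\<lambda>w. (z \<bullet> w) / soft_norm e z)) (at z)"
  unfolding soft_norm_def[abs_def] using sq_nonneg[of z]
  by (auto intro!: derivative_eq_intros sq_derivative simp: fun_eq_iff field_simps)

text \<open>By Lagrange's identity, the Hessian of the soft norm is a sum of squares of the forms
  \<open>w \<mapsto> w \<bullet> b\<close> and \<open>w \<mapsto> (z \<bullet> b)(w \<bullet> c) - (z \<bullet> c)(w \<bullet> b)\<close>.\<close>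

lemma spsh_soft_norm:
  assumes e: "e > 0" shows "spsh (soft_norm e :: complex^'n::finite \<Rightarrow> real)"
  unfolding spsh_def
proof (intro conjI allI)
  show "smooth (cplx (soft_norm e :: complex^'n \<Rightarrow> real))" by (rule smooth_soft_norm[OF e])
  fix z :: "complex^'n"
  define \<rho> where "\<rho> = soft_norm e z"
  have \<rho>: "\<rho> > 0" "\<rho> * \<rho> = z \<bullet> z + e" using soft_norm_pos[OF e, of z] soft_norm_square[OF e, of z] by (simp_all add: \<rho>_def sq_def)
  define I where "I = (Basis :: (complex^'n) set) <+> ((Basis :: (complex^'n) set) \<times> (Basis :: (complex^'n) set))"
  define c where "c = case_sum (\<lambda>_::complex^'n. e / \<rho> ^ 3) (\<lambda>_::(complex^'n) \<times> (complex^'n). 1 / (2 * \<rho> ^ 3))"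
  define x where "x = case_sum (\<lambda>b. b) (\<lambda>(b, c). (z \<bullet> b) *\<^sub>R c - (z \<bullet> c) *\<^sub>R b)"
  show "psd (hess (soft_norm e) z)"
  proof (rule psd_hess_rank_sum[where I=I and c=c and x=x])
    show "smooth (cplx (soft_norm e :: complex^'n \<Rightarrow> real))" by (rule smooth_soft_norm[OF e])
    show "c i \<ge> 0" for i using \<rho> e by (auto simp: c_def split: sum.split)
    fix w w' :: "complex^'n"
    have ei: "(\<Sum>b\<in>Basis. (b \<bullet> y) * (b \<bullet> y')) = y \<bullet> y'" for y y' :: "complex^'n"
      unfolding euclidean_inner[of y y'] by (simp only: inner_commute)
    have L: "(\<Sum>b\<in>Basis. \<Sum>c\<in>Basis. ((z \<bullet> b) * (c \<bullet> w') - (z \<bullet> c) * (b \<bullet> w')) * ((z \<bullet> b) * (c \<bullet> w) - (z \<bullet> c) * (b \<bullet> w)))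
        = 2 * ((z \<bullet> z) * (w' \<bullet> w) - (z \<bullet> w') * (z \<bullet> w))" (is "?L = _")
    proof -
      have zc: "z \<bullet> b = b \<bullet> z" for b by (rule inner_commute)
      have "?L = (\<Sum>b\<in>Basis. \<Sum>c\<in>Basis. ((b \<bullet> z) * (b \<bullet> z)) * ((c \<bullet> w') * (c \<bullet> w)) + ((b \<bullet> w') * (b \<bullet> w)) * ((c \<bullet> z) * (c \<bullet> z))
          - ((b \<bullet> z) * (b \<bullet> w)) * ((c \<bullet> z) * (c \<bullet> w')) - ((b \<bullet> z) * (b \<bullet> w')) * ((c \<bullet> z) * (c \<bullet> w)))"
        unfolding zc by (intro sum.cong refl) (simp add: algebra_simps)
      also have "\<dots> = (z \<bullet> z) * (w' \<bullet> w) + (w' \<bullet> w) * (z \<bullet> z) - (z \<bullet> w) * (z \<bullet> w') - (z \<bullet> w') * (z \<bullet> w)"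
        by (simp only: sum_subtractf sum.distrib sum_product[symmetric] ei)
      finally show ?thesis by simp
    qed
    have d1: "dird w (cplx (soft_norm e)) = cplx (\<lambda>z::complex^'n. (z \<bullet> w) / soft_norm e z)"
      by (rule ext) (rule dird_cplx[OF soft_norm_derivative[OF e]])
    have "((\<lambda>z. (z \<bullet> w) / soft_norm e z) has_derivative (\<lambda>v. - (z \<bullet> w) * (inverse (soft_norm e z) * ((z \<bullet> v) / soft_norm e z) * inverse (soft_norm e z)) + (v \<bullet> w) / soft_norm e z)) (at z)"
      using soft_norm_pos[OF e, of z] by (intro has_derivative_divide soft_norm_derivative e has_derivative_inner_left has_derivative_ident) simp
    from dird_cplx[OF this, of w'] have "dird w' (dird w (cplx (soft_norm e))) z = of_real ((w' \<bullet> w) / \<rho> - (z \<bullet> w) * (z \<bullet> w') / \<rho> ^ 3)"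
      unfolding d1 \<rho>_def[symmetric] by (simp add: divide_inverse power3_eq_cube mult_ac)
    also have "(w' \<bullet> w) / \<rho> - (z \<bullet> w) * (z \<bullet> w') / \<rho> ^ 3 = (e * (w' \<bullet> w) + ((z \<bullet> z) * (w' \<bullet> w) - (z \<bullet> w') * (z \<bullet> w))) / \<rho> ^ 3"
    proof -
      have "(w' \<bullet> w) / \<rho> = (\<rho> * \<rho>) * (w' \<bullet> w) / \<rho> ^ 3" using \<rho>(1) by (simp add: power3_eq_cube)
      then show ?thesis unfolding \<rho>(2) by (simp add: diff_divide_distrib add_divide_distrib algebra_simps)
    qed
    also have "\<dots> = (\<Sum>i\<in>I. c i * ((x i \<bullet> w') * (x i \<bullet> w)))"
    proof -
      have "(\<Sum>i\<in>I. c i * ((x i \<bullet> w') * (x i \<bullet> w))) = (\<Sum>b\<in>Basis. (e / \<rho> ^ 3) * ((b \<bullet> w') * (b \<bullet> w)))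
          + (\<Sum>b\<in>Basis. \<Sum>c\<in>Basis. (1 / (2 * \<rho> ^ 3)) * (((z \<bullet> b) * (c \<bullet> w') - (z \<bullet> c) * (b \<bullet> w')) * ((z \<bullet> b) * (c \<bullet> w) - (z \<bullet> c) * (b \<bullet> w))))"
        unfolding I_def by (simp add: sum.Plus c_def x_def sum.cartesian_product inner_diff_left split_beta)
      also have "\<dots> = (e / \<rho> ^ 3) * (w' \<bullet> w) + (1 / (2 * \<rho> ^ 3)) * (2 * ((z \<bullet> z) * (w' \<bullet> w) - (z \<bullet> w') * (z \<bullet> w)))"
        unfolding sum_distrib_left[symmetric] ei L ..
      also have "\<dots> = (e * (w' \<bullet> w) + ((z \<bullet> z) * (w' \<bullet> w) - (z \<bullet> w') * (z \<bullet> w))) / \<rho> ^ 3"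
        using \<rho>(1) by (simp add: field_simps)
      finally show ?thesis by simp
    qed
    finally show "dird w' (dird w (cplx (soft_norm e))) z = of_real (\<Sum>i\<in>I. c i * ((x i \<bullet> w') * (x i \<bullet> w)))" .
  qed
qed

section \<open>Support functions\<close>

lemma Re_hermitian_product: "Re (hermitian_product z v) = z \<bullet> v"
  by (simp add: hermitian_product_def inner_vec_def inner_complex_def)

lemma support_function_alt: "support_function A z = (SUP v\<in>A. z \<bullet> v)"
  by (simp add: support_function_def Re_hermitian_product)

lemma support_function_cball: "support_function (cball 0 1) z = norm (z :: complex^'n::finite)"
  unfolding support_function_alt
proof (rule cSup_eq_maximum)
  show "norm z \<in> (\<lambda>v. z \<bullet> v) ` cball 0 1"
  proof (rule image_eqI[where x="sgn z"])
    show "norm z = z \<bullet> sgn z" by (cases "z = 0") (simp_all add: sgn_div_norm power2_norm_eq_inner[symmetric] power2_eq_square)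
  qed (simp add: norm_sgn)
  show "y \<le> norm z" if y: "y \<in> (\<lambda>v. z \<bullet> v) ` cball 0 1" for y
  proof -
    obtain v where v: "y = z \<bullet> v" "norm v \<le> 1" using y by auto
    have "z \<bullet> v \<le> norm z * norm v" by (rule norm_cauchy_schwarz)
    also have "\<dots> \<le> norm z * 1" by (rule mult_left_mono[OF v(2)]) simp
    finally show ?thesis by (simp add: v)
  qed
qed

lemma approximates_norm:
  assumes "\<And>m. e m > 0" "e \<longlonglongrightarrow> 0"
  shows "approximates (norm :: complex^'n::finite \<Rightarrow> real) (\<lambda>m. soft_norm (e m))"
  unfolding approximates_def
proof (intro conjI allI)
  show "spsh (soft_norm (e m))" for m by (rule spsh_soft_norm[OF assms(1)])
  have bd: "dist (soft_norm (e m) z) (norm z) \<le> sqrt (e m)" for m and z :: "complex^'n"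
  proof -
    have "norm z \<le> soft_norm (e m) z" unfolding soft_norm_def sq_norm using assms(1)[of m] by (intro real_le_rsqrt) simp
    moreover have "soft_norm (e m) z \<le> sqrt (sq z) + sqrt (e m)"
      unfolding soft_norm_def using assms(1)[of m] sq_nonneg[of z] by (intro sqrt_add_le_add_sqrt) auto
    ultimately show ?thesis by (simp add: dist_real_def sq_norm)
  qed
  have "(\<lambda>m. sqrt (e m)) \<longlonglongrightarrow> 0" using tendsto_real_sqrt[OF assms(2)] by simp
  then show "uniform_limit (cball 0 R) (\<lambda>m. soft_norm (e m)) (norm :: complex^'n \<Rightarrow> real) sequentially" for R
    unfolding uniform_limit_iff
  proof (intro allI impI)
    fix \<delta> :: real assume "\<delta> > 0"
    then have "\<forall>\<^sub>F m in sequentially. sqrt (e m) < \<delta>" using \<open>(\<lambda>m. sqrt (e m)) \<longlonglongrightarrow> 0\<close> by (rule order_tendstoD(2)[rotated])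
    then show "\<forall>\<^sub>F m in sequentially. \<forall>z\<in>cball (0::complex^'n) R. dist (soft_norm (e m) z) (norm z) < \<delta>"
    proof eventually_elim
      case (elim m)
      then show ?case using le_less_trans[OF bd[of m]] by blast
    qed
  qed
qed

section \<open>Limits of the radial integrals as the soft maxima sharpen\<close>

context radial begin

context
  fixes P :: "(complex^'n) set"
  assumes P: "finite P" "P \<noteq> {}"
begin

abbreviation (input) grd :: "nat \<Rightarrow> complex^'n \<Rightarrow> complex^'n" where "grd i \<equiv> lse_grad P (real (Suc i))"

lemma grd_limit:
  "(\<lambda>i. z \<bullet> grd i z) \<longlonglongrightarrow> fin_support P z" "(\<lambda>i. (norm (grd i z))^2) \<longlonglongrightarrow> (norm (face_mean P z))^2"
proof -
  have "(\<lambda>i. z \<bullet> grd i z) \<longlonglongrightarrow> z \<bullet> face_mean P z" by (intro tendsto_intros lse_grad_limit P)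
  then show "(\<lambda>i. z \<bullet> grd i z) \<longlonglongrightarrow> fin_support P z" by (simp only: inner_commute[of z] face_mean_inner[OF P])
  show "(\<lambda>i. (norm (grd i z))^2) \<longlonglongrightarrow> (norm (face_mean P z))^2" by (intro tendsto_intros lse_grad_limit P)
qed

lemma grd_continuous: "continuous_on UNIV (grd i)"
  by (rule continuous_lse_grad[OF P]) simp

lemma laplacian_limit:
  "(\<lambda>i. LINT z|lborel. (z \<bullet> grd i z) * F' (sq z)) \<longlonglongrightarrow> sphere_int 1 (fin_support P) * J DIM(complex^'n)"
proof -
  obtain M where M: "\<And>v. v \<in> P \<Longrightarrow> norm v \<le> M" "M \<ge> 0" using norm_bound[OF P] by blast
  have "(\<lambda>i. LINT z|lborel. (z \<bullet> grd i z) * F' (sq z)) \<longlonglongrightarrow> (LINT z|lborel. fin_support P z * F' (sq z))"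
  proof (rule integral_dominated_convergence[where w="\<lambda>z. \<bar>(M * norm z) * F' ((norm z)^2)\<bar>"])
    show "(\<lambda>z. fin_support P z * F' (sq z)) \<in> borel_measurable lborel"
      using integral_F'(1)[OF homog_fin_support[OF P]] by (rule borel_measurable_integrable)
    show "(\<lambda>z. (z \<bullet> grd i z) * F' (sq z)) \<in> borel_measurable lborel" for i
      unfolding sq_norm measurable_lborel2
      by (intro borel_measurable_continuous_onI continuous_intros grd_continuous cont)
    show "integrable lborel (\<lambda>z::complex^'n. \<bar>(M * norm z) * F' ((norm z)^2)\<bar>)"
      by (intro integrable_abs integrable_radial continuous_intros)
    show "AE z in lborel. (\<lambda>i. (z \<bullet> grd i z) * F' (sq z)) \<longlonglongrightarrow> fin_support P z * F' (sq z)"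
      by (intro AE_I2 tendsto_mult_right grd_limit)
    show "AE z in lborel. norm ((z \<bullet> grd i z) * F' (sq z)) \<le> \<bar>(M * norm z) * F' ((norm z)^2)\<bar>" for i
    proof (rule AE_I2)
      fix z :: "complex^'n"
      have "norm (grd i z) \<le> M" by (rule norm_lse_grad_le[OF P _ M(1)]) simp
      then have "\<bar>z \<bullet> grd i z\<bar> \<le> M * norm z"
        using Cauchy_Schwarz_ineq2[of z "grd i z"] mult_left_mono[of "norm (grd i z)" M "norm z"] by (simp add: mult.commute)
      then show "norm ((z \<bullet> grd i z) * F' (sq z)) \<le> \<bar>(M * norm z) * F' ((norm z)^2)\<bar>"
        using M(2) by (simp add: abs_mult sq_norm mult_right_mono)
    qed
  qed
  then show ?thesis using integral_F'(2)[OF homog_fin_support[OF P]] by simp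
qed

text \<open>After the integral with F'' has been rewritten by \<open>radial_int_F''\<close>, the
  coefficient of the squared gradient collapses to N - (N - 1) = 1, while that of the squared
  support function stays N: this is the combination bounded by Poincare's inequality.\<close>

lemma e2_limit:
  "(\<lambda>i. LINT z|lborel. 4 * (((z \<bullet> grd i z)^2 - sq z * (norm (grd i z))^2) * F'' (sq z)) - 2 * (real DIM(complex^'n) - 1) * ((norm (grd i z))^2 * F' (sq z)))
    \<longlonglongrightarrow> - 2 * J (DIM(complex^'n) - 1) * (real DIM(complex^'n) * sphere_int 2 (\<lambda>z. (fin_support P z)^2) - sphere_int 0 (\<lambda>z. (norm (face_mean P z))^2))"
proof -
  define N where "N = real DIM(complex^'n)"
  have N: "N \<ge> 1" using DIM_positive[where 'a="complex^'n"] by (simp only: N_def Suc_le_eq real_of_nat_ge_one_iff One_nat_def)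
  obtain M where M: "\<And>v. v \<in> P \<Longrightarrow> norm v \<le> M" "M \<ge> 0" using norm_bound[OF P] by blast
  \<comment> \<open>The squared norm lifts the squared gradient from degree 0 to the degree 2
    required by \<open>radial_int_F''\<close>, without changing its sphere integral.\<close>
  define \<psi> where "\<psi> z = (fin_support P z)^2 + (- 1) * (norm z ^ 2 * (norm (face_mean P z))^2)" for z
  let ?I = "\<lambda>i z. 4 * (((z \<bullet> grd i z)^2 - sq z * (norm (grd i z))^2) * F'' (sq z)) - 2 * (N - 1) * ((norm (grd i z))^2 * F' (sq z))"
  let ?L = "\<lambda>z. 4 * (\<psi> z * F'' (sq z)) - 2 * (N - 1) * ((norm (face_mean P z))^2 * F' (sq z))"
  let ?W = "\<lambda>z::complex^'n. \<bar>(8 * M^2 * norm z ^ 2) * F'' ((norm z)^2)\<bar> + \<bar>(2 * N * M^2) * F' ((norm z)^2)\<bar>"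
  have hh: "homog 2 (\<lambda>z. (fin_support P z)^2)"
    using homog_mult[OF homog_fin_support[OF P] homog_fin_support[OF P]] by (simp add: power2_eq_square numeral_2_eq_2)
  have hG: "homog 2 (\<lambda>z. norm z ^ 2 * (norm (face_mean P z))^2)"
    using homog_mult[OF homog_norm_power[of 2] homog_face_mean[OF P]] by simp
  have h: "homog 2 \<psi>" unfolding \<psi>_def[abs_def] by (intro homog_add homog_cmult hh hG)
  have S: "sphere_int 2 \<psi> = sphere_int 2 (\<lambda>z. (fin_support P z)^2) - sphere_int 0 (\<lambda>z. (norm (face_mean P z))^2)"
    unfolding \<psi>_def[abs_def] sphere_int_add[OF hh homog_cmult[OF hG]] sphere_int_cmult
    using sphere_int_norm_power[OF homog_face_mean[OF P], of 2] by simp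
  have i1: "integrable lborel (\<lambda>z. 4 * (\<psi> z * F'' (sq z)))" by (intro integrable_mult_right radial_int_F''(1) h)
  have i2: "integrable lborel (\<lambda>z. 2 * (N - 1) * ((norm (face_mean P z))^2 * F' (sq z)))"
    by (intro integrable_mult_right integral_F'(1)[OF homog_face_mean[OF P]])
  have "(\<lambda>i. LINT z|lborel. ?I i z)
    \<longlonglongrightarrow> (LINT z|lborel. ?L z)"
  proof (rule integral_dominated_convergence[where w="\<lambda>z. ?W z"])
    show "(\<lambda>z. ?L z) \<in> borel_measurable lborel"
      by (intro borel_measurable_integrable Bochner_Integration.integrable_diff i1 i2)
    show "(\<lambda>z. ?I i z) \<in> borel_measurable lborel" for i
      unfolding sq_norm measurable_lborel2
      by (intro borel_measurable_continuous_onI continuous_intros grd_continuous cont)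
    show "integrable lborel (\<lambda>z::complex^'n. ?W z)"
      by (intro Bochner_Integration.integrable_add integrable_abs integrable_radial continuous_intros)
    show "AE z in lborel. (\<lambda>i. ?I i z)
      \<longlonglongrightarrow> ?L z"
    proof (rule AE_I2)
      fix z :: "complex^'n"
      have "\<psi> z = (fin_support P z)^2 - sq z * (norm (face_mean P z))^2" by (simp add: \<psi>_def sq_norm)
      then show "(\<lambda>i. ?I i z)
        \<longlonglongrightarrow> ?L z"
        by (simp only:) (intro tendsto_diff tendsto_mult tendsto_power tendsto_const grd_limit)
    qed
    show "AE z in lborel. norm (?I i z)
      \<le> ?W z" for i
    proof (rule AE_I2)
      fix z :: "complex^'n"
      have "norm (grd i z) \<le> M" by (rule norm_lse_grad_le[OF P _ M(1)]) simp
      then have g: "(norm (grd i z))^2 \<le> M^2" by (intro power_mono) auto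
      have "(z \<bullet> grd i z)^2 \<le> (norm z)^2 * (norm (grd i z))^2"
        using Cauchy_Schwarz_ineq[of z "grd i z"] by (simp add: power2_norm_eq_inner)
      then have "\<bar>(z \<bullet> grd i z)^2 - sq z * (norm (grd i z))^2\<bar> \<le> (norm z)^2 * (norm (grd i z))^2"
        by (simp add: abs_le_iff sq_norm)
      also have "\<dots> \<le> (norm z)^2 * M^2" by (rule mult_left_mono[OF g]) simp
      finally have a: "\<bar>(z \<bullet> grd i z)^2 - sq z * (norm (grd i z))^2\<bar> \<le> 2 * M^2 * norm z ^ 2"
        using mult_nonneg_nonneg[of "(norm z)^2" "M^2"] by (simp add: mult_ac)
      have "\<bar>4 * (((z \<bullet> grd i z)^2 - sq z * (norm (grd i z))^2) * F'' (sq z))\<bar> = 4 * (\<bar>(z \<bullet> grd i z)^2 - sq z * (norm (grd i z))^2\<bar> * \<bar>F'' (sq z)\<bar>)"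
        by (simp add: abs_mult)
      also have "\<dots> \<le> 4 * ((2 * M^2 * norm z ^ 2) * \<bar>F'' (sq z)\<bar>)" by (intro mult_left_mono mult_right_mono a) auto
      finally have A: "\<bar>4 * (((z \<bullet> grd i z)^2 - sq z * (norm (grd i z))^2) * F'' (sq z))\<bar> \<le> \<bar>(8 * M^2 * norm z ^ 2) * F'' ((norm z)^2)\<bar>"
        by (simp add: abs_mult sq_norm)
      have "\<bar>2 * (N - 1) * ((norm (grd i z))^2 * F' (sq z))\<bar> = (2 * (N - 1)) * ((norm (grd i z))^2 * \<bar>F' (sq z)\<bar>)"
        using N by (simp add: abs_mult)
      also have "\<dots> \<le> (2 * N) * (M^2 * \<bar>F' (sq z)\<bar>)" using N by (intro mult_mono mult_right_mono g) auto
      finally have "\<bar>2 * (N - 1) * ((norm (grd i z))^2 * F' (sq z))\<bar> \<le> \<bar>(2 * N * M^2) * F' ((norm z)^2)\<bar>"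
        using N by (simp add: abs_mult sq_norm mult.assoc)
      with A show "norm (?I i z)
        \<le> ?W z"
        unfolding real_norm_def by (intro order_trans[OF abs_triangle_ineq4] add_mono)
    qed
  qed
  also have "(LINT z|lborel. ?L z)
     = 4 * (LINT z|lborel. \<psi> z * F'' (sq z)) - 2 * (N - 1) * (LINT z|lborel. (norm (face_mean P z))^2 * F' (sq z))"
    unfolding Bochner_Integration.integral_diff[OF i1 i2] integral_mult_right_zero ..
  also have "(LINT z|lborel. \<psi> z * F'' (sq z)) = - (N / 2) * ((sphere_int 2 (\<lambda>z. (fin_support P z)^2) - sphere_int 0 (\<lambda>z. (norm (face_mean P z))^2)) * J (DIM(complex^'n) - 1))"
    unfolding radial_int_F''(2)[OF h] S N_def ..
  also have "(LINT z|lborel. (norm (face_mean P z))^2 * F' (sq z)) = sphere_int 0 (\<lambda>z. (norm (face_mean P z))^2) * J (DIM(complex^'n) - 1)"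
    using integral_F'(2)[OF homog_face_mean[OF P]] by simp
  finally show ?thesis unfolding N_def[symmetric] by (simp add: algebra_simps)
qed

end

end

section \<open>Replacing the soft norm by the square\<close>

lemma DERIV_deriv_Dk:
  assumes "open S" "\<And>k. Dk S k f"
  shows "s \<in> S \<Longrightarrow> (f has_real_derivative deriv f s) (at s)" "Dk S k (deriv f)"
proof -
  have d: "(f has_real_derivative deriv f s) (at s)" if "s \<in> S" for s
    using assms(2)[of "Suc 0"] that by (auto simp: DERIV_imp_deriv)
  show "s \<in> S \<Longrightarrow> (f has_real_derivative deriv f s) (at s)" by (rule d)
  obtain f' where f': "\<forall>s\<in>S. (f has_real_derivative f' s) (at s)" "Dk S k f'" using assms(2)[of "Suc k"] by auto
  show "Dk S k (deriv f)"
    by (rule Dk_cong[OF assms(1) f'(2)]) (use f'(1) in \<open>auto simp: DERIV_imp_deriv\<close>)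
qed

lemma Dk_power: "(\<And>k. Dk S k f) \<Longrightarrow> Dk S k (\<lambda>s. f s ^ j)"
  by (induction j) (auto intro: Dk_mult Dk_const)

definition cutf :: "real \<Rightarrow> real \<Rightarrow> real \<Rightarrow> real" where
  "cutf \<alpha> \<beta> s = step ((\<beta>^2 - s) / (\<beta>^2 - \<alpha>\<^sup>2))"

text \<open>The derivative of sqrt (s + e), which is the factor that each soft norm hands over to
  the test function.\<close>

definition dsn :: "real \<Rightarrow> real \<Rightarrow> real" where "dsn e s = inverse (2 * sqrt (s + e))"

definition radF' :: "real \<Rightarrow> real \<Rightarrow> real \<Rightarrow> nat \<Rightarrow> real \<Rightarrow> real" where
  "radF' \<alpha> \<beta> e j s = deriv (cutf \<alpha> \<beta>) s * dsn e s ^ j"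

text \<open>The antiderivative of \<open>radF'\<close> that vanishes from \<open>\<beta>^2\<close>
  on; j counts the soft norms already replaced by squares, and j = 0 gives back the cutoff. The
  lower limit - e / 2 stays inside the domain s > - e and leaves room for a two-sided derivative at
  s = 0.\<close>

definition radF :: "real \<Rightarrow> real \<Rightarrow> real \<Rightarrow> nat \<Rightarrow> real \<Rightarrow> real" where
  "radF \<alpha> \<beta> e j s = integral {- e / 2..s} (radF' \<alpha> \<beta> e j) - integral {- e / 2..\<beta>^2} (radF' \<alpha> \<beta> e j)"

context
  fixes \<alpha> \<beta> e :: real
  assumes \<alpha>: "0 < \<alpha>" "\<alpha> < \<beta>" and e: "e > 0"
begin

lemma ab: "\<alpha>^2 < \<beta>^2" "0 < \<alpha>^2" "0 < \<beta>"
  using \<alpha> by (auto intro: power_strict_mono)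

lemma Dk_cutf: "Dk UNIV k (cutf \<alpha> \<beta>)"
proof -
  have "Dk UNIV k (\<lambda>s. inverse (\<beta>^2 - \<alpha>\<^sup>2) * (\<beta>^2 + (- 1) * s))" by (intro Dk_mult Dk_add Dk_const Dk_ident)
  then have "Dk UNIV k (\<lambda>s. step (inverse (\<beta>^2 - \<alpha>\<^sup>2) * (\<beta>^2 + (- 1) * s)))" by (intro Dk_compose[OF _ Dk_step]) auto
  then show ?thesis by (simp add: cutf_def[abs_def] divide_inverse mult.commute)
qed

lemma cutf_range: "0 \<le> cutf \<alpha> \<beta> s" "cutf \<alpha> \<beta> s \<le> 1" unfolding cutf_def by (rule step_range)+

lemma cutf_1: "s \<le> \<alpha>^2 \<Longrightarrow> cutf \<alpha> \<beta> s = 1" unfolding cutf_def using ab by (intro step_1) (simp add: le_divide_eq)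

lemma cutf_0: "s \<ge> \<beta>^2 \<Longrightarrow> cutf \<alpha> \<beta> s = 0" unfolding cutf_def using ab by (intro step_0) (simp add: divide_le_eq)

lemma cutf_antimono: "s \<le> s' \<Longrightarrow> cutf \<alpha> \<beta> s' \<le> cutf \<alpha> \<beta> s"
  unfolding cutf_def using ab by (intro step_mono divide_right_mono) auto

lemma cutf_deriv: "(cutf \<alpha> \<beta> has_real_derivative deriv (cutf \<alpha> \<beta>) s) (at s)"
  by (rule DERIV_deriv_Dk(1)[OF open_UNIV Dk_cutf UNIV_I])

lemma deriv_cutf_nonpos: "deriv (cutf \<alpha> \<beta>) s \<le> 0"
proof (rule ccontr)
  assume "\<not> ?thesis"
  then obtain d where d: "d > 0" "\<And>h. 0 < h \<Longrightarrow> h < d \<Longrightarrow> cutf \<alpha> \<beta> s < cutf \<alpha> \<beta> (s + h)"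
    using DERIV_pos_inc_right[OF cutf_deriv, of s] by (auto simp: not_le)
  show False using d(2)[of "d / 2"] d(1) cutf_antimono[of s "s + d / 2"] by simp
qed

text \<open>The end points are included, because the cutoff attains its extreme values 1 and 0
  there.\<close>

lemma deriv_cutf_0:
  assumes "s \<le> \<alpha>^2 \<or> s \<ge> \<beta>^2" shows "deriv (cutf \<alpha> \<beta>) s = 0"
proof (cases "s \<le> \<alpha>^2")
  case True
  show ?thesis by (rule DERIV_local_max[OF cutf_deriv, of 1]) (simp_all add: cutf_1[OF True] cutf_range)
next
  case False
  then have "s \<ge> \<beta>^2" using assms by simp
  then show ?thesis by (intro DERIV_local_min[OF cutf_deriv, of 1]) (simp_all add: cutf_0 cutf_range)
qed

lemma Dk_dsn: "Dk {- e<..} k (dsn e)"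
  unfolding dsn_def[abs_def]
  by (rule Dk_inverse) (auto intro!: Dk_mult Dk_const Dk_sqrt Dk_add Dk_ident)

lemma Dk_subset: "Dk T k f \<Longrightarrow> S \<subseteq> T \<Longrightarrow> Dk S k f"
  by (induction k arbitrary: f) (auto intro: continuous_on_subset)

lemma Dk_radF': "Dk {- e<..} k (radF' \<alpha> \<beta> e j)"
  unfolding radF'_def[abs_def]
  by (intro Dk_mult Dk_power Dk_dsn Dk_subset[OF DERIV_deriv_Dk(2)[OF open_UNIV Dk_cutf]]) simp

lemma dsn_pos: "s > - e \<Longrightarrow> dsn e s > 0" by (simp add: dsn_def)

lemma dsn_antimono: "- e < s \<Longrightarrow> s \<le> s' \<Longrightarrow> dsn e s' \<le> dsn e s"
  unfolding dsn_def by (intro le_imp_inverse_le) auto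

lemma sqrt_deriv: "s > - e \<Longrightarrow> ((\<lambda>s. sqrt (s + e)) has_real_derivative dsn e s) (at s)"
  by (rule DERIV_cong[OF DERIV_chain2[OF DERIV_real_sqrt, of "\<lambda>s. s + e" s 1 UNIV]])
    (auto intro!: derivative_eq_intros simp: dsn_def)

lemma radF'_nonpos: "s > - e \<Longrightarrow> radF' \<alpha> \<beta> e j s \<le> 0"
  unfolding radF'_def using deriv_cutf_nonpos dsn_pos[of s] by (simp add: mult_nonpos_nonneg)

lemma radF'_0: "s \<le> \<alpha>^2 \<or> s \<ge> \<beta>^2 \<Longrightarrow> radF' \<alpha> \<beta> e j s = 0"
  by (simp add: radF'_def deriv_cutf_0)

lemma radF_deriv: assumes s: "s > - e / 2" shows "(radF \<alpha> \<beta> e j has_real_derivative radF' \<alpha> \<beta> e j s) (at s)"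
proof -
  have "continuous_on {- e / 2..s + 1} (radF' \<alpha> \<beta> e j)"
    by (rule continuous_on_subset[OF Dk_continuous[OF Dk_radF'[where k=0]]]) (use e in auto)
  then have "((\<lambda>x. integral {- e / 2..x} (radF' \<alpha> \<beta> e j)) has_real_derivative radF' \<alpha> \<beta> e j s) (at s within {- e / 2..s + 1})"
    by (rule integral_has_real_derivative) (use s in auto)
  then have "((\<lambda>x. integral {- e / 2..x} (radF' \<alpha> \<beta> e j)) has_real_derivative radF' \<alpha> \<beta> e j s) (at s)"
    by (subst (asm) at_within_interior) (use s in auto)
  then show ?thesis unfolding radF_def[abs_def] by (auto intro!: derivative_eq_intros)
qed

lemma Dk_radF: "Dk {- e / 2<..} k (radF \<alpha> \<beta> e j)"
proof (cases k)
  case 0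
  have "continuous_on {- e / 2<..} (radF \<alpha> \<beta> e j)"
    by (rule DERIV_continuous_on[where D="radF' \<alpha> \<beta> e j"]) (auto intro!: has_field_derivative_at_within radF_deriv)
  then show ?thesis by (simp add: 0)
next
  case (Suc i)
  have "Dk {- e / 2<..} (Suc i) (radF \<alpha> \<beta> e j)"
    by (rule Dk_SucI[OF radF_deriv Dk_subset[OF Dk_radF']]) (use e in auto)
  then show ?thesis by (simp only: Suc)
qed

lemma radF_b: "radF \<alpha> \<beta> e j (\<beta>^2) = 0" by (simp add: radF_def)

lemma radF_0: assumes "s \<ge> \<beta>^2" shows "radF \<alpha> \<beta> e j s = 0"
proof -
  have "radF \<alpha> \<beta> e j s = radF \<alpha> \<beta> e j (\<beta>^2)"
  proof (cases "s = \<beta>^2")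
    case False
    then have "\<beta>^2 < s" using assms by simp
    then show ?thesis
    proof (rule DERIV_isconst2)
      have *: "(radF \<alpha> \<beta> e j has_real_derivative 0) (at x)" if "\<beta>^2 \<le> x" for x
      proof -
        have "x > - e / 2" using that e zero_le_power2[of \<beta>] by linarith
        then show ?thesis using radF_deriv[of x j] radF'_0[of x j] that by simp
      qed
      show "continuous_on {\<beta>^2..s} (radF \<alpha> \<beta> e j)"
        by (rule DERIV_continuous_on[where D="\<lambda>_. 0"]) (auto intro: has_field_derivative_at_within *)
      show "(radF \<alpha> \<beta> e j has_real_derivative 0) (at x)" if "\<beta>^2 < x" "x < s" for x using * that by simp
    qed (use assms in auto)
  qed simp
  then show ?thesis by (simp add: radF_b)
qed

lemma nonincreasing_to_0:
  assumes "\<And>s. s \<ge> 0 \<Longrightarrow> (f has_real_derivative f' s) (at s)" "\<And>s. s \<ge> 0 \<Longrightarrow> f' s \<le> 0" "\<And>s. s \<ge> \<beta>^2 \<Longrightarrow> f s = 0" "s \<ge> 0"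
  shows "f s \<ge> (0::real)"
proof (cases "s \<le> \<beta>^2")
  case True
  have "f (\<beta>^2) \<le> f s"
    by (rule DERIV_nonpos_imp_nonincreasing[OF True]) (use assms in \<open>meson order_trans\<close>)
  then show ?thesis using assms(3) by simp
qed (use assms(3) in auto)

lemma radF_nonneg: "s \<ge> 0 \<Longrightarrow> radF \<alpha> \<beta> e j s \<ge> 0"
  by (rule nonincreasing_to_0[where f'="radF' \<alpha> \<beta> e j"]) (use e in \<open>auto intro!: radF_deriv radF'_nonpos radF_0\<close>)

text \<open>Both sides vanish from \<open>\<beta>^2\<close> on, so derivatives may be compared.
  These are nonzero only beyond \<open>\<alpha>^2\<close>, where \<open>dsn\<close> is at most its
  value at \<open>\<alpha>^2\<close>.\<close>

lemma radF_le: assumes "s \<ge> 0" shows "radF \<alpha> \<beta> e j s \<le> dsn e (\<alpha>^2) ^ j * cutf \<alpha> \<beta> s"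
proof -
  let ?c = "dsn e (\<alpha>^2) ^ j"
  have "?c * cutf \<alpha> \<beta> s - radF \<alpha> \<beta> e j s \<ge> 0"
  proof (rule nonincreasing_to_0[where s=s and f="\<lambda>s. ?c * cutf \<alpha> \<beta> s - radF \<alpha> \<beta> e j s" and f'="\<lambda>s. ?c * deriv (cutf \<alpha> \<beta>) s - radF' \<alpha> \<beta> e j s"])
    fix s :: real assume s: "s \<ge> 0"
    show "((\<lambda>s. ?c * cutf \<alpha> \<beta> s - radF \<alpha> \<beta> e j s) has_real_derivative ?c * deriv (cutf \<alpha> \<beta>) s - radF' \<alpha> \<beta> e j s) (at s)"
      by (intro DERIV_diff DERIV_cmult cutf_deriv radF_deriv) (use s e in linarith)
    show "?c * deriv (cutf \<alpha> \<beta>) s - radF' \<alpha> \<beta> e j s \<le> 0"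
    proof (cases "s \<le> \<alpha>^2")
      case True then show ?thesis by (simp add: radF'_def deriv_cutf_0)
    next
      case False
      have "dsn e s ^ j \<le> ?c" using False ab s e dsn_pos[of s] by (intro power_mono dsn_antimono; linarith)
      then have "?c * deriv (cutf \<alpha> \<beta>) s \<le> dsn e s ^ j * deriv (cutf \<alpha> \<beta>) s"
        by (rule mult_right_mono_neg[OF _ deriv_cutf_nonpos])
      then show ?thesis by (simp add: radF'_def mult.commute)
    qed
  qed (simp_all add: cutf_0 radF_0 assms)
  then show ?thesis by simp
qed

lemma radF_cutf: assumes "s \<ge> 0" shows "radF \<alpha> \<beta> e 0 s = cutf \<alpha> \<beta> s"
proof (rule antisym)
  show "radF \<alpha> \<beta> e 0 s \<le> cutf \<alpha> \<beta> s" using radF_le[OF assms, of 0] by simp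
  have "radF \<alpha> \<beta> e 0 s - cutf \<alpha> \<beta> s \<ge> 0"
  proof (rule nonincreasing_to_0[where s=s and f="\<lambda>s. radF \<alpha> \<beta> e 0 s - cutf \<alpha> \<beta> s" and f'="\<lambda>s. radF' \<alpha> \<beta> e 0 s - deriv (cutf \<alpha> \<beta>) s"])
    show "((\<lambda>s. radF \<alpha> \<beta> e 0 s - cutf \<alpha> \<beta> s) has_real_derivative radF' \<alpha> \<beta> e 0 s - deriv (cutf \<alpha> \<beta>) s) (at s)" if "s \<ge> 0" for s
      by (intro DERIV_diff cutf_deriv radF_deriv) (use that e in linarith)
  qed (simp_all add: radF'_def cutf_0 radF_0 assms)
  then show "cutf \<alpha> \<beta> s \<le> radF \<alpha> \<beta> e 0 s" by simp
qed

lemma test_radF: "test_function (cplx (\<lambda>z::complex^'n::finite. radF \<alpha> \<beta> e j (sq z)))"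
proof (rule test_functionI)
  show "smooth (cplx (\<lambda>z::complex^'n. radF \<alpha> \<beta> e j (sq z)))"
  proof (rule smooth_compose_real[OF smooth_sq _ Dk_radF])
    show "sq z \<in> {- e / 2<..}" for z :: "complex^'n" using sq_nonneg[of z] e by simp
  qed
  show "{z::complex^'n. complex_of_real (radF \<alpha> \<beta> e j (sq z)) \<noteq> 0} \<subseteq> cball 0 \<beta>"
  proof
    fix z :: "complex^'n" assume z: "z \<in> {z. complex_of_real (radF \<alpha> \<beta> e j (sq z)) \<noteq> 0}"
    then have "\<not> \<beta>^2 \<le> (norm z)^2" using radF_0[of "sq z" j] by (auto simp: sq_norm)
    then show "z \<in> cball 0 \<beta>" using ab(3) power_mono[of \<beta> "norm z" 2] by force
  qed
qed simp

lemma radial_radF: "radial TYPE('n::finite) (radF \<alpha> \<beta> e j) (radF' \<alpha> \<beta> e j) (deriv (radF' \<alpha> \<beta> e j)) (\<beta> + 1)"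
proof
  \<comment> \<open>The radius is \<open>\<beta> + 1\<close> so that these s lie in the open set
    where \<open>radF'\<close> vanishes, and its derivative vanishes there too.\<close>
  have big: "\<beta>^2 < s" if "(\<beta> + 1)^2 \<le> s" for s using that ab(3) by (simp add: power2_sum)
  show "test_function (cplx (\<lambda>z::complex^'n. radF \<alpha> \<beta> e j (sq z)))" by (rule test_radF)
  show "(radF \<alpha> \<beta> e j has_real_derivative radF' \<alpha> \<beta> e j s) (at s)" if "s \<ge> 0" for s
    by (rule radF_deriv) (use that e in linarith)
  show "(radF' \<alpha> \<beta> e j has_real_derivative deriv (radF' \<alpha> \<beta> e j) s) (at s)" if "s \<ge> 0" for s
    by (rule DERIV_deriv_Dk(1)[OF open_greaterThan Dk_radF']) (use that e in simp)
  show "continuous_on {0..} (deriv (radF' \<alpha> \<beta> e j))"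
    by (rule continuous_on_subset[OF Dk_continuous[OF DERIV_deriv_Dk(2)[OF open_greaterThan Dk_radF', where k=0]]]) (use e in auto)
  show "radF' \<alpha> \<beta> e j s = 0" if "(\<beta> + 1)^2 \<le> s" for s using big[OF that] by (intro radF'_0) simp
  show "deriv (radF' \<alpha> \<beta> e j) s = 0" if "(\<beta> + 1)^2 \<le> s" for s
  proof (rule DERIV_imp_deriv)
    show "(radF' \<alpha> \<beta> e j has_real_derivative 0) (at s)"
      by (rule has_field_derivative_transform_within_open[of "\<lambda>_. 0" 0 s "{\<beta>^2<..}"]) (use big[OF that] radF'_0 in \<open>auto\<close>)
  qed
  show "\<beta> + 1 \<ge> 0" using ab by simp
qed

text \<open>Each soft norm becomes a square at the price of one step in the family of radial test functions.\<close>

lemma soft_norm_chain: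
  fixes xs :: "(complex^'n::finite \<Rightarrow> real) list"
  assumes "\<And>u. u \<in> set xs \<Longrightarrow> smooth (cplx u)"
  shows "(LINT z|lborel. wcoef (xs @ replicate j (soft_norm e)) [] z * of_real (radF \<alpha> \<beta> e i (sq z))) =
    (LINT z|lborel. wcoef (xs @ replicate j sq) [] z * of_real (radF \<alpha> \<beta> e (i + j) (sq z)))"
  using assms
proof (induction j arbitrary: xs i)
  case (Suc j)
  let ?\<phi> = "soft_norm e :: complex^'n \<Rightarrow> real"
  have s: "smooth (cplx u)" if "u \<in> set (xs @ replicate j ?\<phi>)" for u
    using that Suc.prems smooth_soft_norm[OF e] by (auto split: if_splits)
  have pos: "sq z > - e / 2" "sq z > - e" for z :: "complex^'n" using sq_nonneg[of z] e by linarith+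
  have "(LINT z|lborel. wcoef (xs @ replicate (Suc j) ?\<phi>) [] z * of_real (radF \<alpha> \<beta> e i (sq z)))
      = (LINT z|lborel. wcoef ((\<lambda>z. sqrt (sq z + e)) # (xs @ replicate j ?\<phi>)) [] z * of_real (radF \<alpha> \<beta> e i (sq z)))"
    by (simp add: wcoef_move soft_norm_def[abs_def])
  also have "\<dots> = (LINT z|lborel. wcoef (sq # (xs @ replicate j ?\<phi>)) [] z * of_real (radF \<alpha> \<beta> e (Suc i) (sq z)))"
  proof (rule integral_wcoef_radial[where f'="radF' \<alpha> \<beta> e i" and \<phi>'="dsn e" and \<phi>="\<lambda>s. sqrt (s + e)" and f="radF \<alpha> \<beta> e i" and F="radF \<alpha> \<beta> e (Suc i)"])
    show "smooth (cplx (\<lambda>z::complex^'n. sqrt (sq z + e)))" using smooth_soft_norm[OF e, where 'n='n] by (simp add: soft_norm_def[abs_def])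
    show "(radF \<alpha> \<beta> e (Suc i) has_real_derivative radF' \<alpha> \<beta> e i (sq z) * dsn e (sq z)) (at (sq z))" for z :: "complex^'n"
      using radF_deriv[OF pos(1)[of z], of "Suc i"] by (simp add: radF'_def mult_ac)
  qed (use s in \<open>auto intro!: test_radF radF_deriv sqrt_deriv pos\<close>)
  also have "\<dots> = (LINT z|lborel. wcoef ((sq # xs) @ replicate j sq) [] z * of_real (radF \<alpha> \<beta> e (Suc i + j) (sq z)))"
    unfolding append_Cons[symmetric] by (rule Suc.IH) (use Suc.prems in auto)
  finally show ?case by (simp add: wcoef_move)
qed simp

text \<open>The function \<open>q\<close> is the probability density - d/dr of the cutoff at r^2,
  and it is nonzero only between \<open>\<alpha>\<close> and \<open>\<beta>\<close>. The quantity in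
  question is the average under \<open>q\<close> of r^(k-1) times the j-th power of
  \<open>dsn\<close>, hence lies between the extreme values of this expression.\<close>

lemma radial_int_bounds:
  assumes k: "k \<ge> 1"
  shows "dsn e (\<beta>^2) ^ j * \<alpha> ^ (k - 1) \<le> - 2 * radial_int k (\<lambda>r. radF' \<alpha> \<beta> e j (r^2))"
    "- 2 * radial_int k (\<lambda>r. radF' \<alpha> \<beta> e j (r^2)) \<le> dsn e (\<alpha>^2) ^ j * \<beta> ^ (k - 1)"
proof -
  define q where "q r = (- 2 * r * deriv (cutf \<alpha> \<beta>) (r^2)) * indicator {0..\<beta>} r" for r
  have der: "((\<lambda>r. - cutf \<alpha> \<beta> (r^2)) has_real_derivative - 2 * r * deriv (cutf \<alpha> \<beta>) (r^2)) (at r)" for r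
    by (rule derivative_eq_intros DERIV_chain2[OF cutf_deriv] refl)+ simp
  have cd: "continuous_on UNIV (deriv (cutf \<alpha> \<beta>))" by (rule Dk_continuous[OF DERIV_deriv_Dk(2)[OF open_UNIV Dk_cutf, where k=0]])
  have cc: "isCont (\<lambda>r. - 2 * r * deriv (cutf \<alpha> \<beta>) (r^2)) r" for r
  proof -
    have c: "isCont (deriv (cutf \<alpha> \<beta>)) s" for s using cd by (simp add: continuous_on_eq_continuous_at)
    have "isCont (\<lambda>r. deriv (cutf \<alpha> \<beta>) (r^2)) r"
      by (rule isCont_o2[where f="\<lambda>r. r^2" and g="deriv (cutf \<alpha> \<beta>)", OF _ c]) (intro continuous_intros)
    then show ?thesis by (intro continuous_intros)
  qed
  have q: "integrable lborel q" "(LINT r|lborel. q r) = 1"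
  proof -
    have "has_bochner_integral lborel q (- cutf \<alpha> \<beta> (\<beta>^2) - - cutf \<alpha> \<beta> (0^2))"
      unfolding q_def[abs_def] by (rule has_bochner_integral_FTC_Icc_real) (use ab der cc in auto)
    then show "integrable lborel q" "(LINT r|lborel. q r) = 1"
      using ab by (auto simp: has_bochner_integral_iff cutf_0 cutf_1)
  qed
  have q0: "q r \<ge> 0" for r unfolding q_def using deriv_cutf_nonpos by (auto simp: indicator_def mult_nonneg_nonpos)
  define f where "f r = - 2 * ((indicator {0<..} r * r ^ k) * radF' \<alpha> \<beta> e j (r^2))" for r
  have f: "f r = q r * (r ^ (k - 1) * dsn e (r^2) ^ j)" for r
  proof (cases "0 < r \<and> r \<le> \<beta>")
    case True
    have "r ^ k = r * r ^ (k - 1)" using k by (cases k) auto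
    then show ?thesis using True by (simp add: f_def q_def radF'_def)
  next
    case False
    then consider "r \<le> 0" | "r > \<beta>" by linarith
    then show ?thesis
    proof cases
      case 1 then show ?thesis by (cases "r = 0") (auto simp: f_def q_def)
    next
      case 2
      then have "\<beta>^2 \<le> r^2" using ab by (intro power_mono) auto
      then show ?thesis using 2 by (simp add: f_def q_def radF'_0)
    qed
  qed
  have fb: "(dsn e (\<beta>^2) ^ j * \<alpha> ^ (k - 1)) * q r \<le> f r \<and> f r \<le> (dsn e (\<alpha>^2) ^ j * \<beta> ^ (k - 1)) * q r" for r
  proof (cases "q r = 0")
    case False
    then have r: "0 < r" "r \<le> \<beta>" "deriv (cutf \<alpha> \<beta>) (r^2) \<noteq> 0" by (auto simp: q_def indicator_def split: if_splits intro: le_neq_trans)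
    then have "\<not> r^2 \<le> \<alpha>^2" using deriv_cutf_0 by blast
    then have ra: "\<alpha> \<le> r" using r(1) power_mono[of r \<alpha> 2] by (meson less_imp_le not_le)
    have r2: "\<alpha>^2 \<le> r^2" "r^2 \<le> \<beta>^2" using ra r \<alpha> by (auto intro: power_mono)
    have pos: "dsn e (r^2) \<ge> 0" "dsn e (\<alpha>^2) \<ge> 0" "dsn e (\<beta>^2) \<ge> 0" by (auto intro!: less_imp_le dsn_pos order.strict_trans2[OF _ zero_le_power2] simp: e)
    have me: "- e < r^2" "- e < \<alpha>^2" using e zero_le_power2[of r] zero_le_power2[of \<alpha>] by linarith+
    have d: "dsn e (\<beta>^2) \<le> dsn e (r^2)" "dsn e (r^2) \<le> dsn e (\<alpha>^2)"
      using dsn_antimono[OF me(1) r2(2)] dsn_antimono[OF me(2) r2(1)] by simp_all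
    have "dsn e (\<beta>^2) ^ j * \<alpha> ^ (k - 1) \<le> dsn e (r^2) ^ j * r ^ (k - 1)"
      using ra \<alpha> pos d by (intro mult_mono power_mono) auto
    moreover have "dsn e (r^2) ^ j * r ^ (k - 1) \<le> dsn e (\<alpha>^2) ^ j * \<beta> ^ (k - 1)"
      using ra r \<alpha> pos d by (intro mult_mono power_mono) auto
    ultimately show ?thesis unfolding f using q0[of r] by (simp add: mult.commute[of "q r"] mult.commute[of "r ^ _"] mult_right_mono)
  qed (simp add: f)
  have fi: "integrable lborel f"
  proof (rule Bochner_Integration.integrable_bound[of _ "\<lambda>r. (dsn e (\<alpha>^2) ^ j * \<beta> ^ (k - 1)) * q r"])
    show "integrable lborel (\<lambda>r. (dsn e (\<alpha>^2) ^ j * \<beta> ^ (k - 1)) * q r)" using q by simp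
    have "continuous_on UNIV (\<lambda>r::real. radF' \<alpha> \<beta> e j (r^2))"
      by (rule continuous_on_compose2[OF Dk_continuous[OF Dk_radF'[where k=0]]]) (use e in \<open>auto intro!: continuous_intros order.strict_trans2[OF _ zero_le_power2]\<close>)
    then have [measurable]: "(\<lambda>r::real. radF' \<alpha> \<beta> e j (r^2)) \<in> borel_measurable borel" by (rule borel_measurable_continuous_onI)
    show "f \<in> borel_measurable lborel" unfolding f_def by measurable
    show "AE r in lborel. norm (f r) \<le> norm ((dsn e (\<alpha>^2) ^ j * \<beta> ^ (k - 1)) * q r)"
    proof (rule AE_I2)
      fix r
      have "0 \<le> (dsn e (\<beta>^2) ^ j * \<alpha> ^ (k - 1)) * q r"
        using q0[of r] \<alpha> e by (intro mult_nonneg_nonneg zero_le_power) (auto simp: dsn_def)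
      then show "norm (f r) \<le> norm ((dsn e (\<alpha>^2) ^ j * \<beta> ^ (k - 1)) * q r)" using fb[of r] by simp
    qed
  qed
  have J: "- 2 * radial_int k (\<lambda>r. radF' \<alpha> \<beta> e j (r^2)) = (LINT r|lborel. f r)"
    unfolding radial_int_def f_def by simp
  have "(LINT r|lborel. (dsn e (\<beta>^2) ^ j * \<alpha> ^ (k - 1)) * q r) \<le> (LINT r|lborel. f r)" "(LINT r|lborel. f r) \<le> (LINT r|lborel. (dsn e (\<alpha>^2) ^ j * \<beta> ^ (k - 1)) * q r)"
    using fb q(1) fi by (intro integral_mono integrable_mult_right; blast)+
  then show "dsn e (\<beta>^2) ^ j * \<alpha> ^ (k - 1) \<le> - 2 * radial_int k (\<lambda>r. radF' \<alpha> \<beta> e j (r^2))"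
    "- 2 * radial_int k (\<lambda>r. radF' \<alpha> \<beta> e j (r^2)) \<le> dsn e (\<alpha>^2) ^ j * \<beta> ^ (k - 1)"
    unfolding J by (simp_all add: q(2))
qed

end

section \<open>The three measures\<close>

lemma wcoef_append_commute: "wcoef (xs @ ys) L z = wcoef (ys @ xs) L z"
proof (induction xs arbitrary: ys)
  case (Cons x xs)
  have "wcoef ((x # xs) @ ys) L z = wcoef (xs @ (ys @ [x])) L z" using wcoef_move[of x "xs @ ys" "[]" L z] by simp
  also have "\<dots> = wcoef ((ys @ [x]) @ xs) L z" by (rule Cons.IH)
  finally show ?case by simp
qed simp

lemma sphere_int_mono:
  assumes "homog k \<psi>" "homog k \<phi>" "\<And>x. \<psi> x \<le> \<phi> x"
  shows "sphere_int k \<psi> \<le> sphere_int k \<phi>"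
  unfolding sphere_int_def
  using homog_ball_integrable[OF assms(1)] homog_ball_integrable[OF assms(2)] assms(3)
  by (intro mult_left_mono integral_mono) (auto intro!: mult_left_mono)

lemma sphere_int_uminus:
  fixes \<psi> :: "'a::euclidean_space \<Rightarrow> real"
  assumes "homog k \<psi>" shows "sphere_int k (\<lambda>x. \<psi> (- x)) = sphere_int k \<psi>"
proof -
  have m: "(\<lambda>x. indicator (cball 0 1) x * \<psi> x) \<in> borel_measurable borel"
    using homog_ball_integrable[OF assms] by (simp add: borel_measurable_integrable[THEN measurable_lborel2[THEN equalityD1, THEN subsetD]])
  have "distr lborel borel uminus = (lborel :: 'a measure)"
    using lborel_affine[of "-1" "0::'a"] by (simp add: density_1)
  then have "(LINT x|lborel. indicator (cball 0 1) x * \<psi> x) = (LINT x|distr lborel borel uminus. indicator (cball 0 1) x * \<psi> x)"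
    by simp
  also have "\<dots> = (LINT x|lborel. indicator (cball 0 1) (- x) * \<psi> (- x))" by (rule integral_distr[OF _ m]) simp
  finally show ?thesis by (simp add: sphere_int_def indicator_def)
qed

text \<open>The support function may be negative, but h (x) + h (- x) is not, and the sphere
  integral is invariant under reflection.\<close>

lemma sphere_int_fin_support_nonneg:
  assumes P: "finite P" "P \<noteq> {}" shows "sphere_int 1 (fin_support P) \<ge> 0"
proof -
  have h: "homog 1 (fin_support P)" by (rule homog_fin_support[OF P])
  have h': "homog 1 (\<lambda>x. fin_support P (- x))"
  proof -
    have "(\<lambda>x. fin_support P (- x)) \<in> borel_measurable borel"
      by (rule measurable_compose[OF _ homog_measurable[OF h]]) measurable
    then show ?thesis using h unfolding homog_def by (metis norm_minus_cancel scaleR_minus_right)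
  qed
  obtain v where v: "v \<in> P" using P by blast
  have "0 = sphere_int 1 (\<lambda>x. 0 * fin_support P x)" by (subst sphere_int_cmult) simp
  also have "\<dots> \<le> sphere_int 1 (\<lambda>x. fin_support P x + fin_support P (- x))"
  proof (intro sphere_int_mono homog_cmult homog_add h h')
    show "0 * fin_support P x \<le> fin_support P x + fin_support P (- x)" for x
      using fin_support_ge[OF P v, of x] fin_support_ge[OF P v, of "- x"] by simp
  qed
  also have "\<dots> = 2 * sphere_int 1 (fin_support P)" unfolding sphere_int_add[OF h h'] sphere_int_uminus[OF h] by simp
  finally show ?thesis by simp
qed

lemma sphere_int_1_eq: "sphere_int 0 (\<lambda>_::'a::euclidean_space. 1) = real DIM('a) * unit_ball_vol (real DIM('a))"
  by (simp add: sphere_int_def content_cball)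

lemma sphere_int_1_pos: "sphere_int 0 (\<lambda>_::'a::euclidean_space. 1) > 0"
  unfolding sphere_int_1_eq by simp

section \<open>Estimates of the three integrals for finite sets\<close>

context
  fixes \<alpha> \<beta> e :: real
  assumes \<alpha>: "0 < \<alpha>" "\<alpha> < \<beta>" and e: "e > 0"
begin

lemma dsn_le: "dsn e (\<alpha>^2) \<le> 1 / (2 * \<alpha>)"
proof -
  have "\<alpha> \<le> sqrt (\<alpha>^2 + e)" using e by (intro real_le_rsqrt) simp
  moreover from this have "sqrt (\<alpha>^2 + e) > 0" using \<alpha> by linarith
  ultimately show ?thesis unfolding dsn_def inverse_eq_divide using \<alpha> by (intro divide_left_mono mult_pos_pos) auto
qed

lemma dsn_nonneg: "dsn e (s^2) \<ge> 0"
  using e by (simp add: dsn_def)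

text \<open>With all soft norms replaced by squares the density is the constant of
  \<open>wcoef_sq_0\<close>, and what remains is the volume of a ball times the bound on
  \<open>radF\<close>.\<close>

lemma mu0_bound:
  "Re (LINT z|lborel. wcoef (replicate CARD('n) (soft_norm e :: complex^'n::finite \<Rightarrow> real)) [] z * of_real (cutf \<alpha> \<beta> (sq z)))
    \<le> 4 ^ CARD('n) * fact CARD('n) * (1 / (2 * \<alpha>)) ^ CARD('n) * (unit_ball_vol (real DIM(complex^'n)) * \<beta> ^ DIM(complex^'n))"
proof -
  let ?n = "CARD('n)"
  have \<beta>: "\<beta> > 0" using \<alpha> by simp
  have "(LINT z|lborel. wcoef (replicate ?n (soft_norm e :: complex^'n \<Rightarrow> real)) [] z * of_real (cutf \<alpha> \<beta> (sq z)))
      = (LINT z|lborel. wcoef (replicate ?n (sq :: complex^'n \<Rightarrow> real)) [] z * of_real (radF \<alpha> \<beta> e ?n (sq z)))"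
    using soft_norm_chain[OF \<alpha> e, of "[]" ?n 0] by (simp add: radF_cutf[OF \<alpha> e sq_nonneg])
  also have "\<dots> = (LINT z|lborel. of_real ((4 ^ ?n * fact ?n) * radF \<alpha> \<beta> e ?n (sq (z::complex^'n))))"
    by (simp add: wcoef_sq_0)
  also have "\<dots> = of_real ((4 ^ ?n * fact ?n) * (LINT z|lborel. radF \<alpha> \<beta> e ?n (sq (z::complex^'n))))"
    by (simp only: integral_complex_of_real integral_mult_right_zero)
  finally have 1: "Re (LINT z|lborel. wcoef (replicate ?n (soft_norm e :: complex^'n \<Rightarrow> real)) [] z * of_real (cutf \<alpha> \<beta> (sq z)))
      = (4 ^ ?n * fact ?n) * (LINT z|lborel. radF \<alpha> \<beta> e ?n (sq (z::complex^'n)))" by (simp only: Re_complex_of_real)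
  have "(LINT z|lborel. radF \<alpha> \<beta> e ?n (sq (z::complex^'n))) \<le> (LINT z|lborel. (1 / (2 * \<alpha>)) ^ ?n * indicator (cball (0::complex^'n) \<beta>) z)"
  proof (rule integral_mono)
    have "integrable lborel (\<lambda>z::complex^'n. Re (of_real (radF \<alpha> \<beta> e ?n (sq z))))"
      by (intro integrable_Re test_integrable test_radF \<alpha> e)
    then show "integrable lborel (\<lambda>z::complex^'n. radF \<alpha> \<beta> e ?n (sq z))" by simp
    show "integrable lborel (\<lambda>z. (1 / (2 * \<alpha>)) ^ ?n * indicator (cball (0::complex^'n) \<beta>) z)"
      by (intro integrable_mult_right integrable_real_indicator emeasure_lborel_cball_finite) simp
    show "radF \<alpha> \<beta> e ?n (sq z) \<le> (1 / (2 * \<alpha>)) ^ ?n * indicator (cball 0 \<beta>) z" for z :: "complex^'n"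
    proof (cases "z \<in> cball 0 \<beta>")
      case True
      have "radF \<alpha> \<beta> e ?n (sq z) \<le> dsn e (\<alpha>^2) ^ ?n * cutf \<alpha> \<beta> (sq z)" by (rule radF_le[OF \<alpha> e sq_nonneg])
      also have "\<dots> \<le> (1 / (2 * \<alpha>)) ^ ?n * 1"
        using \<alpha> cutf_range[OF \<alpha> e, of "sq z"] by (intro mult_mono power_mono dsn_le dsn_nonneg) auto
      finally show ?thesis using True by simp
    next
      case False
      then have "\<beta>^2 \<le> sq z" unfolding sq_norm using \<beta> by (intro power_mono) auto
      then show ?thesis using False radF_0[OF \<alpha> e] by simp
    qed
  qed
  also have "\<dots> = (1 / (2 * \<alpha>)) ^ ?n * (unit_ball_vol (real DIM(complex^'n)) * \<beta> ^ DIM(complex^'n))"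
    using \<beta> by (simp only: integral_mult_right_zero) (simp add: content_cball)
  finally show ?thesis unfolding 1 mult.assoc by (intro mult_left_mono) auto
qed

context
  fixes P :: "(complex^'n::finite) set"
  assumes P: "finite P" "P \<noteq> {}"
begin

text \<open>The limit is exact, with c equal to -2 times a radial integral; only a lower bound for c
  is exported, as this measure is to be estimated from below.\<close>

lemma mu1_limit:
  assumes j: "j + 1 = CARD('n)"
  obtains c where
    "(\<lambda>i. LINT z|lborel. wcoef (lse P (real (Suc i)) # replicate j (soft_norm e)) [] z * of_real (cutf \<alpha> \<beta> (sq z))) \<longlonglongrightarrow>
      of_real (4 ^ j * fact j * (sphere_int 1 (fin_support P) * c))"
    "dsn e (\<beta>^2) ^ j * \<alpha> ^ (DIM(complex^'n) - 1) \<le> c"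
proof -
  interpret R: radial "radF \<alpha> \<beta> e j" "radF' \<alpha> \<beta> e j" "deriv (radF' \<alpha> \<beta> e j)" "\<beta> + 1" "TYPE('n)" by (rule radial_radF[OF \<alpha> e])
  have eq: "(LINT z|lborel. wcoef (lse P (real (Suc i)) # replicate j (soft_norm e)) [] z * of_real (cutf \<alpha> \<beta> (sq z)))
      = of_real (4 ^ j * fact j * ((LINT z|lborel. (z \<bullet> lse_grad P (real (Suc i)) z) * radF' \<alpha> \<beta> e j (sq z)) * - 2))" for i
  proof -
    let ?u = "lse P (real (Suc i))"
    have t: "real (Suc i) > 0" by simp
    have "(LINT z|lborel. wcoef (?u # replicate j (soft_norm e)) [] z * of_real (cutf \<alpha> \<beta> (sq z)))
        = (LINT z|lborel. wcoef ([?u] @ replicate j sq) [] z * of_real (radF \<alpha> \<beta> e j (sq z)))"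
      using soft_norm_chain[OF \<alpha> e, of "[?u]" j 0] smooth_lse[OF P t] by (simp add: radF_cutf[OF \<alpha> e sq_nonneg] del: of_nat_Suc)
    also have "\<dots> = (LINT z|lborel. (4 ^ j * fact j) * (of_real (radF \<alpha> \<beta> e j (sq z)) * (\<Sum>b\<in>Basis. dird b (dird b (cplx ?u)) z)))"
    proof (rule Bochner_Integration.integral_cong[OF refl])
      fix z :: "complex^'n"
      have "wcoef ([?u] @ replicate j sq) [] z = 4 ^ (j + 1) * fact j * (1 / 4 * (\<Sum>b\<in>Basis. dird b (dird b (cplx ?u)) z))"
        unfolding wcoef_append_commute[of "[?u]"] wcoef_sq_1[OF j] hess_trace_lse[OF P t] j ..
      then show "wcoef ([?u] @ replicate j sq) [] z * of_real (radF \<alpha> \<beta> e j (sq z))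
          = (4 ^ j * fact j) * (of_real (radF \<alpha> \<beta> e j (sq z)) * (\<Sum>b\<in>Basis. dird b (dird b (cplx ?u)) z))" by simp
    qed
    also have "\<dots> = (4 ^ j * fact j) * of_real (- 2 * (LINT z|lborel. (z \<bullet> lse_grad P (real (Suc i)) z) * radF' \<alpha> \<beta> e j (sq z)))"
      unfolding integral_mult_right_zero R.laplacian_radial[OF smooth_lse[OF P t] dird_lse[OF P t]] ..
    finally show ?thesis by simp
  qed
  have "(\<lambda>i. complex_of_real (4 ^ j * fact j * ((LINT z|lborel. (z \<bullet> lse_grad P (real (Suc i)) z) * radF' \<alpha> \<beta> e j (sq z)) * - 2)))
      \<longlonglongrightarrow> of_real (4 ^ j * fact j * ((sphere_int 1 (fin_support P) * R.J DIM(complex^'n)) * - 2))"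
    by (intro tendsto_of_real tendsto_mult tendsto_const R.laplacian_limit P)
  then have "(\<lambda>i. LINT z|lborel. wcoef (lse P (real (Suc i)) # replicate j (soft_norm e)) [] z * of_real (cutf \<alpha> \<beta> (sq z))) \<longlonglongrightarrow>
      of_real (4 ^ j * fact j * (sphere_int 1 (fin_support P) * (- 2 * R.J DIM(complex^'n))))"
    unfolding eq by (simp add: mult_ac)
  moreover have "dsn e (\<beta>^2) ^ j * \<alpha> ^ (DIM(complex^'n) - 1) \<le> - 2 * R.J DIM(complex^'n)"
    unfolding R.J_def by (rule radial_int_bounds(1)[OF \<alpha> e]) simp
  ultimately show ?thesis by (rule that)
qed

text \<open>Passing to the real Hessian leaves only an upper bound for each i; the bound itself
  converges, and the slack \<open>\<delta>\<close> turns its limit into an estimate valid from some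
  index on, so that a single soft maximum can be picked later.\<close>

lemma mu2_eventually:
  assumes j: "j + 2 = CARD('n)" and \<delta>: "\<delta> > 0"
  defines "\<omega> \<equiv> sphere_int 0 (\<lambda>_::complex^'n. 1)"
  shows "\<forall>\<^sub>F i in sequentially.
    Re (LINT z|lborel. wcoef (lse P (real (Suc i)) # lse P (real (Suc i)) # replicate j (soft_norm e)) [] z * of_real (cutf \<alpha> \<beta> (sq z)))
      \<le> 4 ^ j * fact j * ((1 / (2 * \<alpha>)) ^ j * \<beta> ^ (DIM(complex^'n) - 2) * ((real DIM(complex^'n) - 1) * (sphere_int 1 (fin_support P))^2 / \<omega>)) + \<delta>"
proof -
  interpret R: radial "radF \<alpha> \<beta> e j" "radF' \<alpha> \<beta> e j" "deriv (radF' \<alpha> \<beta> e j)" "\<beta> + 1" "TYPE('n)" by (rule radial_radF[OF \<alpha> e])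
  let ?N = "DIM(complex^'n)"
  define q where "q = (real ?N - 1) * (sphere_int 1 (fin_support P))^2 / \<omega>"
  define X where "X = real ?N * sphere_int 2 (\<lambda>z. (fin_support P z)^2) - sphere_int 0 (\<lambda>z. (norm (face_mean P z))^2)"
  define E where "E i = (LINT z|lborel. 4 * (((z \<bullet> lse_grad P (real (Suc i)) z)^2 - sq z * (norm (lse_grad P (real (Suc i)) z))^2) * deriv (radF' \<alpha> \<beta> e j) (sq z))
      - 2 * (real ?N - 1) * ((norm (lse_grad P (real (Suc i)) z))^2 * radF' \<alpha> \<beta> e j (sq z)))" for i
  have N1: "?N \<ge> 1" using DIM_positive[where 'a="complex^'n"] by (simp only: Suc_le_eq One_nat_def)
  have q0: "q \<ge> 0" unfolding q_def \<omega>_def using sphere_int_1_pos[where 'a="complex^'n"] N1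
    by (intro divide_nonneg_nonneg mult_nonneg_nonneg zero_le_power2) (simp_all only: diff_ge_0_iff_ge real_of_nat_ge_one_iff less_imp_le)
  have le: "Re (LINT z|lborel. wcoef (lse P (real (Suc i)) # lse P (real (Suc i)) # replicate j (soft_norm e)) [] z * of_real (cutf \<alpha> \<beta> (sq z)))
      \<le> 4 ^ j * fact j * E i" for i
  proof -
    let ?u = "lse P (real (Suc i))"
    let ?D = "\<lambda>z. (\<Sum>b\<in>Basis. dird b (dird b (cplx ?u)) z)^2 - (\<Sum>b\<in>Basis. \<Sum>c\<in>Basis. (dird c (dird b (cplx ?u)) z)^2)"
    have t: "real (Suc i) > 0" by simp
    have su: "smooth (cplx ?u)" by (rule smooth_lse[OF P t])
    have sw: "smooth (wcoef ([?u, ?u] @ replicate j sq) [])" by (rule smooth_wcoef) (use su in \<open>auto split: if_splits\<close>)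
    have sD: "smooth ?D" by (intro smooth_diff smooth_power smooth_sum smooth_dird su)
    have test: "test_function (cplx (\<lambda>z::complex^'n. radF \<alpha> \<beta> e j (sq z)))" by (rule test_radF[OF \<alpha> e])
    have i1: "integrable lborel (\<lambda>z. wcoef ([?u, ?u] @ replicate j sq) [] z * of_real (radF \<alpha> \<beta> e j (sq z)))"
      by (rule smooth_mult_test_integrable[OF sw test])
    have i2: "integrable lborel (\<lambda>z. of_real (radF \<alpha> \<beta> e j (sq z)) * ?D z)"
      using smooth_mult_test_integrable[OF sD test] by (simp only: mult.commute)
    have "(LINT z|lborel. wcoef (?u # ?u # replicate j (soft_norm e)) [] z * of_real (cutf \<alpha> \<beta> (sq z)))
        = (LINT z|lborel. wcoef ([?u, ?u] @ replicate j sq) [] z * of_real (radF \<alpha> \<beta> e j (sq z)))"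
      using soft_norm_chain[OF \<alpha> e, of "[?u, ?u]" j 0] su by (simp add: radF_cutf[OF \<alpha> e sq_nonneg] del: of_nat_Suc)
    then have "Re (LINT z|lborel. wcoef (?u # ?u # replicate j (soft_norm e)) [] z * of_real (cutf \<alpha> \<beta> (sq z)))
        = (LINT z|lborel. Re (wcoef ([?u, ?u] @ replicate j sq) [] z * of_real (radF \<alpha> \<beta> e j (sq z))))"
      using i1 by (simp only: integral_Re)
    also have "\<dots> \<le> (LINT z|lborel. (4 ^ j * fact j) * Re (of_real (radF \<alpha> \<beta> e j (sq z)) * ?D z))"
    proof (rule integral_mono)
      show "integrable lborel (\<lambda>z. Re (wcoef ([?u, ?u] @ replicate j sq) [] z * of_real (radF \<alpha> \<beta> e j (sq z))))" by (rule integrable_Re[OF i1])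
      show "integrable lborel (\<lambda>z. (4 ^ j * fact j) * Re (of_real (radF \<alpha> \<beta> e j (sq z)) * ?D z))" by (intro integrable_mult_right integrable_Re i2)
      fix z :: "complex^'n"
      define W where "W = (\<Sum>a\<in>UNIV. hess ?u z a a)^2 - (\<Sum>a\<in>UNIV. \<Sum>b\<in>UNIV. hess ?u z a b * hess ?u z b a)"
      define F where "F = radF \<alpha> \<beta> e j (sq z)"
      have F: "F \<ge> 0" unfolding F_def by (rule radF_nonneg[OF \<alpha> e sq_nonneg])
      have W: "wcoef ([?u, ?u] @ replicate j sq) [] z = of_real (4 ^ (j + 2) * fact j) * W"
        unfolding wcoef_append_commute[of "[?u, ?u]"] wcoef_sq_2[OF j] j W_def by simp
      have "Re W \<le> 1 / 16 * Re (?D z)" unfolding W_def by (rule hess_e2_lse[OF P t])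
      then have "(4 ^ (j + 2) * fact j * F) * Re W \<le> (4 ^ (j + 2) * fact j * F) * (1 / 16 * Re (?D z))"
        by (rule mult_left_mono) (use F in simp)
      moreover have "Re (wcoef ([?u, ?u] @ replicate j sq) [] z * of_real F) = (4 ^ (j + 2) * fact j * F) * Re W"
        unfolding W by (simp del: of_real_mult add: mult_ac)
      moreover have "(4 ^ j * fact j) * Re (of_real F * ?D z) = (4 ^ (j + 2) * fact j * F) * (1 / 16 * Re (?D z))"
        by (simp add: power_add)
      ultimately show "Re (wcoef ([?u, ?u] @ replicate j sq) [] z * of_real (radF \<alpha> \<beta> e j (sq z))) \<le> (4 ^ j * fact j) * Re (of_real (radF \<alpha> \<beta> e j (sq z)) * ?D z)"
        unfolding F_def[symmetric] by linarith
    qed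
    also have "\<dots> = (4 ^ j * fact j) * Re (LINT z|lborel. of_real (radF \<alpha> \<beta> e j (sq z)) * ?D z)"
      using i2 by (simp only: integral_mult_right_zero integral_Re)
    also have "\<dots> = 4 ^ j * fact j * E i"
      unfolding R.e2_radial[OF su dird_lse[OF P t]] Re_complex_of_real E_def ..
    finally show ?thesis .
  qed
  have J: "- 2 * R.J (?N - 1) \<le> (1 / (2 * \<alpha>)) ^ j * \<beta> ^ (?N - 2)" "- 2 * R.J (?N - 1) \<ge> 0"
  proof -
    have N2: "?N - 1 \<ge> 1" using j by simp
    have "- 2 * R.J (?N - 1) \<le> dsn e (\<alpha>^2) ^ j * \<beta> ^ (?N - 1 - 1)"
      unfolding R.J_def by (rule radial_int_bounds(2)[OF \<alpha> e N2])
    also have "\<dots> \<le> (1 / (2 * \<alpha>)) ^ j * \<beta> ^ (?N - 1 - 1)"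
      using \<alpha> by (intro mult_right_mono power_mono dsn_le dsn_nonneg) auto
    finally show "- 2 * R.J (?N - 1) \<le> (1 / (2 * \<alpha>)) ^ j * \<beta> ^ (?N - 2)" by (simp only: diff_diff_left one_add_one)
    have "0 \<le> dsn e (\<beta>^2) ^ j * \<alpha> ^ (?N - 1 - 1)" using \<alpha> dsn_nonneg by simp
    also have "\<dots> \<le> - 2 * R.J (?N - 1)" unfolding R.J_def by (rule radial_int_bounds(1)[OF \<alpha> e N2])
    finally show "- 2 * R.J (?N - 1) \<ge> 0" .
  qed
  \<comment> \<open>Poincare's inequality enters here; the radial factor in front is nonnegative, so
    the inequality keeps its direction.\<close>
  have "(- 2 * R.J (?N - 1)) * X \<le> (- 2 * R.J (?N - 1)) * q"
    by (rule mult_left_mono[OF _ J(2)]) (use fin_support_poincare[OF P] in \<open>simp only: X_def q_def \<omega>_def\<close>)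
  also have "\<dots> \<le> ((1 / (2 * \<alpha>)) ^ j * \<beta> ^ (?N - 2)) * q" by (rule mult_right_mono[OF J(1) q0])
  finally have "4 ^ j * fact j * ((- 2 * R.J (?N - 1)) * X) \<le> 4 ^ j * fact j * (((1 / (2 * \<alpha>)) ^ j * \<beta> ^ (?N - 2)) * q)"
    by (rule mult_left_mono) simp
  moreover have "(\<lambda>i. 4 ^ j * fact j * E i) \<longlonglongrightarrow> 4 ^ j * fact j * ((- 2 * R.J (?N - 1)) * X)"
    unfolding E_def X_def by (intro tendsto_mult tendsto_const R.e2_limit P)
  then have "\<forall>\<^sub>F i in sequentially. 4 ^ j * fact j * E i < 4 ^ j * fact j * ((- 2 * R.J (?N - 1)) * X) + \<delta>"
    by (rule order_tendstoD(2)) (use \<delta> in simp)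
  ultimately show ?thesis unfolding q_def[symmetric]
    by (elim eventually_mono) (use le in \<open>meson add_right_mono less_imp_le order_trans\<close>)
qed

end

end

section \<open>Approximation of a convex body by finite sets\<close>

lemma support_function_ge:
  assumes "compact A" "v \<in> A" shows "z \<bullet> v \<le> support_function A z"
  unfolding support_function_alt
proof (rule cSUP_upper[OF assms(2)])
  have "compact ((\<lambda>v. z \<bullet> v) ` A)" by (intro compact_continuous_image continuous_intros assms)
  then show "bdd_above ((\<lambda>v. z \<bullet> v) ` A)" by (intro bounded_imp_bdd_above compact_imp_bounded)
qed

lemma support_function_le:
  assumes "A \<noteq> {}" "\<And>v. v \<in> A \<Longrightarrow> z \<bullet> v \<le> c" shows "support_function A z \<le> c"
  unfolding support_function_alt by (rule cSUP_least[OF assms])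

lemma finite_net:
  fixes A :: "(complex^'n::finite) set"
  assumes A: "compact A" "A \<noteq> {}" and \<delta>: "\<delta> > 0"
  obtains P where "finite P" "P \<noteq> {}" "P \<subseteq> A" "\<And>z. fin_support P z \<le> support_function A z"
    "\<And>z. support_function A z \<le> fin_support P z + \<delta> * norm z"
proof -
  obtain P where P: "finite P" "P \<subseteq> A" "A \<subseteq> (\<Union>x\<in>P. ball x \<delta>)"
    using seq_compact_imp_totally_bounded[OF compact_imp_seq_compact[OF A(1)], rule_format, OF \<delta>] by auto
  have ne: "P \<noteq> {}" using P(3) A(2) by blast
  have 1: "fin_support P z \<le> support_function A z" for z
    using fin_support_attained[OF P(1) ne, where z=z] support_function_ge[OF A(1)] P(2) by (metis subsetD)
  have 2: "support_function A z \<le> fin_support P z + \<delta> * norm z" for z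
  proof (rule support_function_le[OF A(2)])
    fix v assume "v \<in> A"
    then obtain x where x: "x \<in> P" "dist x v < \<delta>" using P(3) by auto
    have "z \<bullet> v = z \<bullet> x + z \<bullet> (v - x)" by (simp add: inner_diff_right)
    also have "z \<bullet> (v - x) \<le> norm z * norm (v - x)" by (rule norm_cauchy_schwarz)
    also have "\<dots> \<le> norm z * \<delta>" using x(2) by (intro mult_left_mono) (simp_all add: dist_norm norm_minus_commute)
    finally show "z \<bullet> v \<le> fin_support P z + \<delta> * norm z"
      using fin_support_ge[OF P(1) ne x(1), of z] by (simp add: mult.commute)
  qed
  show ?thesis by (rule that[OF P(1) ne P(2) 1 2])
qed

text \<open>A diagonal choice: for each m a net of mesh 1/(m+1) in \<open>A\<close>, then a soft
  maximum over it that is both close enough and subject to \<open>Q m\<close>. The predicate is a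
  parameter because the same construction serves the lower estimate of one measure and the upper
  estimate of another.\<close>

lemma approx_sequence:
  fixes A :: "(complex^'n::finite) set"
  assumes A: "compact A" "A \<noteq> {}"
    and Q: "\<And>m P. finite P \<Longrightarrow> P \<noteq> {} \<Longrightarrow> \<forall>\<^sub>F i in sequentially. Q m P i"
  obtains P i where "\<And>m. Q m (P m) (i m)"
    "approximates (support_function A) (\<lambda>m. lse (P m) (real (Suc (i m))))"
    "(\<lambda>m. sphere_int 1 (fin_support (P m))) \<longlonglongrightarrow> sphere_int 1 (support_function A)"
    "sphere_int 1 (support_function A) \<ge> 0"
proof -
  define h where "h = support_function A"
  define \<epsilon> where "\<epsilon> m = inverse (real (Suc m))" for m
  have \<epsilon>: "\<epsilon> m > 0" "\<epsilon> \<longlonglongrightarrow> 0" for m unfolding \<epsilon>_def[abs_def] by (simp, rule LIMSEQ_inverse_real_of_nat)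
  have "\<forall>m. \<exists>P. finite P \<and> P \<noteq> {} \<and> P \<subseteq> A \<and> (\<forall>z. fin_support P z \<le> h z) \<and> (\<forall>z. h z \<le> fin_support P z + \<epsilon> m * norm z)"
    unfolding h_def using finite_net[OF A \<epsilon>(1)] by metis
  then obtain P where P: "\<And>m. finite (P m)" "\<And>m. P m \<noteq> {}" "\<And>m. P m \<subseteq> A" "\<And>m z. fin_support (P m) z \<le> h z"
    "\<And>m z. h z \<le> fin_support (P m) z + \<epsilon> m * norm z" by metis
  have "\<forall>m. \<exists>i. Q m (P m) i \<and> ln (real (card (P m))) / real (Suc i) \<le> \<epsilon> m"
  proof
    fix m
    have "(\<lambda>i. ln (real (card (P m))) * inverse (real (Suc i))) \<longlonglongrightarrow> 0"
      by (rule tendsto_mult_right_zero[OF LIMSEQ_inverse_real_of_nat])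
    then have "\<forall>\<^sub>F i in sequentially. ln (real (card (P m))) * inverse (real (Suc i)) < \<epsilon> m"
      by (rule order_tendstoD(2)) (simp add: \<epsilon>(1))
    then have "\<forall>\<^sub>F i in sequentially. Q m (P m) i \<and> ln (real (card (P m))) / real (Suc i) \<le> \<epsilon> m"
      using Q[OF P(1,2), of m] by eventually_elim (simp add: divide_inverse)
    then show "\<exists>i. Q m (P m) i \<and> ln (real (card (P m))) / real (Suc i) \<le> \<epsilon> m"
      using eventually_happens trivial_limit_sequentially by blast
  qed
  then obtain i where i: "\<And>m. Q m (P m) (i m)" "\<And>m. ln (real (card (P m))) / real (Suc (i m)) \<le> \<epsilon> m" by metis
  have bd: "dist (lse (P m) (real (Suc (i m))) z) (h z) \<le> \<epsilon> m * (1 + norm z)" for m z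
  proof -
    have t: "real (Suc (i m)) > 0" by simp
    have "0 \<le> \<epsilon> m * norm z" using \<epsilon>(1)[of m] by simp
    then show ?thesis
      using lse_bounds[OF P(1,2) t, of m z] P(4)[where m=m and z=z] P(5)[where m=m and z=z] i(2)[of m] \<epsilon>(1)[of m]
      unfolding dist_real_def distrib_left mult_1_right by linarith
  qed
  have 1: "approximates h (\<lambda>m. lse (P m) (real (Suc (i m))))"
    unfolding approximates_def
  proof (intro conjI allI)
    show "spsh (lse (P m) (real (Suc (i m))))" for m by (rule spsh_lse[OF P(1,2)]) simp
    show "uniform_limit (cball 0 R) (\<lambda>m. lse (P m) (real (Suc (i m)))) h sequentially" for R
      unfolding uniform_limit_iff
    proof (intro allI impI)
      fix d :: real assume d: "d > 0"
      have "(\<lambda>m. \<epsilon> m * (1 + \<bar>R\<bar>)) \<longlonglongrightarrow> 0" by (rule tendsto_mult_left_zero[OF \<epsilon>(2)])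
      then have "\<forall>\<^sub>F m in sequentially. \<epsilon> m * (1 + \<bar>R\<bar>) < d" by (rule order_tendstoD(2)) (simp add: d)
      then show "\<forall>\<^sub>F m in sequentially. \<forall>z\<in>cball 0 R. dist (lse (P m) (real (Suc (i m))) z) (h z) < d"
      proof eventually_elim
        case (elim m)
        show ?case
        proof
          fix z :: "complex^'n" assume "z \<in> cball 0 R"
          then have "\<epsilon> m * (1 + norm z) \<le> \<epsilon> m * (1 + \<bar>R\<bar>)" using \<epsilon>(1)[of m] by (intro mult_left_mono) auto
          then show "dist (lse (P m) (real (Suc (i m))) z) (h z) < d" using bd[of m z] elim by linarith
        qed
      qed
    qed
  qed
  have hp: "homog 1 (fin_support (P m))" for m by (rule homog_fin_support[OF P(1,2)])
  have hn: "homog 1 (\<lambda>z::complex^'n. norm z)" using homog_norm_power[of 1, where 'a = "complex^'n"] by simp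
  have lim: "(\<lambda>m. fin_support (P m) z) \<longlonglongrightarrow> h z" for z
  proof (rule tendsto_sandwich[where f="\<lambda>m. h z - \<epsilon> m * norm z" and h="\<lambda>_. h z"])
    have "(\<lambda>m. h z - \<epsilon> m * norm z) \<longlonglongrightarrow> h z - 0" by (intro tendsto_diff tendsto_const tendsto_mult_left_zero \<epsilon>(2))
    then show "(\<lambda>m. h z - \<epsilon> m * norm z) \<longlonglongrightarrow> h z" by simp
    show "\<forall>\<^sub>F m in sequentially. h z - \<epsilon> m * norm z \<le> fin_support (P m) z"
      using P(5)[of z] by (intro always_eventually allI) (simp add: diff_le_eq)
  qed (use P(4) in auto)
  \<comment> \<open>The growth bound, homogeneity and measurability are inherited from the finite
    nets as pointwise limits.\<close>
  have hh: "homog 1 h"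
  proof -
    obtain M where M: "\<And>v. v \<in> A \<Longrightarrow> norm v \<le> M" using compact_imp_bounded[OF A(1)] by (auto simp: bounded_iff)
    have "\<bar>h z\<bar> \<le> M * norm z ^ 1" for z
      by (rule LIMSEQ_le_const2[OF tendsto_rabs[OF lim[of z]]])
        (use abs_fin_support_le[OF P(1,2)] M P(3) in \<open>simp, meson subsetD\<close>)
    moreover have "h (c *\<^sub>R z) = c ^ 1 * h z" if "c > 0" for c z
    proof (rule LIMSEQ_unique[OF lim])
      show "(\<lambda>m. fin_support (P m) (c *\<^sub>R z)) \<longlonglongrightarrow> c ^ 1 * h z"
        unfolding fin_support_scale[OF P(1,2) that] power_one_right by (intro tendsto_mult_left lim)
    qed
    moreover have "h \<in> borel_measurable borel"
      by (rule borel_measurable_LIMSEQ_metric[OF fin_support_measurable[OF P(1,2)] lim])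
    ultimately show ?thesis unfolding homog_def by blast
  qed
  define c where "c = sphere_int 1 (\<lambda>z::complex^'n. norm z)"
  have up: "sphere_int 1 (fin_support (P m)) \<le> sphere_int 1 h" for m by (rule sphere_int_mono[OF hp hh P(4)])
  have lo: "sphere_int 1 h \<le> sphere_int 1 (fin_support (P m)) + \<epsilon> m * c" for m
    using sphere_int_mono[OF hh homog_add[OF hp homog_cmult[OF hn]] P(5)]
    unfolding sphere_int_add[OF hp homog_cmult[OF hn]] sphere_int_cmult c_def .
  have 2: "(\<lambda>m. sphere_int 1 (fin_support (P m))) \<longlonglongrightarrow> sphere_int 1 h"
  proof (rule tendsto_sandwich[where f="\<lambda>m. sphere_int 1 h - \<epsilon> m * c" and h="\<lambda>_. sphere_int 1 h"])
    have "(\<lambda>m. sphere_int 1 h - \<epsilon> m * c) \<longlonglongrightarrow> sphere_int 1 h - 0" by (intro tendsto_diff tendsto_const tendsto_mult_left_zero \<epsilon>(2))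
    then show "(\<lambda>m. sphere_int 1 h - \<epsilon> m * c) \<longlonglongrightarrow> sphere_int 1 h" by simp
    show "\<forall>\<^sub>F m in sequentially. sphere_int 1 h - \<epsilon> m * c \<le> sphere_int 1 (fin_support (P m))"
      using lo by (intro always_eventually allI) (simp add: diff_le_eq)
  qed (use up in auto)
  have 3: "sphere_int 1 h \<ge> 0" using sphere_int_fin_support_nonneg[OF P(1,2), of 0] up[of 0] by linarith
  show ?thesis by (rule that[OF i(1) 1[unfolded h_def] 2[unfolded h_def] 3[unfolded h_def]])
qed

section \<open>Comparison of the measures of the unit ball\<close>

lemma list_all2_replicate_same: "R a b \<Longrightarrow> list_all2 R (replicate k a) (replicate k b)"
  by (induction k) auto

lemma test_cutf:
  assumes "0 < \<alpha>" "\<alpha> < \<beta>" shows "test_function (cplx (\<lambda>z::complex^'n::finite. cutf \<alpha> \<beta> (sq z)))"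
  using test_radF[OF assms zero_less_one, of 0] by (simp add: radF_cutf[OF assms zero_less_one sq_nonneg])

lemma le_of_le_mult_power:
  fixes x c :: real
  assumes "\<And>b. b > 1 \<Longrightarrow> x \<le> c * b ^ k" shows "x \<le> c"
proof -
  have "((\<lambda>b. c * b ^ k) \<longlongrightarrow> c * 1 ^ k) (at_right 1)" by (intro tendsto_intros)
  then have "x \<le> c * 1 ^ k"
    by (rule tendsto_lowerbound) (use assms in \<open>auto intro: eventually_mono[OF eventually_at_right_less]\<close>)
  then show ?thesis by simp
qed

lemma ge_of_ge_mult_power:
  fixes x c :: real
  assumes "\<And>b. 0 < b \<Longrightarrow> b < 1 \<Longrightarrow> c * b ^ k \<le> x" shows "c \<le> x"
proof -
  have "((\<lambda>b. c * b ^ k) \<longlongrightarrow> c * 1 ^ k) (at_left 1)" by (intro tendsto_intros)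
  then have "c * 1 ^ k \<le> x"
    by (rule tendsto_upperbound) (use assms in \<open>auto intro: eventually_mono[OF eventually_at_left_real[of 0 1]]\<close>)
  then show ?thesis by simp
qed

context
  fixes E :: "nat \<Rightarrow> real"
  assumes E: "\<And>m. E m > 0" "E \<longlonglongrightarrow> 0"
begin

text \<open>Upper estimates use a cutoff that is 1 on the unit ball and 0 outside radius
  \<open>\<beta>\<close> > 1; the lower estimate \<open>mu1_lower\<close> uses one that vanishes
  outside the unit ball. When the free radius tends to 1 the additional powers of it
  disappear.\<close>

lemma mu0_upper:
  "measure (bedford_taylor_measure (replicate CARD('n) (norm :: complex^'n::finite \<Rightarrow> real))) (cball 0 1)
    \<le> 2 ^ CARD('n) * fact CARD('n) * unit_ball_vol (real DIM(complex^'n))"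
proof (rule le_of_le_mult_power)
  fix \<beta> :: real assume \<beta>: "\<beta> > 1"
  let ?n = "CARD('n)"
  let ?us = "replicate ?n (norm :: complex^'n \<Rightarrow> real)"
  have ab: "0 < (1::real)" "1 < \<beta>" using \<beta> by auto
  have la: "list_all2 approximates ?us (replicate ?n (\<lambda>m. soft_norm (E m)))"
    by (intro list_all2_replicate_same approximates_norm E)
  have t: "test_function (cplx (\<lambda>z::complex^'n. cutf 1 \<beta> (sq z)))" by (rule test_cutf[OF ab])
  have "(\<lambda>m. Re (LINT z|lborel. wcoef (map (\<lambda>U. U m) (replicate ?n (\<lambda>m. soft_norm (E m)))) [] z * cplx (\<lambda>z::complex^'n. cutf 1 \<beta> (sq z)) z))
      \<longlonglongrightarrow> Re (bedford_taylor ?us [] (cplx (\<lambda>z. cutf 1 \<beta> (sq z))))"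
    by (intro tendsto_Re bedford_taylor_limit[OF la _ t]) simp
  then have "Re (bedford_taylor ?us [] (cplx (\<lambda>z. cutf 1 \<beta> (sq z)))) \<le> 4 ^ ?n * fact ?n * (1 / (2 * 1)) ^ ?n * (unit_ball_vol (real DIM(complex^'n)) * \<beta> ^ DIM(complex^'n))"
    by (rule LIMSEQ_le_const2) (use mu0_bound[OF ab E(1)] in \<open>simp only: map_replicate, blast\<close>)
  also have "\<dots> = 2 ^ ?n * fact ?n * unit_ball_vol (real DIM(complex^'n)) * \<beta> ^ DIM(complex^'n)"
  proof -
    have "(4::real) ^ ?n * (1 / (2 * 1)) ^ ?n = 2 ^ ?n" by (simp add: power_mult_distrib[symmetric])
    from this[symmetric] show ?thesis by (simp only: mult_ac)
  qed
  finally have "Re (bedford_taylor ?us [] (cplx (\<lambda>z. cutf 1 \<beta> (sq z)))) \<le> 2 ^ ?n * fact ?n * unit_ball_vol (real DIM(complex^'n)) * \<beta> ^ DIM(complex^'n)" .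
  moreover have "measure (bedford_taylor_measure ?us) (cball 0 1) \<le> Re (bedford_taylor ?us [] (cplx (\<lambda>z. cutf 1 \<beta> (sq z))))"
  proof (rule bedford_taylor_measure_bounds(1)[OF la _ t])
    show "1 \<le> cutf 1 \<beta> (sq z)" if "z \<in> cball 0 1" for z :: "complex^'n"
      using cutf_1[OF ab E(1), of "sq z"] that power_mono[of "norm z" 1 2] by (simp add: sq_norm)
  qed (use cutf_range[OF ab E(1)] in auto)
  ultimately show "measure (bedford_taylor_measure ?us) (cball 0 1) \<le> 2 ^ ?n * fact ?n * unit_ball_vol (real DIM(complex^'n)) * \<beta> ^ DIM(complex^'n)"
    by linarith
qed

context
  fixes A :: "(complex^'n::finite) set"
  assumes A: "compact A" "A \<noteq> {}"
begin

lemma mu1_lower: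
  assumes j: "j + 1 = CARD('n)"
  shows "2 ^ j * fact j * sphere_int 1 (support_function A)
    \<le> measure (bedford_taylor_measure (support_function A # replicate j norm)) (cball 0 1)"
proof (rule ge_of_ge_mult_power[where k="DIM(complex^'n) - 1"])
  fix \<alpha> :: real assume \<alpha>: "0 < \<alpha>" "\<alpha> < 1"
  let ?N = "DIM(complex^'n)"
  let ?us = "support_function A # replicate j norm"
  define K where "K m = dsn (E m) (1^2) ^ j * \<alpha> ^ (?N - 1)" for m
  let ?I = "\<lambda>m P i. Re (LINT z|lborel. wcoef (lse P (real (Suc i)) # replicate j (soft_norm (E m))) [] z * of_real (cutf \<alpha> 1 (sq z)))"
  \<comment> \<open>Subtracting \<open>E m\<close> makes the limiting inequality strict, hence
    eventually true along the soft maxima; the loss tends to 0 with m.\<close>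
  have Q: "\<forall>\<^sub>F i in sequentially. 4 ^ j * fact j * (sphere_int 1 (fin_support P) * K m) - E m \<le> ?I m P i"
    if P: "finite P" "P \<noteq> {}" for m and P :: "(complex^'n) set"
  proof -
    obtain c where c: "(\<lambda>i. LINT z|lborel. wcoef (lse P (real (Suc i)) # replicate j (soft_norm (E m))) [] z * of_real (cutf \<alpha> 1 (sq z))) \<longlonglongrightarrow>
      of_real (4 ^ j * fact j * (sphere_int 1 (fin_support P) * c))" "K m \<le> c"
      using mu1_limit[OF \<alpha> E(1) P j, of m] unfolding K_def by blast
    have "(\<lambda>i. ?I m P i) \<longlonglongrightarrow> 4 ^ j * fact j * (sphere_int 1 (fin_support P) * c)" using tendsto_Re[OF c(1)] by simp
    moreover have "4 ^ j * fact j * (sphere_int 1 (fin_support P) * K m) \<le> 4 ^ j * fact j * (sphere_int 1 (fin_support P) * c)"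
      by (intro mult_left_mono c(2) sphere_int_fin_support_nonneg P) simp
    then have "4 ^ j * fact j * (sphere_int 1 (fin_support P) * K m) - E m < 4 ^ j * fact j * (sphere_int 1 (fin_support P) * c)" using E(1)[of m] by linarith
    ultimately have "\<forall>\<^sub>F i in sequentially. 4 ^ j * fact j * (sphere_int 1 (fin_support P) * K m) - E m < ?I m P i" by (rule order_tendstoD(1))
    then show ?thesis by eventually_elim simp
  qed
  obtain P i where Pi: "\<And>m. 4 ^ j * fact j * (sphere_int 1 (fin_support (P m)) * K m) - E m \<le> ?I m (P m) (i m)"
    "approximates (support_function A) (\<lambda>m. lse (P m) (real (Suc (i m))))"
    "(\<lambda>m. sphere_int 1 (fin_support (P m))) \<longlonglongrightarrow> sphere_int 1 (support_function A)"
    using approx_sequence[OF A, where Q="\<lambda>m P i. 4 ^ j * fact j * (sphere_int 1 (fin_support P) * K m) - E m \<le> ?I m P i", OF Q] by blast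
  have la: "list_all2 approximates ?us ((\<lambda>m. lse (P m) (real (Suc (i m)))) # replicate j (\<lambda>m. soft_norm (E m)))"
    by (intro list_all2_Cons[THEN iffD2] conjI Pi(2) list_all2_replicate_same approximates_norm E)
  have t: "test_function (cplx (\<lambda>z::complex^'n. cutf \<alpha> 1 (sq z)))" by (rule test_cutf[OF \<alpha>])
  have len: "length ?us = CARD('n)" using j by simp
  have lim: "(\<lambda>m. ?I m (P m) (i m)) \<longlonglongrightarrow> Re (bedford_taylor ?us [] (cplx (\<lambda>z. cutf \<alpha> 1 (sq z))))"
    using tendsto_Re[OF bedford_taylor_limit[OF la _ t, of "[]"]] len by (simp del: of_nat_Suc)
  have "K \<longlonglongrightarrow> inverse (2 * sqrt (1^2 + 0)) ^ j * \<alpha> ^ (?N - 1)"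
    unfolding K_def[abs_def] dsn_def by (intro tendsto_intros E(2)) simp
  then have "(\<lambda>m. 4 ^ j * fact j * (sphere_int 1 (fin_support (P m)) * K m) - E m) \<longlonglongrightarrow> 4 ^ j * fact j * (sphere_int 1 (support_function A) * (inverse (2 * sqrt (1^2 + 0)) ^ j * \<alpha> ^ (?N - 1))) - 0"
    by (intro tendsto_intros Pi(3) E(2))
  from LIMSEQ_le[OF this lim] Pi(1)
  have "4 ^ j * fact j * (sphere_int 1 (support_function A) * (inverse (2 * sqrt (1^2 + 0)) ^ j * \<alpha> ^ (?N - 1))) - 0 \<le> Re (bedford_taylor ?us [] (cplx (\<lambda>z. cutf \<alpha> 1 (sq z))))"
    by blast
  also have "\<dots> \<le> measure (bedford_taylor_measure ?us) (cball 0 1)"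
  proof (rule bedford_taylor_measure_bounds(2)[OF la len t])
    show "cutf \<alpha> 1 (sq z) \<le> 0" if "z \<notin> cball 0 1" for z :: "complex^'n"
      using cutf_0[OF \<alpha> E(1), of "sq z"] that power_mono[of 1 "norm z" 2] by (simp add: sq_norm)
  qed (use cutf_range[OF \<alpha> E(1)] in auto)
  also have "4 ^ j * fact j * (sphere_int 1 (support_function A) * (inverse (2 * sqrt (1^2 + 0)) ^ j * \<alpha> ^ (?N - 1))) - 0 = 2 ^ j * fact j * sphere_int 1 (support_function A) * \<alpha> ^ (?N - 1)"
  proof -
    have "(4::real) ^ j * inverse (2 * sqrt (1^2 + 0)) ^ j = 2 ^ j" by (simp add: power_mult_distrib[symmetric])
    from this[symmetric] show ?thesis by (simp only: diff_0_right mult_ac)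
  qed
  finally show "2 ^ j * fact j * sphere_int 1 (support_function A) * \<alpha> ^ (?N - 1) \<le> measure (bedford_taylor_measure ?us) (cball 0 1)" .
qed

lemma mu2_upper:
  assumes j: "j + 2 = CARD('n)"
  defines "\<omega> \<equiv> sphere_int 0 (\<lambda>_::complex^'n. 1)"
  shows "measure (bedford_taylor_measure (support_function A # support_function A # replicate j norm)) (cball 0 1)
    \<le> 2 ^ j * fact j * ((real DIM(complex^'n) - 1) * (sphere_int 1 (support_function A))^2 / \<omega>)"
proof (rule le_of_le_mult_power[where k="DIM(complex^'n) - 2"])
  fix \<beta> :: real assume \<beta>: "\<beta> > 1"
  let ?N = "DIM(complex^'n)"
  let ?us = "support_function A # support_function A # replicate j norm"
  have ab: "0 < (1::real)" "1 < \<beta>" using \<beta> by auto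
  define B where "B s = 4 ^ j * fact j * ((1 / (2 * 1)) ^ j * \<beta> ^ (?N - 2) * ((real ?N - 1) * s^2 / \<omega>))" for s :: real
  let ?I = "\<lambda>m P i. Re (LINT z|lborel. wcoef (lse P (real (Suc i)) # lse P (real (Suc i)) # replicate j (soft_norm (E m))) [] z * of_real (cutf 1 \<beta> (sq z)))"
  have Q: "\<forall>\<^sub>F i in sequentially. ?I m P i \<le> B (sphere_int 1 (fin_support P)) + E m"
    if P: "finite P" "P \<noteq> {}" for m and P :: "(complex^'n) set"
    unfolding B_def \<omega>_def by (rule mu2_eventually[OF ab E(1) P j E(1)])
  obtain P i where Pi: "\<And>m. ?I m (P m) (i m) \<le> B (sphere_int 1 (fin_support (P m))) + E m"
    "approximates (support_function A) (\<lambda>m. lse (P m) (real (Suc (i m))))"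
    "(\<lambda>m. sphere_int 1 (fin_support (P m))) \<longlonglongrightarrow> sphere_int 1 (support_function A)"
    using approx_sequence[OF A, where Q="\<lambda>m P i. ?I m P i \<le> B (sphere_int 1 (fin_support P)) + E m", OF Q] by blast
  have la: "list_all2 approximates ?us ((\<lambda>m. lse (P m) (real (Suc (i m)))) # (\<lambda>m. lse (P m) (real (Suc (i m)))) # replicate j (\<lambda>m. soft_norm (E m)))"
    by (intro list_all2_Cons[THEN iffD2] conjI Pi(2) list_all2_replicate_same approximates_norm E)
  have t: "test_function (cplx (\<lambda>z::complex^'n. cutf 1 \<beta> (sq z)))" by (rule test_cutf[OF ab])
  have len: "length ?us = CARD('n)" using j by simp
  have lim: "(\<lambda>m. ?I m (P m) (i m)) \<longlonglongrightarrow> Re (bedford_taylor ?us [] (cplx (\<lambda>z. cutf 1 \<beta> (sq z))))"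
    using tendsto_Re[OF bedford_taylor_limit[OF la _ t, of "[]"]] len by (simp del: of_nat_Suc)
  have \<omega>: "\<omega> \<noteq> 0" unfolding \<omega>_def using sphere_int_1_pos[where 'a="complex^'n"] by simp
  have "(\<lambda>m. B (sphere_int 1 (fin_support (P m))) + E m) \<longlonglongrightarrow> B (sphere_int 1 (support_function A)) + 0"
    unfolding B_def by (intro tendsto_add tendsto_mult tendsto_const tendsto_divide tendsto_power Pi(3) E(2) \<omega>)
  from LIMSEQ_le[OF lim this] Pi(1)
  have 1: "Re (bedford_taylor ?us [] (cplx (\<lambda>z. cutf 1 \<beta> (sq z)))) \<le> B (sphere_int 1 (support_function A)) + 0" by blast
  have "measure (bedford_taylor_measure ?us) (cball 0 1) \<le> Re (bedford_taylor ?us [] (cplx (\<lambda>z. cutf 1 \<beta> (sq z))))"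
  proof (rule bedford_taylor_measure_bounds(1)[OF la len t])
    show "1 \<le> cutf 1 \<beta> (sq z)" if "z \<in> cball 0 1" for z :: "complex^'n"
      using cutf_1[OF ab E(1), of "sq z"] that power_mono[of "norm z" 1 2] by (simp add: sq_norm)
  qed (use cutf_range[OF ab E(1)] in auto)
  also note 1
  also have "B (sphere_int 1 (support_function A)) + 0 = 2 ^ j * fact j * ((real ?N - 1) * (sphere_int 1 (support_function A))^2 / \<omega>) * \<beta> ^ (?N - 2)"
  proof -
    have "(4::real) ^ j * (1 / (2 * 1)) ^ j = 2 ^ j" by (simp add: power_mult_distrib[symmetric])
    from this[symmetric] show ?thesis unfolding B_def add_0_right by (simp only: mult_ac)
  qed
  finally show "measure (bedford_taylor_measure ?us) (cball 0 1) \<le> 2 ^ j * fact j * ((real ?N - 1) * (sphere_int 1 (support_function A))^2 / \<omega>) * \<beta> ^ (?N - 2)" .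
qed

end

end

theorem proposition11p2:
  fixes A :: "(complex^'n::finite) set"
  assumes "CARD('n) \<ge> 2"
    and "convex_body A"
  shows "(mixed_pseudovolume (A # replicate (CARD('n) - 1) (cball 0 1)))\<^sup>2
    \<ge> ((2 * real CARD('n) - 2) / (2 * real CARD('n) - 1))
        * mixed_pseudovolume (replicate 2 A @ replicate (CARD('n) - 2) (cball 0 1))
        * pseudovolume (cball 0 1 :: (complex^'n) set)"
proof -
  have A: "compact A" "A \<noteq> {}" using assms(2) by (auto simp: convex_body_def)
  obtain j where j: "CARD('n) = j + 2" using assms(1) by (metis add.commute le_iff_add)
  define n where "n = CARD('n)"
  define E where "E m = inverse (real (Suc m))" for m
  have E: "E m > 0" "E \<longlonglongrightarrow> 0" for m unfolding E_def[abs_def] by (simp, rule LIMSEQ_inverse_real_of_nat)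
  define h where "h = support_function A"
  define d where "d = fact CARD('n) * measure lborel (cball (0 :: real^'n) 1)"
  define \<sigma> where "\<sigma> = sphere_int 1 h"
  define V where "V = unit_ball_vol (real DIM(complex^'n))"
  define \<mu>0 where "\<mu>0 = measure (bedford_taylor_measure (replicate CARD('n) (norm :: complex^'n \<Rightarrow> real))) (cball 0 1)"
  define \<mu>1 where "\<mu>1 = measure (bedford_taylor_measure (h # replicate (j + 1) norm)) (cball 0 1)"
  define \<mu>2 where "\<mu>2 = measure (bedford_taylor_measure (h # h # replicate j norm)) (cball 0 1)"
  have b: "support_function (cball 0 1) = (norm :: complex^'n \<Rightarrow> real)" by (rule ext) (rule support_function_cball)
  have N: "real DIM(complex^'n) = 2 * real j + 4" using j by simp
  have N1: "2 * real j + 4 - 1 = 2 * real j + 3" by simp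
  have V: "V > 0" by (simp add: V_def)
  \<comment> \<open>With a trivial predicate only the nonnegativity of the sphere integral is
    extracted; it permits squaring the lower bound for \<open>\<mu>1\<close>.\<close>
  have \<sigma>: "\<sigma> \<ge> 0" unfolding \<sigma>_def h_def using approx_sequence[OF A, of "\<lambda>_ _ _. True"] by auto
  have 0: "\<mu>0 \<le> 2 ^ (j + 2) * fact (j + 2) * V" using mu0_upper[OF E, where 'n='n] by (simp only: \<mu>0_def V_def j)
  have 1: "2 ^ (j + 1) * fact (j + 1) * \<sigma> \<le> \<mu>1"
    unfolding \<mu>1_def \<sigma>_def h_def by (rule mu1_lower[OF E A]) (use j in simp)
  have 2: "\<mu>2 \<le> 2 ^ j * fact j * ((2 * real j + 3) * \<sigma>^2 / ((2 * real j + 4) * V))"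
    using mu2_upper[OF E A j[symmetric]] unfolding sphere_int_1_eq \<mu>2_def \<sigma>_def h_def V_def N by (simp only: N1)
  have "((2 * real j + 2) / (2 * real j + 3)) * \<mu>2 * \<mu>0
      \<le> ((2 * real j + 2) / (2 * real j + 3)) * (2 ^ j * fact j * ((2 * real j + 3) * \<sigma>^2 / ((2 * real j + 4) * V))) * (2 ^ (j + 2) * fact (j + 2) * V)"
    using V by (intro mult_mono 0 2 mult_left_mono) (simp_all add: \<mu>2_def \<mu>0_def)
  \<comment> \<open>The volume cancels, (j+2)! against 2 j + 4 leaves (j+1)! / 2, and (2 j + 2) j!
    is 2 (j+1)!. The product of the two upper bounds is thus exactly the square of the lower bound,
    which is how the constant of the theorem arises.\<close>
  also have "\<dots> = (2 ^ (j + 1) * fact (j + 1) * \<sigma>)^2"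
  proof -
    have cancel: "(2 * x / a) * (p * f * (a * s / (2 * b * V))) * (q * (b * g) * V) = (p * q) * ((x * f) * g) * s"
      if "a \<noteq> 0" "b \<noteq> 0" for a b f g p q s x :: real
      using that V by (simp add: field_simps)
    have f: "fact (j + 2) = (real j + 2) * fact (j + 1)" "(real j + 1) * fact j = (fact (j + 1) :: real)" by (simp_all add: algebra_simps)
    have e: "2 * real j + 2 = 2 * (real j + 1)" "2 * real j + 4 = 2 * (real j + 2)" by simp_all
    show ?thesis unfolding f(1) e
      by (subst cancel) (simp_all only: f(2), simp_all add: power2_eq_square power_add)
  qed
  also have "\<dots> \<le> \<mu>1^2" using 1 \<sigma> by (intro power_mono) auto
  finally have main: "((2 * real j + 2) / (2 * real j + 3)) * \<mu>2 * \<mu>0 \<le> \<mu>1^2" .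
  have m: "mixed_pseudovolume (A # replicate (CARD('n) - 1) (cball 0 1)) = \<mu>1 / d"
    "mixed_pseudovolume (replicate 2 A @ replicate (CARD('n) - 2) (cball 0 1)) = \<mu>2 / d"
    "pseudovolume (cball 0 1 :: (complex^'n) set) = \<mu>0 / d"
    by (simp_all add: mixed_pseudovolume_def pseudovolume_def \<mu>0_def \<mu>1_def \<mu>2_def d_def j b h_def numeral_2_eq_2)
  have c: "(2 * real CARD('n) - 2) / (2 * real CARD('n) - 1) = (2 * real j + 2) / (2 * real j + 3)" by (simp add: j add.commute)
  have "((2 * real j + 2) / (2 * real j + 3)) * (\<mu>2 / d) * (\<mu>0 / d) = (((2 * real j + 2) / (2 * real j + 3)) * \<mu>2 * \<mu>0) / d^2"
    by (simp add: power2_eq_square)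
  also have "\<dots> \<le> \<mu>1^2 / d^2" by (rule divide_right_mono[OF main]) simp
  finally show ?thesis unfolding m c power_divide .
qed

end
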